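(* For every $n\ge1$ there exists a constant $\mathfrak{C}_3(n)>0$ such that for any $\mathfrak{m}\in\mathbb{S}^{2n-1}$ and any horizontal $(2n+1)$-uniform cone $\mu$ on $\mathbb{H}^n$ we have $$\int_{B_1(0)}\langle\mathfrak{m},z_H\rangle^2\,d\mu(z)\ge\mathfrak{C}_3(n).$$
   Context: The Heisenberg group $\mathbb{H}^n$ is $\mathbb{R}^{2n}\times\mathbb{R}$, with points $x=(x_H,x_T)$ and product $x*y=(x_H+y_H,\,x_T+y_T+2\langle x_H,Jy_H\rangle)$, where $J=\begin{pmatrix}0&\mathrm{id}_n\\-\mathrm{id}_n&0\end{pmatrix}$. The Koranyi norm is $\|x\|=(|x_H|^4+|x_T|^2)^{1/4}$, the Koranyi distance is $d(x,y)=\|x^{-1}*y\|$, $B_r(x)=\{z: d(z,x)\le r\}$, and $D_\lambda(x)=(\lambda x_H,\lambda^2x_T)$ for $\lambda>0$. $\mathbb{S}^{2n-1}$ is the Euclidean unit sphere of $\mathbb{R}^{2n}$. A Radon measure $\mu$ is $m$-uniform if $0\in\mathrm{supp}(\mu)$ and $\mu(B_r(x))=r^m$ for all $r>0$ and $x\in\mathrm{supp}(\mu)$. It is an $m$-uniform cone if moreover $\lambda^{-m}\mu_{0,\lambda}=\mu$ for every $\lambda>0$, where $\mu_{0,\lambda}(A)=\mu(D_\lambda(A))$. For $b\in\mathbb{R}^{2n}$, $\mathcal{Q}$ a real symmetric $2n\times 2n$ matrix and $\mathcal{T}\in\mathbb{R}$, $\mathbb{K}(b,\mathcal{Q},\mathcal{T}):=\{(x,t)\in\mathbb{R}^{2n}\times\mathbb{R}:\langle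 b,x\rangle+\langle x,\mathcal{Q}x\rangle+\mathcal{T}t=0\}$. A $(2n+1)$-uniform measure $\mu$ is vertical if there are $b\in\mathbb{R}^{2n}$ and a non-zero symmetric $\mathcal{Q}$ with $\mathrm{supp}(\mu)\subseteq\mathbb{K}(b,\mathcal{Q},0)$; otherwise it is horizontal. *)

theory Defs
  imports "HOL-Analysis.Analysis"
begin

text \<open>The index type \<^typ>\<open>'n + 'n\<close> has \<open>2n\<close> elements for \<open>n = CARD('n)\<close>: \<open>Inl\<close> indexes the
  first block of \<open>n\<close> coordinates and \<open>Inr\<close> the second. The Euclidean (product) topology on
  \<open>'n heis\<close> is the one induced by the Koranyi distance, so \<^const>\<open>borel\<close>, \<^const>\<open>open\<close> and
  \<^const>\<open>compact\<close> have their intended meaning.\<close>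

type_synonym 'n heis = "(real ^ ('n + 'n)) \<times> real"

definition sympl_J :: "real ^ ('n::finite + 'n) ^ ('n + 'n)" where
  "sympl_J = (\<chi> i j. case (i, j) of
      (Inl a, Inr b) \<Rightarrow> (if a = b then 1 else 0)
    | (Inr a, Inl b) \<Rightarrow> (if a = b then - 1 else 0)
    | _ \<Rightarrow> 0)"

definition heis_mult :: "('n::finite) heis \<Rightarrow> 'n heis \<Rightarrow> 'n heis" where
  "heis_mult x y = (fst x + fst y, snd x + snd y + 2 * (fst x \<bullet> (sympl_J *v fst y)))"

text \<open>As \<open>\<langle>v, J v\<rangle> = 0\<close>, the inverse for \<open>heis_mult\<close> is the additive one.\<close>

definition heis_inv :: "('n::finite) heis \<Rightarrow> 'n heis" where
  "heis_inv x = (- fst x, - snd x)"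

definition koranyi_norm :: "('n::finite) heis \<Rightarrow> real" where
  "koranyi_norm x = root 4 (norm (fst x) ^ 4 + \<bar>snd x\<bar> ^ 2)"

definition koranyi_dist :: "('n::finite) heis \<Rightarrow> 'n heis \<Rightarrow> real" where
  "koranyi_dist x y = koranyi_norm (heis_mult (heis_inv x) y)"

definition koranyi_ball :: "real \<Rightarrow> ('n::finite) heis \<Rightarrow> 'n heis set" where
  "koranyi_ball r x = {z. koranyi_dist x z \<le> r}"

definition heis_dil :: "real \<Rightarrow> ('n::finite) heis \<Rightarrow> 'n heis" where
  "heis_dil l x = (l *\<^sub>R fst x, l ^ 2 * snd x)"

definition radon_measure :: "'a::topological_space measure \<Rightarrow> bool" where
  "radon_measure \<mu> \<longleftrightarrow>
     sets \<mu> = sets borel \<and>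
     (\<forall>K. compact K \<longrightarrow> emeasure \<mu> K < \<infinity>) \<and>
     (\<forall>U. open U \<longrightarrow> emeasure \<mu> U = (SUP K\<in>{K. compact K \<and> K \<subseteq> U}. emeasure \<mu> K)) \<and>
     (\<forall>A\<in>sets borel. emeasure \<mu> A = (INF U\<in>{U. open U \<and> A \<subseteq> U}. emeasure \<mu> U))"

definition msupport :: "'a::topological_space measure \<Rightarrow> 'a set" where
  "msupport \<mu> = {x. \<forall>U. open U \<and> x \<in> U \<longrightarrow> emeasure \<mu> U > 0}"

definition uniform_measure_H :: "nat \<Rightarrow> ('n::finite) heis measure \<Rightarrow> bool" where
  "uniform_measure_H m \<mu> \<longleftrightarrow>
     radon_measure \<mu> \<and> 0 \<in> msupport \<mu> \<and>
     (\<forall>r>0. \<forall>x\<in>msupport \<mu>. emeasure \<mu> (koranyi_ball r x) = ennreal (r ^ m))"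

definition uniform_cone_H :: "nat \<Rightarrow> ('n::finite) heis measure \<Rightarrow> bool" where
  "uniform_cone_H m \<mu> \<longleftrightarrow>
     uniform_measure_H m \<mu> \<and>
     (\<forall>l>0. \<forall>A\<in>sets borel.
        ennreal (inverse (l ^ m)) * emeasure \<mu> (heis_dil l ` A) = emeasure \<mu> A)"

definition quadric_H ::
  "real ^ ('n::finite + 'n) \<Rightarrow> real ^ ('n + 'n) ^ ('n + 'n) \<Rightarrow> real \<Rightarrow> 'n heis set" where
  "quadric_H b Q T = {(x, t). b \<bullet> x + x \<bullet> (Q *v x) + T * t = 0}"

text \<open>Vertical and horizontal are properties of \<open>(2n+1)\<close>-uniform measures only, so uniformity is
  part of both definitions.\<close>

definition vertical_uniform :: "('n::finite) heis measure \<Rightarrow> bool" where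
  "vertical_uniform \<mu> \<longleftrightarrow>
     uniform_measure_H (2 * CARD('n) + 1) \<mu> \<and>
     (\<exists>b Q. transpose Q = Q \<and> Q \<noteq> 0 \<and> msupport \<mu> \<subseteq> quadric_H b Q 0)"

definition horizontal_uniform :: "('n::finite) heis measure \<Rightarrow> bool" where
  "horizontal_uniform \<mu> \<longleftrightarrow>
     uniform_measure_H (2 * CARD('n) + 1) \<mu> \<and> \<not> vertical_uniform \<mu>"

end

theory Submission imports Defs "HOL-Analysis.Analysis"
begin

text \<open>
  The proof is by compactness. Suppose that there are horizontal uniform cones \<open>\<mu>\<^sub>i\<close> and unit
  vectors \<open>m\<^sub>i\<close> for which the integrals tend to zero.

  A horizontal uniform cone lives on a quadratic graph. The integral of \<open>(1 - d(u,z)\<^sup>4)\<^sub>+\<^sup>3\<close> over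
  \<open>z\<close> depends only on masses of balls about \<open>u\<close>, so it is the same for all \<open>u\<close> in the support.
  For a cone, \<open>u\<close> may be replaced by its dilates, and comparing the second-order terms in the
  dilation parameter gives an equation \<open>\<langle>u\<^sub>H, Q u\<^sub>H\<rangle> + T u\<^sub>T = 0\<close> (\<open>moment_quadric\<close>). The
  trace of \<open>Q\<close> is a negative multiple of a second moment, and horizontality excludes \<open>T = 0\<close>, so the
  support lies in a graph \<open>t = \<langle>x, A x\<rangle>\<close> with \<open>A\<close> symmetric (\<open>horizontal_uniform_cone_graph\<close>).

  On this graph the measure is a constant multiple of the area with density
  \<open>\<bar>2 (A + J) x\<bar>\<close>. Near a regular point, where the density is non-zero, the graph looks like a
  vertical hyperplane, so small balls have area about \<open>c r\<^sup>2\<^sup>n\<^sup>+\<^sup>1\<close> with \<open>c\<close> depending only on \<open>n\<close>, while uniformity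
  gives them mass \<open>r\<^sup>2\<^sup>n\<^sup>+\<^sup>1\<close>. Integrating over pairs of close points in both orders compares
  area and mass (\<open>area_le_M\<close>, \<open>M_le_area\<close>) on the projected support \<open>E\<close>. The set \<open>E\<close>
  contains all regular points: it is open among them (\<open>regular_interior\<close>), they are connected
  unless all gradients are parallel, and in that case a planar computation excludes that \<open>E\<close>
  is a half plane (\<open>half_plane_impossible\<close>). Hence area is at most \<open>c\<close> times mass
  (\<open>area_le_M_full\<close>). This has two consequences: unit balls about regular points have area
  at most \<open>c\<close> (\<open>surf_le_flat\<close>), and the \<open>h\<close>-neighbourhood of the part of the graph in the unit
  ball has volume at least of order \<open>h\<close> (\<open>neighbourhood_volume_ge\<close>).

  It remains to exclude a sequence of matrices \<open>A\<^sub>i\<close> for which the area of the unit ball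
  concentrates near the hyperplanes orthogonal to \<open>m\<^sub>i\<close>. If the \<open>A\<^sub>i\<close> are bounded, their limit
  contradicts this directly (\<open>bounded_impossible\<close>). Otherwise let \<open>B\<close> be a limit of the
  matrices \<open>A\<^sub>i\<close> divided by \<open>1 + \<bar>A\<^sub>i\<bar>\<close>. A null vector of \<open>B\<close> outside its kernel carries a sheet of definite
  area, which must lie in the limit hyperplane; so \<open>B\<close> is semidefinite (\<open>B_semidefinite\<close>). If \<open>B\<close> has
  rank at least two, the unit balls collapse onto a set of codimension two and their neighbourhoods have
  volume of order \<open>h\<^sup>2\<close>, which is too small (\<open>high_rank_impossible\<close>). If \<open>B\<close> has rank one, some unit ball
  consists of two sheets whose area together exceeds \<open>c\<close> (\<open>rank_one_impossible\<close>).
\<close>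

section \<open>Slicing Lebesgue measure along a direction\<close>

lemma lborel_translate: "(\<integral>\<^sup>+z. \<Phi> (a + z) \<partial>lborel) = (\<integral>\<^sup>+z. \<Phi> z \<partial>lborel)"
  if [measurable]: "\<Phi> \<in> borel_measurable borel" for \<Phi> :: "'a::euclidean_space \<Rightarrow> ennreal"
  by (subst (2) lborel_distr_plus[symmetric, of a]) (simp add: nn_integral_distr)

lemma lborel_dilate:
  fixes \<Phi> :: "'a::euclidean_space \<Rightarrow> ennreal"
  assumes [measurable]: "\<Phi> \<in> borel_measurable borel" and r: "r > 0"
  shows "(\<integral>\<^sup>+z. \<Phi> z \<partial>lborel) = ennreal (r ^ DIM('a)) * (\<integral>\<^sup>+z. \<Phi> (r *\<^sub>R z) \<partial>lborel)"
  using r by (subst lborel_affine[of r 0]) (auto simp: nn_integral_density nn_integral_distr nn_integral_cmult)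

text \<open>The slab \<open>0 \<le> f \<bullet> y \<le> 1\<close> stands in for the hyperplane orthogonal to
  \<open>f\<close>: every line in direction \<open>f\<close> meets it in a segment of length one,
  so that integrating over the slab averages over the lines without a measure on the hyperplane.\<close>
lemma lborel_slices:
  fixes f :: "'a::euclidean_space" and \<Phi> :: "'a \<Rightarrow> ennreal"
  assumes f: "norm f = 1" and [measurable]: "\<Phi> \<in> borel_measurable borel"
  shows "(\<integral>\<^sup>+z. \<Phi> z \<partial>lborel) =
    (\<integral>\<^sup>+y. indicator {y. 0 \<le> f \<bullet> y \<and> f \<bullet> y \<le> 1} y * (\<integral>\<^sup>+t. \<Phi> (y + t *\<^sub>R f) \<partial>lborel) \<partial>lborel)"
    (is "_ = ?R")
proof -
  have ff: "f \<bullet> f = 1" using f by (simp add: dot_square_norm)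
  have "?R = (\<integral>\<^sup>+y. (\<integral>\<^sup>+t. indicator {y. 0 \<le> f \<bullet> y \<and> f \<bullet> y \<le> 1} y * \<Phi> (y + t *\<^sub>R f) \<partial>lborel) \<partial>lborel)"
    by (intro nn_integral_cong nn_integral_cmult[symmetric]) measurable
  also have "\<dots> = (\<integral>\<^sup>+t. (\<integral>\<^sup>+y. indicator {y. 0 \<le> f \<bullet> y \<and> f \<bullet> y \<le> 1} y * \<Phi> (y + t *\<^sub>R f) \<partial>lborel) \<partial>(lborel::real measure))"
    by (rule lborel_pair.Fubini') measurable
  also have "\<dots> = (\<integral>\<^sup>+t. (\<integral>\<^sup>+y. indicator {0..1} (f \<bullet> y - t) * \<Phi> y \<partial>lborel) \<partial>(lborel::real measure))"
  proof (rule nn_integral_cong)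
    fix t :: real
    have [measurable]: "(\<lambda>y. indicator {0..1} (f \<bullet> y - t) * \<Phi> y) \<in> borel_measurable borel" by measurable
    show "(\<integral>\<^sup>+y. indicator {y. 0 \<le> f \<bullet> y \<and> f \<bullet> y \<le> 1} y * \<Phi> (y + t *\<^sub>R f) \<partial>lborel) =
      (\<integral>\<^sup>+y. indicator {0..1} (f \<bullet> y - t) * \<Phi> y \<partial>lborel)"
      by (subst lborel_translate[of _ "t *\<^sub>R f", symmetric])
         (auto intro!: nn_integral_cong simp: inner_add_right ff add.commute split: split_indicator)
  qed
  also have "\<dots> = (\<integral>\<^sup>+y. (\<integral>\<^sup>+t. indicator {0..1} (f \<bullet> y - t) * \<Phi> y \<partial>(lborel::real measure)) \<partial>lborel)"
    by (rule lborel_pair.Fubini') measurable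
  also have "\<dots> = (\<integral>\<^sup>+y. \<Phi> y \<partial>lborel)"
  proof (rule nn_integral_cong)
    fix y :: 'a
    have "(\<integral>\<^sup>+t. indicator {0..1} (f \<bullet> y - t) * \<Phi> y \<partial>(lborel::real measure))
      = (\<integral>\<^sup>+t. \<Phi> y * indicator {f \<bullet> y - 1..f \<bullet> y} t \<partial>lborel)"
      by (intro nn_integral_cong) (auto split: split_indicator)
    also have "\<dots> = \<Phi> y" by (subst nn_integral_cmult_indicator) auto
    finally show "(\<integral>\<^sup>+t. indicator {0..1} (f \<bullet> y - t) * \<Phi> y \<partial>(lborel::real measure)) = \<Phi> y" .
  qed
  finally show ?thesis by simp
qed

text \<open>The substitution \<open>u = g x\<close>: the derivative, integrated where \<open>g\<close> has
  values in a window, measures the part of the window that \<open>g\<close> sweeps.\<close>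
lemma crossing_integral:
  fixes g g' :: "real \<Rightarrow> real"
  assumes "a \<le> b" and d: "\<And>x. x \<in> {a..b} \<Longrightarrow> (g has_real_derivative g' x) (at x)"
    and c: "continuous_on {a..b} g'" and n: "\<And>x. x \<in> {a..b} \<Longrightarrow> g' x \<ge> 0"
  shows "(\<integral>\<^sup>+x. indicator {x. a \<le> x \<and> x \<le> b \<and> \<bar>g x\<bar> \<le> w} x * ennreal (g' x) \<partial>lborel)
     = emeasure lborel ({-w..w} \<inter> {g a..g b})"
proof -
  have "(\<integral>\<^sup>+x. indicator {x. a \<le> x \<and> x \<le> b \<and> \<bar>g x\<bar> \<le> w} x * ennreal (g' x) \<partial>lborel)
    = (\<integral>\<^sup>+x. ennreal (indicator {-w..w} (g x) * g' x * indicator {a..b} x) \<partial>lborel)"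
    by (intro nn_integral_cong) (auto split: split_indicator)
  also have "\<dots> = (\<integral>\<^sup>+x. ennreal (indicator {-w..w} x * indicator {g a..g b} x) \<partial>lborel)"
    by (rule nn_integral_substitution[symmetric])
       (use assms in \<open>auto simp: set_borel_measurable_def\<close>)
  also have "\<dots> = (\<integral>\<^sup>+x. indicator ({-w..w} \<inter> {g a..g b}) x \<partial>lborel)"
    by (intro nn_integral_cong) (auto split: split_indicator)
  finally show ?thesis by simp
qed

corollary crossing_integral_le:
  fixes g g' :: "real \<Rightarrow> real"
  assumes "a \<le> b" and d: "\<And>x. x \<in> {a..b} \<Longrightarrow> (g has_real_derivative g' x) (at x)"
    and c: "continuous_on {a..b} g'" and n: "\<And>x. x \<in> {a..b} \<Longrightarrow> g' x \<ge> 0" and "0 \<le> w"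
  shows "(\<integral>\<^sup>+x. indicator {x. a \<le> x \<and> x \<le> b \<and> \<bar>g x\<bar> \<le> w} x * ennreal (g' x) \<partial>lborel) \<le> ennreal (2 * w)"
proof -
  have "emeasure lborel ({-w..w} \<inter> {g a..g b}) \<le> emeasure lborel {-w..w}"
    by (intro emeasure_mono) auto
  then show ?thesis using assms by (subst crossing_integral) auto
qed

corollary crossing_integral_eq:
  fixes g g' :: "real \<Rightarrow> real"
  assumes "a \<le> b" and d: "\<And>x. x \<in> {a..b} \<Longrightarrow> (g has_real_derivative g' x) (at x)"
    and c: "continuous_on {a..b} g'" and n: "\<And>x. x \<in> {a..b} \<Longrightarrow> g' x \<ge> 0" and "0 \<le> w"
    and "g a \<le> -w" "w \<le> g b"
  shows "(\<integral>\<^sup>+x. indicator {x. a \<le> x \<and> x \<le> b \<and> \<bar>g x\<bar> \<le> w} x * ennreal (g' x) \<partial>lborel) = ennreal (2 * w)"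
proof -
  have "{-w..w} \<inter> {g a..g b} = {-w..w}" using assms by auto
  then show ?thesis using assms by (subst crossing_integral) auto
qed

definition perp :: "'a::euclidean_space \<Rightarrow> 'a \<Rightarrow> 'a" where
  "perp f z = z - (f \<bullet> z) *\<^sub>R f"

lemma perp_shift: "norm f = 1 \<Longrightarrow> perp f (y + t *\<^sub>R f) = perp f y"
  by (simp add: perp_def algebra_simps dot_square_norm)

lemma norm_perp: assumes "norm f = 1" shows "(norm (perp f z))\<^sup>2 = (norm z)\<^sup>2 - (f \<bullet> z)\<^sup>2"
proof -
  have ff: "f \<bullet> f = 1" using assms by (simp add: dot_square_norm)
  show ?thesis
    unfolding power2_norm_eq_inner perp_def
    by (simp add: inner_diff_left inner_diff_right ff inner_commute power2_eq_square)
qed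

lemma perp_measurable [measurable]: "perp f \<in> borel_measurable borel"
  unfolding perp_def[abs_def] by measurable

text \<open>Along each line in direction \<open>f\<close> the function \<open>p\<close> climbs from \<open>-
  w\<close> to \<open>w\<close>, so its derivative, integrated over the crossing, contributes
  \<open>2 * w\<close>. A density \<open>D\<close> that dominates \<open>\<theta>\<close> times
  this derivative therefore has at least \<open>\<theta>\<close> times the area of a flat sheet of
  thickness \<open>2 * w\<close>.\<close>
lemma sheet_lower:
  fixes f :: "'a::euclidean_space" and p p' D :: "'a \<Rightarrow> real" and w :: "'a \<Rightarrow> real"
  assumes f: "norm f = 1" and \<eta>: "\<eta> \<ge> 0" and \<epsilon>: "0 \<le> \<theta>"
    and [measurable]: "p \<in> borel_measurable borel" "D \<in> borel_measurable borel" "w \<in> borel_measurable borel"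
       "p' \<in> borel_measurable borel" "Y \<in> sets borel" "G \<in> sets borel"
    and w0: "\<And>y. w y \<ge> 0"
    and deriv: "\<And>y. ((\<lambda>t. p (y + t *\<^sub>R f)) has_real_derivative p' y) (at 0)"
    and cont: "continuous_on UNIV p'"
    and slab: "\<And>z. perp f z \<in> Y \<Longrightarrow> \<bar>f \<bullet> z - s\<bar> \<le> \<eta> \<Longrightarrow> 0 \<le> p' z \<and> \<theta> * p' z \<le> D z"
    and lo: "\<And>z. perp f z \<in> Y \<Longrightarrow> f \<bullet> z = s - \<eta> \<Longrightarrow> p z \<le> - w (perp f z)"
    and hi: "\<And>z. perp f z \<in> Y \<Longrightarrow> f \<bullet> z = s + \<eta> \<Longrightarrow> p z \<ge> w (perp f z)"
    and G: "\<And>z. perp f z \<in> Y \<Longrightarrow> \<bar>f \<bullet> z - s\<bar> \<le> \<eta> \<Longrightarrow> \<bar>p z\<bar> \<le> w (perp f z) \<Longrightarrow> z \<in> G"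
  shows "ennreal \<theta> * (\<integral>\<^sup>+y. indicator {y. 0 \<le> f \<bullet> y \<and> f \<bullet> y \<le> 1} y * (indicator Y (perp f y) * ennreal (2 * w (perp f y))) \<partial>lborel)
    \<le> (\<integral>\<^sup>+z. indicator {z \<in> G. \<bar>f \<bullet> z - s\<bar> \<le> \<eta>} z * ennreal (D z) \<partial>lborel)"
proof -
  have ff: "f \<bullet> f = 1" using f by (simp add: dot_square_norm)
  have deriv': "((\<lambda>t. p (y + t *\<^sub>R f)) has_real_derivative p' (y + t *\<^sub>R f)) (at t)" for y t
  proof -
    have "((\<lambda>h. p ((y + t *\<^sub>R f) + h *\<^sub>R f)) has_real_derivative p' (y + t *\<^sub>R f)) (at 0)" by (rule deriv)
    then have "((\<lambda>h. p (y + (h + t) *\<^sub>R f)) has_real_derivative p' (y + t *\<^sub>R f)) (at 0)"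
      by (simp add: algebra_simps)
    then show ?thesis
      by (subst (asm) DERIV_shift[of "\<lambda>t. p (y + t *\<^sub>R f)" _ 0 t, symmetric]) simp
  qed
  have "(\<integral>\<^sup>+z. indicator {z \<in> G. \<bar>f \<bullet> z - s\<bar> \<le> \<eta>} z * ennreal (D z) \<partial>lborel)
    \<ge> (\<integral>\<^sup>+z. indicator {z. perp f z \<in> Y \<and> \<bar>f \<bullet> z - s\<bar> \<le> \<eta> \<and> \<bar>p z\<bar> \<le> w (perp f z)} z * (ennreal \<theta> * ennreal (p' z)) \<partial>lborel)" (is "_ \<ge> ?I")
    using slab G \<epsilon> by (intro nn_integral_mono)
      (auto split: split_indicator simp: ennreal_mult'[symmetric] intro!: ennreal_leI)
  moreover have "?I = (\<integral>\<^sup>+y. indicator {y. 0 \<le> f \<bullet> y \<and> f \<bullet> y \<le> 1} y * (\<integral>\<^sup>+t. indicator {z. perp f z \<in> Y \<and> \<bar>f \<bullet> z - s\<bar> \<le> \<eta> \<and> \<bar>p z\<bar> \<le> w (perp f z)} (y + t *\<^sub>R f) * (ennreal \<theta> * ennreal (p' (y + t *\<^sub>R f))) \<partial>lborel) \<partial>lborel)"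
    by (intro lborel_slices f) measurable
  moreover have "\<dots> = (\<integral>\<^sup>+y. indicator {y. 0 \<le> f \<bullet> y \<and> f \<bullet> y \<le> 1} y * (ennreal \<theta> * (indicator Y (perp f y) * ennreal (2 * w (perp f y)))) \<partial>lborel)"
  proof (intro nn_integral_cong arg_cong2[where f = times] refl)
    fix y
    show "(\<integral>\<^sup>+t. indicator {z. perp f z \<in> Y \<and> \<bar>f \<bullet> z - s\<bar> \<le> \<eta> \<and> \<bar>p z\<bar> \<le> w (perp f z)} (y + t *\<^sub>R f) * (ennreal \<theta> * ennreal (p' (y + t *\<^sub>R f))) \<partial>lborel)
      = ennreal \<theta> * (indicator Y (perp f y) * ennreal (2 * w (perp f y)))" (is "?l = _")
    proof (cases "perp f y \<in> Y")
      case False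
      then show ?thesis by (simp add: perp_shift f)
    next
      case True
      define \<sigma> where "\<sigma> = s - f \<bullet> y"
      have "?l = (\<integral>\<^sup>+t. ennreal \<theta> * (indicator {t. \<sigma> - \<eta> \<le> t \<and> t \<le> \<sigma> + \<eta> \<and> \<bar>p (y + t *\<^sub>R f)\<bar> \<le> w (perp f y)} t * ennreal (p' (y + t *\<^sub>R f))) \<partial>lborel)"
        using True by (intro nn_integral_cong)
          (auto simp: perp_shift f inner_add_right ff \<sigma>_def abs_le_iff split: split_indicator)
      also have "\<dots> = ennreal \<theta> * (\<integral>\<^sup>+t. (indicator {t. \<sigma> - \<eta> \<le> t \<and> t \<le> \<sigma> + \<eta> \<and> \<bar>p (y + t *\<^sub>R f)\<bar> \<le> w (perp f y)} t * ennreal (p' (y + t *\<^sub>R f))) \<partial>lborel)"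
        by (rule nn_integral_cmult) measurable
      also have "(\<integral>\<^sup>+t. (indicator {t. \<sigma> - \<eta> \<le> t \<and> t \<le> \<sigma> + \<eta> \<and> \<bar>p (y + t *\<^sub>R f)\<bar> \<le> w (perp f y)} t * ennreal (p' (y + t *\<^sub>R f))) \<partial>lborel) = ennreal (2 * w (perp f y))"
      proof (rule crossing_integral_eq)
        show "continuous_on {\<sigma> - \<eta>..\<sigma> + \<eta>} (\<lambda>t. p' (y + t *\<^sub>R f))"
          by (rule continuous_on_compose2[OF cont]) (auto intro!: continuous_intros)
        show "0 \<le> p' (y + x *\<^sub>R f)" if "x \<in> {\<sigma> - \<eta>..\<sigma> + \<eta>}" for x
          using that True slab[of "y + x *\<^sub>R f"] by (auto simp: perp_shift f inner_add_right ff \<sigma>_def)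
        show "p (y + (\<sigma> - \<eta>) *\<^sub>R f) \<le> - w (perp f y)"
          using lo[of "y + (\<sigma> - \<eta>) *\<^sub>R f"] True by (auto simp: perp_shift f inner_add_right ff \<sigma>_def)
        show "w (perp f y) \<le> p (y + (\<sigma> + \<eta>) *\<^sub>R f)"
          using hi[of "y + (\<sigma> + \<eta>) *\<^sub>R f"] True by (auto simp: perp_shift f inner_add_right ff \<sigma>_def)
      qed (use deriv' \<eta> w0 in auto)
      finally show ?thesis using True by simp
    qed
  qed
  moreover have "\<dots> = ennreal \<theta> * (\<integral>\<^sup>+y. indicator {y. 0 \<le> f \<bullet> y \<and> f \<bullet> y \<le> 1} y * (indicator Y (perp f y) * ennreal (2 * w (perp f y))) \<partial>lborel)"
    by (subst nn_integral_cmult[symmetric]) (measurable, simp add: mult.left_commute)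
  ultimately show ?thesis by simp
qed

text \<open>Since \<open>p\<close> is monotone on each line, the crossing of the window \<open>[- w,
  w]\<close> contributes at most its length \<open>2 * w\<close>.\<close>
lemma sheet_upper:
  fixes f :: "'a::euclidean_space" and p p' D :: "'a \<Rightarrow> real" and w :: "'a \<Rightarrow> real"
  assumes f: "norm f = 1" and \<eta>: "\<eta> \<ge> 0" and \<epsilon>: "0 \<le> \<theta>"
    and [measurable]: "p \<in> borel_measurable borel" "D \<in> borel_measurable borel" "w \<in> borel_measurable borel"
       "p' \<in> borel_measurable borel" "Y \<in> sets borel" "G \<in> sets borel"
    and w0: "\<And>y. w y \<ge> 0"
    and deriv: "\<And>y. ((\<lambda>t. p (y + t *\<^sub>R f)) has_real_derivative p' y) (at 0)"
    and cont: "continuous_on UNIV p'"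
    and slab: "\<And>z. perp f z \<in> Y \<Longrightarrow> \<bar>f \<bullet> z\<bar> \<le> \<eta> \<Longrightarrow> 0 \<le> p' z"
    and G: "\<And>z. z \<in> G \<Longrightarrow> perp f z \<in> Y \<and> \<bar>f \<bullet> z\<bar> \<le> \<eta> \<and> \<bar>p z\<bar> \<le> w (perp f z) \<and> D z \<le> \<theta> * p' z"
  shows "(\<integral>\<^sup>+z. indicator G z * ennreal (D z) \<partial>lborel) \<le>
     ennreal \<theta> * (\<integral>\<^sup>+y. indicator {y. 0 \<le> f \<bullet> y \<and> f \<bullet> y \<le> 1} y * (indicator Y (perp f y) * ennreal (2 * w (perp f y))) \<partial>lborel)"
proof -
  have ff: "f \<bullet> f = 1" using f by (simp add: dot_square_norm)
  have deriv': "((\<lambda>t. p (y + t *\<^sub>R f)) has_real_derivative p' (y + t *\<^sub>R f)) (at t)" for y t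
  proof -
    have "((\<lambda>h. p ((y + t *\<^sub>R f) + h *\<^sub>R f)) has_real_derivative p' (y + t *\<^sub>R f)) (at 0)" by (rule deriv)
    then have "((\<lambda>h. p (y + (h + t) *\<^sub>R f)) has_real_derivative p' (y + t *\<^sub>R f)) (at 0)"
      by (simp add: algebra_simps)
    then show ?thesis
      by (subst (asm) DERIV_shift[of "\<lambda>t. p (y + t *\<^sub>R f)" _ 0 t, symmetric]) simp
  qed
  let ?H = "{z. perp f z \<in> Y \<and> \<bar>f \<bullet> z\<bar> \<le> \<eta> \<and> \<bar>p z\<bar> \<le> w (perp f z)}"
  have "(\<integral>\<^sup>+z. indicator G z * ennreal (D z) \<partial>lborel)
    \<le> (\<integral>\<^sup>+z. indicator ?H z * (ennreal \<theta> * ennreal (p' z)) \<partial>lborel)" (is "_ \<le> ?I")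
    using slab G \<epsilon> by (intro nn_integral_mono)
      (auto split: split_indicator simp: ennreal_mult'[symmetric] intro!: ennreal_leI)
  also have "?I = (\<integral>\<^sup>+y. indicator {y. 0 \<le> f \<bullet> y \<and> f \<bullet> y \<le> 1} y * (\<integral>\<^sup>+t. indicator ?H (y + t *\<^sub>R f) * (ennreal \<theta> * ennreal (p' (y + t *\<^sub>R f))) \<partial>lborel) \<partial>lborel)"
    by (intro lborel_slices f) measurable
  also have "\<dots> \<le> (\<integral>\<^sup>+y. indicator {y. 0 \<le> f \<bullet> y \<and> f \<bullet> y \<le> 1} y * (ennreal \<theta> * (indicator Y (perp f y) * ennreal (2 * w (perp f y)))) \<partial>lborel)"
  proof (intro nn_integral_mono mult_left_mono)
    fix y
    show "(\<integral>\<^sup>+t. indicator ?H (y + t *\<^sub>R f) * (ennreal \<theta> * ennreal (p' (y + t *\<^sub>R f))) \<partial>lborel)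
      \<le> ennreal \<theta> * (indicator Y (perp f y) * ennreal (2 * w (perp f y)))" (is "?l \<le> _")
    proof (cases "perp f y \<in> Y")
      case False
      then show ?thesis by (simp add: perp_shift f)
    next
      case True
      define \<sigma> where "\<sigma> = - f \<bullet> y"
      have "?l = (\<integral>\<^sup>+t. ennreal \<theta> * (indicator {t. \<sigma> - \<eta> \<le> t \<and> t \<le> \<sigma> + \<eta> \<and> \<bar>p (y + t *\<^sub>R f)\<bar> \<le> w (perp f y)} t * ennreal (p' (y + t *\<^sub>R f))) \<partial>lborel)"
        using True by (intro nn_integral_cong)
          (auto simp: perp_shift f inner_add_right ff \<sigma>_def abs_le_iff split: split_indicator)
      also have "\<dots> = ennreal \<theta> * (\<integral>\<^sup>+t. (indicator {t. \<sigma> - \<eta> \<le> t \<and> t \<le> \<sigma> + \<eta> \<and> \<bar>p (y + t *\<^sub>R f)\<bar> \<le> w (perp f y)} t * ennreal (p' (y + t *\<^sub>R f))) \<partial>lborel)"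
        by (rule nn_integral_cmult) measurable
      also have "(\<integral>\<^sup>+t. (indicator {t. \<sigma> - \<eta> \<le> t \<and> t \<le> \<sigma> + \<eta> \<and> \<bar>p (y + t *\<^sub>R f)\<bar> \<le> w (perp f y)} t * ennreal (p' (y + t *\<^sub>R f))) \<partial>lborel) \<le> ennreal (2 * w (perp f y))"
      proof (rule crossing_integral_le)
        show "continuous_on {\<sigma> - \<eta>..\<sigma> + \<eta>} (\<lambda>t. p' (y + t *\<^sub>R f))"
          by (rule continuous_on_compose2[OF cont]) (auto intro!: continuous_intros)
        show "0 \<le> p' (y + x *\<^sub>R f)" if "x \<in> {\<sigma> - \<eta>..\<sigma> + \<eta>}" for x
          using that True slab[of "y + x *\<^sub>R f"] by (auto simp: perp_shift f inner_add_right ff \<sigma>_def)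
      qed (use deriv' \<eta> w0 in auto)
      finally show ?thesis using True by (simp add: mult_left_mono)
    qed
  qed simp
  also have "\<dots> = ennreal \<theta> * (\<integral>\<^sup>+y. indicator {y. 0 \<le> f \<bullet> y \<and> f \<bullet> y \<le> 1} y * (indicator Y (perp f y) * ennreal (2 * w (perp f y))) \<partial>lborel)"
    by (subst nn_integral_cmult[symmetric]) (measurable, simp add: mult.left_commute)
  finally show ?thesis .
qed

text \<open>Integrate \<open>\<Phi> y * indicator (cball 0 1) (T x - y)\<close> over all pairs in both
  orders: integrating first over either variable produces the volume of the unit ball, because
  \<open>T\<close> maps unit balls to unit balls. Cancelling that volume gives the claim.\<close>
lemma lborel_isometry:
  fixes T S :: "'a::euclidean_space \<Rightarrow> 'a" and \<Phi> :: "'a \<Rightarrow> ennreal"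
  assumes T: "linear T" and n: "\<And>x. norm (T x) = norm x" and S: "\<And>x. T (S x) = x"
    and [measurable]: "\<Phi> \<in> borel_measurable borel" "S \<in> borel_measurable borel"
  shows "(\<integral>\<^sup>+z. \<Phi> (T z) \<partial>lborel) = (\<integral>\<^sup>+z. \<Phi> z \<partial>lborel)"
proof -
  interpret linear T by (rule T)
  have [measurable]: "T \<in> borel_measurable borel"
    by (intro borel_measurable_continuous_onI linear_continuous_on linear_linear[THEN iffD2] T linear_conv_bounded_linear[THEN iffD1])
  let ?\<Psi> = "indicator (cball 0 1) :: 'a \<Rightarrow> ennreal"
  have m[measurable]: "?\<Psi> \<in> borel_measurable borel" by (rule borel_measurable_indicator) simp
  let ?V = "\<integral>\<^sup>+w. ?\<Psi> w \<partial>lborel"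
  have V: "?V = emeasure lborel (cball (0::'a) 1)" by simp
  have V0: "?V \<noteq> 0" unfolding V using unit_ball_vol_pos[of "real DIM('a)"] by (simp add: emeasure_cball del: unit_ball_vol_pos)
  have V1: "?V \<noteq> \<infinity>" unfolding V using emeasure_bounded_finite[of "cball (0::'a) 1"] by simp
  have "(\<integral>\<^sup>+y. (\<integral>\<^sup>+x. \<Phi> y * ?\<Psi> (T x - y) \<partial>lborel) \<partial>lborel) = (\<integral>\<^sup>+y. \<Phi> y * ?V \<partial>lborel)"
  proof (rule nn_integral_cong)
    fix y
    have "(\<integral>\<^sup>+x. \<Phi> y * ?\<Psi> (T x - y) \<partial>lborel) = \<Phi> y * (\<integral>\<^sup>+x. ?\<Psi> (T x - y) \<partial>lborel)"
      by (rule nn_integral_cmult) measurable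
    also have "(\<integral>\<^sup>+x. ?\<Psi> (T x - y) \<partial>lborel) = (\<integral>\<^sup>+x. ?\<Psi> (- S y + x) \<partial>lborel)"
    proof (intro nn_integral_cong)
      fix x
      have "T x - y = T (- S y + x)" by (simp add: add diff neg S)
      then have "norm (T x - y) = norm (- S y + x)" by (simp only: n)
      then show "?\<Psi> (T x - y) = ?\<Psi> (- S y + x)" by (simp add: indicator_def)
    qed
    also have "\<dots> = ?V" by (rule lborel_translate) measurable
    finally show "(\<integral>\<^sup>+x. \<Phi> y * ?\<Psi> (T x - y) \<partial>lborel) = \<Phi> y * ?V" .
  qed
  also have "\<dots> = ?V * (\<integral>\<^sup>+y. \<Phi> y \<partial>lborel)" by (simp add: nn_integral_multc mult.commute)
  finally have 1: "(\<integral>\<^sup>+y. (\<integral>\<^sup>+x. \<Phi> y * ?\<Psi> (T x - y) \<partial>lborel) \<partial>lborel) = ?V * (\<integral>\<^sup>+y. \<Phi> y \<partial>lborel)" .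
  have "(\<integral>\<^sup>+y. (\<integral>\<^sup>+x. \<Phi> y * ?\<Psi> (T x - y) \<partial>lborel) \<partial>lborel) = (\<integral>\<^sup>+x. (\<integral>\<^sup>+y. \<Phi> y * ?\<Psi> (T x - y) \<partial>lborel) \<partial>lborel)"
    by (rule lborel_pair.Fubini') measurable
  also have "\<dots> = (\<integral>\<^sup>+x. (\<integral>\<^sup>+w. \<Phi> (T x + w) * ?\<Psi> w \<partial>lborel) \<partial>lborel)"
  proof (rule nn_integral_cong)
    fix x
    have [measurable]: "(\<lambda>y. \<Phi> y * ?\<Psi> (T x - y)) \<in> borel_measurable borel" by measurable
    have "(\<integral>\<^sup>+y. \<Phi> y * ?\<Psi> (T x - y) \<partial>lborel) = (\<integral>\<^sup>+w. \<Phi> (T x + w) * ?\<Psi> (T x - (T x + w)) \<partial>lborel)"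
      by (rule lborel_translate[symmetric]) measurable
    then show "(\<integral>\<^sup>+y. \<Phi> y * ?\<Psi> (T x - y) \<partial>lborel) = (\<integral>\<^sup>+w. \<Phi> (T x + w) * ?\<Psi> w \<partial>lborel)"
      by (simp add: indicator_def)
  qed
  also have "\<dots> = (\<integral>\<^sup>+w. (\<integral>\<^sup>+x. \<Phi> (T x + w) * ?\<Psi> w \<partial>lborel) \<partial>lborel)"
    by (rule lborel_pair.Fubini') measurable
  also have "\<dots> = (\<integral>\<^sup>+w. (\<integral>\<^sup>+x. \<Phi> (T x) \<partial>lborel) * ?\<Psi> w \<partial>lborel)"
  proof (rule nn_integral_cong)
    fix w
    have "(\<integral>\<^sup>+x. \<Phi> (T x + w) * ?\<Psi> w \<partial>lborel) = (\<integral>\<^sup>+x. \<Phi> (T x + w) \<partial>lborel) * ?\<Psi> w"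
      by (rule nn_integral_multc) measurable
    also have "(\<integral>\<^sup>+x. \<Phi> (T x + w) \<partial>lborel) = (\<integral>\<^sup>+x. \<Phi> (T (S w + x)) \<partial>lborel)"
      by (simp add: add S add.commute)
    also have "\<dots> = (\<integral>\<^sup>+x. \<Phi> (T x) \<partial>lborel)"
      by (rule lborel_translate[of "\<lambda>x. \<Phi> (T x)"]) measurable
    finally show "(\<integral>\<^sup>+x. \<Phi> (T x + w) * ?\<Psi> w \<partial>lborel) = (\<integral>\<^sup>+x. \<Phi> (T x) \<partial>lborel) * ?\<Psi> w" .
  qed
  also have "\<dots> = ?V * (\<integral>\<^sup>+x. \<Phi> (T x) \<partial>lborel)" by (subst nn_integral_cmult) (auto simp: mult.commute)
  finally have "?V * (\<integral>\<^sup>+y. \<Phi> y \<partial>lborel) = ?V * (\<integral>\<^sup>+x. \<Phi> (T x) \<partial>lborel)" using 1 by simp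
  then show ?thesis using V0 V1 by (simp add: ennreal_mult_cancel_left)
qed

text \<open>For \<open>s = 0\<close> this is the area of the unit ball in the limit of infinitely steep
  graphs: on a vertical hyperplane with normal \<open>f\<close> the last coordinate becomes free
  and takes over the role of \<open>f \<bullet> z\<close>. For a sheet at Euclidean distance
  \<open>s\<close> from the centre, the squared norm of the component orthogonal to
  \<open>f\<close> acquires the summand \<open>s\<^sup>2\<close>.\<close>
definition cyl :: "real \<Rightarrow> 'a::euclidean_space \<Rightarrow> ennreal" where
  "cyl s f = emeasure lborel {z. ((norm z)\<^sup>2 - (f \<bullet> z)\<^sup>2 + s\<^sup>2)\<^sup>2 + (f \<bullet> z)\<^sup>2 \<le> 1}"

text \<open>The reflection in the hyperplane orthogonal to \<open>f - g\<close> exchanges the two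
  directions.\<close>
lemma cyl_direction:
  fixes f g :: "'a::euclidean_space"
  assumes f: "norm f = 1" and g: "norm g = 1"
  shows "cyl s f = cyl s g"
proof (cases "f = g")
  case False
  define e where "e = f - g"
  have ff: "f \<bullet> f = 1" "g \<bullet> g = 1" using f g by (simp_all add: dot_square_norm)
  have e0: "e \<bullet> e \<noteq> 0" using False by (simp add: e_def)
  define T where "T z = z - (2 * (e \<bullet> z) / (e \<bullet> e)) *\<^sub>R e" for z
  have lin: "linear T"
    by (rule linearI) (auto simp: T_def algebra_simps inner_add_right add_divide_distrib)
  have inv: "T (T z) = z" for z
    using e0 by (simp add: T_def algebra_simps inner_diff_right)
  have nT: "norm (T z) = norm z" for z
  proof -
    have "T z \<bullet> T z = z \<bullet> z - 4 * (e \<bullet> z) * (e \<bullet> z) / (e \<bullet> e) + 4 * (e \<bullet> z) * (e \<bullet> z) / (e \<bullet> e)"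
      using e0 by (simp add: T_def inner_diff_left inner_diff_right inner_commute power2_eq_square field_simps)
    then show ?thesis by (simp add: norm_eq)
  qed
  have ee: "e \<bullet> e = 2 * (e \<bullet> f)" by (simp add: e_def inner_diff_left inner_diff_right ff inner_commute)
  have fT: "f \<bullet> T z = g \<bullet> z" for z
  proof -
    have "f \<bullet> T z = f \<bullet> z - 2 * (e \<bullet> z) / (e \<bullet> e) * (e \<bullet> f)"
      by (simp add: T_def inner_diff_right inner_commute)
    also have "\<dots> = f \<bullet> z - e \<bullet> z" using e0 unfolding ee by simp
    finally show ?thesis by (simp add: e_def inner_diff_left)
  qed
  have Tm: "T \<in> borel_measurable borel"
    using lin by (intro borel_measurable_continuous_onI linear_continuous_on) (simp add: linear_conv_bounded_linear)
  have "cyl s f = (\<integral>\<^sup>+z. indicator {z. ((norm z)\<^sup>2 - (f \<bullet> z)\<^sup>2 + s\<^sup>2)\<^sup>2 + (f \<bullet> z)\<^sup>2 \<le> 1} z \<partial>lborel)"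
    unfolding cyl_def by (subst nn_integral_indicator) measurable
  also have "\<dots> = (\<integral>\<^sup>+z. indicator {z. ((norm z)\<^sup>2 - (f \<bullet> z)\<^sup>2 + s\<^sup>2)\<^sup>2 + (f \<bullet> z)\<^sup>2 \<le> 1} (T z) \<partial>lborel)"
    by (rule lborel_isometry[OF lin nT inv _ Tm, symmetric]) measurable
  also have "\<dots> = (\<integral>\<^sup>+z. indicator {z. ((norm z)\<^sup>2 - (g \<bullet> z)\<^sup>2 + s\<^sup>2)\<^sup>2 + (g \<bullet> z)\<^sup>2 \<le> 1} z \<partial>lborel)"
    by (intro nn_integral_cong) (simp add: nT fT indicator_def)
  also have "\<dots> = cyl s g"
    unfolding cyl_def by (subst nn_integral_indicator) measurable
  finally show ?thesis .
qed simp

text \<open>Half the length of the fibre over \<open>y\<close>, in direction \<open>f\<close>, of the set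
  that defines \<open>cyl s f\<close>.\<close>
definition width :: "real \<Rightarrow> 'a::euclidean_space \<Rightarrow> real" where
  "width s y = sqrt (max 0 (1 - ((norm y)\<^sup>2 + s\<^sup>2)\<^sup>2))"

lemma width_measurable[measurable]: "width s \<in> borel_measurable borel"
  unfolding width_def[abs_def] by measurable

lemma width_nonneg: "width s y \<ge> 0" by (simp add: width_def)

lemma width_le1: "width s y \<le> 1" by (simp add: width_def)

lemma le_width_iff: "(norm y)\<^sup>2 + s\<^sup>2 \<le> 1 \<Longrightarrow> \<bar>p\<bar> \<le> width s y \<longleftrightarrow> ((norm y)\<^sup>2 + s\<^sup>2)\<^sup>2 + p\<^sup>2 \<le> 1"
proof -
  assume *: "(norm y)\<^sup>2 + s\<^sup>2 \<le> 1"
  then have "((norm y)\<^sup>2 + s\<^sup>2)\<^sup>2 \<le> 1" by (simp add: power_le_one)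
  then have "width s y = sqrt (1 - ((norm y)\<^sup>2 + s\<^sup>2)\<^sup>2)" by (simp add: width_def)
  then have "\<bar>p\<bar> \<le> width s y \<longleftrightarrow> p\<^sup>2 \<le> 1 - ((norm y)\<^sup>2 + s\<^sup>2)\<^sup>2"
    using real_sqrt_le_iff[of "p\<^sup>2" "1 - ((norm y)\<^sup>2 + s\<^sup>2)\<^sup>2"] by simp
  then show ?thesis by linarith
qed

lemma width_0: "(norm y)\<^sup>2 + s\<^sup>2 > 1 \<Longrightarrow> width s y = 0"
  using one_le_power[of "(norm y)\<^sup>2 + s\<^sup>2" 2] by (simp add: width_def)

lemma width_mono: assumes "s\<^sup>2 \<le> t\<^sup>2" shows "width t y \<le> width s y"
proof -
  have "((norm y)\<^sup>2 + s\<^sup>2)\<^sup>2 \<le> ((norm y)\<^sup>2 + t\<^sup>2)\<^sup>2" using assms by (intro power_mono) auto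
  then show ?thesis unfolding width_def by (intro real_sqrt_le_mono max.mono) auto
qed

lemma cyl_slices:
  assumes f: "norm (f::'a::euclidean_space) = 1"
  shows "cyl s f = (\<integral>\<^sup>+y. indicator {y. 0 \<le> f \<bullet> y \<and> f \<bullet> y \<le> 1} y * ennreal (2 * width s (perp f y)) \<partial>lborel)"
proof -
  have ff: "f \<bullet> f = 1" using f by (simp add: dot_square_norm)
  let ?C = "{z. ((norm z)\<^sup>2 - (f \<bullet> z)\<^sup>2 + s\<^sup>2)\<^sup>2 + (f \<bullet> z)\<^sup>2 \<le> 1}"
  have "cyl s f = (\<integral>\<^sup>+z. indicator ?C z \<partial>lborel)"
    unfolding cyl_def by (subst nn_integral_indicator) measurable
  also have "\<dots> = (\<integral>\<^sup>+y. indicator {y. 0 \<le> f \<bullet> y \<and> f \<bullet> y \<le> 1} y * (\<integral>\<^sup>+t. indicator ?C (y + t *\<^sub>R f) \<partial>lborel) \<partial>lborel)"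
    by (intro lborel_slices f) measurable
  also have "\<dots> = (\<integral>\<^sup>+y. indicator {y. 0 \<le> f \<bullet> y \<and> f \<bullet> y \<le> 1} y * ennreal (2 * width s (perp f y)) \<partial>lborel)"
  proof (intro nn_integral_cong arg_cong2[where f = times] refl)
    fix y
    have C: "y + t *\<^sub>R f \<in> ?C \<longleftrightarrow> ((norm (perp f y))\<^sup>2 + s\<^sup>2)\<^sup>2 + (f \<bullet> y + t)\<^sup>2 \<le> 1" for t
    proof -
      have "(norm (y + t *\<^sub>R f))\<^sup>2 - (f \<bullet> (y + t *\<^sub>R f))\<^sup>2 = (norm (perp f y))\<^sup>2"
        using norm_perp[OF f, of "y + t *\<^sub>R f"] by (simp add: perp_shift f)
      then show ?thesis by (simp add: inner_add_right ff)
    qed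
    show "(\<integral>\<^sup>+t. indicator ?C (y + t *\<^sub>R f) \<partial>lborel) = ennreal (2 * width s (perp f y))"
    proof (cases "(norm (perp f y))\<^sup>2 + s\<^sup>2 \<le> 1")
      case True
      let ?w = "width s (perp f y)"
      have "(\<integral>\<^sup>+t. indicator ?C (y + t *\<^sub>R f) \<partial>lborel) = (\<integral>\<^sup>+t. indicator {- (f \<bullet> y) - ?w .. - (f \<bullet> y) + ?w} t \<partial>lborel)"
      proof (rule nn_integral_cong)
        fix t
        have "y + t *\<^sub>R f \<in> ?C \<longleftrightarrow> \<bar>f \<bullet> y + t\<bar> \<le> ?w" using C[of t] le_width_iff[OF True, of "f \<bullet> y + t"] by simp
        also have "\<dots> \<longleftrightarrow> t \<in> {- (f \<bullet> y) - ?w .. - (f \<bullet> y) + ?w}" by auto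
        finally show "indicator ?C (y + t *\<^sub>R f) = (indicator {- (f \<bullet> y) - ?w .. - (f \<bullet> y) + ?w} t :: ennreal)"
          by (simp add: indicator_def)
      qed
      also have "\<dots> = ennreal (2 * ?w)" using width_nonneg[of s "perp f y"] by simp
      finally show ?thesis .
    next
      case False
      have "1 < ((norm (perp f y))\<^sup>2 + s\<^sup>2)\<^sup>2" using False by simp
      then have "\<not> ((norm (perp f y))\<^sup>2 + s\<^sup>2)\<^sup>2 + (f \<bullet> y + t)\<^sup>2 \<le> 1" for t
        using zero_le_power2[of "f \<bullet> y + t"] by linarith
      then have "indicator ?C (y + t *\<^sub>R f) = (0::ennreal)" for t using C[of t] by (simp add: indicator_def)
      then show ?thesis using width_0[of "perp f y" s] False by simp
    qed
  qed
  finally show ?thesis .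
qed

lemma cyl_finite: assumes "norm (f::'a::euclidean_space) = 1" shows "cyl s f < \<infinity>"
proof -
  have "{z. ((norm z)\<^sup>2 - (f \<bullet> z)\<^sup>2 + s\<^sup>2)\<^sup>2 + (f \<bullet> z)\<^sup>2 \<le> 1} \<subseteq> cball 0 2"
  proof
    fix z assume "z \<in> {z. ((norm z)\<^sup>2 - (f \<bullet> z)\<^sup>2 + s\<^sup>2)\<^sup>2 + (f \<bullet> z)\<^sup>2 \<le> 1}"
    then have z: "((norm z)\<^sup>2 - (f \<bullet> z)\<^sup>2 + s\<^sup>2)\<^sup>2 + (f \<bullet> z)\<^sup>2 \<le> 1" by simp
    have a: "((norm z)\<^sup>2 - (f \<bullet> z)\<^sup>2 + s\<^sup>2)\<^sup>2 \<le> 1" "(f \<bullet> z)\<^sup>2 \<le> 1"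
      using z zero_le_power2[of "(norm z)\<^sup>2 - (f \<bullet> z)\<^sup>2 + s\<^sup>2"] zero_le_power2[of "f \<bullet> z"] by linarith+
    have "(norm z)\<^sup>2 - (f \<bullet> z)\<^sup>2 + s\<^sup>2 \<le> 1" using a(1) by (simp add: abs_square_le_1 abs_le_iff)
    moreover have "(2::real)\<^sup>2 = 4" by simp
    ultimately have "(norm z)\<^sup>2 \<le> 2\<^sup>2" using a(2) zero_le_power2[of s] by linarith
    then have "norm z \<le> 2" by (rule power2_le_imp_le) simp
    then show "z \<in> cball 0 2" by simp
  qed
  then show ?thesis unfolding cyl_def
    by (meson bounded_cball bounded_subset emeasure_bounded_finite)
qed

lemma cyl_positive: assumes "norm (f::'a::euclidean_space) = 1" "0 \<le> s" "s < 1" shows "cyl s f > 0"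
proof -
  let ?U = "{z. ((norm z)\<^sup>2 - (f \<bullet> z)\<^sup>2 + s\<^sup>2)\<^sup>2 + (f \<bullet> z)\<^sup>2 < 1}"
  have "open ?U" by (intro open_Collect_less continuous_intros)
  moreover have "0 \<in> ?U" using assms by (simp add: power_less_one_iff)
  ultimately obtain e where e: "e > 0" "cball 0 e \<subseteq> ?U" by (meson open_contains_cball)
  have "0 < emeasure lborel (cball (0::'a) e)"
    using e(1) by (simp add: emeasure_cball unit_ball_vol_pos ennreal_zero_less_mult_iff)
  also have "\<dots> \<le> emeasure lborel ?U" by (intro emeasure_mono e) measurable
  also have "\<dots> \<le> cyl s f" unfolding cyl_def
    by (intro emeasure_mono) auto
  finally show ?thesis .
qed

lemma cyl_antimono: assumes "norm (f::'a::euclidean_space) = 1" "0 \<le> s" "s \<le> t" shows "cyl t f \<le> cyl s f"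
proof -
  have st: "s\<^sup>2 \<le> t\<^sup>2" using assms by (simp add: power_mono)
  have "width t y \<le> width s y" for y :: 'a using st by (rule width_mono)
  then show ?thesis unfolding cyl_slices[OF assms(1)]
    by (intro nn_integral_mono mult_left_mono ennreal_leI) auto
qed

lemma cyl_continuous_0:
  assumes f: "norm (f::'a::euclidean_space) = 1" and x: "x < cyl 0 f"
  obtains s where "0 < s" "s < 1" "x < cyl s f"
proof -
  define \<sigma> where "\<sigma> k = inverse (real (Suc (Suc k)))" for k
  define F where "F k y = indicator {y. 0 \<le> f \<bullet> y \<and> f \<bullet> y \<le> 1} y * ennreal (2 * width (\<sigma> k) (perp f y))" for k y
  have s0: "\<sigma> \<longlonglongrightarrow> 0" unfolding \<sigma>_def
    by (rule LIMSEQ_Suc[OF LIMSEQ_inverse_real_of_nat])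
  have "(\<lambda>k. cyl (\<sigma> k) f) \<longlonglongrightarrow> cyl 0 f"
    unfolding cyl_slices[OF f]
  proof (rule nn_integral_LIMSEQ)
    show "incseq (\<lambda>k y. indicator {y. 0 \<le> f \<bullet> y \<and> f \<bullet> y \<le> 1} y * ennreal (2 * width (\<sigma> k) (perp f y)))"
    proof (rule incseq_SucI, rule le_funI, intro mult_left_mono ennreal_leI)
      fix k :: nat and y :: 'a
      have "(\<sigma> (Suc k))\<^sup>2 \<le> (\<sigma> k)\<^sup>2" unfolding \<sigma>_def by (intro power_mono) (auto simp: field_simps)
      then show "width (\<sigma> k) (perp f y) \<le> width (\<sigma> (Suc k)) (perp f y)" by (rule width_mono)
    qed auto
    show "(\<lambda>k. indicator {y. 0 \<le> f \<bullet> y \<and> f \<bullet> y \<le> 1} y * ennreal (2 * width (\<sigma> k) (perp f y))) \<longlonglongrightarrow>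
       indicator {y. 0 \<le> f \<bullet> y \<and> f \<bullet> y \<le> 1} y * ennreal (2 * width 0 (perp f y))" for y
    proof (intro ennreal_tendsto_cmult tendsto_ennrealI tendsto_mult tendsto_const)
      show "(\<lambda>k. width (\<sigma> k) (perp f y)) \<longlonglongrightarrow> width 0 (perp f y)"
        unfolding width_def by (intro tendsto_intros s0)
      show "indicator {y. 0 \<le> f \<bullet> y \<and> f \<bullet> y \<le> 1} y < (top::ennreal)" by (simp add: indicator_def)
    qed
  qed measurable
  then have "eventually (\<lambda>k. x < cyl (\<sigma> k) f) sequentially" using x by (rule order_tendstoD)
  then obtain k where "x < cyl (\<sigma> k) f" by (auto simp: eventually_sequentially)
  moreover have "0 < \<sigma> k" "\<sigma> k < 1" by (auto simp: \<sigma>_def field_simps)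
  ultimately show ?thesis using that by blast
qed

section \<open>Area of unit balls in a quadratic graph\<close>

lemma norm_matrix_vector_le: "norm (A *v x) \<le> norm A * norm x" for A :: "real^'k::finite^'l::finite"
proof -
  have "norm (A *v x) = L2_set (\<lambda>i. \<bar>(A $ i) \<bullet> x\<bar>) UNIV"
    by (simp add: norm_vec_def matrix_vector_mult_def inner_vec_def)
  also have "\<dots> \<le> L2_set (\<lambda>i. norm (A $ i) * norm x) UNIV"
    by (intro L2_set_mono Cauchy_Schwarz_ineq2) auto
  also have "\<dots> = norm A * norm x"
    using L2_set_left_distrib[of "norm x" "\<lambda>i. norm (A $ i)" UNIV] unfolding norm_vec_def[of A] by simp
  finally show ?thesis .
qed

lemma bounded_bilinear_matrix_vector: "bounded_bilinear (\<lambda>(A::real^'k::finite^'l::finite) x. A *v x)"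
proof
  show "\<exists>K. \<forall>(A::real^'k^'l) x. norm (A *v x) \<le> norm A * norm x * K"
    by (rule exI[of _ 1]) (simp add: norm_matrix_vector_le)
qed (simp_all add: algebra_simps scaleR_matrix_vector_assoc[symmetric])

lemma continuous_on_mv [continuous_intros]:
  "continuous_on S F \<Longrightarrow> continuous_on S g \<Longrightarrow> continuous_on S (\<lambda>p. F p *v g p)"
  for F :: "'a::topological_space \<Rightarrow> real^'k::finite^'l::finite"
  by (rule bounded_bilinear.continuous_on[OF bounded_bilinear_matrix_vector])

lemma tendsto_mv [tendsto_intros]:
  "(F \<longlongrightarrow> B) G \<Longrightarrow> (g \<longlongrightarrow> b) G \<Longrightarrow> ((\<lambda>p. F p *v g p) \<longlongrightarrow> B *v b) G"
  for F :: "'a \<Rightarrow> real^'k::finite^'l::finite"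
  by (rule bounded_bilinear.tendsto[OF bounded_bilinear_matrix_vector])

lemma symmetric_matrix_swap: "transpose A = A \<Longrightarrow> x \<bullet> (A *v y) = (A *v x) \<bullet> y" for A :: "real^'k::finite^'k"
  by (metis dot_lmul_matrix vector_transpose_matrix)

lemma sum_plus_type: "(\<Sum>i\<in>(UNIV::('n::finite+'n) set). g i) = (\<Sum>a\<in>UNIV. g (Inl a)) + (\<Sum>a\<in>UNIV. g (Inr a))"
  by (subst UNIV_Plus_UNIV[symmetric]) (simp only: sum.Plus finite, simp)

lemma sympl_J_Inl: "(sympl_J *v x) $ Inl a = x $ Inr a"
  by (simp add: matrix_vector_mult_def sympl_J_def sum_plus_type if_distrib[of "\<lambda>c. c * _"] cong: if_cong)

lemma sympl_J_Inr: "(sympl_J *v x) $ Inr a = - x $ Inl a"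
  by (simp add: matrix_vector_mult_def sympl_J_def sum_plus_type if_distrib[of "\<lambda>c. c * _"] cong: if_cong)

lemma sympl_J_antisym: "x \<bullet> (sympl_J *v y) = - ((sympl_J *v x) \<bullet> y)"
  by (simp add: inner_vec_def sum_plus_type sympl_J_Inl sympl_J_Inr sum_negf mult.commute)

lemma sympl_J_norm: "norm (sympl_J *v x) = norm x"
  by (simp add: norm_eq inner_vec_def sum_plus_type sympl_J_Inl sympl_J_Inr)

lemma sympl_J_sq: "sympl_J *v (sympl_J *v x) = - x"
proof -
  have "(sympl_J *v (sympl_J *v x)) $ i = (- x) $ i" for i
    by (cases i) (simp_all add: sympl_J_Inl sympl_J_Inr)
  then show ?thesis by (simp add: vec_eq_iff)
qed

lemma sympl_J_self: "x \<bullet> (sympl_J *v x) = 0"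
  using sympl_J_antisym[of x x] by (simp add: inner_commute)

text \<open>The horizontal gradient of \<open>\<langle>x, A x\<rangle> - t\<close>: differentiating along
  the left-invariant field \<open>(v, 2 \<langle>x, J v\<rangle>)\<close> gives \<open>\<langle>2
  (A + J) x, v\<rangle>\<close>.\<close>
definition hgrad :: "real ^ ('n::finite + 'n) ^ ('n + 'n) \<Rightarrow> real ^ ('n + 'n) \<Rightarrow> real ^ ('n + 'n)" where
  "hgrad A x = 2 *\<^sub>R (A *v x + sympl_J *v x)"

text \<open>With \<open>b = hgrad A u\<close> this is the vertical coordinate of the group difference of the
  points of the graph \<open>t = \<langle>x, A x\<rangle>\<close> over \<open>u\<close> and
  \<open>u + z\<close>.\<close>
definition hgt :: "real ^ ('n::finite + 'n) ^ ('n + 'n) \<Rightarrow> real ^ ('n + 'n) \<Rightarrow> real ^ ('n + 'n) \<Rightarrow> real" where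
  "hgt A b z = z \<bullet> (A *v z) + b \<bullet> z"

text \<open>The area, with density \<open>norm (hgrad A x)\<close>, of the Koranyi ball of radius
  \<open>r\<close> about a point \<open>u\<close> of the graph, as a function of \<open>b = hgrad
  A u\<close> only.\<close>
definition surf :: "real ^ ('n::finite + 'n) ^ ('n + 'n) \<Rightarrow> real ^ ('n + 'n) \<Rightarrow> real \<Rightarrow> ennreal" where
  "surf A b r = (\<integral>\<^sup>+z. indicator {z. norm z ^ 4 + (hgt A b z)\<^sup>2 \<le> r ^ 4} z * ennreal (norm (b + hgrad A z)) \<partial>lborel)"

lemma measurable_matrix_vector [measurable]:
  "(\<lambda>x. A *v x) \<in> borel_measurable borel" for A :: "real^'k::finite^'l::finite"
  by (intro borel_measurable_continuous_onI continuous_intros)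

lemma hgrad_measurable [measurable]: "hgrad A \<in> borel_measurable borel"
  unfolding hgrad_def[abs_def] by measurable

lemma hgt_measurable [measurable]: "hgt A b \<in> borel_measurable borel"
  unfolding hgt_def[abs_def] by measurable

lemma hgrad_add: "hgrad A (x + y) = hgrad A x + hgrad A y"
  by (simp add: hgrad_def algebra_simps)

lemma hgrad_scale: "hgrad A (c *\<^sub>R x) = c *\<^sub>R hgrad A x"
  by (simp add: hgrad_def algebra_simps)

text \<open>A symmetric matrix cannot cancel the antisymmetric \<open>J\<close>.\<close>
lemma hgrad_nonzero:
  fixes A :: "real ^ ('n::finite + 'n) ^ ('n + 'n)"
  assumes A: "transpose A = A" shows "\<exists>z. hgrad A z \<noteq> 0"
proof (rule ccontr)
  assume "\<not> (\<exists>z. hgrad A z \<noteq> 0)"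
  then have h0: "A *v z = - (sympl_J *v z)" for z by (simp add: hgrad_def eq_neg_iff_add_eq_0)
  have J0: "x \<bullet> (sympl_J *v y) = 0" for x y :: "real ^ ('n + 'n)"
    using symmetric_matrix_swap[OF A, of x y] sympl_J_antisym[of x y] unfolding h0 by simp
  obtain e :: "real ^ ('n + 'n)" where "norm e = 1" by (metis norm_axis_1)
  then have "norm (sympl_J *v e) = 1" by (simp add: sympl_J_norm)
  then show False using J0[of "sympl_J *v e" e] by (simp add: dot_square_norm)
qed

lemma norm_hgrad_le: "norm (hgrad A x) \<le> (2 * norm A + 2) * norm x"
proof -
  have "norm (A *v x + sympl_J *v x) \<le> norm A * norm x + norm x"
    using norm_triangle_ineq[of "A *v x" "sympl_J *v x"] norm_matrix_vector_le[of A x] by (simp add: sympl_J_norm)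
  then show ?thesis unfolding hgrad_def norm_scaleR by (simp add: distrib_right)
qed

lemma hgt_shift:
  assumes "transpose A = A"
  shows "hgt A b (y + t *\<^sub>R f) = hgt A b y + t * (2 * (f \<bullet> (A *v y)) + b \<bullet> f) + t\<^sup>2 * (f \<bullet> (A *v f))"
  using symmetric_matrix_swap[OF assms, of y f]
  by (simp add: hgt_def algebra_simps inner_add_left inner_add_right power2_eq_square inner_commute)

lemma hgt_deriv:
  assumes "transpose A = A"
  shows "((\<lambda>t. hgt A b (y + t *\<^sub>R f)) has_real_derivative (2 * (f \<bullet> (A *v y)) + b \<bullet> f)) (at 0)"
  unfolding hgt_shift[OF assms] by (auto intro!: derivative_eq_intros)

lemma surf_scale:
  fixes A :: "real ^ ('n::finite + 'n) ^ ('n + 'n)"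
  assumes r: "r > 0"
  shows "surf A b r = ennreal (r ^ (2 * CARD('n) + 1)) * surf A (b /\<^sub>R r) 1"
proof -
  have "surf A b r = ennreal (r ^ (2 * CARD('n))) * (\<integral>\<^sup>+z. indicator {z. norm z ^ 4 + (hgt A b z)\<^sup>2 \<le> r ^ 4} (r *\<^sub>R z) * ennreal (norm (b + hgrad A (r *\<^sub>R z))) \<partial>lborel)"
    unfolding surf_def by (subst lborel_dilate[OF _ r]) (measurable, simp add: mult_2)
  also have "(\<integral>\<^sup>+z. indicator {z. norm z ^ 4 + (hgt A b z)\<^sup>2 \<le> r ^ 4} (r *\<^sub>R z) * ennreal (norm (b + hgrad A (r *\<^sub>R z))) \<partial>lborel)
    = (\<integral>\<^sup>+z. ennreal r * (indicator {z. norm z ^ 4 + (hgt A (b /\<^sub>R r) z)\<^sup>2 \<le> 1 ^ 4} z * ennreal (norm (b /\<^sub>R r + hgrad A z))) \<partial>lborel)"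
  proof (rule nn_integral_cong)
    fix z :: "real ^ ('n + 'n)"
    have 1: "b + hgrad A (r *\<^sub>R z) = r *\<^sub>R (b /\<^sub>R r + hgrad A z)"
      using r by (simp add: hgrad_scale scaleR_right_distrib)
    have 2: "hgt A b (r *\<^sub>R z) = r\<^sup>2 * hgt A (b /\<^sub>R r) z"
      using r by (simp add: hgt_def matrix_vector_mult_scaleR power2_eq_square field_simps)
    have "norm (r *\<^sub>R z) ^ 4 + (hgt A b (r *\<^sub>R z))\<^sup>2 = r ^ 4 * (norm z ^ 4 + (hgt A (b /\<^sub>R r) z)\<^sup>2)"
      unfolding 2 using r by (simp add: power_mult_distrib algebra_simps flip: power_mult)
    then have "norm (r *\<^sub>R z) ^ 4 + (hgt A b (r *\<^sub>R z))\<^sup>2 \<le> r ^ 4 \<longleftrightarrow> norm z ^ 4 + (hgt A (b /\<^sub>R r) z)\<^sup>2 \<le> 1"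
      using r by simp
    then show "indicator {z. norm z ^ 4 + (hgt A b z)\<^sup>2 \<le> r ^ 4} (r *\<^sub>R z) * ennreal (norm (b + hgrad A (r *\<^sub>R z))) =
      ennreal r * (indicator {z. norm z ^ 4 + (hgt A (b /\<^sub>R r) z)\<^sup>2 \<le> 1 ^ 4} z * ennreal (norm (b /\<^sub>R r + hgrad A z)))"
      using r unfolding 1 by (auto simp: indicator_def ennreal_mult' )
  qed
  also have "\<dots> = ennreal r * surf A (b /\<^sub>R r) 1"
    unfolding surf_def by (rule nn_integral_cmult) measurable
  finally show ?thesis using r by (simp add: ennreal_mult' mult_ac)
qed

lemma norm_le_of_perp:
  assumes "norm f = 1" "norm (perp f z) \<le> 1" "\<bar>f \<bullet> z\<bar> \<le> 1"
  shows "norm z \<le> 2"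
proof -
  have "z = perp f z + (f \<bullet> z) *\<^sub>R f" by (simp add: perp_def)
  then have "norm z \<le> norm (perp f z) + norm ((f \<bullet> z) *\<^sub>R f)" by (metis norm_triangle_ineq)
  then show ?thesis using assms by simp
qed

lemma norm_perp_le: "norm f = 1 \<Longrightarrow> norm (perp f z) \<le> norm z"
  by (rule power2_le_imp_le) (simp_all add: norm_perp)

lemma pow4_eq: "(x::real) ^ 4 = (x\<^sup>2)\<^sup>2" by (simp flip: power_mult)

text \<open>In direction \<open>b\<close> the height is monotone on the unit ball once \<open>norm b\<close>
  dominates \<open>norm A\<close>, so the ball is a single sheet, and its density is almost the
  derivative of the height.\<close>
lemma surf_upper:
  fixes A :: "real ^ ('n::finite + 'n) ^ ('n + 'n)" and f b :: "real ^ ('n + 'n)"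
  assumes A: "transpose A = A" and \<epsilon>: "\<epsilon> > 0"
    and b1: "norm b \<ge> 4 * norm A" and b2: "\<epsilon> * norm b \<ge> 2 * norm A + 2 + 2 * norm A * (1 + \<epsilon>)"
    and f: "norm f = 1"
  shows "surf A b 1 \<le> ennreal (1 + \<epsilon>) * cyl 0 f"
proof -
  have b0: "norm b > 0" using b2 \<epsilon> by (smt (verit) mult_eq_0_iff mult_nonneg_nonneg norm_ge_zero)
  define e where "e = b /\<^sub>R norm b"
  have e: "norm e = 1" "b = norm b *\<^sub>R e" using b0 by (auto simp: e_def)
  have ee: "e \<bullet> e = 1" using e(1) by (simp add: dot_square_norm)
  have be: "b \<bullet> e = norm b" by (subst e(2)) (simp add: ee)
  define p' where "p' y = 2 * (e \<bullet> (A *v y)) + b \<bullet> e" for y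
  have p'_ge: "p' z \<ge> norm b - 2 * norm A * norm z" for z
  proof -
    have "\<bar>e \<bullet> (A *v z)\<bar> \<le> norm A * norm z"
      using Cauchy_Schwarz_ineq2[of e "A *v z"] norm_matrix_vector_le[of A z] e(1) by simp
    then show ?thesis unfolding p'_def be by linarith
  qed
  let ?Y = "{y. norm y \<le> 1} :: (real ^ ('n + 'n)) set"
  have "surf A b 1 \<le> ennreal (1 + \<epsilon>) * (\<integral>\<^sup>+y. indicator {y. 0 \<le> e \<bullet> y \<and> e \<bullet> y \<le> 1} y * (indicator ?Y (perp e y) * ennreal (2 * width 0 (perp e y))) \<partial>lborel)"
    unfolding surf_def
  proof (rule sheet_upper[where p = "hgt A b" and p' = p' and \<eta> = 1])
    show "continuous_on UNIV p'" unfolding p'_def by (intro continuous_intros)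
    show "p' \<in> borel_measurable borel" unfolding p'_def by measurable
    show "((\<lambda>t. hgt A b (y + t *\<^sub>R e)) has_real_derivative p' y) (at 0)" for y
      unfolding p'_def by (rule hgt_deriv[OF A])
    show "0 \<le> p' z" if z: "perp e z \<in> ?Y" "\<bar>e \<bullet> z\<bar> \<le> 1" for z
    proof -
      have "norm z \<le> 2" using norm_le_of_perp[OF e(1)] z by auto
      then have "norm A * norm z \<le> norm A * 2" by (intro mult_left_mono) auto
      then show ?thesis using p'_ge[of z] b1 by linarith
    qed
    fix z assume "z \<in> {z. norm z ^ 4 + (hgt A b z)\<^sup>2 \<le> 1 ^ 4}"
    then have z: "norm z ^ 4 + (hgt A b z)\<^sup>2 \<le> 1" by simp
    have "norm z ^ 4 \<le> 1" using z zero_le_power2[of "hgt A b z"] by linarith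
    then have z1: "norm z \<le> 1" by (simp add: power_le_one_iff)
    have pz: "norm (perp e z) \<le> 1" using norm_perp_le[OF e(1), of z] z1 by linarith
    moreover have "\<bar>e \<bullet> z\<bar> \<le> 1" using Cauchy_Schwarz_ineq2[of e z] e(1) z1 by simp
    moreover have "\<bar>hgt A b z\<bar> \<le> width 0 (perp e z)"
    proof (subst le_width_iff)
      show "(norm (perp e z))\<^sup>2 + 0\<^sup>2 \<le> 1" using pz by (simp add: power_le_one)
      have "norm (perp e z) ^ 4 \<le> norm z ^ 4" using norm_perp_le[OF e(1), of z] by (intro power_mono) auto
      moreover have "((norm (perp e z))\<^sup>2 + 0\<^sup>2)\<^sup>2 = norm (perp e z) ^ 4" by simp
      ultimately show "((norm (perp e z))\<^sup>2 + 0\<^sup>2)\<^sup>2 + (hgt A b z)\<^sup>2 \<le> 1" using z by linarith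
    qed
    moreover have "norm (b + hgrad A z) \<le> (1 + \<epsilon>) * p' z"
    proof -
      have "norm (hgrad A z) \<le> 2 * norm A + 2"
        using norm_hgrad_le[of A z] mult_left_mono[OF z1, of "2 * norm A + 2"] by simp
      then have 1: "norm (b + hgrad A z) \<le> norm b + 2 * norm A + 2"
        using norm_triangle_ineq[of b "hgrad A z"] by linarith
      have "norm A * norm z \<le> norm A" using mult_left_mono[OF z1, of "norm A"] by simp
      then have "p' z \<ge> norm b - 2 * norm A" using p'_ge[of z] by linarith
      then have "(1 + \<epsilon>) * p' z \<ge> (1 + \<epsilon>) * (norm b - 2 * norm A)" using \<epsilon> by (intro mult_left_mono) auto
      then show ?thesis using 1 b2 by (simp add: algebra_simps)
    qed
    ultimately show "perp e z \<in> ?Y \<and> \<bar>e \<bullet> z\<bar> \<le> 1 \<and> \<bar>hgt A b z\<bar> \<le> width 0 (perp e z) \<and> norm (b + hgrad A z) \<le> (1 + \<epsilon>) * p' z"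
      by auto
  qed (use e \<epsilon> width_nonneg in \<open>auto\<close>)
  also have "\<dots> \<le> ennreal (1 + \<epsilon>) * cyl 0 e"
    unfolding cyl_slices[OF e(1)] by (intro mult_left_mono nn_integral_mono) (auto simp: indicator_def)
  finally show ?thesis using cyl_direction[OF e(1) f] by simp
qed

text \<open>A sheet of the ball that crosses the hyperplane \<open>f \<bullet> z = s\<close> steeply. The
  rotational part \<open>2 *\<^sub>R (sympl_J *v z)\<close> of the density is at most
  \<open>4\<close> where \<open>norm z \<le> 2\<close>; the hypothesis on the slope leaves a
  fraction \<open>\<theta>\<close> after subtracting it. Points of the sheet lie at distance at
  most \<open>\<bar>s\<bar> + \<eta>\<close> in direction \<open>f\<close>, which costs the offset
  in \<open>cyl\<close>.\<close>
lemma one_sheet_lower: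
  fixes A :: "real ^ ('n::finite + 'n) ^ ('n + 'n)" and D :: "real ^ ('n + 'n) \<Rightarrow> real"
  assumes A: "transpose A = A" and \<theta>: "0 \<le> \<theta>" "\<theta> < 1" and \<sigma>: "\<sigma> = 1 \<or> \<sigma> = (-1::real)"
    and \<eta>: "0 \<le> \<eta>" "\<bar>s\<bar> + \<eta> \<le> 1"
    and f: "norm f = 1"
    and steep: "\<And>z. norm (perp f z) \<le> 1 \<Longrightarrow> \<bar>f \<bullet> z - s\<bar> \<le> \<eta> \<Longrightarrow> (1 - \<theta>) * (\<sigma> * (2 * (f \<bullet> (A *v z)) + b \<bullet> f)) \<ge> 4"
    and lo: "\<And>z. norm (perp f z) \<le> 1 \<Longrightarrow> f \<bullet> z = s - \<eta> \<Longrightarrow> \<sigma> * hgt A b z \<le> - 1"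
    and hi: "\<And>z. norm (perp f z) \<le> 1 \<Longrightarrow> f \<bullet> z = s + \<eta> \<Longrightarrow> \<sigma> * hgt A b z \<ge> 1"
  shows "ennreal \<theta> * cyl (\<bar>s\<bar> + \<eta>) f \<le>
    (\<integral>\<^sup>+z. indicator {z \<in> {z. norm z ^ 4 + (hgt A b z)\<^sup>2 \<le> 1}. \<bar>f \<bullet> z - s\<bar> \<le> \<eta>} z * ennreal (norm (b + hgrad A z)) \<partial>lborel)"
proof -
  let ?s = "\<bar>s\<bar> + \<eta>"
  define p' where "p' y = \<sigma> * (2 * (f \<bullet> (A *v y)) + b \<bullet> f)" for y
  let ?Y = "{y. (norm y)\<^sup>2 + ?s\<^sup>2 \<le> 1} :: (real ^ ('n + 'n)) set"
  have Y1: "norm y \<le> 1" if "y \<in> ?Y" for y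
  proof -
    have "(norm y)\<^sup>2 \<le> 1\<^sup>2" using that zero_le_power2[of ?s] unfolding mem_Collect_eq one_power2 by linarith
    then show ?thesis by (rule power2_le_imp_le) simp
  qed
  have eq: "cyl ?s f = (\<integral>\<^sup>+y. indicator {y. 0 \<le> f \<bullet> y \<and> f \<bullet> y \<le> 1} y * (indicator ?Y (perp f y) * ennreal (2 * width ?s (perp f y))) \<partial>lborel)"
    unfolding cyl_slices[OF f]
    by (intro nn_integral_cong arg_cong2[where f = times] refl) (auto simp: indicator_def not_le dest: width_0)
  show ?thesis
    unfolding eq
  proof (rule sheet_lower[where p = "\<lambda>z. \<sigma> * hgt A b z" and p' = p' and w = "width ?s"])
    show "continuous_on UNIV p'" unfolding p'_def by (intro continuous_intros)
    show "p' \<in> borel_measurable borel" unfolding p'_def by measurable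
    show "((\<lambda>t. \<sigma> * hgt A b (y + t *\<^sub>R f)) has_real_derivative p' y) (at 0)" for y
      unfolding p'_def by (intro DERIV_cmult hgt_deriv[OF A])
    fix z assume z: "perp f z \<in> ?Y"
    note z1 = Y1[OF z]
    show "\<sigma> * hgt A b z \<le> - width ?s (perp f z)" if "f \<bullet> z = s - \<eta>"
      using lo[OF z1 that] width_le1[of ?s "perp f z"] by linarith
    show "\<sigma> * hgt A b z \<ge> width ?s (perp f z)" if "f \<bullet> z = s + \<eta>"
      using hi[OF z1 that] width_le1[of ?s "perp f z"] by linarith
    assume z2: "\<bar>f \<bullet> z - s\<bar> \<le> \<eta>"
    have fz: "\<bar>f \<bullet> z\<bar> \<le> ?s" using z2 by linarith
    have zn: "norm z \<le> 2" by (rule norm_le_of_perp[OF f z1]) (use fz \<eta> in linarith)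
    have st: "(1 - \<theta>) * p' z \<ge> 4" using steep[OF z1 z2] by (simp add: p'_def)
    have i1: "norm (b + hgrad A z) \<ge> \<sigma> * (f \<bullet> (b + hgrad A z))"
      using Cauchy_Schwarz_ineq2[of f "b + hgrad A z"] f \<sigma> by auto
    have i2: "\<sigma> * (f \<bullet> (b + hgrad A z)) = p' z + \<sigma> * (2 * (f \<bullet> (sympl_J *v z)))"
      by (simp add: p'_def hgrad_def inner_add_right inner_commute algebra_simps)
    have i3: "\<sigma> * (2 * (f \<bullet> (sympl_J *v z))) \<ge> - 4"
    proof -
      have "\<bar>f \<bullet> (sympl_J *v z)\<bar> \<le> 2" using Cauchy_Schwarz_ineq2[of f "sympl_J *v z"] f zn by (simp add: sympl_J_norm)
      then show ?thesis using \<sigma> by auto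
    qed
    have "norm (b + hgrad A z) \<ge> p' z - 4" using i1 i2 i3 by linarith
    moreover have "0 \<le> p' z" using st \<theta> by (smt (verit) mult_nonneg_nonpos)
    ultimately show "0 \<le> p' z \<and> \<theta> * p' z \<le> norm (b + hgrad A z)" using st by (simp add: algebra_simps)
    assume w: "\<bar>\<sigma> * hgt A b z\<bar> \<le> width ?s (perp f z)"
    then have w: "\<bar>hgt A b z\<bar> \<le> width ?s (perp f z)" using \<sigma> by auto
    have "(norm (perp f z))\<^sup>2 + ?s\<^sup>2 \<le> 1" using z by simp
    with w have "((norm (perp f z))\<^sup>2 + ?s\<^sup>2)\<^sup>2 + (hgt A b z)\<^sup>2 \<le> 1" by (simp only: le_width_iff)
    moreover have "norm z ^ 4 \<le> ((norm (perp f z))\<^sup>2 + ?s\<^sup>2)\<^sup>2"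
    proof -
      have "(f \<bullet> z)\<^sup>2 \<le> ?s\<^sup>2" using fz by (metis abs_ge_zero power2_abs power_mono)
      then have "(norm z)\<^sup>2 \<le> (norm (perp f z))\<^sup>2 + ?s\<^sup>2" using norm_perp[OF f, of z] by linarith
      then show ?thesis unfolding pow4_eq by (intro power_mono) auto
    qed
    ultimately show "z \<in> {z. norm z ^ 4 + (hgt A b z)\<^sup>2 \<le> 1}" by simp
  next
    show "?Y \<in> sets borel" by measurable
    show "{z. norm z ^ 4 + (hgt A b z)\<^sup>2 \<le> 1} \<in> sets borel" by measurable
    show "(\<lambda>z. \<sigma> * hgt A b z) \<in> borel_measurable borel" by measurable
    show "(\<lambda>z. norm (b + hgrad A z)) \<in> borel_measurable borel" by measurable
    show "0 \<le> width ?s y" for y :: "real ^ ('n + 'n)" by (rule width_nonneg)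
    show "norm f = 1" "0 \<le> \<eta>" "0 \<le> \<theta>" by fact+
    show "width ?s \<in> borel_measurable borel" by (rule width_measurable)
  qed
qed

lemma surf_lower:
  fixes A :: "real ^ ('n::finite + 'n) ^ ('n + 'n)" and f b :: "real ^ ('n + 'n)"
  assumes A: "transpose A = A" and \<theta>: "0 \<le> \<theta>" "\<theta> < 1" and \<eta>: "0 < \<eta>" "\<eta> \<le> 1"
    and b1: "(1 - \<theta>) * (norm b - 4 * norm A) \<ge> 4" and b2: "norm b * \<eta> \<ge> 1 + 4 * norm A"
    and f: "norm f = 1"
  shows "ennreal \<theta> * cyl \<eta> f \<le> surf A b 1"
proof -
  have b0: "norm b > 0" using b2 \<eta> by (smt (verit) mult_eq_0_iff norm_ge_zero)
  define e where "e = b /\<^sub>R norm b"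
  have e: "norm e = 1" "b = norm b *\<^sub>R e" using b0 by (auto simp: e_def)
  have ee: "e \<bullet> e = 1" using e(1) by (simp add: dot_square_norm)
  have be: "b \<bullet> e = norm b" by (subst e(2)) (simp add: ee)
  have nz: "norm z \<le> 2" if "norm (perp e z) \<le> 1" "\<bar>e \<bullet> z\<bar> \<le> \<eta>" for z
    by (rule norm_le_of_perp[OF e(1) that(1)]) (use that \<eta> in linarith)
  have Az: "\<bar>v \<bullet> (A *v z)\<bar> \<le> norm A * norm v * norm z" for v z
    using Cauchy_Schwarz_ineq2[of v "A *v z"] mult_left_mono[OF norm_matrix_vector_le[of A z], of "norm v"]
    by (simp add: algebra_simps)
  have q4: "\<bar>z \<bullet> (A *v z)\<bar> \<le> 4 * norm A" if "norm z \<le> 2" for z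
  proof -
    have "norm z * norm z \<le> 2 * 2" using that by (intro mult_mono) auto
    then have "norm A * (norm z * norm z) \<le> norm A * 4" by (intro mult_left_mono) auto
    then show ?thesis using Az[of z z] by (simp add: algebra_simps)
  qed
  have "ennreal \<theta> * cyl (\<bar>0\<bar> + \<eta>) e \<le> (\<integral>\<^sup>+z. indicator {z \<in> {z. norm z ^ 4 + (hgt A b z)\<^sup>2 \<le> 1}. \<bar>e \<bullet> z - 0\<bar> \<le> \<eta>} z * ennreal (norm (b + hgrad A z)) \<partial>lborel)"
  proof (rule one_sheet_lower[where \<sigma> = 1, OF A])
    fix z assume z: "norm (perp e z) \<le> 1"
    { assume "\<bar>e \<bullet> z - 0\<bar> \<le> \<eta>"
      then have z2: "norm z \<le> 2" using nz z by simp
      then have "norm A * norm z \<le> norm A * 2" by (intro mult_left_mono) auto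
      then have "2 * (e \<bullet> (A *v z)) + b \<bullet> e \<ge> norm b - 4 * norm A" using Az[of e z] e be by simp
      then have "(1 - \<theta>) * (2 * (e \<bullet> (A *v z)) + b \<bullet> e) \<ge> (1 - \<theta>) * (norm b - 4 * norm A)" using \<theta> by (intro mult_left_mono) auto
      then show "(1 - \<theta>) * (1 * (2 * (e \<bullet> (A *v z)) + b \<bullet> e)) \<ge> 4" using b1 by simp }
    have bz: "b \<bullet> z = norm b * (e \<bullet> z)" by (subst e(2)) simp
    { assume *: "e \<bullet> z = 0 - \<eta>"
      then have "norm z \<le> 2" using nz z \<eta> by simp
      then show "1 * hgt A b z \<le> - 1" using q4[of z] b2 * by (simp add: hgt_def bz) }
    { assume *: "e \<bullet> z = 0 + \<eta>"
      then have "norm z \<le> 2" using nz z \<eta> by simp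
      then show "1 * hgt A b z \<ge> 1" using q4[of z] b2 * by (simp add: hgt_def bz) }
  qed (use e \<theta> \<eta> in auto)
  also have "\<dots> \<le> surf A b 1" unfolding surf_def
    by (intro nn_integral_mono) (auto simp: indicator_def)
  finally show ?thesis using cyl_direction[OF e(1) f] \<eta> by simp
qed

text \<open>By \<open>surf_scale\<close>, zooming in at a regular point lets \<open>b\<close> grow while
  \<open>A\<close> stays fixed, so this gives the area of small balls about regular points,
  uniformly as long as the gradient is bounded below.\<close>
lemma surf_asymptotic:
  fixes A :: "real ^ ('n::finite + 'n) ^ ('n + 'n)"
  assumes A: "transpose A = A" and f: "norm (f :: real ^ ('n + 'n)) = 1" and \<epsilon>: "\<epsilon> > 0"
  obtains R where "R > 0" "\<And>b. norm b \<ge> R \<Longrightarrow> surf A b 1 \<le> ennreal (1 + \<epsilon>) * cyl 0 f \<and> cyl 0 f \<le> ennreal (1 + \<epsilon>) * surf A b 1"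
proof -
  define \<theta> where "\<theta> = 1 / (1 + \<epsilon> / 2)"
  have \<theta>: "0 < \<theta>" "\<theta> < 1" using \<epsilon> by (auto simp: \<theta>_def field_simps)
  have k: "(1 + \<epsilon>) * \<theta> > 1" using \<epsilon> by (simp add: \<theta>_def field_simps)
  define c where "c = enn2real (cyl 0 f)"
  have c: "cyl 0 f = ennreal c" "c > 0"
    using cyl_finite[OF f, of 0] cyl_positive[OF f, of 0] by (auto simp: c_def enn2real_positive_iff)
  have "ennreal (c / ((1 + \<epsilon>) * \<theta>)) < cyl 0 f" using c k by (simp add: ennreal_less_iff divide_less_eq)
  from cyl_continuous_0[OF f this] obtain \<eta> where \<eta>: "0 < \<eta>" "\<eta> < 1" "ennreal (c / ((1 + \<epsilon>) * \<theta>)) < cyl \<eta> f" .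
  define R where "R = 1 + 4 * norm A + (2 * norm A + 2 + 2 * norm A * (1 + \<epsilon>)) / \<epsilon> + 4 / (1 - \<theta>) + (1 + 4 * norm A) / \<eta>"
  have pos: "(2 * norm A + 2 + 2 * norm A * (1 + \<epsilon>)) / \<epsilon> \<ge> 0" "4 / (1 - \<theta>) \<ge> 0" "(1 + 4 * norm A) / \<eta> \<ge> 0"
    using \<epsilon> \<theta> \<eta> by auto
  show ?thesis
  proof (rule that)
    show "R > 0" unfolding R_def using pos norm_ge_zero[of A] by linarith
    fix b :: "real ^ ('n + 'n)" assume b: "norm b \<ge> R"
    have b1: "norm b \<ge> 4 * norm A" using b pos unfolding R_def by linarith
    have "norm b \<ge> (2 * norm A + 2 + 2 * norm A * (1 + \<epsilon>)) / \<epsilon>" using b pos norm_ge_zero[of A] unfolding R_def by linarith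
    then have b2: "\<epsilon> * norm b \<ge> 2 * norm A + 2 + 2 * norm A * (1 + \<epsilon>)" using \<epsilon> by (simp add: pos_divide_le_eq mult.commute)
    have "norm b - 4 * norm A \<ge> 4 / (1 - \<theta>)" using b pos unfolding R_def by linarith
    then have b3: "(1 - \<theta>) * (norm b - 4 * norm A) \<ge> 4" using \<theta> by (simp add: pos_divide_le_eq mult.commute)
    have "norm b \<ge> (1 + 4 * norm A) / \<eta>" using b pos norm_ge_zero[of A] unfolding R_def by linarith
    then have b4: "norm b * \<eta> \<ge> 1 + 4 * norm A" using \<eta> by (simp add: pos_divide_le_eq)
    have "cyl 0 f = ennreal ((1 + \<epsilon>) * \<theta>) * ennreal (c / ((1 + \<epsilon>) * \<theta>))"
      using k c \<theta> \<epsilon> by (simp flip: ennreal_mult')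
    also have "\<dots> \<le> ennreal ((1 + \<epsilon>) * \<theta>) * cyl \<eta> f" using \<eta> by (intro mult_left_mono) auto
    also have "\<dots> = ennreal (1 + \<epsilon>) * (ennreal \<theta> * cyl \<eta> f)" using \<theta> \<epsilon> by (simp add: ennreal_mult' mult.assoc)
    also have "\<dots> \<le> ennreal (1 + \<epsilon>) * surf A b 1"
      by (intro mult_left_mono surf_lower A f b3 b4) (use \<theta> \<eta> in auto)
    finally show "surf A b 1 \<le> ennreal (1 + \<epsilon>) * cyl 0 f \<and> cyl 0 f \<le> ennreal (1 + \<epsilon>) * surf A b 1"
      using surf_upper[OF A \<epsilon> b1 b2 f] by simp
  qed
qed

section \<open>The Koranyi distance\<close>

lemma koranyi_norm_nonneg: "koranyi_norm x \<ge> 0"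
  by (simp add: koranyi_norm_def)

lemma koranyi_norm_pow4: "koranyi_norm x ^ 4 = norm (fst x) ^ 4 + (snd x)\<^sup>2"
  by (simp add: koranyi_norm_def)

lemma koranyi_norm_le_iff: "r \<ge> 0 \<Longrightarrow> koranyi_norm x \<le> r \<longleftrightarrow> norm (fst x) ^ 4 + (snd x)\<^sup>2 \<le> r ^ 4"
  using koranyi_norm_nonneg[of x] power_mono_iff[of "koranyi_norm x" r 4] by (simp add: koranyi_norm_pow4)

lemma norm_fst_le_koranyi: "norm (fst x) \<le> koranyi_norm x"
proof -
  have "norm (fst x) ^ 4 \<le> koranyi_norm x ^ 4" by (simp add: koranyi_norm_pow4)
  then show ?thesis using koranyi_norm_nonneg[of x] by simp
qed

lemma snd_le_koranyi: "\<bar>snd x\<bar> \<le> (koranyi_norm x)\<^sup>2"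
proof (rule power2_le_imp_le)
  have "\<bar>snd x\<bar>\<^sup>2 \<le> koranyi_norm x ^ 4" by (simp add: koranyi_norm_pow4)
  then show "\<bar>snd x\<bar>\<^sup>2 \<le> ((koranyi_norm x)\<^sup>2)\<^sup>2" by (simp flip: power_mult)
qed simp

text \<open>Bessel inequality for \<open>x\<close> and the orthogonal pair \<open>y\<close>, \<open>J
  y\<close> of equal length.\<close>
lemma sympl_bessel: "(x \<bullet> y)\<^sup>2 + (x \<bullet> (sympl_J *v y))\<^sup>2 \<le> (norm x)\<^sup>2 * (norm y)\<^sup>2"
proof -
  define S where "S = (x \<bullet> y)\<^sup>2 + (x \<bullet> (sympl_J *v y))\<^sup>2"
  define w where "w = (x \<bullet> y) *\<^sub>R y + (x \<bullet> (sympl_J *v y)) *\<^sub>R (sympl_J *v y)"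
  have S0: "S \<ge> 0" by (simp add: S_def)
  have 1: "x \<bullet> w = S" by (simp add: w_def S_def inner_add_right power2_eq_square)
  have "(sympl_J *v y) \<bullet> (sympl_J *v y) = y \<bullet> y" using sympl_J_norm[of y] by (simp add: norm_eq)
  moreover have "(sympl_J *v y) \<bullet> y = 0" using sympl_J_self[of y] by (simp add: inner_commute)
  ultimately have 2: "(norm w)\<^sup>2 = S * (norm y)\<^sup>2"
    unfolding power2_norm_eq_inner
    by (simp add: w_def S_def inner_add_left inner_add_right sympl_J_self power2_eq_square algebra_simps)
  have "S\<^sup>2 \<le> (norm x)\<^sup>2 * (norm w)\<^sup>2"
    using Cauchy_Schwarz_ineq[of x w] unfolding 1 power2_norm_eq_inner .
  then have "S * S \<le> S * ((norm x)\<^sup>2 * (norm y)\<^sup>2)" unfolding 2 by (simp add: power2_eq_square mult_ac)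
  then have "S \<le> (norm x)\<^sup>2 * (norm y)\<^sup>2"
    using S0 by (cases "S = 0") (auto simp: mult_le_cancel_left)
  then show ?thesis by (simp add: S_def)
qed

text \<open>The argument of Cygan: the complex number \<open>\<bar>x\<^sub>H\<bar>\<^sup>2 + i
  x\<^sub>T\<close> has modulus \<open>\<parallel>x\<parallel>\<^sup>2\<close>, and for a product
  it is the sum of those of the factors plus \<open>2 (\<langle>x\<^sub>H, y\<^sub>H\<rangle> + i
  \<langle>x\<^sub>H, J y\<^sub>H\<rangle>)\<close>, which the Bessel inequality bounds.\<close>
lemma koranyi_norm_triangle: "koranyi_norm (heis_mult x y) \<le> koranyi_norm x + koranyi_norm y"
proof -
  define Z where "Z p = Complex ((norm (fst p))\<^sup>2) (snd p)" for p :: "'a heis"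
  have Z: "cmod (Z p) = (koranyi_norm p)\<^sup>2" for p :: "'a heis"
  proof (rule power2_eq_imp_eq)
    show "(cmod (Z p))\<^sup>2 = ((koranyi_norm p)\<^sup>2)\<^sup>2"
      by (simp add: Z_def cmod_power2 koranyi_norm_pow4 flip: power_mult)
  qed auto
  define W where "W = Complex (fst x \<bullet> fst y) (fst x \<bullet> (sympl_J *v fst y))"
  have "cmod W \<le> norm (fst x) * norm (fst y)"
  proof (rule power2_le_imp_le)
    show "(cmod W)\<^sup>2 \<le> (norm (fst x) * norm (fst y))\<^sup>2"
      using sympl_bessel[of "fst x" "fst y"] by (simp add: W_def cmod_power2 power_mult_distrib)
  qed simp
  also have "\<dots> \<le> koranyi_norm x * koranyi_norm y"
    by (intro mult_mono norm_fst_le_koranyi) (auto simp: koranyi_norm_nonneg)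
  finally have W: "cmod W \<le> koranyi_norm x * koranyi_norm y" .
  have "(norm (fst x + fst y))\<^sup>2 = (norm (fst x))\<^sup>2 + (norm (fst y))\<^sup>2 + 2 * (fst x \<bullet> fst y)"
    unfolding power2_norm_eq_inner by (simp add: inner_add_left inner_add_right inner_commute)
  then have "Z (heis_mult x y) = Z x + Z y + 2 * W"
    by (simp add: Z_def W_def heis_mult_def complex_eq_iff)
  then have "cmod (Z (heis_mult x y)) \<le> cmod (Z x) + cmod (Z y) + 2 * cmod W"
    by (metis (no_types, opaque_lifting) norm_triangle_ineq norm_mult norm_numeral add_right_mono order_trans)
  also have "\<dots> \<le> (koranyi_norm x + koranyi_norm y)\<^sup>2"
    using W by (simp add: Z power2_sum)
  finally have "(koranyi_norm (heis_mult x y))\<^sup>2 \<le> (koranyi_norm x + koranyi_norm y)\<^sup>2" by (simp add: Z)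
  then show ?thesis by (rule power2_le_imp_le) (simp add: koranyi_norm_nonneg)
qed

lemma koranyi_dist_eq: "koranyi_dist x y = koranyi_norm (fst y - fst x, snd y - snd x - 2 * (fst x \<bullet> (sympl_J *v fst y)))"
  by (simp add: koranyi_dist_def heis_mult_def heis_inv_def)

lemma koranyi_dist_commute: "koranyi_dist x y = koranyi_dist y x"
proof -
  have "fst y \<bullet> (sympl_J *v fst x) = - (fst x \<bullet> (sympl_J *v fst y))"
    using sympl_J_antisym[of "fst y" "fst x"] by (simp add: inner_commute)
  then have "(snd x - snd y - 2 * (fst y \<bullet> (sympl_J *v fst x)))\<^sup>2 = (snd y - snd x - 2 * (fst x \<bullet> (sympl_J *v fst y)))\<^sup>2"
    by (simp add: power2_eq_square algebra_simps)
  then show ?thesis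
    unfolding koranyi_dist_eq koranyi_norm_def by (simp add: norm_minus_commute)
qed

lemma koranyi_dist_triangle: "koranyi_dist x z \<le> koranyi_dist x y + koranyi_dist y z"
proof -
  have "heis_mult (heis_inv x) z = heis_mult (heis_mult (heis_inv x) y) (heis_mult (heis_inv y) z)"
    using sympl_J_self[of "fst y"]
    by (simp add: heis_mult_def heis_inv_def algebra_simps inner_add_left inner_add_right)
  then show ?thesis using koranyi_norm_triangle by (simp add: koranyi_dist_def)
qed

definition lift :: "real ^ ('n::finite + 'n) ^ ('n + 'n) \<Rightarrow> real ^ ('n + 'n) \<Rightarrow> 'n heis" where
  "lift A x = (x, x \<bullet> (A *v x))"

definition gdist :: "real ^ ('n::finite + 'n) ^ ('n + 'n) \<Rightarrow> real ^ ('n + 'n) \<Rightarrow> real ^ ('n + 'n) \<Rightarrow> real" where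
  "gdist A u v = koranyi_dist (lift A u) (lift A v)"

lemma gdist_commute: "gdist A u v = gdist A v u"
  unfolding gdist_def by (rule koranyi_dist_commute)

lemma gdist_triangle: "gdist A u w \<le> gdist A u v + gdist A v w"
  unfolding gdist_def by (rule koranyi_dist_triangle)

lemma gdist_nonneg: "gdist A u v \<ge> 0"
  unfolding gdist_def koranyi_dist_def by (rule koranyi_norm_nonneg)

lemma norm_le_gdist: "norm (v - u) \<le> gdist A u v"
  unfolding gdist_def koranyi_dist_eq lift_def using norm_fst_le_koranyi by force

lemma gdist_le_iff:
  assumes "transpose A = A" "r \<ge> 0"
  shows "gdist A u v \<le> r \<longleftrightarrow> norm (v - u) ^ 4 + (hgt A (hgrad A u) (v - u))\<^sup>2 \<le> r ^ 4"
proof -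
  have "v \<bullet> (A *v v) - u \<bullet> (A *v u) - 2 * (u \<bullet> (sympl_J *v v)) = hgt A (hgrad A u) (v - u)"
    using symmetric_matrix_swap[OF assms(1), of v u] sympl_J_antisym[of u v] sympl_J_self[of u]
    by (simp add: hgt_def hgrad_def algebra_simps inner_add_left inner_add_right inner_commute
        inner_diff_left inner_diff_right)
  then show ?thesis
    unfolding gdist_def koranyi_dist_eq lift_def using assms(2) by (simp add: koranyi_norm_le_iff)
qed

lemma infdist_nbhd_tendsto:
  fixes K :: "'a::euclidean_space set"
  assumes K: "compact K" "K \<noteq> {}" and s: "sets N = sets borel"
    and fin: "\<And>S. bounded S \<Longrightarrow> S \<in> sets borel \<Longrightarrow> emeasure N S < \<infinity>"
  shows "(\<lambda>k. emeasure N {v. infdist v K \<le> inverse (real (Suc k))}) \<longlonglongrightarrow> emeasure N K"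
proof -
  let ?F = "\<lambda>k. {v. infdist v K \<le> inverse (real (Suc k))}"
  have cl: "closed (?F k)" for k by (intro closed_Collect_le continuous_intros)
  have bd: "bounded (?F k)" for k
  proof -
    obtain B where B: "\<And>x. x \<in> K \<Longrightarrow> norm x \<le> B" using compact_imp_bounded[OF K(1)] by (auto simp: bounded_iff)
    have "norm v \<le> B + 1" if "v \<in> ?F k" for v
    proof -
      obtain x where x: "x \<in> K" "infdist v K = dist v x" using infdist_attains_inf[OF compact_imp_closed[OF K(1)] K(2)] by blast
      have "inverse (real (Suc k)) \<le> 1" by (simp add: field_simps)
      then have "norm (v - x) \<le> 1" using that x by (simp add: dist_norm)
      then show ?thesis using B[OF x(1)] norm_triangle_ineq[of "v - x" x] by simp
    qed
    then show ?thesis by (auto simp: bounded_iff)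
  qed
  have INT: "(\<Inter>k. ?F k) = K"
  proof (intro equalityI subsetI)
    fix v assume "v \<in> (\<Inter>k. ?F k)"
    then have "infdist v K \<le> inverse (real (Suc k))" for k by auto
    then have "infdist v K \<le> 0"
      using LIMSEQ_inverse_real_of_nat by (intro LIMSEQ_le_const[OF LIMSEQ_inverse_real_of_nat]) auto
    then have "infdist v K = 0" using infdist_nonneg[of v K] by simp
    then show "v \<in> K" using in_closed_iff_infdist_zero[OF compact_imp_closed[OF K(1)] K(2)] by simp
  next
    fix v assume "v \<in> K" then show "v \<in> (\<Inter>k. ?F k)" by simp
  qed
  have "(\<lambda>k. emeasure N (?F k)) \<longlonglongrightarrow> emeasure N (\<Inter>k. ?F k)"
  proof (rule Lim_emeasure_decseq)
    show "range ?F \<subseteq> sets N" using cl s by auto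
    show "decseq ?F"
    proof (rule decseq_SucI)
      fix k have "inverse (real (Suc (Suc k))) \<le> inverse (real (Suc k))" by (simp add: field_simps)
      then show "?F (Suc k) \<le> ?F k" by (auto simp del: of_nat_Suc intro: order_trans)
    qed
    show "emeasure N (?F k) \<noteq> \<infinity>" for k using fin[OF bd] cl by (simp add: less_top[symmetric])
  qed
  then show ?thesis by (simp only: INT)
qed

section \<open>Uniform measures on quadratic graphs\<close>

definition hball :: "real ^ ('n::finite + 'n) ^ ('n + 'n) \<Rightarrow> real \<Rightarrow> real ^ ('n + 'n) \<Rightarrow> (real ^ ('n + 'n)) set" where
  "hball A r u = {v. gdist A u v \<le> r}"

definition harea :: "real ^ ('n::finite + 'n) ^ ('n + 'n) \<Rightarrow> (real ^ ('n + 'n)) measure" where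
  "harea A = density lborel (\<lambda>x. ennreal (norm (hgrad A x)))"

lemma sets_harea [measurable_cong, simp]: "sets (harea A) = sets borel"
  by (simp add: harea_def)

lemma emeasure_harea: "S \<in> sets borel \<Longrightarrow> emeasure (harea A) S = (\<integral>\<^sup>+x. indicator S x * ennreal (norm (hgrad A x)) \<partial>lborel)"
  unfolding harea_def by (subst emeasure_density) (auto simp: mult.commute)

lemma continuous_gdist: "continuous_on UNIV (\<lambda>(u, v). gdist A u v)"
proof -
  have "continuous_on UNIV (\<lambda>x. koranyi_norm (fst (snd x) - fst (fst x), snd (snd x) - snd (fst x) - 2 * (fst (fst x) \<bullet> (sympl_J *v fst (snd x)))))"
    unfolding koranyi_norm_def by (intro continuous_intros)
  then have "continuous_on UNIV (\<lambda>x. koranyi_dist (fst x) (snd x))" unfolding koranyi_dist_eq .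
  moreover have "continuous_on UNIV (\<lambda>x. (lift A (fst x), lift A (snd x)))"
    unfolding lift_def by (intro continuous_intros)
  ultimately have "continuous_on UNIV (\<lambda>x. koranyi_dist (lift A (fst x)) (lift A (snd x)))"
    using continuous_on_compose2[of UNIV "\<lambda>x. koranyi_dist (fst x) (snd x)" UNIV "\<lambda>x. (lift A (fst x), lift A (snd x))"] by simp
  then show ?thesis unfolding gdist_def by (simp add: case_prod_beta)
qed

lemma closed_hball: "closed (hball A r u)"
proof -
  have "continuous_on UNIV (\<lambda>v. gdist A u v)"
    using continuous_on_compose2[OF continuous_gdist, of UNIV "\<lambda>v. (u, v)" A]
    by (simp add: continuous_on_Pair)
  then show ?thesis unfolding hball_def by (intro closed_Collect_le continuous_intros)
qed

lemma hball_borel [measurable]: "hball A r u \<in> sets borel"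
  using closed_hball by (rule borel_closed)

lemma harea_hball:
  fixes A :: "real ^ ('n::finite + 'n) ^ ('n + 'n)"
  assumes A: "transpose A = A" and r: "r \<ge> 0"
  shows "emeasure (harea A) (hball A r u) = surf A (hgrad A u) r"
proof -
  have "emeasure (harea A) (hball A r u) = (\<integral>\<^sup>+x. indicator (hball A r u) (u + x) * ennreal (norm (hgrad A (u + x))) \<partial>lborel)"
    by (subst emeasure_harea) (auto intro!: lborel_translate[symmetric])
  also have "\<dots> = surf A (hgrad A u) r"
    unfolding surf_def
    by (intro nn_integral_cong) (simp add: hball_def gdist_le_iff[OF A r] indicator_def hgrad_add)
  finally show ?thesis .
qed

lemma harea_bounded_finite:
  assumes "bounded S" "S \<in> sets borel"
  shows "emeasure (harea A) S < \<infinity>"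
proof -
  obtain B where B: "B > 0" "\<And>x. x \<in> S \<Longrightarrow> norm x \<le> B" using assms(1) bounded_pos by blast
  have "emeasure (harea A) S \<le> (\<integral>\<^sup>+x. ennreal ((2 * norm A + 2) * B) * indicator S x \<partial>lborel)"
    unfolding emeasure_harea[OF assms(2)]
  proof (intro nn_integral_mono)
    fix x show "indicator S x * ennreal (norm (hgrad A x)) \<le> ennreal ((2 * norm A + 2) * B) * indicator S x"
    proof (cases "x \<in> S")
      case True
      have "norm (hgrad A x) \<le> (2 * norm A + 2) * norm x" by (rule norm_hgrad_le)
      also have "\<dots> \<le> (2 * norm A + 2) * B" using B(2)[OF True] by (intro mult_left_mono) auto
      finally show ?thesis using True by (simp add: ennreal_leI)
    qed simp
  qed
  also have "\<dots> = ennreal ((2 * norm A + 2) * B) * emeasure lborel S"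
    using assms(2) by (subst nn_integral_cmult_indicator) auto
  also have "\<dots> < \<infinity>" using emeasure_bounded_finite[OF assms(1)] by (simp add: ennreal_mult_less_top)
  finally show ?thesis .
qed

lemma cancel_power:
  assumes "r > 0" "ennreal (r ^ k) * x \<le> y * (ennreal (r ^ k) * z)"
  shows "x \<le> y * z"
proof -
  have "ennreal (r ^ k) * x \<le> ennreal (r ^ k) * (y * z)" using assms by (simp add: mult_ac)
  then show ?thesis using assms(1) by (subst (asm) ennreal_mult_le_mult_iff) auto
qed

lemma le_of_eps: "x \<le> y" if "\<And>\<epsilon>. \<epsilon> > 0 \<Longrightarrow> x \<le> ennreal (1 + \<epsilon>) * y" for x y :: ennreal
proof (cases y)
  case (real q)
  show ?thesis
  proof (rule ennreal_le_epsilon)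
    fix e :: real assume e: "0 < e"
    have "x \<le> ennreal (1 + e / (q + 1)) * y" using e real by (intro that) auto
    also have "\<dots> = ennreal ((1 + e / (q + 1)) * q)" using e real by (simp add: ennreal_mult'')
    also have "(1 + e / (q + 1)) * q \<le> q + e" using e real by (simp add: field_simps)
    finally show "x \<le> y + ennreal e" using e real by (simp add: ennreal_leI ennreal_plus)
  qed
qed simp

text \<open>The situation after projecting a uniform cone, supported in the graph \<open>t = \<langle>x, A
  x\<rangle>\<close>, to \<open>\<real>\<^sup>2\<^sup>n\<close>: \<open>M\<close> is the projected
  measure and \<open>E\<close> the projected support. The constant \<open>cyl 0 f\<close> is the
  same for all unit vectors \<open>f\<close>, by \<open>cyl_direction\<close>.\<close>
locale uniform_graph =
  fixes A :: "real ^ ('n::finite + 'n) ^ ('n + 'n)" and M :: "(real ^ ('n + 'n)) measure" and E :: "(real ^ ('n + 'n)) set"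
    and f :: "real ^ ('n + 'n)"
  assumes A: "transpose A = A" and sets_M [measurable_cong, simp]: "sets M = sets borel"
    and closed_E: "closed E" and null_E: "emeasure M (- E) = 0"
    and unif: "\<And>u r. u \<in> E \<Longrightarrow> r > 0 \<Longrightarrow> emeasure M (hball A r u) = ennreal (r ^ (2 * CARD('n) + 1))"
    and E0: "0 \<in> E" and E_cone: "\<And>u l. u \<in> E \<Longrightarrow> l > 0 \<Longrightarrow> l *\<^sub>R u \<in> E"
    and f: "norm f = 1"
begin

abbreviation "B \<equiv> hball A"
abbreviation "lam \<equiv> harea A"
abbreviation "c \<equiv> cyl 0 f"

lemma c_finite: "c < \<infinity>" "c > 0" "c \<noteq> \<infinity>" "c \<noteq> top"
  using cyl_finite[OF f, of 0] cyl_positive[OF f, of 0] by auto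

lemma E_borel [measurable]: "E \<in> sets borel"
  using closed_E by (rule borel_closed)

lemma lam_B_asymptotic:
  assumes \<kappa>: "\<kappa> > 0" and \<epsilon>: "\<epsilon> > 0"
  obtains r0 where "r0 > 0" "\<And>u r. \<kappa> \<le> norm (hgrad A u) \<Longrightarrow> 0 < r \<Longrightarrow> r \<le> r0 \<Longrightarrow>
     emeasure lam (B r u) \<le> ennreal (1 + \<epsilon>) * (ennreal (r ^ (2 * CARD('n) + 1)) * c) \<and>
     ennreal (r ^ (2 * CARD('n) + 1)) * c \<le> ennreal (1 + \<epsilon>) * emeasure lam (B r u)"
proof -
  obtain R where R: "R > 0" "\<And>b. norm b \<ge> R \<Longrightarrow> surf A b 1 \<le> ennreal (1 + \<epsilon>) * c \<and> c \<le> ennreal (1 + \<epsilon>) * surf A b 1"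
    using surf_asymptotic[OF A f \<epsilon>] by blast
  show ?thesis
  proof (rule that[of "\<kappa> / R"])
    show "\<kappa> / R > 0" using \<kappa> R by simp
    fix u r assume u: "\<kappa> \<le> norm (hgrad A u)" and r: "0 < r" "r \<le> \<kappa> / R"
    have "R * r \<le> norm (hgrad A u)" using r R u by (simp add: field_simps)
    then have "norm (hgrad A u /\<^sub>R r) \<ge> R" using r by (simp add: field_simps)
    note s = R(2)[OF this]
    have eq: "emeasure lam (B r u) = ennreal (r ^ (2 * CARD('n) + 1)) * surf A (hgrad A u /\<^sub>R r) 1"
      unfolding harea_hball[OF A less_imp_le[OF r(1)]] by (rule surf_scale[OF r(1)])
    show "emeasure lam (B r u) \<le> ennreal (1 + \<epsilon>) * (ennreal (r ^ (2 * CARD('n) + 1)) * c) \<and>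
     ennreal (r ^ (2 * CARD('n) + 1)) * c \<le> ennreal (1 + \<epsilon>) * emeasure lam (B r u)"
      unfolding eq mult.left_commute[of "ennreal (1 + \<epsilon>)"]
      using s by (intro conjI mult_left_mono) auto
  qed
qed

text \<open>The ball either misses \<open>E\<close> or lies in a ball of twice the radius about a point of
  \<open>E\<close>.\<close>
lemma M_B_le: assumes "r > 0" shows "emeasure M (B r u) \<le> ennreal ((2 * r) ^ (2 * CARD('n) + 1))"
proof (cases "B r u \<inter> E = {}")
  case True
  then have "emeasure M (B r u) \<le> emeasure M (- E)" by (intro emeasure_mono) auto
  then show ?thesis by (simp add: null_E)
next
  case False
  then obtain v where v: "v \<in> E" "gdist A u v \<le> r" by (auto simp: hball_def)
  have "B r u \<subseteq> B (2 * r) v"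
  proof
    fix w assume "w \<in> B r u"
    then show "w \<in> B (2 * r) v"
      using gdist_triangle[of A v w u] v(2) gdist_commute[of A u v] by (simp add: hball_def)
  qed
  then have "emeasure M (B r u) \<le> emeasure M (B (2 * r) v)" by (intro emeasure_mono) auto
  then show ?thesis using unif[OF v(1), of "2 * r"] assms by simp
qed

lemma M_finite_bounded: assumes "bounded S" "S \<in> sets borel" shows "emeasure M S < \<infinity>"
proof -
  obtain b where b: "b > 0" "\<And>x. x \<in> S \<Longrightarrow> norm x \<le> b" using assms(1) bounded_pos by blast
  define r where "r = root 4 (b ^ 4 + (norm A * b\<^sup>2)\<^sup>2) + 1"
  have r: "r > 0" unfolding r_def by (intro add_nonneg_pos real_root_ge_zero add_nonneg_nonneg) auto
  have "S \<subseteq> B r 0"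
  proof
    fix x assume x: "x \<in> S"
    have "\<bar>hgt A (hgrad A 0) x\<bar> \<le> norm A * b\<^sup>2"
    proof -
      have "\<bar>hgt A (hgrad A 0) x\<bar> = \<bar>x \<bullet> (A *v x)\<bar>" by (simp add: hgt_def hgrad_def)
      also have "\<dots> \<le> norm x * (norm A * norm x)"
        using Cauchy_Schwarz_ineq2[of x "A *v x"] mult_left_mono[OF norm_matrix_vector_le[of A x], of "norm x"] by simp
      also have "\<dots> = norm A * (norm x)\<^sup>2" by (simp add: power2_eq_square)
      also have "\<dots> \<le> norm A * b\<^sup>2" using b(2)[OF x] by (intro mult_left_mono power_mono) auto
      finally show ?thesis .
    qed
    then have "(hgt A (hgrad A 0) x)\<^sup>2 \<le> (norm A * b\<^sup>2)\<^sup>2"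
      by (metis abs_ge_zero power2_abs power_mono)
    moreover have "norm x ^ 4 \<le> b ^ 4" using b(2)[OF x] by (intro power_mono) auto
    moreover have "b ^ 4 + (norm A * b\<^sup>2)\<^sup>2 \<le> r ^ 4"
    proof -
      have "(root 4 (b ^ 4 + (norm A * b\<^sup>2)\<^sup>2)) ^ 4 \<le> r ^ 4" unfolding r_def by (intro power_mono) auto
      then show ?thesis by simp
    qed
    ultimately show "x \<in> B r 0" using r by (simp add: hball_def gdist_le_iff[OF A])
  qed
  then have "emeasure M S \<le> emeasure M (B r 0)" by (intro emeasure_mono) auto
  also have "\<dots> < \<infinity>" using unif[OF E0 r] by simp
  finally show ?thesis .
qed

lemma sigma_finite_M: "sigma_finite_measure M"
proof
  have sp: "space M = UNIV" using sets_eq_imp_space_eq[OF sets_M] by simp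
  show "\<exists>F. countable F \<and> F \<subseteq> sets M \<and> \<Union> F = space M \<and> (\<forall>a\<in>F. emeasure M a \<noteq> \<infinity>)"
  proof (intro exI[of _ "range (\<lambda>k::nat. cball 0 (real k))"] conjI ballI)
    show "\<Union> (range (\<lambda>k::nat. cball (0::real ^ ('n + 'n)) (real k))) = space M"
      unfolding sp by (auto simp: real_arch_simple)
    fix a :: "(real ^ ('n + 'n)) set" assume "a \<in> range (\<lambda>k::nat. cball 0 (real k))"
    then show "emeasure M a \<noteq> \<infinity>" using M_finite_bounded[of a] by auto
  qed auto
qed

text \<open>Fubini for the symmetric set of pairs at distance at most \<open>r\<close>. Applied with small
  \<open>r\<close>, it trades the known masses of balls about points of \<open>E\<close> for the
  asymptotically known areas of balls about regular points.\<close>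
lemma swap_balls:
  assumes [measurable]: "S \<in> sets borel" "T \<in> sets borel"
  shows "(\<integral>\<^sup>+u. indicator S u * emeasure M (B r u \<inter> T) \<partial>lam) = (\<integral>\<^sup>+v. indicator T v * emeasure lam (B r v \<inter> S) \<partial>M)"
proof -
  interpret M: sigma_finite_measure M by (rule sigma_finite_M)
  interpret P: pair_sigma_finite lborel M ..
  let ?h = "\<lambda>u v. indicator S u * ennreal (norm (hgrad A u)) * indicator T v * indicator {x. gdist A (fst x) (snd x) \<le> r} (u, v)"
  have [measurable]: "{x. gdist A (fst x) (snd x) \<le> r} \<in> sets (borel \<Otimes>\<^sub>M borel)"
    unfolding borel_prod using continuous_gdist[of A]
    by (intro borel_closed closed_Collect_le) (simp_all add: case_prod_beta)
  have 1: "emeasure M (B r u \<inter> T) = (\<integral>\<^sup>+v. indicator T v * indicator {x. gdist A (fst x) (snd x) \<le> r} (u, v) \<partial>M)" for u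
  proof -
    have "(\<integral>\<^sup>+v. indicator T v * indicator {x. gdist A (fst x) (snd x) \<le> r} (u, v) \<partial>M) = (\<integral>\<^sup>+v. indicator (B r u \<inter> T) v \<partial>M)"
      by (intro nn_integral_cong) (auto simp: indicator_def hball_def)
    then show ?thesis by simp
  qed
  have "(\<integral>\<^sup>+u. indicator S u * emeasure M (B r u \<inter> T) \<partial>lam) = (\<integral>\<^sup>+u. ennreal (norm (hgrad A u)) * (indicator S u * emeasure M (B r u \<inter> T)) \<partial>lborel)"
    unfolding harea_def 1 by (subst nn_integral_density) auto
  also have "\<dots> = (\<integral>\<^sup>+u. (\<integral>\<^sup>+v. ?h u v \<partial>M) \<partial>lborel)"
  proof (rule nn_integral_cong)
    fix u
    have "(\<integral>\<^sup>+v. ?h u v \<partial>M) = (\<integral>\<^sup>+v. (ennreal (norm (hgrad A u)) * indicator S u) * (indicator T v * indicator {x. gdist A (fst x) (snd x) \<le> r} (u, v)) \<partial>M)"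
      by (intro nn_integral_cong) (simp add: mult_ac)
    also have "\<dots> = (ennreal (norm (hgrad A u)) * indicator S u) * emeasure M (B r u \<inter> T)"
      unfolding 1 by (rule nn_integral_cmult) measurable
    finally show "ennreal (norm (hgrad A u)) * (indicator S u * emeasure M (B r u \<inter> T)) = (\<integral>\<^sup>+v. ?h u v \<partial>M)"
      by (simp add: mult_ac)
  qed
  also have "\<dots> = (\<integral>\<^sup>+v. (\<integral>\<^sup>+u. ?h u v \<partial>lborel) \<partial>M)"
    by (rule P.Fubini'[symmetric]) measurable
  also have "\<dots> = (\<integral>\<^sup>+v. indicator T v * emeasure lam (B r v \<inter> S) \<partial>M)"
  proof (intro nn_integral_cong)
    fix v
    have "(\<integral>\<^sup>+u. ?h u v \<partial>lborel) = (\<integral>\<^sup>+u. indicator T v * (indicator (B r v \<inter> S) u * ennreal (norm (hgrad A u))) \<partial>lborel)"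
      by (intro nn_integral_cong) (auto simp: indicator_def hball_def gdist_commute)
    then show "(\<integral>\<^sup>+u. ?h u v \<partial>lborel) = indicator T v * emeasure lam (B r v \<inter> S)"
      by (subst (asm) nn_integral_cmult) (auto simp: emeasure_harea)
  qed
  finally show ?thesis .
qed

lemma hgrad_nbhd_lower:
  assumes K: "compact K" "\<And>x. x \<in> K \<Longrightarrow> hgrad A x \<noteq> 0"
  obtains \<kappa> \<rho> where "\<kappa> > 0" "\<rho> > 0" "\<And>v. K \<noteq> {} \<Longrightarrow> infdist v K \<le> \<rho> \<Longrightarrow> norm (hgrad A v) \<ge> \<kappa>"
proof (cases "K = {}")
  case True then show ?thesis using that[of 1 1] by auto
next
  case False
  have "continuous_on K (\<lambda>x. norm (hgrad A x))" unfolding hgrad_def by (intro continuous_intros)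
  from continuous_attains_inf[OF K(1) False this] obtain x0 where x0: "x0 \<in> K" "\<And>x. x \<in> K \<Longrightarrow> norm (hgrad A x0) \<le> norm (hgrad A x)" by auto
  define \<kappa> where "\<kappa> = norm (hgrad A x0) / 2"
  have k: "\<kappa> > 0" using K(2)[OF x0(1)] by (simp add: \<kappa>_def)
  define L where "L = 2 * norm A + 2"
  have L: "L > 0" by (simp add: L_def add_nonneg_pos)
  show ?thesis
  proof (rule that[of \<kappa> "\<kappa> / L"])
    fix v assume v: "infdist v K \<le> \<kappa> / L"
    obtain x where x: "x \<in> K" "infdist v K = dist v x" using infdist_attains_inf[OF compact_imp_closed[OF K(1)] False] by blast
    have "norm (hgrad A (x - v)) \<le> L * norm (x - v)" unfolding L_def by (rule norm_hgrad_le)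
    also have "\<dots> \<le> L * (\<kappa> / L)" using v x L by (intro mult_left_mono) (auto simp: dist_norm norm_minus_commute)
    finally have "norm (hgrad A (x - v)) \<le> \<kappa>" using L by simp
    moreover have "hgrad A x = hgrad A v + hgrad A (x - v)" by (simp flip: hgrad_add)
    ultimately have "norm (hgrad A x) \<le> norm (hgrad A v) + \<kappa>" by (metis add_left_mono norm_triangle_ineq order_trans)
    then show "\<kappa> \<le> norm (hgrad A v)" using x0(2)[OF x(1)] by (simp add: \<kappa>_def)
  qed (use k L in auto)
qed

lemma infdist_hball: "v \<in> B r u \<Longrightarrow> u \<in> K \<Longrightarrow> infdist v K \<le> r"
  using infdist_le[of u K v] norm_le_gdist[of v u A] by (simp add: hball_def dist_norm)


text \<open>Integrate \<open>M (B r u) = r ^ (2 * n + 1)\<close> over \<open>u \<in> E \<inter> K\<close>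
  against the area, swap, and use that the areas of small balls are at most \<open>(1 +
  \<epsilon>) * c * r ^ (2 * n + 1)\<close>. As \<open>r\<close> tends to zero the points that
  contribute shrink to \<open>K\<close>.\<close>
lemma area_le_M_regular:
  assumes K: "compact K" and reg: "\<And>x. x \<in> K \<Longrightarrow> hgrad A x \<noteq> 0"
  shows "emeasure lam (E \<inter> K) \<le> c * emeasure M K"
proof (cases "K = {}")
  case False
  have Kb[measurable]: "K \<in> sets borel" using K by (simp add: borel_compact)
  obtain \<kappa> \<rho> where \<kappa>: "\<kappa> > 0" "\<rho> > 0" "\<And>v. infdist v K \<le> \<rho> \<Longrightarrow> norm (hgrad A v) \<ge> \<kappa>"
    using hgrad_nbhd_lower[OF K reg] False by metis
  show ?thesis
  proof (rule le_of_eps)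
    fix \<epsilon> :: real assume \<epsilon>: "\<epsilon> > 0"
    obtain r0 where r0: "r0 > 0" "\<And>u r. \<kappa> \<le> norm (hgrad A u) \<Longrightarrow> 0 < r \<Longrightarrow> r \<le> r0 \<Longrightarrow>
       emeasure lam (B r u) \<le> ennreal (1 + \<epsilon>) * (ennreal (r ^ (2 * CARD('n) + 1)) * c)"
      using lam_B_asymptotic[OF \<kappa>(1) \<epsilon>] by metis
    have step: "emeasure lam (E \<inter> K) \<le> (ennreal (1 + \<epsilon>) * c) * emeasure M {v. infdist v K \<le> r}" if r: "0 < r" "r \<le> r0" "r \<le> \<rho>" for r
    proof -
      have [measurable]: "{v. infdist v K \<le> r} \<in> sets borel"
        by (intro borel_closed closed_Collect_le continuous_intros)
      have "ennreal (r ^ (2 * CARD('n) + 1)) * emeasure lam (E \<inter> K) = (\<integral>\<^sup>+u. ennreal (r ^ (2 * CARD('n) + 1)) * indicator (E \<inter> K) u \<partial>lam)"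
        by (rule nn_integral_cmult_indicator[symmetric]) simp
      also have "\<dots> = (\<integral>\<^sup>+u. indicator (E \<inter> K) u * emeasure M (B r u \<inter> UNIV) \<partial>lam)"
        using unif r by (intro nn_integral_cong) (auto simp: indicator_def)
      also have "\<dots> = (\<integral>\<^sup>+v. indicator UNIV v * emeasure lam (B r v \<inter> (E \<inter> K)) \<partial>M)"
        by (rule swap_balls) simp_all
      also have "\<dots> \<le> (\<integral>\<^sup>+v. (ennreal (1 + \<epsilon>) * (ennreal (r ^ (2 * CARD('n) + 1)) * c)) * indicator {v. infdist v K \<le> r} v \<partial>M)"
      proof (rule nn_integral_mono)
        fix v
        show "indicator UNIV v * emeasure lam (B r v \<inter> (E \<inter> K)) \<le> (ennreal (1 + \<epsilon>) * (ennreal (r ^ (2 * CARD('n) + 1)) * c)) * indicator {v. infdist v K \<le> r} v"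
        proof (cases "infdist v K \<le> r")
          case True
          have "emeasure lam (B r v \<inter> (E \<inter> K)) \<le> emeasure lam (B r v)" by (intro emeasure_mono) auto
          also have "\<dots> \<le> ennreal (1 + \<epsilon>) * (ennreal (r ^ (2 * CARD('n) + 1)) * c)"
            using r0(2)[OF \<kappa>(3) r(1,2), of v] True r by simp
          finally show ?thesis using True by simp
        next
          case F: False
          have "v \<in> B r u" if "u \<in> B r v" for u using that by (simp add: hball_def gdist_commute)
          then have "B r v \<inter> (E \<inter> K) = {}" using infdist_hball F by blast
          then show ?thesis by simp
        qed
      qed
      also have "\<dots> = (ennreal (1 + \<epsilon>) * (ennreal (r ^ (2 * CARD('n) + 1)) * c)) * emeasure M {v. infdist v K \<le> r}"
        by (rule nn_integral_cmult_indicator) simp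
      finally have "ennreal (r ^ (2 * CARD('n) + 1)) * emeasure lam (E \<inter> K) \<le> (ennreal (1 + \<epsilon>) * c) * (ennreal (r ^ (2 * CARD('n) + 1)) * emeasure M {v. infdist v K \<le> r})"
        by (simp only: mult_ac)
      then show ?thesis by (rule cancel_power[OF r(1)])
    qed
    have lim: "(\<lambda>k. (ennreal (1 + \<epsilon>) * c) * emeasure M {v. infdist v K \<le> inverse (real (Suc k))}) \<longlonglongrightarrow> (ennreal (1 + \<epsilon>) * c) * emeasure M K"
      using c_finite by (intro ennreal_tendsto_cmult infdist_nbhd_tendsto K False M_finite_bounded sets_M) (auto simp: ennreal_mult_less_top)
    have "eventually (\<lambda>k. inverse (real (Suc k)) < min r0 \<rho>) sequentially"
      using r0(1) \<kappa>(2) by (intro order_tendstoD(2)[OF LIMSEQ_inverse_real_of_nat]) simp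
    then have "eventually (\<lambda>k. emeasure lam (E \<inter> K) \<le> (ennreal (1 + \<epsilon>) * c) * emeasure M {v. infdist v K \<le> inverse (real (Suc k))}) sequentially"
      by eventually_elim (rule step, auto)
    then have "emeasure lam (E \<inter> K) \<le> (ennreal (1 + \<epsilon>) * c) * emeasure M K"
      by (intro tendsto_lowerbound[OF lim]) auto
    then show "emeasure lam (E \<inter> K) \<le> ennreal (1 + \<epsilon>) * (c * emeasure M K)" by (simp only: mult.assoc)
  qed
qed simp

text \<open>The same double integral from the other side. Balls about points \<open>u\<close> outside
  \<open>E\<close> have no exact mass, but at most \<open>2 ^ (2 * n + 1)\<close> times the
  expected one, and such \<open>u\<close> fill a set whose area tends to zero.\<close>
lemma M_le_area_regular:
  assumes K: "compact K" and reg: "\<And>x. x \<in> K \<Longrightarrow> hgrad A x \<noteq> 0"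
  shows "c * emeasure M K \<le> emeasure lam (E \<inter> K)"
proof (cases "E \<inter> K = {}")
  case True
  have "emeasure M K \<le> emeasure M (- E)" using True by (intro emeasure_mono) auto
  then show ?thesis by (simp add: null_E)
next
  case False
  let ?K = "E \<inter> K"
  have Kc: "compact ?K" using K closed_E by (metis compact_Int_closed inf_commute)
  have Kb[measurable]: "?K \<in> sets borel" "K \<in> sets borel" using K Kc by (auto simp: borel_compact)
  obtain \<kappa> \<rho> where \<kappa>: "\<kappa> > 0" "\<rho> > 0" "\<And>v. infdist v ?K \<le> \<rho> \<Longrightarrow> norm (hgrad A v) \<ge> \<kappa>"
    using hgrad_nbhd_lower[OF Kc] reg False by (metis IntD2)
  have MK: "emeasure M K = emeasure M ?K"
  proof (rule antisym)
    have "emeasure M K \<le> emeasure M (?K \<union> (- E))" by (intro emeasure_mono) auto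
    also have "\<dots> \<le> emeasure M ?K + emeasure M (- E)" by (intro emeasure_subadditive) auto
    finally show "emeasure M K \<le> emeasure M ?K" by (simp add: null_E)
    show "emeasure M ?K \<le> emeasure M K" by (intro emeasure_mono) auto
  qed
  define N where "N r = {v. infdist v ?K \<le> r}" for r
  have [measurable]: "N r \<in> sets borel" for r
    unfolding N_def by (intro borel_closed closed_Collect_le continuous_intros)
  have KN: "?K \<subseteq> N r" if "r > 0" for r using that by (auto simp: N_def)
  show ?thesis
  proof (rule le_of_eps)
    fix \<epsilon> :: real assume \<epsilon>: "\<epsilon> > 0"
    obtain r0 where r0: "r0 > 0" "\<And>u r. \<kappa> \<le> norm (hgrad A u) \<Longrightarrow> 0 < r \<Longrightarrow> r \<le> r0 \<Longrightarrow>
       ennreal (r ^ (2 * CARD('n) + 1)) * c \<le> ennreal (1 + \<epsilon>) * emeasure lam (B r u)"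
      using lam_B_asymptotic[OF \<kappa>(1) \<epsilon>] by metis
    let ?C = "ennreal (2 ^ (2 * CARD('n) + 1))"
    have step: "c * emeasure M ?K \<le> ennreal (1 + \<epsilon>) * (emeasure lam (N r) + ?C * emeasure lam (N r - ?K))" if r: "0 < r" "r \<le> r0" for r
    proof -
      let ?R = "ennreal (r ^ (2 * CARD('n) + 1))"
      have "?R * (c * emeasure M ?K) = (\<integral>\<^sup>+v. (?R * c) * indicator ?K v \<partial>M)"
        by (subst nn_integral_cmult_indicator) (auto simp: mult.assoc)
      also have "\<dots> \<le> (\<integral>\<^sup>+v. ennreal (1 + \<epsilon>) * (indicator ?K v * emeasure lam (B r v \<inter> UNIV)) \<partial>M)"
      proof (rule nn_integral_mono)
        fix v
        have "infdist v ?K \<le> \<rho>" if "v \<in> ?K" using that \<kappa>(2) by simp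
        then show "(?R * c) * indicator ?K v \<le> ennreal (1 + \<epsilon>) * (indicator ?K v * emeasure lam (B r v \<inter> UNIV))"
          using r0(2)[OF \<kappa>(3) r, of v] by (cases "v \<in> ?K") (auto simp del: IntI Int_iff)
      qed
      also have "\<dots> = ennreal (1 + \<epsilon>) * (\<integral>\<^sup>+v. indicator ?K v * emeasure lam (B r v \<inter> UNIV) \<partial>M)"
      proof (rule nn_integral_cmult)
        have "(\<lambda>v. surf A (hgrad A v) r) \<in> borel_measurable borel"
          unfolding surf_def hgt_def by measurable
        then show "(\<lambda>v. indicator ?K v * emeasure lam (B r v \<inter> UNIV)) \<in> borel_measurable M"
          using r by (simp add: harea_hball[OF A])
      qed
      finally have I: "?R * (c * emeasure M ?K) \<le> ennreal (1 + \<epsilon>) * (\<integral>\<^sup>+v. indicator ?K v * emeasure lam (B r v \<inter> UNIV) \<partial>M)" .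
      have "(\<integral>\<^sup>+v. indicator ?K v * emeasure lam (B r v \<inter> UNIV) \<partial>M) = (\<integral>\<^sup>+u. indicator UNIV u * emeasure M (B r u \<inter> ?K) \<partial>lam)"
        by (rule swap_balls[symmetric]) simp_all
      also have "\<dots> \<le> (\<integral>\<^sup>+u. ?R * indicator (N r) u + (?R * ?C) * indicator (N r - ?K) u \<partial>lam)"
      proof (rule nn_integral_mono)
        fix u
        show "indicator UNIV u * emeasure M (B r u \<inter> ?K) \<le> ?R * indicator (N r) u + (?R * ?C) * indicator (N r - ?K) u"
        proof (cases "u \<in> N r")
          case False
          have "u \<in> B r v" if "v \<in> B r u" for v using that by (simp add: hball_def gdist_commute)
          then have "B r u \<inter> ?K = {}" using infdist_hball False unfolding N_def by blast
          then show ?thesis by simp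
        next
          case True
          show ?thesis
          proof (cases "u \<in> ?K")
            case True
            have "emeasure M (B r u \<inter> ?K) \<le> emeasure M (B r u)" by (intro emeasure_mono) auto
            also have "\<dots> = ?R" using unif[of u r] True r by simp
            finally show ?thesis using \<open>u \<in> N r\<close> True by simp
          next
            case False
            have "emeasure M (B r u \<inter> ?K) \<le> emeasure M (B r u)" by (intro emeasure_mono) auto
            also have "\<dots> \<le> ennreal ((2 * r) ^ (2 * CARD('n) + 1))" by (rule M_B_le[OF r(1)])
            also have "\<dots> = ?R * ?C" using r by (simp only: power_mult_distrib) (simp add: ennreal_mult' mult_ac)
            finally show ?thesis using \<open>u \<in> N r\<close> False by (auto simp: add_increasing)
          qed
        qed
      qed
      also have "\<dots> = ?R * emeasure lam (N r) + (?R * ?C) * emeasure lam (N r - ?K)"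
        by (subst nn_integral_add) (auto simp: nn_integral_cmult_indicator)
      also have "\<dots> = ?R * (emeasure lam (N r) + ?C * emeasure lam (N r - ?K))"
        by (simp only: distrib_left mult.assoc)
      finally have "ennreal (1 + \<epsilon>) * (\<integral>\<^sup>+v. indicator ?K v * emeasure lam (B r v \<inter> UNIV) \<partial>M)
         \<le> ennreal (1 + \<epsilon>) * (?R * (emeasure lam (N r) + ?C * emeasure lam (N r - ?K)))"
        by (rule mult_left_mono) simp
      with I have "?R * (c * emeasure M ?K) \<le> ennreal (1 + \<epsilon>) * (?R * (emeasure lam (N r) + ?C * emeasure lam (N r - ?K)))"
        by (rule order_trans)
      then show ?thesis by (rule cancel_power[OF r(1)])
    qed
    have fin: "emeasure lam ?K < \<infinity>" by (intro harea_bounded_finite compact_imp_bounded Kc) simp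
    have lim1: "(\<lambda>k. emeasure lam (N (inverse (real (Suc k))))) \<longlonglongrightarrow> emeasure lam ?K"
      unfolding N_def by (intro infdist_nbhd_tendsto Kc False harea_bounded_finite sets_harea)
    have lim2: "(\<lambda>k. emeasure lam (N (inverse (real (Suc k))) - ?K)) \<longlonglongrightarrow> 0"
    proof -
      have "emeasure lam (N (inverse (real (Suc k))) - ?K) = emeasure lam (N (inverse (real (Suc k)))) - emeasure lam ?K" for k
        using KN[of "inverse (real (Suc k))"] fin by (intro emeasure_Diff) auto
      moreover have "(\<lambda>k. emeasure lam (N (inverse (real (Suc k)))) - emeasure lam ?K) \<longlonglongrightarrow> emeasure lam ?K - emeasure lam ?K"
        using fin by (intro tendsto_diff_ennreal_general lim1 tendsto_const) auto
      ultimately show ?thesis using fin by (simp add: ennreal_minus_cancel_iff)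
    qed
    have lim: "(\<lambda>k. ennreal (1 + \<epsilon>) * (emeasure lam (N (inverse (real (Suc k)))) + ?C * emeasure lam (N (inverse (real (Suc k))) - ?K)))
       \<longlonglongrightarrow> ennreal (1 + \<epsilon>) * (emeasure lam ?K + ?C * 0)"
      by (intro ennreal_tendsto_cmult tendsto_add lim1 lim2) auto
    have "eventually (\<lambda>k. inverse (real (Suc k)) < r0) sequentially"
      using r0(1) by (intro order_tendstoD(2)[OF LIMSEQ_inverse_real_of_nat]) simp
    then have "eventually (\<lambda>k. c * emeasure M ?K \<le> ennreal (1 + \<epsilon>) * (emeasure lam (N (inverse (real (Suc k)))) + ?C * emeasure lam (N (inverse (real (Suc k))) - ?K))) sequentially"
      by eventually_elim (rule step, auto)
    then have "c * emeasure M ?K \<le> ennreal (1 + \<epsilon>) * (emeasure lam ?K + ?C * 0)"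
      by (intro tendsto_lowerbound[OF lim]) auto
    then show "c * emeasure M K \<le> ennreal (1 + \<epsilon>) * emeasure lam (E \<inter> K)" by (simp add: MK)
  qed
qed

lemma bounded_hball: "bounded (B r u)"
proof -
  have "B r u \<subseteq> cball u r"
  proof
    fix v assume "v \<in> B r u"
    then show "v \<in> cball u r" using norm_le_gdist[of v u A] by (simp add: hball_def dist_norm norm_minus_commute)
  qed
  then show ?thesis by (rule bounded_subset[OF bounded_cball])
qed

lemma compact_hball: "compact (B r u)"
  using bounded_hball closed_hball by (simp add: compact_eq_bounded_closed)

text \<open>An exhaustion of the regular set by closed sets, to pass from compact sets without singular
  points to arbitrary ones.\<close>
definition reg_part :: "nat \<Rightarrow> (real ^ ('n + 'n)) set" where
  "reg_part k = {x. inverse (real (Suc k)) \<le> norm (hgrad A x)}"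

lemma closed_reg_part: "closed (reg_part k)"
  unfolding reg_part_def hgrad_def by (intro closed_Collect_le continuous_intros)

lemma reg_part_regular: assumes "x \<in> reg_part k" shows "hgrad A x \<noteq> 0"
proof
  assume "hgrad A x = 0"
  then have "inverse (real (Suc k)) \<le> 0" using assms by (simp add: reg_part_def del: of_nat_Suc)
  moreover have "inverse (real (Suc k)) > 0" by simp
  ultimately show False by linarith
qed

lemma reg_part_limit:
  assumes s: "sets N = sets borel" and C: "compact C"
  shows "(\<lambda>k. emeasure N (C \<inter> reg_part k)) \<longlonglongrightarrow> emeasure N (C \<inter> {x. hgrad A x \<noteq> 0})"
proof -
  have "(\<Union>k. C \<inter> reg_part k) = C \<inter> {x. hgrad A x \<noteq> 0}"
  proof (intro equalityI subsetI)
    fix x assume x: "x \<in> C \<inter> {x. hgrad A x \<noteq> 0}"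
    then have "norm (hgrad A x) > 0" by simp
    then obtain k where "inverse (real (Suc k)) < norm (hgrad A x)" using reals_Archimedean by blast
    then show "x \<in> (\<Union>k. C \<inter> reg_part k)" using x by (auto simp: reg_part_def intro: less_imp_le)
  qed (auto simp: reg_part_def)
  moreover have "(\<lambda>k. emeasure N (C \<inter> reg_part k)) \<longlonglongrightarrow> emeasure N (\<Union>k. C \<inter> reg_part k)"
  proof (rule Lim_emeasure_incseq)
    show "range (\<lambda>k. C \<inter> reg_part k) \<subseteq> sets N"
      using C closed_reg_part by (auto simp: s intro!: sets.Int borel_closed compact_imp_closed)
    show "incseq (\<lambda>k. C \<inter> reg_part k)"
    proof (rule incseq_SucI)
      fix k have "inverse (real (Suc (Suc k))) \<le> inverse (real (Suc k))" by (simp add: field_simps)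
      then have "inverse (real (Suc (Suc k))) \<le> norm (hgrad A x)" if "inverse (real (Suc k)) \<le> norm (hgrad A x)" for x
        using that by (rule order_trans)
      then show "C \<inter> reg_part k \<le> C \<inter> reg_part (Suc k)" unfolding reg_part_def by blast
    qed
  qed
  ultimately show ?thesis by simp
qed

lemma harea_singular_null: assumes [measurable]: "S \<in> sets borel" and "\<And>x. x \<in> S \<Longrightarrow> hgrad A x = 0" shows "emeasure lam S = 0"
proof -
  have "emeasure lam S = (\<integral>\<^sup>+x. 0 \<partial>(lborel::(real ^ ('n + 'n)) measure))"
    unfolding emeasure_harea[OF assms(1)] using assms(2) by (intro nn_integral_cong) (auto simp: indicator_def)
  then show ?thesis by simp
qed

lemma area_le_M:
  assumes C: "compact C"
  shows "emeasure lam (E \<inter> C) \<le> c * emeasure M C"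
proof -
  have [measurable]: "C \<in> sets borel" using C by (simp add: borel_compact)
  have EC: "compact (E \<inter> C)" using C closed_E by (metis compact_Int_closed inf_commute)
  have [measurable]: "{x. hgrad A x \<noteq> 0} \<in> sets borel" "{x. hgrad A x = 0} \<in> sets borel" by measurable
  have "emeasure lam (E \<inter> C) \<le> emeasure lam (E \<inter> C \<inter> {x. hgrad A x \<noteq> 0} \<union> {x. hgrad A x = 0})"
    by (intro emeasure_mono) auto
  also have "\<dots> \<le> emeasure lam (E \<inter> C \<inter> {x. hgrad A x \<noteq> 0}) + emeasure lam {x. hgrad A x = 0}"
    by (intro emeasure_subadditive) auto
  also have "emeasure lam {x. hgrad A x = 0} = 0" by (rule harea_singular_null) auto
  also have "emeasure lam (E \<inter> C \<inter> {x. hgrad A x \<noteq> 0}) \<le> c * emeasure M C"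
  proof (rule LIMSEQ_le_const2[OF reg_part_limit[OF sets_harea EC]], intro exI allI impI)
    fix k
    have "emeasure lam (E \<inter> (C \<inter> reg_part k)) \<le> c * emeasure M (C \<inter> reg_part k)"
    proof (rule area_le_M_regular)
      show "compact (C \<inter> reg_part k)" using C closed_reg_part by (rule compact_Int_closed)
      show "hgrad A x \<noteq> 0" if "x \<in> C \<inter> reg_part k" for x
        using that reg_part_regular by blast
    qed
    also have "\<dots> \<le> c * emeasure M C" by (intro mult_left_mono emeasure_mono) auto
    finally show "emeasure lam (E \<inter> C \<inter> reg_part k) \<le> c * emeasure M C" by (simp add: Int_assoc)
  qed
  finally show ?thesis by simp
qed

lemma M_le_area:
  assumes C: "compact C"
  shows "c * emeasure M (C \<inter> {x. hgrad A x \<noteq> 0}) \<le> emeasure lam (E \<inter> C)"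
proof -
  have [measurable]: "C \<in> sets borel" using C by (simp add: borel_compact)
  have lim: "(\<lambda>k. c * emeasure M (C \<inter> reg_part k)) \<longlonglongrightarrow> c * emeasure M (C \<inter> {x. hgrad A x \<noteq> 0})"
    using c_finite by (intro ennreal_tendsto_cmult reg_part_limit sets_M C) auto
  show ?thesis
  proof (rule LIMSEQ_le_const2[OF lim], intro exI allI impI)
    fix k
    have "c * emeasure M (C \<inter> reg_part k) \<le> emeasure lam (E \<inter> (C \<inter> reg_part k))"
    proof (rule M_le_area_regular)
      show "compact (C \<inter> reg_part k)" using C closed_reg_part by (rule compact_Int_closed)
      show "hgrad A x \<noteq> 0" if "x \<in> C \<inter> reg_part k" for x
        using that reg_part_regular by blast
    qed
    also have "\<dots> \<le> emeasure lam (E \<inter> C)" by (intro emeasure_mono) auto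
    finally show "c * emeasure M (C \<inter> reg_part k) \<le> emeasure lam (E \<inter> C)" .
  qed
qed

section \<open>The support fills the regular set: rank at least two\<close>


lemma gdist_small:
  assumes "r > 0" obtains d where "d > 0" "\<And>y. dist y x \<le> d \<Longrightarrow> gdist A x y < r"
proof -
  have "continuous_on UNIV (\<lambda>v. gdist A x v)"
    using continuous_on_compose2[OF continuous_gdist, of UNIV "\<lambda>v. (x, v)" A] by (simp add: continuous_on_Pair)
  then have "isCont (\<lambda>v. gdist A x v) x" by (simp add: continuous_on_eq_continuous_at)
  moreover have "gdist A x x = 0"
    using gdist_le_iff[OF A, of 0 x x] gdist_nonneg[of A x x] by (simp add: hgt_def)
  ultimately have "((\<lambda>v. gdist A x v) \<longlongrightarrow> 0) (at x)" by (simp add: isCont_def)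
  then have "eventually (\<lambda>v. gdist A x v < r) (at x)" using assms by (rule order_tendstoD)
  then obtain d where d: "d > 0" "\<And>y. y \<noteq> x \<Longrightarrow> dist y x < d \<Longrightarrow> gdist A x y < r"
    unfolding eventually_at by auto
  show ?thesis
  proof (rule that[of "d / 2"])
    fix y assume "dist y x \<le> d / 2"
    then show "gdist A x y < r" using d \<open>gdist A x x = 0\<close> assms by (cases "y = x") auto
  qed (use d in simp)
qed

text \<open>Suppose that points \<open>y\<close> outside \<open>E\<close> accumulate at \<open>x0\<close>,
  and let \<open>\<rho>\<close> be the distance from \<open>y\<close> to \<open>E\<close>. The
  ball of radius \<open>3 * \<rho>\<close> about an almost nearest point of \<open>E\<close>
  contains the hole of radius \<open>\<rho> / 2\<close> about \<open>y\<close>. The mass of the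
  big ball forces \<open>E\<close> to occupy almost all of its area, so there is no room for the
  hole.\<close>
lemma regular_interior:
  assumes x0: "x0 \<in> E" "hgrad A x0 \<noteq> 0"
  obtains d where "d > 0" "cball x0 d \<subseteq> E"
proof -
  let ?m = "2 * CARD('n) + 1"
  \<comment> \<open>The radii of the big ball and of the hole have the ratio 6.\<close>
  define \<epsilon> where "\<epsilon> = 1 / (4 * 6 ^ ?m :: real)"
  have "(1::real) \<le> 6 ^ ?m" by (rule one_le_power) simp
  then have "1 \<le> 4 * (6 ^ ?m :: real)" by linarith
  then have \<epsilon>: "0 < \<epsilon>" "\<epsilon> \<le> 1" unfolding \<epsilon>_def by (simp_all only: divide_le_eq_1 zero_less_divide_1_iff) auto
  obtain \<kappa> \<rho>0 where \<kappa>: "\<kappa> > 0" "\<rho>0 > 0" "\<And>v. infdist v {x0} \<le> \<rho>0 \<Longrightarrow> norm (hgrad A v) \<ge> \<kappa>"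
    using hgrad_nbhd_lower[of "{x0}"] x0(2) by (metis compact_sing singletonD insert_not_empty)
  have reg: "norm (hgrad A v) \<ge> \<kappa>" if "norm (v - x0) \<le> \<rho>0" for v
    using \<kappa>(3)[of v] that by (simp add: dist_norm)
  obtain r0 where r0: "r0 > 0" "\<And>u r. \<kappa> \<le> norm (hgrad A u) \<Longrightarrow> 0 < r \<Longrightarrow> r \<le> r0 \<Longrightarrow>
     emeasure lam (B r u) \<le> ennreal (1 + \<epsilon>) * (ennreal (r ^ ?m) * c) \<and>
     ennreal (r ^ ?m) * c \<le> ennreal (1 + \<epsilon>) * emeasure lam (B r u)"
    using lam_B_asymptotic[OF \<kappa>(1) \<epsilon>(1)] by metis
  define r1 where "r1 = min r0 \<rho>0 / 8"
  have r1: "r1 > 0" "8 * r1 \<le> r0" "8 * r1 \<le> \<rho>0" using r0 \<kappa> by (auto simp: r1_def)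
  obtain d where d: "d > 0" "\<And>y. dist y x0 \<le> d \<Longrightarrow> gdist A x0 y < r1" using gdist_small[OF r1(1)] by blast
  have "cball x0 d \<subseteq> E"
  proof (rule ccontr)
    assume "\<not> cball x0 d \<subseteq> E"
    then obtain y where "y \<in> cball x0 d" "y \<notin> E" by blast
    then have y: "dist y x0 \<le> d" "y \<notin> E" by (simp_all add: dist_commute)
    define \<rho> where "\<rho> = (INF v\<in>E. gdist A y v)"
    have ne: "E \<noteq> {}" using x0 by auto
    have bdd: "bdd_below (gdist A y ` E)" using gdist_nonneg by (intro bdd_belowI2[of _ 0]) auto
    have "infdist y E \<le> \<rho>" unfolding \<rho>_def
    proof (rule cINF_greatest[OF ne])
      fix v assume "v \<in> E"
      then show "infdist y E \<le> gdist A y v" using infdist_le[of v E y] norm_le_gdist[of v y A] by (simp add: dist_norm norm_minus_commute)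
    qed
    moreover have "infdist y E > 0" using closed_E ne y(2) in_closed_iff_infdist_zero infdist_nonneg[of y E] by fastforce
    ultimately have \<rho>0: "\<rho> > 0" by simp
    have yx0: "gdist A y x0 < r1" using d(2)[OF y(1)] by (simp add: gdist_commute)
    have \<rho>1: "\<rho> < r1" using cINF_lower[OF bdd x0(1)] yx0 unfolding \<rho>_def by simp
    have "\<exists>x\<in>E. gdist A y x < 2 * \<rho>"
    proof (rule ccontr)
      assume "\<not> (\<exists>x\<in>E. gdist A y x < 2 * \<rho>)"
      then have "2 * \<rho> \<le> \<rho>" unfolding \<rho>_def by (intro cINF_greatest[OF ne]) (auto simp: not_less)
      then show False using \<rho>0 by simp
    qed
    then obtain x where x: "x \<in> E" "gdist A y x < 2 * \<rho>" by blast
    let ?K = "B (3 * \<rho>) x" and ?H = "B (\<rho> / 2) y"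
    have HK: "?H \<subseteq> ?K"
    proof
      fix w assume "w \<in> ?H"
      then show "w \<in> ?K" using gdist_triangle[of A x w y] x(2) \<rho>0 by (simp add: hball_def gdist_commute[of A x y])
    qed
    have HE: "?H \<inter> E = {}"
    proof -
      have "w \<notin> ?H" if "w \<in> E" for w
        using cINF_lower[OF bdd that] \<rho>0 unfolding \<rho>_def[symmetric] by (simp add: hball_def)
      then show ?thesis by blast
    qed
    have near: "norm (v - x0) \<le> \<rho>0" if "v \<in> ?K" for v
    proof -
      have "gdist A x0 v \<le> gdist A x0 y + (gdist A y x + gdist A x v)"
        using gdist_triangle[of A x0 v y] gdist_triangle[of A y v x] by linarith
      also have "\<dots> \<le> r1 + (2 * \<rho> + 3 * \<rho>)" using yx0 x(2) that by (simp add: hball_def gdist_commute[of A x0 y])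
      also have "\<dots> \<le> \<rho>0" using \<rho>1 r1 by linarith
      finally show ?thesis using norm_le_gdist[of v x0 A] by simp
    qed
    have "x \<in> ?K" using gdist_le_iff[OF A, of "3 * \<rho>" x x] \<rho>0 by (simp add: hball_def hgt_def)
    then have regx: "norm (hgrad A x) \<ge> \<kappa>" using reg near by blast
    have "y \<in> ?H" using gdist_le_iff[OF A, of "\<rho> / 2" y y] \<rho>0 by (simp add: hball_def hgt_def)
    then have regy: "norm (hgrad A y) \<ge> \<kappa>" using reg near HK by blast
    define c' where "c' = enn2real c"
    have c': "c' > 0" "c = ennreal c'" using c_finite by (auto simp: c'_def enn2real_positive_iff)
    define a where "a = enn2real (emeasure lam (E \<inter> ?K))"
    define b where "b = enn2real (emeasure lam ?H)"
    define k where "k = enn2real (emeasure lam ?K)"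
    have bK: "bounded ?K" "bounded ?H" by (rule bounded_hball)+
    have fin: "emeasure lam (E \<inter> ?K) = ennreal a" "emeasure lam ?H = ennreal b" "emeasure lam ?K = ennreal k"
      using harea_bounded_finite[of "E \<inter> ?K"] harea_bounded_finite[OF bK(2)] harea_bounded_finite[OF bK(1)] bK
      by (auto simp: a_def b_def k_def bounded_Int)
    have nn: "a \<ge> 0" "b \<ge> 0" "k \<ge> 0" by (auto simp: a_def b_def k_def)
    define T where "T = (3 * \<rho>) ^ ?m"
    have T: "T > 0" using \<rho>0 by (simp add: T_def del: power_Suc)
    have half: "(\<rho> / 2) ^ ?m = T / 6 ^ ?m"
    proof -
      have "(\<rho> / 2) ^ ?m = (3 * \<rho> / 6) ^ ?m" by simp
      then show ?thesis unfolding T_def by (simp only: power_divide)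
    qed
    have 1: "c' * T \<le> a"
    proof -
      have "c * emeasure M ?K \<le> emeasure lam (E \<inter> ?K)"
      proof (rule M_le_area_regular[OF compact_hball])
        fix v assume "v \<in> ?K" then show "hgrad A v \<noteq> 0" using reg[OF near] \<kappa>(1) by force
      qed
      then have "ennreal c' * ennreal T \<le> ennreal a" using unif[OF x(1), of "3 * \<rho>"] \<rho>0 c' fin by (simp add: T_def del: power_Suc)
      then show ?thesis using c' T nn by (simp flip: ennreal_mult')
    qed
    have 2: "k \<le> (1 + \<epsilon>) * (T * c')"
    proof -
      have "ennreal k \<le> ennreal (1 + \<epsilon>) * (ennreal T * ennreal c')"
        using r0(2)[OF regx, of "3 * \<rho>"] \<rho>0 \<rho>1 r1 fin c' by (simp add: T_def del: power_Suc)
      then show ?thesis using c' T nn \<epsilon> by (simp flip: ennreal_mult' del: ennreal_plus)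
    qed
    have 3: "T / 6 ^ ?m * c' \<le> (1 + \<epsilon>) * b"
    proof -
      have "ennreal (T / 6 ^ ?m) * ennreal c' \<le> ennreal (1 + \<epsilon>) * ennreal b"
        using r0(2)[OF regy, of "\<rho> / 2"] \<rho>0 \<rho>1 r1 fin c' unfolding half by simp
      then show ?thesis using c' T nn \<epsilon> by (simp flip: ennreal_mult' del: power_Suc ennreal_plus)
    qed
    have 4: "a + b \<le> k"
    proof -
      have "emeasure lam (E \<inter> ?K) + emeasure lam ?H = emeasure lam (E \<inter> ?K \<union> ?H)"
        using HE by (intro plus_emeasure) auto
      also have "\<dots> \<le> emeasure lam ?K" using HK by (intro emeasure_mono) auto
      finally show ?thesis using fin nn by (simp flip: ennreal_plus)
    qed
    have "b \<le> \<epsilon> * (T * c')" using 1 2 4 by (simp add: algebra_simps)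
    then have "(1 + \<epsilon>) * b \<le> 2 * (\<epsilon> * (T * c'))" using \<epsilon> nn c' T by (intro mult_mono) auto
    then have "T / 6 ^ ?m * c' \<le> 2 * (\<epsilon> * (T * c'))" using 3 by linarith
    also have "\<dots> = (T / 6 ^ ?m * c') / 2" by (simp add: \<epsilon>_def del: power_Suc)
    finally have "T / 6 ^ ?m * c' \<le> 0" by simp
    moreover have "0 < T / 6 ^ ?m * c'" using T c' by (intro mult_pos_pos divide_pos_pos) auto
    ultimately show False by linarith
  qed
  then show ?thesis using that d(1) by blast
qed

text \<open>Along a segment of regular points the parameters in \<open>E\<close> form a set that is closed
  and, by \<open>regular_interior\<close>, open.\<close>
lemma segment_in_E:
  assumes x: "x \<in> E" and reg: "\<And>t. 0 \<le> t \<Longrightarrow> t \<le> 1 \<Longrightarrow> hgrad A (x + t *\<^sub>R (y - x)) \<noteq> 0"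
  shows "y \<in> E"
proof -
  define \<gamma> where "\<gamma> t = x + t *\<^sub>R (y - x)" for t :: real
  define S where "S = {t \<in> {0..1}. \<gamma> t \<in> E}"
  have cg: "continuous_on UNIV \<gamma>" unfolding \<gamma>_def by (intro continuous_intros)
  have "closed S"
  proof -
    have "closed (\<gamma> -` E)" using cg closed_E by (simp add: continuous_closed_vimage continuous_on_eq_continuous_at)
    moreover have "S = {0..1} \<inter> \<gamma> -` E" by (auto simp: S_def)
    ultimately show ?thesis by auto
  qed
  moreover have "0 \<in> S" using x by (simp add: S_def \<gamma>_def)
  moreover have "bdd_above S" by (auto simp: S_def intro: bdd_aboveI[of _ 1])
  ultimately have Sup: "Sup S \<in> S" by (intro closed_contains_Sup) auto
  then have t: "0 \<le> Sup S" "Sup S \<le> 1" "\<gamma> (Sup S) \<in> E" by (auto simp: S_def)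
  have "Sup S = 1"
  proof (rule ccontr)
    assume "Sup S \<noteq> 1"
    then have lt: "Sup S < 1" using t by simp
    have "hgrad A (\<gamma> (Sup S)) \<noteq> 0" using reg[OF t(1,2)] by (simp add: \<gamma>_def)
    then obtain d where d: "d > 0" "cball (\<gamma> (Sup S)) d \<subseteq> E" using regular_interior[OF t(3)] by blast
    define h where "h = min (1 - Sup S) (d / (norm (y - x) + 1))"
    have h: "h > 0" "h \<le> 1 - Sup S" "h \<le> d / (norm (y - x) + 1)"
      using lt d by (auto simp: h_def add_nonneg_pos)
    have "norm (h *\<^sub>R (y - x)) \<le> d"
    proof -
      have "h * (norm (y - x) + 1) \<le> d" using h(3) by (simp add: pos_le_divide_eq add_nonneg_pos)
      then show ?thesis using h(1) unfolding norm_scaleR by (simp add: distrib_left)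
    qed
    moreover have "\<gamma> (Sup S + h) - \<gamma> (Sup S) = h *\<^sub>R (y - x)" by (simp add: \<gamma>_def algebra_simps)
    ultimately have "\<gamma> (Sup S + h) \<in> cball (\<gamma> (Sup S)) d" by (metis dist_norm norm_minus_commute mem_cball)
    then have "Sup S + h \<in> S" using d(2) h t by (auto simp: S_def)
    then have "Sup S + h \<le> Sup S" using \<open>bdd_above S\<close> by (intro cSup_upper)
    then show False using h by simp
  qed
  then show ?thesis using t by (simp add: \<gamma>_def)
qed

lemma hgrad_diff: "hgrad A (x + t *\<^sub>R (y - x)) = (1 - t) *\<^sub>R hgrad A x + t *\<^sub>R hgrad A y"
  by (simp add: hgrad_def algebra_simps)

text \<open>If the segment from \<open>x\<close> to \<open>y\<close> meets the kernel, the gradients at its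
  ends are parallel, and a detour through a point \<open>z\<close> with an independent gradient
  avoids the kernel.\<close>
lemma regular_subset_E:
  assumes rank: "\<And>w. \<exists>z. \<forall>s. hgrad A z \<noteq> s *\<^sub>R w"
    and x: "x \<in> E" "hgrad A x \<noteq> 0" and y: "hgrad A y \<noteq> 0"
  shows "y \<in> E"
proof (cases "\<exists>t. 0 \<le> t \<and> t \<le> 1 \<and> hgrad A (x + t *\<^sub>R (y - x)) = 0")
  case False
  then show ?thesis using segment_in_E[OF x(1)] by blast
next
  case True
  then obtain t where t: "(1 - t) *\<^sub>R hgrad A x + t *\<^sub>R hgrad A y = 0" unfolding hgrad_diff by blast
  then have "t \<noteq> 0" using x(2) by auto
  then have yx: "hgrad A y = (- ((1 - t) / t)) *\<^sub>R hgrad A x"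
  proof -
    have "t *\<^sub>R hgrad A y = - ((1 - t) *\<^sub>R hgrad A x)" using t by (simp add: eq_neg_iff_add_eq_0 add.commute)
    then have "inverse t *\<^sub>R (t *\<^sub>R hgrad A y) = inverse t *\<^sub>R (- ((1 - t) *\<^sub>R hgrad A x))" by simp
    then show ?thesis using \<open>t \<noteq> 0\<close> by (simp add: divide_inverse mult.commute scaleR_minus_left)
  qed
  obtain z where z: "\<And>s. hgrad A z \<noteq> s *\<^sub>R hgrad A x" using rank by blast
  have gen: "(1 - s) *\<^sub>R (a *\<^sub>R hgrad A x) + s *\<^sub>R hgrad A z \<noteq> 0" if "a *\<^sub>R hgrad A x \<noteq> 0" for s a
  proof
    assume *: "(1 - s) *\<^sub>R (a *\<^sub>R hgrad A x) + s *\<^sub>R hgrad A z = 0"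
    show False
    proof (cases "s = 0")
      case True then show False using * that by simp
    next
      case False
      have "s *\<^sub>R hgrad A z = - ((1 - s) *\<^sub>R (a *\<^sub>R hgrad A x))" using * by (simp add: eq_neg_iff_add_eq_0 add.commute)
      then have "inverse s *\<^sub>R (s *\<^sub>R hgrad A z) = inverse s *\<^sub>R (- ((1 - s) *\<^sub>R (a *\<^sub>R hgrad A x)))" by simp
      then have "hgrad A z = (- (inverse s * ((1 - s) * a))) *\<^sub>R hgrad A x" using False by simp
      then show False using z by blast
    qed
  qed
  have "z \<in> E"
  proof (rule segment_in_E[OF x(1)])
    fix s show "hgrad A (x + s *\<^sub>R (z - x)) \<noteq> 0" unfolding hgrad_diff using gen[of 1 s] x(2) by simp
  qed
  then show ?thesis
  proof (rule segment_in_E)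
    fix s show "hgrad A (z + s *\<^sub>R (y - z)) \<noteq> 0"
      unfolding hgrad_diff using gen[of "- ((1 - t) / t)" "1 - s"] y yx by (simp add: add.commute)
  qed
qed

end

section \<open>The support fills the regular set: rank one\<close>

lemma lborel_plane:
  fixes w k :: "'a::euclidean_space" and \<Phi> :: "'a \<Rightarrow> ennreal"
  assumes w: "norm w = 1" and k: "norm k = 1" and wk: "w \<bullet> k = 0"
    and basis: "\<And>z. z = (w \<bullet> z) *\<^sub>R w + (k \<bullet> z) *\<^sub>R k" and [measurable]: "\<Phi> \<in> borel_measurable borel"
  shows "(\<integral>\<^sup>+z. \<Phi> z \<partial>lborel) = emeasure lborel {x. 0 \<le> k \<bullet> x \<and> k \<bullet> x \<le> 1 \<and> 0 \<le> w \<bullet> x \<and> w \<bullet> x \<le> 1} *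
     (\<integral>\<^sup>+s. (\<integral>\<^sup>+y. \<Phi> (s *\<^sub>R w + y *\<^sub>R k) \<partial>lborel) \<partial>lborel)" (is "_ = emeasure _ ?Q * ?I")
proof -
  let ?W = "{y. 0 \<le> w \<bullet> y \<and> w \<bullet> y \<le> 1}" and ?K = "{y. 0 \<le> k \<bullet> y \<and> k \<bullet> y \<le> 1}"
  have "(\<integral>\<^sup>+z. \<Phi> z \<partial>lborel) = (\<integral>\<^sup>+y. indicator ?W y * (\<integral>\<^sup>+s. \<Phi> (y + s *\<^sub>R w) \<partial>lborel) \<partial>lborel)"
    by (intro lborel_slices w) measurable
  also have "\<dots> = (\<integral>\<^sup>+x. indicator ?K x * (\<integral>\<^sup>+y. indicator ?W (x + y *\<^sub>R k) * (\<integral>\<^sup>+s. \<Phi> (x + y *\<^sub>R k + s *\<^sub>R w) \<partial>lborel) \<partial>lborel) \<partial>lborel)"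
    by (intro lborel_slices k) measurable
  also have "\<dots> = (\<integral>\<^sup>+x. ?I * indicator ?Q x \<partial>lborel)"
  proof (rule nn_integral_cong)
    fix x
    have "(\<integral>\<^sup>+y. (\<integral>\<^sup>+s. \<Phi> (x + y *\<^sub>R k + s *\<^sub>R w) \<partial>lborel) \<partial>lborel) = (\<integral>\<^sup>+y. (\<integral>\<^sup>+s. \<Phi> (s *\<^sub>R w + y *\<^sub>R k) \<partial>lborel) \<partial>lborel)"
    proof -
      have "(\<integral>\<^sup>+s. \<Phi> (x + y *\<^sub>R k + s *\<^sub>R w) \<partial>lborel) = (\<integral>\<^sup>+s. \<Phi> (s *\<^sub>R w + (k \<bullet> x + y) *\<^sub>R k) \<partial>lborel)" for y
      proof -
        have "(\<integral>\<^sup>+s. \<Phi> (s *\<^sub>R w + (k \<bullet> x + y) *\<^sub>R k) \<partial>lborel) = (\<integral>\<^sup>+s. \<Phi> ((w \<bullet> x + s) *\<^sub>R w + (k \<bullet> x + y) *\<^sub>R k) \<partial>lborel)"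
          by (rule lborel_translate[symmetric]) measurable
        moreover have "(w \<bullet> x + s) *\<^sub>R w + (k \<bullet> x + y) *\<^sub>R k = x + y *\<^sub>R k + s *\<^sub>R w" for s
          using basis[of x] by (simp add: algebra_simps)
        ultimately show ?thesis by simp
      qed
      then show ?thesis
        using lborel_translate[of "\<lambda>y. \<integral>\<^sup>+s. \<Phi> (s *\<^sub>R w + y *\<^sub>R k) \<partial>lborel" "k \<bullet> x"] by simp
    qed
    also have "\<dots> = ?I" by (rule lborel_pair.Fubini'[symmetric]) measurable
    finally have I: "(\<integral>\<^sup>+y. (\<integral>\<^sup>+s. \<Phi> (x + y *\<^sub>R k + s *\<^sub>R w) \<partial>lborel) \<partial>lborel) = ?I" .
    have "indicator ?W (x + y *\<^sub>R k) = (indicator ?W x :: ennreal)" for y by (simp add: indicator_def inner_add_right wk)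
    then have "(\<integral>\<^sup>+y. indicator ?W (x + y *\<^sub>R k) * (\<integral>\<^sup>+s. \<Phi> (x + y *\<^sub>R k + s *\<^sub>R w) \<partial>lborel) \<partial>lborel) = indicator ?W x * ?I"
      by (simp add: nn_integral_cmult I)
    then show "indicator ?K x * (\<integral>\<^sup>+y. indicator ?W (x + y *\<^sub>R k) * (\<integral>\<^sup>+s. \<Phi> (x + y *\<^sub>R k + s *\<^sub>R w) \<partial>lborel) \<partial>lborel) = ?I * indicator ?Q x"
      by (auto simp: indicator_def)
  qed
  also have "\<dots> = emeasure lborel ?Q * ?I"
    by (subst nn_integral_cmult_indicator) (auto simp: mult.commute)
  finally show ?thesis .
qed

text \<open>The planar integral of the half ball in the coordinates \<open>q = \<alpha> * s - 2 * y\<close>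
  (half the gradient) and \<open>T = s * q\<close> (the height). With \<open>\<rho> ^ 4 +
  T\<^sup>2 = 1\<close>, membership confines \<open>q\<close> to an interval of length \<open>2 *
  \<rho>\<close>, the length of the flat slice. When \<open>\<alpha> * T \<le> 0\<close> the
  interval ends at \<open>2 * \<rho>\<close>, and \<open>\<bar>T\<bar> \<le> \<rho> * q\<close>
  excludes \<open>q < 1/2\<close> if moreover \<open>\<bar>T\<bar> \<ge> 1/2\<close>; this is
  where the strict gain comes from.\<close>
lemma slice_length_le:
  fixes \<alpha> T :: real
  defines "S \<equiv> {q. 0 < q \<and> ((T / q)\<^sup>2 + (\<alpha> * (T / q) - q)\<^sup>2 / 4)\<^sup>2 + T\<^sup>2 \<le> 1}"
  assumes J: "T \<in> J \<Longrightarrow> \<alpha> * T \<le> 0 \<and> 1/2 \<le> \<bar>T\<bar> \<and> \<bar>T\<bar> \<le> 3/4"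
  shows "emeasure lborel S + ennreal (1/2) * indicator J T \<le> (\<integral>\<^sup>+y. indicator {y. y ^ 4 + T\<^sup>2 \<le> 1} y \<partial>lborel)"
proof (cases "T\<^sup>2 \<le> 1")
  case False
  then have "T\<^sup>2 > 1" by simp
  then have "S = {}" unfolding S_def using zero_le_power2 by (smt (verit) Collect_empty_eq)
  moreover have "T \<notin> J"
  proof
    assume "T \<in> J"
    then have "\<bar>T\<bar> \<le> 1" using J by force
    then show False using False by (simp add: abs_square_le_1)
  qed
  ultimately show ?thesis by simp
next
  case True
  define \<rho> where "\<rho> = sqrt (sqrt (1 - T\<^sup>2))"
  have \<rho>: "0 \<le> \<rho>" "\<rho> \<le> 1" "\<rho>\<^sup>2 = sqrt (1 - T\<^sup>2)" "(\<rho>\<^sup>2)\<^sup>2 = 1 - T\<^sup>2" using True by (auto simp: \<rho>_def)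
  have "(\<integral>\<^sup>+y. indicator {y. y ^ 4 + T\<^sup>2 \<le> 1} y \<partial>lborel) = (\<integral>\<^sup>+y. indicator {-\<rho>..\<rho>} y \<partial>lborel)"
  proof (rule nn_integral_cong)
    fix y :: real
    have "y ^ 4 + T\<^sup>2 \<le> 1 \<longleftrightarrow> (y\<^sup>2)\<^sup>2 \<le> (\<rho>\<^sup>2)\<^sup>2" using \<rho>(4) by (auto simp flip: power_mult)
    also have "\<dots> \<longleftrightarrow> \<bar>y\<^sup>2\<bar> \<le> \<bar>\<rho>\<^sup>2\<bar>" by (rule abs_le_square_iff[symmetric])
    also have "\<dots> \<longleftrightarrow> y\<^sup>2 \<le> \<rho>\<^sup>2" by simp
    also have "\<dots> \<longleftrightarrow> \<bar>y\<bar> \<le> \<rho>" using \<rho>(1) by (metis abs_of_nonneg abs_le_square_iff)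
    finally show "indicator {y. y ^ 4 + T\<^sup>2 \<le> 1} y = (indicator {-\<rho>..\<rho>} y :: ennreal)" by (auto simp: indicator_def)
  qed
  also have "\<dots> = ennreal (2 * \<rho>)" using \<rho> by simp
  finally have R: "(\<integral>\<^sup>+y. indicator {y. y ^ 4 + T\<^sup>2 \<le> 1} y \<partial>lborel) = ennreal (2 * \<rho>)" .
  define \<beta> where "\<beta> = \<alpha> * T"
  have S: "\<bar>T\<bar> \<le> \<rho> * q" "q\<^sup>2 - 2 * \<rho> * q \<le> \<beta>" "\<beta> \<le> q\<^sup>2 + 2 * \<rho> * q" "0 < q" if "q \<in> S" for q
  proof -
    have q: "0 < q" "((T / q)\<^sup>2 + (\<alpha> * (T / q) - q)\<^sup>2 / 4)\<^sup>2 + T\<^sup>2 \<le> 1" using that by (auto simp: S_def)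
    then have "((T / q)\<^sup>2 + (\<alpha> * (T / q) - q)\<^sup>2 / 4)\<^sup>2 \<le> (\<rho>\<^sup>2)\<^sup>2" using \<rho>(4) by linarith
    then have X: "(T / q)\<^sup>2 + (\<alpha> * (T / q) - q)\<^sup>2 / 4 \<le> \<rho>\<^sup>2" by (rule power2_le_imp_le) simp
    have "(T / q)\<^sup>2 \<le> \<rho>\<^sup>2" using X zero_le_power2[of "\<alpha> * (T / q) - q"] by linarith
    then have "\<bar>T / q\<bar> \<le> \<rho>" using \<rho>(1) by (metis abs_of_nonneg abs_le_square_iff)
    then show "\<bar>T\<bar> \<le> \<rho> * q" using q(1) by (simp add: abs_divide pos_divide_le_eq)
    have "(2 * \<rho>)\<^sup>2 = 4 * \<rho>\<^sup>2" by (simp add: power_mult_distrib)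
    then have "(\<alpha> * (T / q) - q)\<^sup>2 \<le> (2 * \<rho>)\<^sup>2" using X zero_le_power2[of "T / q"] by linarith
    then have "\<bar>\<alpha> * (T / q) - q\<bar> \<le> 2 * \<rho>" using \<rho>(1) by (metis abs_of_nonneg abs_le_square_iff mult_nonneg_nonneg zero_le_numeral)
    then have 1: "\<beta> / q - q \<le> 2 * \<rho>" "q - \<beta> / q \<le> 2 * \<rho>" by (simp_all add: \<beta>_def abs_le_iff)
    show "\<beta> \<le> q\<^sup>2 + 2 * \<rho> * q" using 1(1) q(1) by (simp add: field_simps power2_eq_square)
    show "q\<^sup>2 - 2 * \<rho> * q \<le> \<beta>" using 1(2) q(1) by (simp add: field_simps power2_eq_square)
    show "0 < q" by (rule q(1))
  qed
  have emS: "emeasure lborel S \<le> ennreal (b - a)" if "S \<subseteq> {a..b}" "a \<le> b" for a b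
    using emeasure_mono[of S "{a..b}" lborel] that by simp
  show ?thesis
  proof (cases "T \<in> J")
    case True
    have T: "\<beta> \<le> 0" "1/2 \<le> \<bar>T\<bar>" "\<bar>T\<bar> \<le> 3/4" using J[OF True] by (auto simp: \<beta>_def)
    have "T\<^sup>2 \<le> (3/4)\<^sup>2" using T(3) by (metis abs_ge_zero power2_abs power_mono)
    then have "(1/2)\<^sup>2 \<le> sqrt (1 - T\<^sup>2)" by (intro real_le_rsqrt) (simp add: power2_eq_square)
    then have r2: "1/2 \<le> \<rho>" unfolding \<rho>_def by (rule real_le_rsqrt)
    have "S \<subseteq> {1/2..2*\<rho>}"
    proof
      fix q assume q: "q \<in> S"
      have "\<rho> * q \<le> 1 * q" using \<rho>(2) S(4)[OF q] by (intro mult_right_mono) auto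
      then have "1/2 \<le> q" using S(1)[OF q] T by linarith
      moreover have "q * (q - 2 * \<rho>) \<le> 0" using S(2)[OF q] T(1) by (simp add: algebra_simps power2_eq_square)
      then have "q \<le> 2 * \<rho>" using S(4)[OF q] by (simp add: mult_le_0_iff)
      ultimately show "q \<in> {1/2..2*\<rho>}" by simp
    qed
    then have "emeasure lborel S \<le> ennreal (2 * \<rho> - 1/2)" using emS r2 by simp
    then have "emeasure lborel S + ennreal (1/2) \<le> ennreal (2 * \<rho> - 1/2) + ennreal (1/2)" by (rule add_right_mono)
    also have "\<dots> = ennreal (2 * \<rho>)" using r2 by (subst ennreal_plus[symmetric]) auto
    finally show ?thesis using True R by simp
  next
    case False
    have "emeasure lborel S \<le> ennreal (2 * \<rho>)"
    proof (cases "\<beta> \<le> 0")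
      case True
      have "S \<subseteq> {0..2*\<rho>}"
      proof
        fix q assume q: "q \<in> S"
        have "q * (q - 2 * \<rho>) \<le> 0" using S(2)[OF q] True by (simp add: algebra_simps power2_eq_square)
        then show "q \<in> {0..2*\<rho>}" using S(4)[OF q] by (simp add: mult_le_0_iff)
      qed
      then show ?thesis using emS[of 0 "2 * \<rho>"] \<rho> by simp
    next
      case False
      define R where "R = sqrt (\<rho>\<^sup>2 + \<beta>)"
      have R2: "R\<^sup>2 = \<rho>\<^sup>2 + \<beta>" "R \<ge> 0" using False by (auto simp: R_def)
      have "S \<subseteq> {R - \<rho>..R + \<rho>}"
      proof
        fix q assume q: "q \<in> S"
        have "(q - \<rho>)\<^sup>2 \<le> R\<^sup>2" using S(2)[OF q] R2 by (simp add: power2_eq_square algebra_simps)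
        then have 1: "q - \<rho> \<le> R" using R2(2) by (rule power2_le_imp_le)
        have "R\<^sup>2 \<le> (q + \<rho>)\<^sup>2" using S(3)[OF q] R2 by (simp add: power2_eq_square algebra_simps)
        then have "R \<le> q + \<rho>" by (rule power2_le_imp_le) (use S(4)[OF q] \<rho>(1) in linarith)
        with 1 show "q \<in> {R - \<rho>..R + \<rho>}" by simp
      qed
      then have "emeasure lborel S \<le> ennreal ((R + \<rho>) - (R - \<rho>))" by (rule emS) (use \<rho>(1) in linarith)
      also have "(R + \<rho>) - (R - \<rho>) = 2 * \<rho>" by simp
      finally show ?thesis .
    qed
    then show ?thesis using False R by simp
  qed
qed

text \<open>The left integral is the area of half of the unit ball at the origin of a rank one graph, the
  right one is the flat constant; both lack the same normalising factor. The gain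
  \<open>1/8\<close> is \<open>1/2\<close> for each \<open>T\<close> in an interval of length
  \<open>1/4\<close>.\<close>
lemma half_plane_area:
  fixes \<alpha> :: real
  shows "(\<integral>\<^sup>+s. (\<integral>\<^sup>+y. indicator {(s, y). 0 < \<alpha> * s - 2 * y \<and> (s\<^sup>2 + y\<^sup>2)\<^sup>2 + (s * (\<alpha> * s - 2 * y))\<^sup>2 \<le> 1} (s, y) * ennreal (2 * (\<alpha> * s - 2 * y)) \<partial>lborel) \<partial>lborel)
     + ennreal (1/8) \<le> (\<integral>\<^sup>+s. (\<integral>\<^sup>+y. indicator {(s, y). y ^ 4 + s\<^sup>2 \<le> 1} (s, y) \<partial>lborel) \<partial>(lborel::real measure))"
    (is "?L + _ \<le> ?R")
proof -
  let ?G = "\<lambda>s q. 0 < q \<and> (s\<^sup>2 + ((\<alpha> * s - q)\<^sup>2 / 4))\<^sup>2 + (s * q)\<^sup>2 \<le> (1::real)"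
  define J where "J = (if \<alpha> \<le> 0 then {1/2..3/4} else {-3/4..-1/2::real})"
  have J: "\<alpha> * T \<le> 0 \<and> 1/2 \<le> \<bar>T\<bar> \<and> \<bar>T\<bar> \<le> 3/4" if "T \<in> J" for T
    using that by (auto simp: J_def mult_le_0_iff split: if_splits)
  have J1[measurable]: "J \<in> sets borel" by (simp add: J_def)
  have J2: "emeasure lborel J = ennreal (1/4)" by (simp add: J_def)
  have "?L = (\<integral>\<^sup>+s. (\<integral>\<^sup>+q. indicator {q. ?G s q} q * ennreal q \<partial>lborel) \<partial>lborel)"
  proof (rule nn_integral_cong)
    fix s :: real
    let ?f = "\<lambda>y. indicator {(s, y). 0 < \<alpha> * s - 2 * y \<and> (s\<^sup>2 + y\<^sup>2)\<^sup>2 + (s * (\<alpha> * s - 2 * y))\<^sup>2 \<le> 1} (s, y) * ennreal (2 * (\<alpha> * s - 2 * y))"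
    have fm: "?f \<in> borel_measurable borel"
    proof -
      have "(\<lambda>y. indicator {y. 0 < \<alpha> * s - 2 * y \<and> (s\<^sup>2 + y\<^sup>2)\<^sup>2 + (s * (\<alpha> * s - 2 * y))\<^sup>2 \<le> 1} y * ennreal (2 * (\<alpha> * s - 2 * y))) \<in> borel_measurable borel"
        by measurable
      then show ?thesis by (simp add: indicator_def)
    qed
    have "(\<integral>\<^sup>+y. ?f y \<partial>lborel) = ennreal (1/2) * (\<integral>\<^sup>+q. ?f (\<alpha> * s / 2 + (-1/2) * q) \<partial>lborel)"
      using nn_integral_real_affine[OF fm, of "-1/2" "\<alpha> * s / 2"] by simp
    also have "\<dots> = (\<integral>\<^sup>+q. ennreal (1/2) * ?f (\<alpha> * s / 2 + (-1/2) * q) \<partial>lborel)"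
      by (rule nn_integral_cmult[symmetric]) (use fm in measurable)
    also have "\<dots> = (\<integral>\<^sup>+q. indicator {q. ?G s q} q * ennreal q \<partial>lborel)"
    proof (rule nn_integral_cong)
      fix q :: real
      have 1: "\<alpha> * s - 2 * (\<alpha> * s / 2 + (-1/2) * q) = q" by simp
      have 2: "(\<alpha> * s / 2 + (-1/2) * q)\<^sup>2 = (\<alpha> * s - q)\<^sup>2 / 4" by (simp add: power2_eq_square field_simps)
      show "ennreal (1/2) * ?f (\<alpha> * s / 2 + (-1/2) * q) = indicator {q. ?G s q} q * ennreal q"
      proof -
        have f: "?f (\<alpha> * s / 2 + (-1/2) * q) = indicator {q. ?G s q} q * ennreal (2 * q)"
          by (simp only: indicator_def mem_Collect_eq case_prod_conv 1 2)
        have "ennreal (1/2) * ennreal (2 * q) = ennreal (1/2 * (2 * q))" by (rule ennreal_mult'[symmetric]) simp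
        then have "ennreal (1/2) * ennreal (2 * q) = ennreal q" by simp
        then show ?thesis unfolding f by (simp only: mult.left_commute[of "ennreal (1/2)"])
      qed
    qed
    finally show "(\<integral>\<^sup>+y. ?f y \<partial>lborel) = (\<integral>\<^sup>+q. indicator {q. ?G s q} q * ennreal q \<partial>lborel)" .
  qed
  also have "\<dots> = (\<integral>\<^sup>+q. (\<integral>\<^sup>+s. indicator {q. ?G s q} q * ennreal q \<partial>lborel) \<partial>lborel)"
    by (rule lborel_pair.Fubini') measurable
  also have "\<dots> = (\<integral>\<^sup>+q. (\<integral>\<^sup>+T. indicator {q. 0 < q \<and> ((T / q)\<^sup>2 + (\<alpha> * (T / q) - q)\<^sup>2 / 4)\<^sup>2 + T\<^sup>2 \<le> 1} q \<partial>lborel) \<partial>lborel)"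
  proof (rule nn_integral_cong)
    fix q :: real
    show "(\<integral>\<^sup>+s. indicator {q. ?G s q} q * ennreal q \<partial>lborel) = (\<integral>\<^sup>+T. indicator {q. 0 < q \<and> ((T / q)\<^sup>2 + (\<alpha> * (T / q) - q)\<^sup>2 / 4)\<^sup>2 + T\<^sup>2 \<le> 1} q \<partial>lborel)"
    proof (cases "0 < q")
      case True
      have m: "(\<lambda>s. indicator {q. ?G s q} q * ennreal q) \<in> borel_measurable borel" by measurable
      have "(\<integral>\<^sup>+s. indicator {q. ?G s q} q * ennreal q \<partial>lborel) = ennreal (1/q) * (\<integral>\<^sup>+T. indicator {qa. ?G (0 + 1 / q * T) qa} q * ennreal q \<partial>lborel)"
      proof -
        have q: "1 / q \<noteq> 0" "\<bar>1 / q\<bar> = 1 / q" using True by simp_all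
        show ?thesis using nn_integral_real_affine[OF m q(1), of 0] unfolding q(2) .
      qed
      also have "\<dots> = (\<integral>\<^sup>+T. ennreal (1/q) * (indicator {qa. ?G (0 + 1 / q * T) qa} q * ennreal q) \<partial>lborel)"
        by (rule nn_integral_cmult[symmetric]) measurable
      also have "\<dots> = (\<integral>\<^sup>+T. indicator {q. 0 < q \<and> ((T / q)\<^sup>2 + (\<alpha> * (T / q) - q)\<^sup>2 / 4)\<^sup>2 + T\<^sup>2 \<le> 1} q \<partial>lborel)"
        using True by (intro nn_integral_cong) (auto simp: indicator_def ennreal_mult'[symmetric])
      finally show ?thesis .
    qed simp
  qed
  also have "\<dots> = (\<integral>\<^sup>+T. (\<integral>\<^sup>+q. indicator {q. 0 < q \<and> ((T / q)\<^sup>2 + (\<alpha> * (T / q) - q)\<^sup>2 / 4)\<^sup>2 + T\<^sup>2 \<le> 1} q \<partial>lborel) \<partial>lborel)"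
    by (rule lborel_pair.Fubini') measurable
  finally have L: "?L = (\<integral>\<^sup>+T. (\<integral>\<^sup>+q. indicator {q. 0 < q \<and> ((T / q)\<^sup>2 + (\<alpha> * (T / q) - q)\<^sup>2 / 4)\<^sup>2 + T\<^sup>2 \<le> 1} q \<partial>lborel) \<partial>lborel)" .
  have "ennreal (1/8) = (\<integral>\<^sup>+T. ennreal (1/2) * indicator J T \<partial>lborel)"
  proof -
    have "(\<integral>\<^sup>+T. ennreal (1/2) * indicator J T \<partial>lborel) = ennreal (1/2) * ennreal (1/4)"
      by (subst nn_integral_cmult_indicator) (simp, simp only: J2)
    also have "\<dots> = ennreal (1/2 * (1/4))" by (rule ennreal_mult'[symmetric]) simp
    finally show ?thesis by simp
  qed
  then have "?L + ennreal (1/8) = (\<integral>\<^sup>+T. (\<integral>\<^sup>+q. indicator {q. 0 < q \<and> ((T / q)\<^sup>2 + (\<alpha> * (T / q) - q)\<^sup>2 / 4)\<^sup>2 + T\<^sup>2 \<le> 1} q \<partial>lborel) + ennreal (1/2) * indicator J T \<partial>lborel)"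
    unfolding L by (subst nn_integral_add) auto
  also have "\<dots> \<le> (\<integral>\<^sup>+T. (\<integral>\<^sup>+y. indicator {y. y ^ 4 + T\<^sup>2 \<le> 1} y \<partial>lborel) \<partial>(lborel::real measure))"
  proof (rule nn_integral_mono)
    fix T :: real
    have [measurable]: "{q. 0 < q \<and> ((T / q)\<^sup>2 + (\<alpha> * (T / q) - q)\<^sup>2 / 4)\<^sup>2 + T\<^sup>2 \<le> 1} \<in> sets borel" by measurable
    show "(\<integral>\<^sup>+q. indicator {q. 0 < q \<and> ((T / q)\<^sup>2 + (\<alpha> * (T / q) - q)\<^sup>2 / 4)\<^sup>2 + T\<^sup>2 \<le> 1} q \<partial>lborel) + ennreal (1/2) * indicator J T \<le> (\<integral>\<^sup>+y. indicator {y. y ^ 4 + T\<^sup>2 \<le> 1} y \<partial>lborel)"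
      using slice_length_le[of T J \<alpha>] J by simp
  qed
  also have "\<dots> = ?R" by (intro nn_integral_cong) (simp add: indicator_def)
  finally show ?thesis .
qed

context uniform_graph begin

text \<open>The antisymmetric part of the bilinear form \<open>x \<bullet> hgrad A y\<close> is \<open>2 *
  (x \<bullet> (sympl_J *v y))\<close>. If all gradients are parallel, \<open>sympl_J\<close> thus
  has rank at most two, so \<open>w\<close> and \<open>k = sympl_J *v w\<close> span the whole
  space: rank one occurs in the first Heisenberg group only.\<close>
lemma rank_one_structure:
  assumes w: "norm w = 1" and rank1: "\<And>z. \<exists>s. hgrad A z = s *\<^sub>R w"
  obtains k \<alpha> where "norm k = 1" "w \<bullet> k = 0" "\<And>z. z = (w \<bullet> z) *\<^sub>R w + (k \<bullet> z) *\<^sub>R k"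
    "\<And>z. hgrad A z = (2 * (\<alpha> * (w \<bullet> z) - 2 * (k \<bullet> z))) *\<^sub>R w"
    "\<And>z. hgt A 0 z = (w \<bullet> z) * (\<alpha> * (w \<bullet> z) - 2 * (k \<bullet> z))"
proof -
  have ww: "w \<bullet> w = 1" using w by (simp add: dot_square_norm)
  define \<phi> where "\<phi> z = w \<bullet> hgrad A z" for z
  have L: "hgrad A z = \<phi> z *\<^sub>R w" for z
  proof -
    obtain s where s: "hgrad A z = s *\<^sub>R w" using rank1 by blast
    then show ?thesis by (simp add: \<phi>_def ww)
  qed
  define \<psi> where "\<psi> = 2 *\<^sub>R (A *v w - sympl_J *v w)"
  have \<phi>\<psi>: "\<phi> z = \<psi> \<bullet> z" for z
    using symmetric_matrix_swap[OF A, of w z] sympl_J_antisym[of w z]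
    by (simp add: \<phi>_def \<psi>_def hgrad_def inner_add_right inner_diff_left)
  define k where "k = sympl_J *v w"
  have k: "norm k = 1" "w \<bullet> k = 0" using w by (simp_all add: k_def sympl_J_norm sympl_J_self)
  have four: "4 *\<^sub>R (sympl_J *v y) = \<phi> y *\<^sub>R w - (w \<bullet> y) *\<^sub>R \<psi>" for y
  proof -
    have "x \<bullet> (4 *\<^sub>R (sympl_J *v y)) = x \<bullet> (\<phi> y *\<^sub>R w - (w \<bullet> y) *\<^sub>R \<psi>)" for x
    proof -
      have "x \<bullet> hgrad A y - y \<bullet> hgrad A x = 4 * (x \<bullet> (sympl_J *v y))"
        using symmetric_matrix_swap[OF A, of x y] sympl_J_antisym[of y x]
        by (simp add: hgrad_def inner_add_right inner_commute)
      moreover have "x \<bullet> hgrad A y = \<phi> y * (x \<bullet> w)" by (subst L) simp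
      moreover have "y \<bullet> hgrad A x = \<phi> x * (y \<bullet> w)" by (subst L) simp
      ultimately have "4 * (x \<bullet> (sympl_J *v y)) = \<phi> y * (x \<bullet> w) - \<phi> x * (y \<bullet> w)" by simp
      then show ?thesis unfolding \<phi>\<psi>[of x] by (simp add: inner_diff_right inner_commute mult.commute)
    qed
    then have "\<forall>x. x \<bullet> (4 *\<^sub>R (sympl_J *v y)) = x \<bullet> (\<phi> y *\<^sub>R w - (w \<bullet> y) *\<^sub>R \<psi>)" by blast
    then show ?thesis by (simp only: vector_eq_ldot)
  qed
  define \<alpha> where "\<alpha> = \<phi> w / 2"
  have \<psi>: "\<psi> = (2 * \<alpha>) *\<^sub>R w - 4 *\<^sub>R k" using four[of w] by (simp add: k_def ww \<alpha>_def algebra_simps)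
  have \<phi>: "\<phi> z = 2 * (\<alpha> * (w \<bullet> z) - 2 * (k \<bullet> z))" for z
    unfolding \<phi>\<psi> \<psi> by (simp add: inner_diff_left)
  have Jz: "sympl_J *v z = (w \<bullet> z) *\<^sub>R k - (k \<bullet> z) *\<^sub>R w" for z
  proof -
    have "4 *\<^sub>R (sympl_J *v z) = 4 *\<^sub>R ((w \<bullet> z) *\<^sub>R k - (k \<bullet> z) *\<^sub>R w)"
      unfolding four \<psi> \<phi> by (simp add: algebra_simps)
    then show ?thesis by simp
  qed
  have basis: "z = (w \<bullet> z) *\<^sub>R w + (k \<bullet> z) *\<^sub>R k" for z
  proof -
    have "- z = sympl_J *v (sympl_J *v z)" by (simp add: sympl_J_sq)
    also have "\<dots> = (w \<bullet> z) *\<^sub>R (sympl_J *v k) - (k \<bullet> z) *\<^sub>R (sympl_J *v w)"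
      by (subst Jz[of z]) (simp add: matrix_vector_mult_diff_distrib matrix_vector_mult_scaleR)
    also have "\<dots> = - ((w \<bullet> z) *\<^sub>R w + (k \<bullet> z) *\<^sub>R k)" by (simp add: k_def sympl_J_sq)
    finally show ?thesis by (simp only: neg_equal_iff_equal)
  qed
  have hg: "hgt A 0 z = (w \<bullet> z) * (\<alpha> * (w \<bullet> z) - 2 * (k \<bullet> z))" for z
  proof -
    have "2 * hgt A 0 z = z \<bullet> hgrad A z" by (simp add: hgt_def hgrad_def inner_add_right sympl_J_self)
    also have "\<dots> = \<phi> z * (w \<bullet> z)" by (subst L) (simp add: inner_commute)
    finally show ?thesis unfolding \<phi> by (simp add: algebra_simps)
  qed
  show ?thesis by (rule that[OF k basis _ hg]) (subst L, simp add: \<phi>)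
qed

text \<open>The singular set is a horizontal line, on which the Koranyi distance is comparable to the
  Euclidean one: it is covered by about \<open>1/h\<close> balls of mass of order \<open>h ^ (2 *
  n + 1)\<close>.\<close>
lemma singular_ball_null:
  assumes w: "norm w = 1" and rank1: "\<And>z. \<exists>s. hgrad A z = s *\<^sub>R w"
  shows "emeasure M (B 1 0 \<inter> {x. hgrad A x = 0}) = 0"
proof -
  obtain k \<alpha> where k: "norm k = 1" "w \<bullet> k = 0" and basis: "\<And>z. z = (w \<bullet> z) *\<^sub>R w + (k \<bullet> z) *\<^sub>R k"
    and L: "\<And>z. hgrad A z = (2 * (\<alpha> * (w \<bullet> z) - 2 * (k \<bullet> z))) *\<^sub>R w"
    and hg: "\<And>z. hgt A 0 z = (w \<bullet> z) * (\<alpha> * (w \<bullet> z) - 2 * (k \<bullet> z))"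
    using rank_one_structure[OF w rank1] by metis
  have ww: "w \<bullet> w = 1" "k \<bullet> k = 1" using w k by (simp_all add: dot_square_norm)
  define d where "d = w + (\<alpha> / 2) *\<^sub>R k"
  have w0: "w \<noteq> 0" using w by auto
  have ker: "z = (w \<bullet> z) *\<^sub>R d" if "hgrad A z = 0" for z
  proof -
    have "k \<bullet> z = \<alpha> / 2 * (w \<bullet> z)" using that w0 unfolding L by simp
    then show ?thesis by (subst basis[of z]) (simp add: d_def algebra_simps)
  qed
  have kd: "hgrad A (t *\<^sub>R d) = 0" for t using k(2) by (simp add: L d_def inner_add_right ww inner_commute)
  define D where "D = norm d"
  have gd: "gdist A (s *\<^sub>R d) (t *\<^sub>R d) \<le> \<bar>t - s\<bar> * D" for s t
  proof -
    have "hgt A 0 ((t - s) *\<^sub>R d) = 0" using kd[of "t - s"] w0 unfolding hg L by simp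
    then have "hgt A (hgrad A (s *\<^sub>R d)) (t *\<^sub>R d - s *\<^sub>R d) = 0" using kd[of s] by (simp add: scaleR_diff_left)
    moreover have "norm (t *\<^sub>R d - s *\<^sub>R d) = \<bar>t - s\<bar> * D" by (simp add: D_def flip: scaleR_diff_left)
    ultimately show ?thesis by (subst gdist_le_iff[OF A]) (simp_all add: D_def)
  qed
  let ?m = "2 * CARD('n) + 1"
  let ?S = "B 1 0 \<inter> {x. hgrad A x = 0}"
  have [measurable]: "{x. hgrad A x = 0} \<in> sets borel" by measurable
  have D0: "D > 0"
  proof -
    have "w \<bullet> d = 1" using k(2) by (simp add: d_def inner_add_right ww)
    then have "d \<noteq> 0" by auto
    then show ?thesis by (simp add: D_def)
  qed
  have bound: "emeasure M ?S \<le> ennreal ((2 * D) ^ ?m * 3 * inverse (real (Suc N)))" for N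
  proof -
    define h where "h = inverse (real (Suc N))"
    have h: "h > 0" "h \<le> 1" "real (Suc N) * h = 1" by (auto simp: h_def field_simps)
    have cover: "?S \<subseteq> (\<Union>j\<in>{- int (Suc N)..int (Suc N)}. B (h * D) ((real_of_int j * h) *\<^sub>R d))"
    proof
      fix z assume z: "z \<in> ?S"
      define t where "t = w \<bullet> z"
      have zt: "z = t *\<^sub>R d" using ker z by (simp add: t_def)
      have "norm z \<le> 1" using z norm_le_gdist[of z 0 A] by (simp add: hball_def)
      then have t1: "\<bar>t\<bar> \<le> 1" using Cauchy_Schwarz_ineq2[of w z] w by (simp add: t_def)
      define j where "j = \<lfloor>t * real (Suc N)\<rfloor>"
      have j: "real_of_int j \<le> t * real (Suc N)" "t * real (Suc N) < real_of_int j + 1" by (auto simp: j_def)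
      have tb: "- real (Suc N) \<le> t * real (Suc N)" "t * real (Suc N) \<le> real (Suc N)"
        using mult_right_mono[of "-1" t "real (Suc N)"] mult_right_mono[of t 1 "real (Suc N)"] t1 by auto
      have jj: "j \<in> {- int (Suc N)..int (Suc N)}"
      proof -
        have "- int (Suc N) \<le> j" unfolding j_def le_floor_iff using tb by simp
        moreover have "real_of_int j \<le> real_of_int (int (Suc N))" using order_trans[OF j(1) tb(2)] by (simp only: of_int_of_nat_eq)
        ultimately show ?thesis by simp
      qed
      have e: "t * real (Suc N) * h = t" using h(3) by (simp add: mult.assoc)
      have "\<bar>t - real_of_int j * h\<bar> \<le> h"
      proof -
        have "real_of_int j * h \<le> t * real (Suc N) * h" using j(1) h(1) by (intro mult_right_mono) auto
        moreover have "t * real (Suc N) * h \<le> (real_of_int j + 1) * h" using j(2) h(1) by (intro mult_right_mono) auto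
        ultimately show ?thesis unfolding e by (simp add: algebra_simps abs_le_iff)
      qed
      then have "\<bar>t - real_of_int j * h\<bar> * D \<le> h * D" using D0 by (intro mult_right_mono) auto
      then have "z \<in> B (h * D) ((real_of_int j * h) *\<^sub>R d)"
        using gd[of "real_of_int j * h" t] unfolding zt hball_def by simp
      then show "z \<in> (\<Union>j\<in>{- int (Suc N)..int (Suc N)}. B (h * D) ((real_of_int j * h) *\<^sub>R d))" using jj by blast
    qed
    have hD: "h * D > 0" using h D0 by simp
    have "emeasure M ?S \<le> emeasure M (\<Union>j\<in>{- int (Suc N)..int (Suc N)}. B (h * D) ((real_of_int j * h) *\<^sub>R d))"
      by (intro emeasure_mono cover) auto
    also have "\<dots> \<le> (\<Sum>j\<in>{- int (Suc N)..int (Suc N)}. emeasure M (B (h * D) ((real_of_int j * h) *\<^sub>R d)))"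
      by (intro emeasure_subadditive_finite) auto
    also have "\<dots> \<le> (\<Sum>j\<in>{- int (Suc N)..int (Suc N)}. ennreal ((2 * (h * D)) ^ ?m))"
      by (intro sum_mono M_B_le hD)
    also have "\<dots> = ennreal (real (2 * Suc N + 1) * (2 * (h * D)) ^ ?m)"
      using hD by (simp add: ennreal_mult' ennreal_of_nat_eq_real_of_nat del: power_Suc)
    also have "\<dots> \<le> ennreal ((2 * D) ^ ?m * 3 * h)"
    proof (rule ennreal_leI)
      have "h ^ ?m \<le> h ^ 2" using h by (intro power_decreasing) auto
      moreover have "real (2 * Suc N + 1) \<le> 3 * real (Suc N)" by simp
      ultimately have "real (2 * Suc N + 1) * h ^ ?m \<le> (3 * real (Suc N)) * h ^ 2" using h by (intro mult_mono) auto
      also have "\<dots> = 3 * h * (real (Suc N) * h)" by (simp only: power2_eq_square mult_ac)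
      also have "\<dots> = 3 * h" unfolding h(3) by simp
      finally have "(2 * D) ^ ?m * (real (2 * Suc N + 1) * h ^ ?m) \<le> (2 * D) ^ ?m * (3 * h)"
        using D0 by (intro mult_left_mono) auto
      moreover have "(2 * (h * D)) ^ ?m = (2 * D) ^ ?m * h ^ ?m" by (simp only: power_mult_distrib mult_ac)
      ultimately show "real (2 * Suc N + 1) * (2 * (h * D)) ^ ?m \<le> (2 * D) ^ ?m * 3 * h" by (simp only: mult_ac)
    qed
    finally show ?thesis by (simp add: h_def)
  qed
  have "(\<lambda>N. ennreal ((2 * D) ^ ?m * 3 * inverse (real (Suc N)))) \<longlonglongrightarrow> ennreal ((2 * D) ^ ?m * 3 * 0)"
    by (intro tendsto_ennrealI tendsto_mult tendsto_const LIMSEQ_inverse_real_of_nat)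
  then have "emeasure M ?S \<le> ennreal ((2 * D) ^ ?m * 3 * 0)"
    by (rule LIMSEQ_le_const) (use bound in auto)
  then show ?thesis by simp
qed

text \<open>Otherwise \<open>c = c * M (B 1 0)\<close> would be at most the area of half of the unit ball,
  which is less than \<open>c\<close>.\<close>
lemma half_plane_impossible:
  assumes w: "norm w = 1" and rank1: "\<And>z. \<exists>s. hgrad A z = s *\<^sub>R w"
    and half: "\<And>x. x \<in> E \<Longrightarrow> 0 \<le> w \<bullet> hgrad A x"
  shows False
proof -
  obtain k \<alpha> where k: "norm k = 1" "w \<bullet> k = 0" and basis: "\<And>z. z = (w \<bullet> z) *\<^sub>R w + (k \<bullet> z) *\<^sub>R k"
    and L: "\<And>z. hgrad A z = (2 * (\<alpha> * (w \<bullet> z) - 2 * (k \<bullet> z))) *\<^sub>R w"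
    and hg: "\<And>z. hgt A 0 z = (w \<bullet> z) * (\<alpha> * (w \<bullet> z) - 2 * (k \<bullet> z))"
    using rank_one_structure[OF w rank1] by metis
  have ww: "w \<bullet> w = 1" "k \<bullet> k = 1" "k \<bullet> w = 0" using w k by (simp_all add: dot_square_norm inner_commute)
  let ?q = "\<lambda>s y. \<alpha> * s - 2 * y"
  let ?v = "emeasure lborel {x. 0 \<le> k \<bullet> x \<and> k \<bullet> x \<le> 1 \<and> 0 \<le> w \<bullet> x \<and> w \<bullet> x \<le> 1}"
  have nz: "(norm z)\<^sup>2 = (w \<bullet> z)\<^sup>2 + (k \<bullet> z)\<^sup>2" for z
  proof -
    have "z \<bullet> z = z \<bullet> ((w \<bullet> z) *\<^sub>R w + (k \<bullet> z) *\<^sub>R k)" by (subst basis[of z]) simp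
    then show ?thesis unfolding power2_norm_eq_inner by (simp add: inner_add_right inner_commute power2_eq_square)
  qed
  have co: "w \<bullet> (s *\<^sub>R w + y *\<^sub>R k) = s" "k \<bullet> (s *\<^sub>R w + y *\<^sub>R k) = y" for s y
    using ww k by (simp_all add: inner_add_right)
  let ?H = "(\<integral>\<^sup>+s. (\<integral>\<^sup>+y. indicator {(s, y). 0 < \<alpha> * s - 2 * y \<and> (s\<^sup>2 + y\<^sup>2)\<^sup>2 + (s * (\<alpha> * s - 2 * y))\<^sup>2 \<le> 1} (s, y) * ennreal (2 * (\<alpha> * s - 2 * y)) \<partial>lborel) \<partial>lborel)"
  let ?P = "(\<integral>\<^sup>+s. (\<integral>\<^sup>+y. indicator {(s, y). y ^ 4 + s\<^sup>2 \<le> 1} (s, y) \<partial>lborel) \<partial>(lborel::real measure))"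
  have c: "c = ?v * ?P"
  proof -
    have "c = cyl 0 w" by (rule cyl_direction[OF f w])
    also have "\<dots> = (\<integral>\<^sup>+z. indicator {z. ((norm z)\<^sup>2 - (w \<bullet> z)\<^sup>2 + 0\<^sup>2)\<^sup>2 + (w \<bullet> z)\<^sup>2 \<le> 1} z \<partial>lborel)"
      unfolding cyl_def by (subst nn_integral_indicator) measurable
    also have "\<dots> = ?v * (\<integral>\<^sup>+s. (\<integral>\<^sup>+y. indicator {z. ((norm z)\<^sup>2 - (w \<bullet> z)\<^sup>2 + 0\<^sup>2)\<^sup>2 + (w \<bullet> z)\<^sup>2 \<le> 1} (s *\<^sub>R w + y *\<^sub>R k) \<partial>lborel) \<partial>lborel)"
      by (rule lborel_plane[OF w k basis]) measurable
    also have "\<dots> = ?v * ?P"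
      by (intro arg_cong2[where f = times] nn_integral_cong refl) (simp add: indicator_def nz co)
    finally show ?thesis .
  qed
  have [measurable]: "{x. 0 < w \<bullet> hgrad A x} \<in> sets borel" by measurable
  have i1: "c * 1 \<le> ?v * ?H"
  proof -
    have "emeasure M (B 1 0) = 1" using unif[OF E0, of 1] by simp
    moreover have "emeasure M (B 1 0) \<le> emeasure M (B 1 0 \<inter> {x. hgrad A x \<noteq> 0}) + emeasure M (B 1 0 \<inter> {x. hgrad A x = 0})"
    proof -
      have "emeasure M (B 1 0) = emeasure M ((B 1 0 \<inter> {x. hgrad A x \<noteq> 0}) \<union> (B 1 0 \<inter> {x. hgrad A x = 0}))"
        by (rule arg_cong[where f = "emeasure M"]) blast
      also have "\<dots> \<le> emeasure M (B 1 0 \<inter> {x. hgrad A x \<noteq> 0}) + emeasure M (B 1 0 \<inter> {x. hgrad A x = 0})"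
        by (rule emeasure_subadditive) measurable
      finally show ?thesis .
    qed
    ultimately have "1 \<le> emeasure M (B 1 0 \<inter> {x. hgrad A x \<noteq> 0})" using singular_ball_null[OF w rank1] by simp
    then have "c * 1 \<le> c * emeasure M (B 1 0 \<inter> {x. hgrad A x \<noteq> 0})" by (intro mult_left_mono) auto
    also have "\<dots> \<le> emeasure lam (E \<inter> B 1 0)" by (rule M_le_area[OF compact_hball])
    also have "\<dots> = (\<integral>\<^sup>+x. indicator (E \<inter> B 1 0) x * ennreal (norm (hgrad A x)) \<partial>lborel)"
      by (rule emeasure_harea) measurable
    also have "\<dots> \<le> (\<integral>\<^sup>+x. indicator (B 1 0 \<inter> {x. 0 < w \<bullet> hgrad A x}) x * ennreal (w \<bullet> hgrad A x) \<partial>lborel)"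
    proof (rule nn_integral_mono)
      fix x
      have n: "norm (hgrad A x) = \<bar>w \<bullet> hgrad A x\<bar>"
        using rank1[of x] w by (auto simp: ww)
      show "indicator (E \<inter> B 1 0) x * ennreal (norm (hgrad A x)) \<le> indicator (B 1 0 \<inter> {x. 0 < w \<bullet> hgrad A x}) x * ennreal (w \<bullet> hgrad A x)"
        unfolding n using half[of x] by (cases "w \<bullet> hgrad A x = 0") (auto simp: indicator_def)
    qed
    also have "\<dots> = ?v * (\<integral>\<^sup>+s. (\<integral>\<^sup>+y. indicator (B 1 0 \<inter> {x. 0 < w \<bullet> hgrad A x}) (s *\<^sub>R w + y *\<^sub>R k) * ennreal (w \<bullet> hgrad A (s *\<^sub>R w + y *\<^sub>R k)) \<partial>lborel) \<partial>lborel)"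
      by (rule lborel_plane[OF w k basis]) measurable
    also have "\<dots> = ?v * ?H"
    proof (intro arg_cong2[where f = times and a = ?v] nn_integral_cong refl)
      fix s y :: real
      have 1: "w \<bullet> hgrad A (s *\<^sub>R w + y *\<^sub>R k) = 2 * (\<alpha> * s - 2 * y)" unfolding L co by (simp add: ww)
      have 2: "hgt A (hgrad A 0) (s *\<^sub>R w + y *\<^sub>R k) = s * (\<alpha> * s - 2 * y)"
        using hg[of "s *\<^sub>R w + y *\<^sub>R k"] unfolding co by (simp add: hgrad_def)
      have "norm (s *\<^sub>R w + y *\<^sub>R k) ^ 4 = ((norm (s *\<^sub>R w + y *\<^sub>R k))\<^sup>2)\<^sup>2" by (simp flip: power_mult)
      also have "\<dots> = (s\<^sup>2 + y\<^sup>2)\<^sup>2" unfolding nz co ..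
      finally have 3: "s *\<^sub>R w + y *\<^sub>R k \<in> B 1 0 \<longleftrightarrow> (s\<^sup>2 + y\<^sup>2)\<^sup>2 + (s * (\<alpha> * s - 2 * y))\<^sup>2 \<le> 1"
        using 2 by (simp add: hball_def gdist_le_iff[OF A])
      show "indicator (B 1 0 \<inter> {x. 0 < w \<bullet> hgrad A x}) (s *\<^sub>R w + y *\<^sub>R k) * ennreal (w \<bullet> hgrad A (s *\<^sub>R w + y *\<^sub>R k))
      = indicator {(s, y). 0 < \<alpha> * s - 2 * y \<and> (s\<^sup>2 + y\<^sup>2)\<^sup>2 + (s * (\<alpha> * s - 2 * y))\<^sup>2 \<le> 1} (s, y) * ennreal (2 * (\<alpha> * s - 2 * y))"
        unfolding 1 using 3 by (simp add: indicator_def 1 conj_commute)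
    qed
    finally show ?thesis .
  qed
  have i2: "?v * ?H + ?v * ennreal (1/8) \<le> c"
    unfolding c distrib_left[symmetric] by (intro mult_left_mono half_plane_area) simp
  have "c * 1 + ?v * ennreal (1/8) \<le> c" by (rule order_trans[OF add_right_mono[OF i1] i2])
  then have "c + ?v * ennreal (1/8) \<le> c + 0" by (simp only: mult_1_right add_0_right)
  then have "?v * ennreal (1/8) \<le> 0" using c_finite ennreal_add_left_cancel_le[of c] by auto
  then have "?v = 0" by (auto simp: ennreal_eq_0_iff)
  then show False using c c_finite by auto
qed

text \<open>In rank one the regular set has two components, the sides of a line. Neither side can be
  disjoint from \<open>E\<close>, and each side that meets \<open>E\<close> is contained in it.\<close>
lemma regular_subset:
  assumes x: "x \<in> E" "hgrad A x \<noteq> 0" and y: "hgrad A y \<noteq> 0"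
  shows "y \<in> E"
proof (cases "\<exists>w. \<forall>z. \<exists>s. hgrad A z = s *\<^sub>R w")
  case False
  then have "\<And>w. \<exists>z. \<forall>s. hgrad A z \<noteq> s *\<^sub>R w" by blast
  then show ?thesis using regular_subset_E x y by blast
next
  case True
  then obtain w0 where w0: "\<And>z. \<exists>s. hgrad A z = s *\<^sub>R w0" by blast
  have "w0 \<noteq> 0" using w0[of x] x(2) by auto
  define w where "w = w0 /\<^sub>R norm w0"
  have w: "norm w = 1" using \<open>w0 \<noteq> 0\<close> by (simp add: w_def)
  have r1: "\<exists>s. hgrad A z = s *\<^sub>R w" for z
  proof -
    obtain s where "hgrad A z = s *\<^sub>R w0" using w0 by blast
    then have "hgrad A z = (s * norm w0) *\<^sub>R w" using \<open>w0 \<noteq> 0\<close> by (simp add: w_def)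
    then show ?thesis by blast
  qed
  have ww: "w \<bullet> w = 1" using w by (simp add: dot_square_norm)
  have nz: "w \<bullet> hgrad A z \<noteq> 0" if "hgrad A z \<noteq> 0" for z using r1[of z] that by (auto simp: ww)
  have pos: "\<exists>x\<in>E. w \<bullet> hgrad A x > 0"
  proof (rule ccontr)
    assume "\<not> (\<exists>x\<in>E. w \<bullet> hgrad A x > 0)"
    then have h: "0 \<le> (- w) \<bullet> hgrad A x" if "x \<in> E" for x using that by force
    have "\<exists>s. hgrad A z = s *\<^sub>R (- w)" for z using r1[of z] by (metis minus_minus scaleR_minus_left scaleR_minus_right)
    then show False using half_plane_impossible[of "- w"] w h by auto
  qed
  have neg: "\<exists>x\<in>E. w \<bullet> hgrad A x < 0"
  proof (rule ccontr)
    assume "\<not> (\<exists>x\<in>E. w \<bullet> hgrad A x < 0)"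
    then have h: "0 \<le> w \<bullet> hgrad A x" if "x \<in> E" for x using that by force
    then show False using half_plane_impossible[OF w r1] by auto
  qed
  have same: "y \<in> E" if x': "x' \<in> E" and sgn: "(w \<bullet> hgrad A x') * (w \<bullet> hgrad A y) > 0" for x'
  proof (rule segment_in_E[OF x'])
    fix t :: real assume t: "0 \<le> t" "t \<le> 1"
    let ?a = "w \<bullet> hgrad A x'" and ?b = "w \<bullet> hgrad A y"
    have "w \<bullet> hgrad A (x' + t *\<^sub>R (y - x')) = (1 - t) * ?a + t * ?b"
      unfolding hgrad_diff by (simp add: inner_add_right)
    moreover have "(1 - t) * ?a + t * ?b \<noteq> 0"
    proof (cases "?a > 0")
      case True
      then have "?b > 0" using sgn by (simp add: zero_less_mult_iff)
      then show ?thesis using True t by (smt (verit) mult_nonneg_nonneg mult_pos_pos)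
    next
      case False
      then have "?a < 0" "?b < 0" using sgn by (auto simp: zero_less_mult_iff)
      then show ?thesis using t by (smt (verit) mult_nonneg_nonpos mult_pos_neg)
    qed
    ultimately show "hgrad A (x' + t *\<^sub>R (y - x')) \<noteq> 0" by force
  qed
  show ?thesis
  proof (cases "w \<bullet> hgrad A y > 0")
    case True
    then show ?thesis using pos same by (meson mult_pos_pos)
  next
    case False
    then have "w \<bullet> hgrad A y < 0" using nz[OF y] by simp
    then show ?thesis using neg same by (meson mult_neg_neg)
  qed
qed

theorem area_le_M_full:
  assumes x: "x \<in> E" "hgrad A x \<noteq> 0" and C: "compact C"
  shows "emeasure lam C \<le> c * emeasure M C"
proof -
  have [measurable]: "C \<in> sets borel" using C by (simp add: borel_compact)
  have [measurable]: "{x. hgrad A x = 0} \<in> sets borel" by measurable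
  have "emeasure lam C \<le> emeasure lam ((E \<inter> C) \<union> {x. hgrad A x = 0})"
    using regular_subset[OF x] by (intro emeasure_mono) auto
  also have "\<dots> \<le> emeasure lam (E \<inter> C) + emeasure lam {x. hgrad A x = 0}"
    by (rule emeasure_subadditive) auto
  also have "emeasure lam {x. hgrad A x = 0} = 0" by (rule harea_singular_null) auto
  finally show ?thesis using area_le_M[OF C] by simp
qed

end

section \<open>Uniform cones\<close>

text \<open>The function \<open>(max 0 x) ^ 3\<close> has a Lipschitz second derivative, so its second-order
  expansion has a cubic error even across the kink of \<open>max 0\<close>.\<close>
lemma pos_part_cube_taylor:
  fixes a d :: real
  shows "\<bar>(max 0 (a + d)) ^ 3 - (max 0 a) ^ 3 - 3 * (max 0 a)\<^sup>2 * d - 3 * max 0 a * d\<^sup>2\<bar> \<le> \<bar>d\<bar> ^ 3"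
proof (cases "a \<ge> 0"; cases "a + d \<ge> 0")
  assume "a \<ge> 0" "a + d \<ge> 0"
  then have "(max 0 (a + d)) ^ 3 - (max 0 a) ^ 3 - 3 * (max 0 a)\<^sup>2 * d - 3 * max 0 a * d\<^sup>2 = d ^ 3"
    by (simp add: max_def power3_eq_cube power2_eq_square algebra_simps)
  then show ?thesis by (simp add: power_abs)
next
  assume a: "a \<ge> 0" "\<not> a + d \<ge> 0"
  have "(max 0 (a + d)) ^ 3 - (max 0 a) ^ 3 - 3 * (max 0 a)\<^sup>2 * d - 3 * max 0 a * d\<^sup>2 = (- (a + d)) ^ 3 - (- d) ^ 3"
    using a by (simp add: max_def power3_eq_cube power2_eq_square algebra_simps)
  moreover have "0 \<le> (- (a + d)) ^ 3" using a by (intro zero_le_power) simp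
  moreover have "(- (a + d)) ^ 3 \<le> (- d) ^ 3" using a by (intro power_mono) auto
  ultimately show ?thesis using a by simp
next
  assume a: "\<not> a \<ge> 0" "a + d \<ge> 0"
  have "(a + d) ^ 3 \<le> d ^ 3" using a by (intro power_mono) auto
  then show ?thesis using a by simp
next
  assume "\<not> a \<ge> 0" "\<not> a + d \<ge> 0"
  then show ?thesis by simp
qed

lemma pos_part_square_taylor:
  fixes a d :: real
  assumes "d \<ge> 0"
  shows "\<bar>(max 0 (a + d))\<^sup>2 - (max 0 a)\<^sup>2 - 2 * max 0 a * d\<bar> \<le> d\<^sup>2"
proof (cases "a \<ge> 0")
  case True
  then show ?thesis using assms by (simp add: max_def power2_eq_square algebra_simps)
next
  case F: False
  show ?thesis
  proof (cases "a + d \<ge> 0")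
    case True
    have "(a + d)\<^sup>2 \<le> d\<^sup>2" using F True by (intro power_mono) auto
    then show ?thesis using F True by simp
  qed (use F in simp)
qed

lemma zero_of_small: "x = 0" if "k > 0" "\<And>l. 0 < l \<Longrightarrow> l \<le> k \<Longrightarrow> \<bar>x\<bar> \<le> C * l" for x :: real
proof (rule ccontr)
  assume "x \<noteq> 0"
  define l where "l = min k (\<bar>x\<bar> / (2 * (\<bar>C\<bar> + 1)))"
  have l: "l > 0" "l \<le> k" "l \<le> \<bar>x\<bar> / (2 * (\<bar>C\<bar> + 1))" using \<open>x \<noteq> 0\<close> that(1) by (auto simp: l_def)
  have "C * l \<le> (\<bar>C\<bar> + 1) * l" using l by (intro mult_right_mono) auto
  also have "\<dots> \<le> (\<bar>C\<bar> + 1) * (\<bar>x\<bar> / (2 * (\<bar>C\<bar> + 1)))" using l by (intro mult_left_mono) auto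
  also have "\<dots> = \<bar>x\<bar> / 2" by (simp add: field_simps)
  finally show False using that(2)[OF l(1,2)] \<open>x \<noteq> 0\<close> by simp
qed

lemma sets_radon: "radon_measure \<mu> \<Longrightarrow> sets \<mu> = sets borel"
  by (simp add: radon_measure_def)

lemma closed_msupport: "closed (msupport \<mu>)"
proof -
  have "- msupport \<mu> = \<Union> {U. open U \<and> emeasure \<mu> U = 0}" by (auto simp: msupport_def not_gr_zero)
  then have "open (- msupport \<mu>)" by auto
  then show ?thesis by (simp add: closed_def)
qed

lemma null_outside_msupport:
  fixes \<mu> :: "'a::euclidean_space measure"
  assumes s: "sets \<mu> = sets borel"
  shows "emeasure \<mu> (- msupport \<mu>) = 0"
proof -
  let ?F = "{U. open U \<and> emeasure \<mu> U = 0}"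
  obtain F' where F': "F' \<subseteq> ?F" "countable F'" "\<Union> F' = \<Union> ?F"
    using Lindelof[of ?F] by blast
  have "- msupport \<mu> = \<Union> F'" unfolding F'(3) by (auto simp: msupport_def not_gr_zero)
  moreover have "(\<Union>U\<in>F'. U) \<in> null_sets \<mu>"
    using F' by (intro null_sets_UN') (auto simp: null_sets_def s)
  ultimately show ?thesis by (simp add: null_sets_def)
qed

locale uniform_cone =
  fixes \<mu> :: "('n::finite) heis measure"
  assumes cone: "uniform_cone_H (2 * CARD('n) + 1) \<mu>"
begin

lemma sets_mu [measurable_cong, simp]: "sets \<mu> = sets borel"
  using cone by (simp add: uniform_cone_H_def uniform_measure_H_def sets_radon)

lemma space_mu [simp]: "space \<mu> = UNIV"
  using sets_eq_imp_space_eq[OF sets_mu] by simp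

lemma zero_supp: "0 \<in> msupport \<mu>"
  using cone by (simp add: uniform_cone_H_def uniform_measure_H_def)

lemma mu_ball: "u \<in> msupport \<mu> \<Longrightarrow> r > 0 \<Longrightarrow> emeasure \<mu> (koranyi_ball r u) = ennreal (r ^ (2 * CARD('n) + 1))"
  using cone by (simp add: uniform_cone_H_def uniform_measure_H_def)

lemma AE_supp: "AE z in \<mu>. z \<in> msupport \<mu>"
proof (rule AE_I)
  show "emeasure \<mu> (- msupport \<mu>) = 0" by (rule null_outside_msupport) simp
  show "- msupport \<mu> \<in> sets \<mu>"
    unfolding sets_mu by (rule borel_open) (rule open_Compl[OF closed_msupport])
qed auto

lemma continuous_heis_dil: "continuous_on UNIV (heis_dil l)"
  unfolding heis_dil_def by (intro continuous_intros)

lemma heis_dil_inverse: "l > 0 \<Longrightarrow> heis_dil l (heis_dil (inverse l) z) = z"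
  by (cases z) (simp add: heis_dil_def power_inverse)

lemma heis_dil_image: assumes "l > 0" shows "heis_dil l ` (heis_dil l -` S) = S"
proof -
  have "surj (heis_dil l)" unfolding surj_def using heis_dil_inverse[OF assms] by metis
  then show ?thesis by (rule surj_image_vimage_eq)
qed

lemma heis_dil_measurable [measurable]: "heis_dil l \<in> borel_measurable borel"
  by (intro borel_measurable_continuous_onI continuous_heis_dil)

lemma mu_scale:
  assumes l: "l > 0" and S: "S \<in> sets borel"
  shows "emeasure \<mu> S = ennreal (l ^ (2 * CARD('n) + 1)) * emeasure \<mu> (heis_dil l -` S)"
proof -
  have "heis_dil l -` S \<in> sets borel" using measurable_sets[OF heis_dil_measurable S, of l] by simp
  then have "ennreal (inverse (l ^ (2 * CARD('n) + 1))) * emeasure \<mu> S = emeasure \<mu> (heis_dil l -` S)"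
    using cone l unfolding uniform_cone_H_def by (metis heis_dil_image)
  then have "ennreal (l ^ (2 * CARD('n) + 1)) * emeasure \<mu> (heis_dil l -` S)
     = (ennreal (l ^ (2 * CARD('n) + 1)) * ennreal (inverse (l ^ (2 * CARD('n) + 1)))) * emeasure \<mu> S"
    by (simp add: mult.assoc)
  also have "ennreal (l ^ (2 * CARD('n) + 1)) * ennreal (inverse (l ^ (2 * CARD('n) + 1))) = 1"
    using l by (subst ennreal_mult'[symmetric]) (auto simp del: power_Suc)
  finally show ?thesis by simp
qed

lemma nn_integral_scale:
  assumes l: "l > 0" and [measurable]: "g \<in> borel_measurable borel"
  shows "(\<integral>\<^sup>+z. g z \<partial>\<mu>) = ennreal (l ^ (2 * CARD('n) + 1)) * (\<integral>\<^sup>+z. g (heis_dil l z) \<partial>\<mu>)"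
proof -
  have "\<mu> = scale_measure (ennreal (l ^ (2 * CARD('n) + 1))) (distr \<mu> borel (heis_dil l))"
  proof (rule measure_eqI)
    fix S assume "S \<in> sets \<mu>"
    then have S: "S \<in> sets borel" by simp
    show "emeasure \<mu> S = emeasure (scale_measure (ennreal (l ^ (2 * CARD('n) + 1))) (distr \<mu> borel (heis_dil l))) S"
      using mu_scale[OF l S] S by (simp add: emeasure_distr del: power_Suc)
  qed simp
  then have "(\<integral>\<^sup>+z. g z \<partial>\<mu>) = (\<integral>\<^sup>+z. g z \<partial>(scale_measure (ennreal (l ^ (2 * CARD('n) + 1))) (distr \<mu> borel (heis_dil l))))"
    by simp
  then show ?thesis by (simp add: nn_integral_scale_measure nn_integral_distr del: power_Suc)
qed

lemma dil_supp:
  assumes u: "u \<in> msupport \<mu>" and l: "l > 0"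
  shows "heis_dil l u \<in> msupport \<mu>"
proof -
  have "emeasure \<mu> U > 0" if U: "open U" "heis_dil l u \<in> U" for U
  proof -
    have "open (heis_dil l -` U)"
      by (rule open_vimage[OF U(1) continuous_heis_dil])
    then have "emeasure \<mu> (heis_dil l -` U) > 0" using u U(2) by (auto simp: msupport_def)
    then show ?thesis using mu_scale[OF l, of U] U(1) l by (simp add: ennreal_zero_less_mult_iff del: power_Suc)
  qed
  then show ?thesis by (auto simp: msupport_def)
qed

lemma koranyi_dist_continuous: "continuous_on UNIV (\<lambda>z. koranyi_dist u z)"
  unfolding koranyi_dist_eq koranyi_norm_def by (intro continuous_intros)

lemma closed_koranyi_ball: "closed (koranyi_ball r u)"
  unfolding koranyi_ball_def by (intro closed_Collect_le koranyi_dist_continuous continuous_intros)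

lemma koranyi_ball_borel [measurable]: "koranyi_ball r u \<in> sets borel"
  by (rule borel_closed) (rule closed_koranyi_ball)

lemma mu_finite_ball: "emeasure \<mu> (koranyi_ball r 0) < \<infinity>"
proof -
  have "emeasure \<mu> (koranyi_ball r 0) \<le> emeasure \<mu> (koranyi_ball (max r 1) 0)"
    by (rule emeasure_mono) (auto simp: koranyi_ball_def[abs_def] intro: koranyi_ball_borel[unfolded koranyi_ball_def])
  also have "\<dots> < \<infinity>" using mu_ball[OF zero_supp, of "max r 1"] by (simp del: power_Suc)
  finally show ?thesis .
qed

lemma koranyi_dist_0: "koranyi_dist 0 z = koranyi_norm z"
  by (cases z) (simp add: koranyi_dist_eq zero_prod_def)

lemma sigma_finite_mu: "sigma_finite_measure \<mu>"
proof
  show "\<exists>F. countable F \<and> F \<subseteq> sets \<mu> \<and> \<Union> F = space \<mu> \<and> (\<forall>a\<in>F. emeasure \<mu> a \<noteq> \<infinity>)"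
  proof (intro exI[of _ "range (\<lambda>k::nat. koranyi_ball (real k) 0)"] conjI ballI)
    show "\<Union> (range (\<lambda>k::nat. koranyi_ball (real k) 0)) = space \<mu>"
      by (auto simp: koranyi_ball_def real_arch_simple)
    show "range (\<lambda>k::nat. koranyi_ball (real k) 0) \<subseteq> sets \<mu>" unfolding sets_mu using koranyi_ball_borel by blast
    fix a :: "'n heis set" assume "a \<in> range (\<lambda>k::nat. koranyi_ball (real k) 0)"
    then obtain k :: nat where "a = koranyi_ball (real k) 0" by blast
    then show "emeasure \<mu> a \<noteq> \<infinity>" using less_imp_neq[OF mu_finite_ball[of "real k"]] by simp
  qed auto
qed

text \<open>Only masses of balls about \<open>u\<close> enter, so the integral has the same value at all
  points of the support.\<close>
lemma layer_cake:
  assumes u: "u \<in> msupport \<mu>"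
  shows "(\<integral>\<^sup>+z. ennreal ((max 0 (1 - koranyi_dist u z ^ 4)) ^ 3) \<partial>\<mu>)
    = (\<integral>\<^sup>+r. indicator {0..1} r * (ennreal (3 * (1 - r)\<^sup>2) * ennreal (root 4 r ^ (2 * CARD('n) + 1))) \<partial>lborel)"
proof -
  interpret mu: sigma_finite_measure \<mu> by (rule sigma_finite_mu)
  interpret P: pair_sigma_finite lborel \<mu> ..
  have [measurable]: "(\<lambda>z. koranyi_dist u z) \<in> borel_measurable borel"
    by (intro borel_measurable_continuous_onI koranyi_dist_continuous)
  have pt: "ennreal ((max 0 (1 - d)) ^ 3) = (\<integral>\<^sup>+r. ennreal (3 * (1 - r)\<^sup>2) * indicator {d..1} r \<partial>lborel)" if "d \<ge> 0" for d :: real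
  proof (cases "d \<le> 1")
    case True
    have "(\<integral>\<^sup>+r. ennreal (3 * (1 - r)\<^sup>2) * indicator {d..1} r \<partial>lborel) = ennreal (- ((1 - 1) ^ 3) - (- ((1 - d) ^ 3)))"
    proof (rule nn_integral_FTC_Icc)
      fix x :: real
      show "DERIV (\<lambda>r. - ((1 - r) ^ 3)) x :> 3 * (1 - x)\<^sup>2" by (auto intro!: derivative_eq_intros)
    qed (use True in auto)
    then show ?thesis using True by simp
  next
    case False
    then have "(\<integral>\<^sup>+r. ennreal (3 * (1 - r)\<^sup>2) * indicator {d..1} r \<partial>lborel) = (\<integral>\<^sup>+r. 0 \<partial>(lborel::real measure))"
      by (intro nn_integral_cong) auto
    then show ?thesis using False by simp
  qed
  have "(\<integral>\<^sup>+z. ennreal ((max 0 (1 - koranyi_dist u z ^ 4)) ^ 3) \<partial>\<mu>)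
    = (\<integral>\<^sup>+z. (\<integral>\<^sup>+r. indicator {0..1} r * (ennreal (3 * (1 - r)\<^sup>2) * indicator {z. koranyi_dist u z ^ 4 \<le> r} z) \<partial>lborel) \<partial>\<mu>)"
  proof (rule nn_integral_cong)
    fix z
    have d: "koranyi_dist u z ^ 4 \<ge> 0" by simp
    show "ennreal ((max 0 (1 - koranyi_dist u z ^ 4)) ^ 3) = (\<integral>\<^sup>+r. indicator {0..1} r * (ennreal (3 * (1 - r)\<^sup>2) * indicator {z. koranyi_dist u z ^ 4 \<le> r} z) \<partial>lborel)"
      unfolding pt[OF d] by (intro nn_integral_cong) (auto simp: indicator_def dest: order_trans[OF d])
  qed
  also have "\<dots> = (\<integral>\<^sup>+r. (\<integral>\<^sup>+z. indicator {0..1} r * (ennreal (3 * (1 - r)\<^sup>2) * indicator {z. koranyi_dist u z ^ 4 \<le> r} z) \<partial>\<mu>) \<partial>lborel)"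
    by (rule P.Fubini') measurable
  also have "\<dots> = (\<integral>\<^sup>+r. indicator {0..1} r * (ennreal (3 * (1 - r)\<^sup>2) * ennreal (root 4 r ^ (2 * CARD('n) + 1))) \<partial>lborel)"
  proof (rule nn_integral_cong_AE)
    have "AE r in lborel. r \<noteq> (0::real)" by (rule AE_lborel_singleton)
    then show "AE r in lborel. (\<integral>\<^sup>+z. indicator {0..1} r * (ennreal (3 * (1 - r)\<^sup>2) * indicator {z. koranyi_dist u z ^ 4 \<le> r} z) \<partial>\<mu>)
       = indicator {0..1} r * (ennreal (3 * (1 - r)\<^sup>2) * ennreal (root 4 r ^ (2 * CARD('n) + 1)))"
    proof eventually_elim
      fix r :: real assume r: "r \<noteq> 0"
      show "(\<integral>\<^sup>+z. indicator {0..1} r * (ennreal (3 * (1 - r)\<^sup>2) * indicator {z. koranyi_dist u z ^ 4 \<le> r} z) \<partial>\<mu>)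
       = indicator {0..1} r * (ennreal (3 * (1 - r)\<^sup>2) * ennreal (root 4 r ^ (2 * CARD('n) + 1)))"
      proof (cases "r > 0")
        case True
        have nn: "koranyi_dist u z \<ge> 0" for z by (simp add: koranyi_dist_def koranyi_norm_nonneg)
        have "koranyi_dist u z ^ 4 \<le> r \<longleftrightarrow> koranyi_dist u z \<le> root 4 r" for z
        proof -
          have "r = root 4 r ^ 4" using True by simp
          then have "koranyi_dist u z ^ 4 \<le> r \<longleftrightarrow> koranyi_dist u z ^ 4 \<le> root 4 r ^ 4" by simp
          also have "\<dots> \<longleftrightarrow> koranyi_dist u z \<le> root 4 r" using nn True by (intro power_mono_iff) auto
          finally show ?thesis .
        qed
        then have eq: "{z. koranyi_dist u z ^ 4 \<le> r} = koranyi_ball (root 4 r) u" by (auto simp: koranyi_ball_def)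
        show ?thesis unfolding eq
          by (subst nn_integral_cmult, measurable, subst nn_integral_cmult, measurable)
             (use mu_ball[OF u, of "root 4 r"] True in \<open>simp del: power_Suc\<close>)
      qed (use r in simp)
    qed
  qed
  finally show ?thesis .
qed

end

section \<open>Second-order moment identity\<close>

definition bump :: "('n::finite) heis \<Rightarrow> real" where
  "bump z = max 0 (1 - koranyi_norm z ^ 4)"

text \<open>The coefficients of the powers of \<open>l\<close> in \<open>koranyi_dist (heis_dil l u) z ^
  4\<close>, up to sign.\<close>
definition coef1 :: "('n::finite) heis \<Rightarrow> 'n heis \<Rightarrow> real" where
  "coef1 u z = 4 * (norm (fst z))\<^sup>2 * (fst u \<bullet> fst z) + 4 * snd z * (fst u \<bullet> (sympl_J *v fst z))"

definition coef2 :: "('n::finite) heis \<Rightarrow> 'n heis \<Rightarrow> real" where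
  "coef2 u z = - 4 * (fst u \<bullet> fst z)\<^sup>2 - 2 * (norm (fst z))\<^sup>2 * (norm (fst u))\<^sup>2
     - 4 * (fst u \<bullet> (sympl_J *v fst z))\<^sup>2 + 2 * snd z * snd u"

definition coef3 :: "('n::finite) heis \<Rightarrow> 'n heis \<Rightarrow> real" where
  "coef3 u z = 4 * (fst u \<bullet> fst z) * (norm (fst u))\<^sup>2 - 4 * snd u * (fst u \<bullet> (sympl_J *v fst z))"

lemma koranyi_dist_dil_expand:
  "koranyi_dist (heis_dil l u) z ^ 4 = koranyi_norm z ^ 4 - (l * coef1 u z + l\<^sup>2 * coef2 u z + l ^ 3 * coef3 u z - l ^ 4 * koranyi_norm u ^ 4)"
proof -
  obtain x t where u: "u = (x, t)" by (cases u)
  obtain y \<tau> where z: "z = (y, \<tau>)" by (cases z)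
  define p j a b where "p = x \<bullet> y" and "j = x \<bullet> (sympl_J *v y)" and "a = (norm x)\<^sup>2" and "b = (norm y)\<^sup>2"
  have 1: "(norm (y - l *\<^sub>R x))\<^sup>2 = b - 2 * l * p + l\<^sup>2 * a"
    unfolding b_def a_def p_def power2_norm_eq_inner
    by (simp add: inner_diff_left inner_diff_right inner_commute power2_eq_square algebra_simps)
  have n4: "norm v ^ 4 = ((norm v)\<^sup>2)\<^sup>2" for v :: "real ^ ('a + 'a)" by (simp flip: power_mult)
  have e1: "koranyi_dist (heis_dil l u) z ^ 4 = (b - 2 * l * p + l\<^sup>2 * a)\<^sup>2 + (\<tau> - l\<^sup>2 * t - 2 * (l * j))\<^sup>2"
    unfolding koranyi_dist_eq koranyi_norm_pow4 u z heis_dil_def n4 by (simp add: 1 j_def)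
  have e2: "koranyi_norm z ^ 4 = b\<^sup>2 + \<tau>\<^sup>2" "koranyi_norm u ^ 4 = a\<^sup>2 + t\<^sup>2"
    unfolding koranyi_norm_pow4 n4 by (simp_all add: u z a_def b_def)
  have e3: "coef1 u z = 4 * b * p + 4 * \<tau> * j" "coef2 u z = - 4 * p\<^sup>2 - 2 * b * a - 4 * j\<^sup>2 + 2 * \<tau> * t"
    "coef3 u z = 4 * p * a - 4 * t * j"
    by (simp_all add: coef1_def coef2_def coef3_def u z p_def j_def a_def b_def)
  show ?thesis unfolding e1 e2 e3 by (simp add: power2_eq_square power3_eq_cube power4_eq_xxxx algebra_simps)
qed

lemma continuous_koranyi_norm: "continuous_on UNIV koranyi_norm"
  unfolding koranyi_norm_def[abs_def] by (intro continuous_intros)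

lemma continuous_bump [continuous_intros]: "continuous_on UNIV bump"
  unfolding bump_def[abs_def] by (intro continuous_intros continuous_koranyi_norm)

lemma continuous_coef: "continuous_on UNIV (coef1 u)" "continuous_on UNIV (coef2 u)" "continuous_on UNIV (coef3 u)"
  unfolding coef1_def[abs_def] coef2_def[abs_def] coef3_def[abs_def] by (intro continuous_intros)+

lemma bump_bounds: "0 \<le> bump z" "bump z \<le> 1"
  by (auto simp: bump_def koranyi_norm_nonneg)

lemma bump_zero: "koranyi_norm z \<ge> 1 \<Longrightarrow> bump z = 0"
  using one_le_power[of "koranyi_norm z" 4] by (simp add: bump_def)

lemma bounded_koranyi_ball: "bounded (koranyi_ball r (0::'n::finite heis))"
proof -
  have "norm z \<le> r + r\<^sup>2" if "z \<in> koranyi_ball r 0" for z :: "'n heis"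
  proof -
    have z: "koranyi_norm z \<le> r" using that by (simp add: koranyi_ball_def uniform_cone.koranyi_dist_0 koranyi_dist_eq zero_prod_def)
    then have "\<bar>snd z\<bar> \<le> r\<^sup>2" using snd_le_koranyi[of z] koranyi_norm_nonneg[of z] power_mono[OF z, of 2] by linarith
    then show ?thesis using norm_fst_le_koranyi[of z] z norm_Pair_le[of "fst z" "snd z"] by simp
  qed
  then show ?thesis unfolding bounded_iff by blast
qed

context uniform_cone begin

lemma compact_koranyi_ball: "compact (koranyi_ball r (0::'n heis))"
  unfolding compact_eq_bounded_closed by (intro conjI closed_koranyi_ball bounded_koranyi_ball)

lemma mem_koranyi_ball_0: "z \<in> koranyi_ball r 0 \<longleftrightarrow> koranyi_norm z \<le> r"
  by (simp add: koranyi_ball_def koranyi_dist_0)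

lemma measurable_mu: "continuous_on UNIV g \<Longrightarrow> g \<in> borel_measurable \<mu>"
  unfolding measurable_cong_sets[OF sets_mu refl] by (rule borel_measurable_continuous_onI)

lemma integrable_compact:
  fixes g :: "'n heis \<Rightarrow> 'b::{banach, second_countable_topology}"
  assumes g: "continuous_on UNIV g" and z: "\<And>z. koranyi_norm z > r \<Longrightarrow> g z = 0"
  shows "integrable \<mu> g"
proof -
  have "compact (g ` koranyi_ball r 0)"
    by (rule compact_continuous_image[OF continuous_on_subset[OF g] compact_koranyi_ball]) simp
  then obtain C where C: "\<And>z. z \<in> koranyi_ball r 0 \<Longrightarrow> norm (g z) \<le> C"
    by (meson bounded_iff compact_imp_bounded imageI)
  have m: "g \<in> borel_measurable \<mu>"
    by (rule measurable_mu[OF g])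
  show ?thesis
  proof (rule integrableI_bounded_set[where A = "koranyi_ball r 0" and B = C])
    show "koranyi_ball r 0 \<in> sets \<mu>" by simp
    show "emeasure \<mu> (koranyi_ball r 0) < \<infinity>" by (rule mu_finite_ball)
    show "AE x in \<mu>. x \<in> koranyi_ball r 0 \<longrightarrow> norm (g x) \<le> C" using C by simp
    show "AE x in \<mu>. x \<notin> koranyi_ball r 0 \<longrightarrow> g x = 0" using z by (simp add: mem_koranyi_ball_0)
  qed (rule m)
qed

lemma koranyi_norm_le_add: "koranyi_norm z \<le> koranyi_norm u + koranyi_dist u z"
  using koranyi_dist_triangle[of 0 z u] by (simp add: koranyi_dist_0)

lemma koranyi_norm_dil: "l \<ge> 0 \<Longrightarrow> koranyi_norm (heis_dil l u) = l * koranyi_norm u"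
proof -
  assume l: "l \<ge> 0"
  have "koranyi_norm (heis_dil l u) ^ 4 = (l * koranyi_norm u) ^ 4"
    using l by (simp add: koranyi_norm_pow4 heis_dil_def power_mult_distrib algebra_simps flip: power_mult)
  then show ?thesis using l koranyi_norm_nonneg by (metis mult_nonneg_nonneg power_eq_imp_eq_base zero_less_numeral)
qed

lemma integral_translate:
  assumes u: "u \<in> msupport \<mu>"
  shows "(LINT z|\<mu>. (max 0 (1 - koranyi_dist u z ^ 4)) ^ 3) = (LINT z|\<mu>. bump z ^ 3)"
proof -
  have c: "continuous_on UNIV (\<lambda>z. (max 0 (1 - koranyi_dist u z ^ 4)) ^ 3)"
    by (intro continuous_intros koranyi_dist_continuous)
  have m: "(\<lambda>z. (max 0 (1 - koranyi_dist u z ^ 4)) ^ 3) \<in> borel_measurable \<mu>"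
    by (rule measurable_mu[OF c])
  have c0: "continuous_on UNIV (\<lambda>z. bump z ^ 3)" by (intro continuous_intros)
  have m0: "(\<lambda>z. bump z ^ 3) \<in> borel_measurable \<mu>"
    by (rule measurable_mu[OF c0])
  have "(LINT z|\<mu>. (max 0 (1 - koranyi_dist u z ^ 4)) ^ 3) = enn2real (\<integral>\<^sup>+z. ennreal ((max 0 (1 - koranyi_dist u z ^ 4)) ^ 3) \<partial>\<mu>)"
    by (rule integral_eq_nn_integral[OF m]) simp
  also have "\<dots> = enn2real (\<integral>\<^sup>+z. ennreal ((max 0 (1 - koranyi_dist 0 z ^ 4)) ^ 3) \<partial>\<mu>)"
    unfolding layer_cake[OF u] layer_cake[OF zero_supp] ..
  also have "\<dots> = (LINT z|\<mu>. bump z ^ 3)"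
    unfolding koranyi_dist_0 bump_def[symmetric] by (rule integral_eq_nn_integral[OF m0, symmetric]) (simp add: bump_bounds)
  finally show ?thesis .
qed

lemma taylor_pointwise:
  assumes C: "1 \<le> C" "\<bar>c1\<bar> \<le> C" "\<bar>c2\<bar> \<le> C" "\<bar>c3\<bar> \<le> C" "\<bar>c4\<bar> \<le> C" and l: "0 < l" "l \<le> (1::real)" and a: "a \<le> 1"
  shows "\<bar>(max 0 (a + (l * c1 + l\<^sup>2 * c2 + l ^ 3 * c3 - l ^ 4 * c4))) ^ 3 - (max 0 a) ^ 3 - l * (3 * (max 0 a)\<^sup>2 * c1) - l\<^sup>2 * (3 * (max 0 a)\<^sup>2 * c2 + 3 * max 0 a * c1\<^sup>2)\<bar>
     \<le> (64 * C ^ 3 + 6 * C + 45 * C\<^sup>2) * l ^ 3"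
proof -
  define d where "d = l * c1 + l\<^sup>2 * c2 + l ^ 3 * c3 - l ^ 4 * c4"
  define e where "e = l\<^sup>2 * c2 + l ^ 3 * c3 - l ^ 4 * c4"
  define g where "g = l ^ 3 * c3 - l ^ 4 * c4"
  define X where "X = max 0 a"
  have X: "0 \<le> X" "X \<le> 1" using a by (auto simp: X_def)
  have pw: "l\<^sup>2 \<le> l" "l ^ 3 \<le> l\<^sup>2" "l ^ 4 \<le> l ^ 3" "0 \<le> l\<^sup>2" "0 \<le> l ^ 3" "0 \<le> l ^ 4"
    using l power_decreasing[of 1 2 l] power_decreasing[of 2 3 l] power_decreasing[of 3 4 l] by auto
  have b: "\<bar>l * c1\<bar> \<le> l * C" "\<bar>l\<^sup>2 * c2\<bar> \<le> l\<^sup>2 * C" "\<bar>l ^ 3 * c3\<bar> \<le> l ^ 3 * C" "\<bar>l ^ 4 * c4\<bar> \<le> l ^ 4 * C"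
    using C l by (auto simp: abs_mult intro: mult_left_mono)
  have p: "l ^ 4 * C \<le> l ^ 3 * C" "l ^ 3 * C \<le> l\<^sup>2 * C" "l\<^sup>2 * C \<le> l * C" using pw C by (auto intro: mult_right_mono)
  have g: "\<bar>g\<bar> \<le> 2 * C * l ^ 3" unfolding g_def using b p by (simp add: algebra_simps)
  have e: "\<bar>e\<bar> \<le> 3 * C * l\<^sup>2" unfolding e_def using b p by (simp add: algebra_simps)
  have d: "\<bar>d\<bar> \<le> 4 * C * l" unfolding d_def using b p by (simp add: algebra_simps)
  have R: "\<bar>(max 0 (a + d)) ^ 3 - X ^ 3 - 3 * X\<^sup>2 * d - 3 * X * d\<^sup>2\<bar> \<le> 64 * C ^ 3 * l ^ 3"
  proof -
    have "\<bar>d\<bar> ^ 3 \<le> (4 * C * l) ^ 3" using d by (intro power_mono) auto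
    also have "\<dots> = 64 * C ^ 3 * l ^ 3" by (simp add: power_mult_distrib)
    finally show ?thesis using pos_part_cube_taylor[of a d] by (simp add: X_def)
  qed
  have G: "\<bar>3 * X\<^sup>2 * g\<bar> \<le> 6 * C * l ^ 3"
  proof -
    have "X\<^sup>2 \<le> 1" using X by (simp add: power_le_one)
    then have "\<bar>3 * X\<^sup>2 * g\<bar> \<le> 3 * 1 * (2 * C * l ^ 3)" unfolding abs_mult using g by (intro mult_mono) auto
    then show ?thesis by simp
  qed
  have D: "\<bar>3 * X * (d\<^sup>2 - (l * c1)\<^sup>2)\<bar> \<le> 45 * C\<^sup>2 * l ^ 3"
  proof -
    have "d = l * c1 + e" by (simp add: d_def e_def)
    then have "d\<^sup>2 - (l * c1)\<^sup>2 = e * (2 * (l * c1) + e)" by (simp add: power2_eq_square algebra_simps)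
    moreover have "\<bar>2 * (l * c1) + e\<bar> \<le> 5 * C * l"
    proof -
      have "3 * C * l\<^sup>2 \<le> 3 * C * l" using pw(1) C by (intro mult_left_mono) auto
      then show ?thesis using b(1) e by (simp add: algebra_simps)
    qed
    ultimately have "\<bar>d\<^sup>2 - (l * c1)\<^sup>2\<bar> \<le> (3 * C * l\<^sup>2) * (5 * C * l)"
      using e C(1) unfolding abs_mult by (simp only: abs_mult) (intro mult_mono, auto)
    also have "\<dots> = 15 * C\<^sup>2 * l ^ 3" by (simp add: power2_eq_square power3_eq_cube)
    finally have "\<bar>3 * X * (d\<^sup>2 - (l * c1)\<^sup>2)\<bar> \<le> (3 * 1) * (15 * C\<^sup>2 * l ^ 3)" unfolding abs_mult using X by (intro mult_mono) auto
    then show ?thesis by simp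
  qed
  have "(max 0 (a + d)) ^ 3 - X ^ 3 - l * (3 * X\<^sup>2 * c1) - l\<^sup>2 * (3 * X\<^sup>2 * c2 + 3 * X * c1\<^sup>2)
     = ((max 0 (a + d)) ^ 3 - X ^ 3 - 3 * X\<^sup>2 * d - 3 * X * d\<^sup>2) + 3 * X\<^sup>2 * g + 3 * X * (d\<^sup>2 - (l * c1)\<^sup>2)"
    unfolding d_def g_def by (simp add: power_mult_distrib algebra_simps)
  then show ?thesis using R G D unfolding X_def[symmetric] d_def[symmetric] by (simp add: algebra_simps)
qed

text \<open>The integral of \<open>(max 0 (1 - d\<^sup>4)) ^ 3\<close>, with \<open>d\<close> the distance
  to \<open>heis_dil l u\<close>, does not depend on \<open>l\<close>, because the dilated points
  stay in the support of a cone. The identity is its coefficient of \<open>l\<^sup>2\<close>. The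
  cube makes the integrand smooth enough for an error of order \<open>l ^ 3\<close>.\<close>
lemma moment_identity:
  assumes u: "u \<in> msupport \<mu>"
  shows "(LINT z|\<mu>. 3 * (bump z)\<^sup>2 * coef2 u z + 3 * bump z * (coef1 u z)\<^sup>2) = 0"
proof -
  have cb: "compact (h ` koranyi_ball 2 (0::'n heis))" if "continuous_on UNIV h" for h :: "'n heis \<Rightarrow> real"
    by (rule compact_continuous_image[OF continuous_on_subset[OF that] compact_koranyi_ball]) simp
  obtain C1 where C1: "\<And>z. z \<in> koranyi_ball 2 0 \<Longrightarrow> norm (coef1 u z) \<le> C1"
    using compact_imp_bounded[OF cb[OF continuous_coef(1)]] unfolding bounded_iff by blast
  obtain C2 where C2: "\<And>z. z \<in> koranyi_ball 2 0 \<Longrightarrow> norm (coef2 u z) \<le> C2"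
    using compact_imp_bounded[OF cb[OF continuous_coef(2)]] unfolding bounded_iff by blast
  obtain C3 where C3: "\<And>z. z \<in> koranyi_ball 2 0 \<Longrightarrow> norm (coef3 u z) \<le> C3"
    using compact_imp_bounded[OF cb[OF continuous_coef(3)]] unfolding bounded_iff by blast
  define U where "U = koranyi_norm u"
  have U: "U \<ge> 0" by (simp add: U_def koranyi_norm_nonneg)
  define C where "C = 1 + \<bar>C1\<bar> + \<bar>C2\<bar> + \<bar>C3\<bar> + U ^ 4"
  have U4: "0 \<le> U ^ 4" by simp
  have C: "1 \<le> C" "\<bar>U ^ 4\<bar> \<le> C" "\<And>z. z \<in> koranyi_ball 2 0 \<Longrightarrow> \<bar>coef1 u z\<bar> \<le> C \<and> \<bar>coef2 u z\<bar> \<le> C \<and> \<bar>coef3 u z\<bar> \<le> C"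
  proof -
    have n: "C1 \<le> \<bar>C1\<bar>" "C2 \<le> \<bar>C2\<bar>" "C3 \<le> \<bar>C3\<bar>" "0 \<le> \<bar>C1\<bar>" "0 \<le> \<bar>C2\<bar>" "0 \<le> \<bar>C3\<bar>" by auto
    show "1 \<le> C" unfolding C_def using n U4 by linarith
    show "\<bar>U ^ 4\<bar> \<le> C" unfolding C_def abs_of_nonneg[OF U4] using n by linarith
    fix z :: "'n heis" assume z: "z \<in> koranyi_ball 2 0"
    note b = C1[OF z, unfolded real_norm_def] C2[OF z, unfolded real_norm_def] C3[OF z, unfolded real_norm_def]
    show "\<bar>coef1 u z\<bar> \<le> C \<and> \<bar>coef2 u z\<bar> \<le> C \<and> \<bar>coef3 u z\<bar> \<le> C"
      using b n U4 unfolding C_def by (intro conjI) linarith+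
  qed
  define K where "K = 64 * C ^ 3 + 6 * C + 45 * C\<^sup>2"
  have K0: "K \<ge> 0" using C(1) by (simp add: K_def)
  let ?g1 = "\<lambda>z. 3 * (bump z)\<^sup>2 * coef1 u z"
  let ?g2 = "\<lambda>z. 3 * (bump z)\<^sup>2 * coef2 u z + 3 * bump z * (coef1 u z)\<^sup>2"
  have i1: "integrable \<mu> ?g1"
    by (rule integrable_compact[where r = 1]) (auto intro!: continuous_intros continuous_coef simp: bump_zero)
  have i2: "integrable \<mu> ?g2"
    by (rule integrable_compact[where r = 1]) (auto intro!: continuous_intros continuous_coef simp: bump_zero)
  have i3: "integrable \<mu> (\<lambda>z. bump z ^ 3)"
    by (rule integrable_compact[where r = 1]) (auto intro!: continuous_intros continuous_coef simp: bump_zero)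
  define a where "a = (LINT z|\<mu>. ?g1 z)"
  define b where "b = (LINT z|\<mu>. ?g2 z)"
  define m where "m = measure \<mu> (koranyi_ball 2 0)"
  \<comment> \<open>For these \<open>l\<close> the unit ball about \<open>heis_dil l u\<close> lies in the ball of radius 2 about the origin.\<close>
  have main: "\<bar>l * a + l\<^sup>2 * b\<bar> \<le> K * m * l ^ 3" if l: "0 < l" "l \<le> 1 / (1 + U)" for l
  proof -
    have l1: "l \<le> 1" using l U by (smt (verit) divide_le_eq_1_pos)
    have lU: "l * U \<le> 1"
    proof -
      have "l * (1 + U) \<le> 1" using l U by (simp add: pos_le_divide_eq)
      then show ?thesis using l by (simp add: algebra_simps)
    qed
    let ?\<psi> = "\<lambda>z. (max 0 (1 - koranyi_dist (heis_dil l u) z ^ 4)) ^ 3"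
    have out: "koranyi_dist (heis_dil l u) z > 1" if "koranyi_norm z > 2" for z
      using koranyi_norm_le_add[of z "heis_dil l u"] that lU l koranyi_norm_dil[of l u] by (simp add: U_def)
    have i0: "integrable \<mu> ?\<psi>"
    proof (rule integrable_compact[where r = 2])
      show "continuous_on UNIV ?\<psi>" by (intro continuous_intros koranyi_dist_continuous)
      show "?\<psi> z = 0" if "koranyi_norm z > 2" for z
        using one_le_power[OF less_imp_le[OF out[OF that]], of 4] by simp
    qed
    have bound: "\<bar>?\<psi> z - bump z ^ 3 - l * ?g1 z - l\<^sup>2 * ?g2 z\<bar> \<le> K * l ^ 3 * indicator (koranyi_ball 2 0) z" for z
    proof (cases "koranyi_norm z \<le> 2")
      case True
      then have zb: "z \<in> koranyi_ball 2 0" by (simp add: mem_koranyi_ball_0)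
      have e: "1 - koranyi_dist (heis_dil l u) z ^ 4 = (1 - koranyi_norm z ^ 4) + (l * coef1 u z + l\<^sup>2 * coef2 u z + l ^ 3 * coef3 u z - l ^ 4 * U ^ 4)"
        unfolding koranyi_dist_dil_expand U_def by simp
      have "1 - koranyi_norm z ^ 4 \<le> 1" by simp
      from taylor_pointwise[OF C(1) _ _ _ C(2) l(1) l1 this, of "coef1 u z" "coef2 u z" "coef3 u z"] C(3)[OF zb]
      show ?thesis unfolding e bump_def K_def using zb by simp
    next
      case False
      then have "bump z = 0" by (simp add: bump_zero)
      moreover have "?\<psi> z = 0" using one_le_power[OF less_imp_le[OF out], of z 4] False by simp
      ultimately show ?thesis using K0 l by simp
    qed
    have "(LINT z|\<mu>. ?\<psi> z - bump z ^ 3 - l * ?g1 z - l\<^sup>2 * ?g2 z) = (LINT z|\<mu>. ?\<psi> z) - (LINT z|\<mu>. bump z ^ 3) - l * a - l\<^sup>2 * b"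
      unfolding a_def b_def using i0 i1 i2 i3 by simp
    also have "\<dots> = - (l * a + l\<^sup>2 * b)" using integral_translate[OF dil_supp[OF u l(1)]] by simp
    finally have "\<bar>l * a + l\<^sup>2 * b\<bar> = \<bar>LINT z|\<mu>. ?\<psi> z - bump z ^ 3 - l * ?g1 z - l\<^sup>2 * ?g2 z\<bar>" by simp
    also have "\<dots> \<le> (LINT z|\<mu>. \<bar>?\<psi> z - bump z ^ 3 - l * ?g1 z - l\<^sup>2 * ?g2 z\<bar>)" by (rule integral_abs_bound)
    also have "\<dots> \<le> (LINT z|\<mu>. K * l ^ 3 * indicator (koranyi_ball 2 0) z)"
    proof (rule integral_mono)
      show "integrable \<mu> (\<lambda>z. \<bar>?\<psi> z - bump z ^ 3 - l * ?g1 z - l\<^sup>2 * ?g2 z\<bar>)"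
        using i0 i1 i2 i3 by (intro integrable_abs Bochner_Integration.integrable_diff integrable_mult_right)
      show "integrable \<mu> (\<lambda>z. K * l ^ 3 * indicator (koranyi_ball 2 0) z)"
        using mu_finite_ball[of 2] by (intro integrable_mult_right integrable_real_indicator) auto
    qed (rule bound)
    also have "\<dots> = K * m * l ^ 3" by (simp add: m_def)
    finally show ?thesis .
  qed
  have U1: "1 / (1 + U) > 0" "1 / (1 + U) \<le> 1" using U by auto
  have m0: "m \<ge> 0" by (simp add: m_def)
  have a: "a = 0"
  proof (rule zero_of_small[OF U1(1)])
    fix l assume l: "0 < l" "l \<le> 1 / (1 + U)"
    have l1: "l \<le> 1" using l U1 by linarith
    have "\<bar>l * a\<bar> \<le> \<bar>l\<^sup>2 * b\<bar> + K * m * l ^ 3" using main[OF l] by linarith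
    also have "K * m * l ^ 3 \<le> K * m * l\<^sup>2" using l l1 K0 m0 by (intro mult_left_mono power_decreasing) auto
    finally have "l * \<bar>a\<bar> \<le> l * ((\<bar>b\<bar> + K * m) * l)" using l by (simp add: abs_mult power2_eq_square algebra_simps)
    then show "\<bar>a\<bar> \<le> (\<bar>b\<bar> + K * m) * l" using l by simp
  qed
  have "b = 0"
  proof (rule zero_of_small[OF U1(1)])
    fix l assume l: "0 < l" "l \<le> 1 / (1 + U)"
    have "l\<^sup>2 * \<bar>b\<bar> \<le> l\<^sup>2 * (K * m * l)" using main[OF l] l unfolding a by (simp add: abs_mult power2_eq_square power3_eq_cube algebra_simps)
    then show "\<bar>b\<bar> \<le> K * m * l" using l by simp
  qed
  then show ?thesis by (simp add: b_def)
qed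

end

section \<open>The support lies in a quadric\<close>

definition outer :: "real^'k \<Rightarrow> real^'k^'k" where
  "outer v = (\<chi> i j. v $ i * v $ j)"

lemma quadratic_outer: "x \<bullet> (outer v *v x) = (x \<bullet> v)\<^sup>2" for v :: "real^'k::finite"
proof -
  have "outer v *v x = (v \<bullet> x) *\<^sub>R v"
    by (simp add: outer_def matrix_vector_mult_def vec_eq_iff inner_vec_def sum_distrib_left mult_ac)
  then show ?thesis by (simp add: power2_eq_square inner_commute)
qed

lemma transpose_outer: "transpose (outer v) = outer v"
  by (simp add: outer_def transpose_def vec_eq_iff mult.commute)

lemma trace_outer: "trace (outer v) = v \<bullet> v" for v :: "real^'k::finite"
  by (simp add: outer_def trace_def inner_vec_def)

lemma continuous_on_outer [continuous_intros]:
  "continuous_on S g \<Longrightarrow> continuous_on S (\<lambda>z. outer (g z))"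
  unfolding outer_def by (intro continuous_intros)

lemma bounded_linear_quadratic: "bounded_linear (\<lambda>A. x \<bullet> (A *v x))" for x :: "real^'k::finite"
  unfolding linear_conv_bounded_linear[symmetric]
  by (rule linearI) (simp_all add: algebra_simps inner_add_right scaleR_matrix_vector_assoc[symmetric])

lemma bounded_linear_transpose: "bounded_linear (transpose :: real^'k::finite^'k \<Rightarrow> real^'k^'k)"
  unfolding linear_conv_bounded_linear[symmetric]
  by (rule linearI) (simp_all add: transpose_def vec_eq_iff)

lemma bounded_linear_trace: "bounded_linear (trace :: real^'k::finite^'k \<Rightarrow> real)"
  unfolding linear_conv_bounded_linear[symmetric]
  by (rule linearI) (simp_all add: trace_def sum.distrib sum_distrib_left)

text \<open>The vector that represents \<open>coef1\<close>: \<open>coef1 u z\<close> is four times the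
  inner product of \<open>fst u\<close> with it.\<close>
definition moment_vec :: "('n::finite) heis \<Rightarrow> real ^ ('n + 'n)" where
  "moment_vec z = (norm (fst z))\<^sup>2 *\<^sub>R fst z + snd z *\<^sub>R (sympl_J *v fst z)"

text \<open>The integrand of the moment identity, as a quadratic form in \<open>fst u\<close>; only the
  summand \<open>2 * snd z * snd u\<close> of \<open>coef2\<close> is left out.\<close>
definition moment_density :: "('n::finite) heis \<Rightarrow> real ^ ('n + 'n) ^ ('n + 'n)" where
  "moment_density z = (- 12 * (bump z)\<^sup>2) *\<^sub>R outer (fst z) + (- 6 * (bump z)\<^sup>2 * (norm (fst z))\<^sup>2) *\<^sub>R mat 1
     + (- 12 * (bump z)\<^sup>2) *\<^sub>R outer (sympl_J *v fst z) + (48 * bump z) *\<^sub>R outer (moment_vec z)"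

lemma moment_vec_sq: "moment_vec z \<bullet> moment_vec z = koranyi_norm z ^ 4 * (norm (fst z))\<^sup>2"
proof -
  have "(sympl_J *v fst z) \<bullet> (sympl_J *v fst z) = fst z \<bullet> fst z" using sympl_J_norm[of "fst z"] by (simp add: norm_eq)
  moreover have "(sympl_J *v fst z) \<bullet> fst z = 0" using sympl_J_self[of "fst z"] by (simp add: inner_commute)
  ultimately have "moment_vec z \<bullet> moment_vec z = ((norm (fst z))\<^sup>2)\<^sup>2 * (fst z \<bullet> fst z) + (snd z)\<^sup>2 * (fst z \<bullet> fst z)"
    by (simp add: moment_vec_def inner_add_left inner_add_right sympl_J_self power2_eq_square)
  then show ?thesis unfolding koranyi_norm_pow4 power2_norm_eq_inner[symmetric]
    by (simp add: algebra_simps flip: power_mult)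
qed

lemma quadratic_moment_density:
  "fst u \<bullet> (moment_density z *v fst u) + snd u * (6 * (bump z)\<^sup>2 * snd z)
     = 3 * (bump z)\<^sup>2 * coef2 u z + 3 * bump z * (coef1 u z)\<^sup>2"
proof -
  have 1: "coef1 u z = 4 * (fst u \<bullet> moment_vec z)"
    by (simp add: coef1_def moment_vec_def inner_add_right)
  have sm: "(c *\<^sub>R B) *v x = c *\<^sub>R (B *v x)" for c and B :: "real ^ ('a + 'a) ^ ('a + 'a)" and x
    by (simp add: scaleR_matrix_vector_assoc)
  have "fst u \<bullet> (moment_density z *v fst u) =
     (- 12 * (bump z)\<^sup>2) * (fst u \<bullet> fst z)\<^sup>2 + (- 6 * (bump z)\<^sup>2 * (norm (fst z))\<^sup>2) * (norm (fst u))\<^sup>2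
     + (- 12 * (bump z)\<^sup>2) * (fst u \<bullet> (sympl_J *v fst z))\<^sup>2 + (48 * bump z) * (fst u \<bullet> moment_vec z)\<^sup>2"
    unfolding moment_density_def matrix_vector_mult_add_rdistrib sm inner_add_right inner_scaleR_right quadratic_outer
      matrix_vector_mul_lid power2_norm_eq_inner ..
  then show ?thesis unfolding 1 coef2_def by (simp add: power_mult_distrib algebra_simps)
qed

lemma trace_moment_density:
  "trace (moment_density (z::('n::finite) heis)) = - 12 * (real CARD('n) + 2) * ((bump z)\<^sup>2 * (norm (fst z))\<^sup>2) + 48 * (bump z * koranyi_norm z ^ 4 * (norm (fst z))\<^sup>2)"
proof -
  have tr: "trace (c *\<^sub>R B) = c * trace B" "trace (B + B') = trace B + trace B'" for c and B B' :: "real ^ ('n + 'n) ^ ('n + 'n)"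
    by (simp_all add: trace_def sum_distrib_left sum.distrib)
  have tI: "trace (mat 1 :: real ^ ('n + 'n) ^ ('n + 'n)) = 2 * real CARD('n)" by (simp add: trace_def mat_def)
  have "(sympl_J *v fst z) \<bullet> (sympl_J *v fst z) = (norm (fst z))\<^sup>2"
    using sympl_J_norm[of "fst z"] by (simp add: dot_square_norm)
  then show ?thesis
    unfolding moment_density_def tr trace_outer moment_vec_sq tI by (simp add: dot_square_norm algebra_simps)
qed

lemma continuous_moment_density: "continuous_on UNIV moment_density"
  unfolding moment_density_def[abs_def] moment_vec_def[abs_def] by (intro continuous_intros)

lemma moment_density_zero: "koranyi_norm z > 1 \<Longrightarrow> moment_density z = 0"
  by (simp add: moment_density_def bump_zero)

context uniform_cone begin

definition moment_matrix :: "real ^ ('n + 'n) ^ ('n + 'n)" where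
  "moment_matrix = (LINT z|\<mu>. moment_density z)"

definition mass2 :: real where "mass2 = (LINT z|\<mu>. (bump z)\<^sup>2 * (norm (fst z))\<^sup>2)"

lemma integrable_moment_density: "integrable \<mu> moment_density"
  by (rule integrable_compact[OF continuous_moment_density]) (rule moment_density_zero)

lemma transpose_moment_matrix: "transpose moment_matrix = moment_matrix"
proof -
  have tr: "transpose (moment_density z) = moment_density z" for z :: "'n heis"
    by (simp add: moment_density_def transpose_def outer_def mat_def vec_eq_iff mult.commute)
  show ?thesis
    unfolding moment_matrix_def
    by (rule integral_bounded_linear[OF bounded_linear_transpose integrable_moment_density, unfolded tr, symmetric])
qed

text \<open>The moment identity is a quadratic equation for \<open>u\<close> in which \<open>snd u\<close>
  occurs linearly.\<close>
lemma moment_quadric: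
  assumes u: "u \<in> msupport \<mu>"
  shows "fst u \<bullet> (moment_matrix *v fst u) + (LINT z|\<mu>. 6 * (bump z)\<^sup>2 * snd z) * snd u = 0"
proof -
  have i: "integrable \<mu> (\<lambda>z. 6 * (bump z)\<^sup>2 * snd z)"
    by (rule integrable_compact[where r = 1]) (auto intro!: continuous_intros simp: bump_zero)
  have "fst u \<bullet> (moment_matrix *v fst u) = (LINT z|\<mu>. fst u \<bullet> (moment_density z *v fst u))"
    unfolding moment_matrix_def by (rule integral_bounded_linear[OF bounded_linear_quadratic integrable_moment_density, symmetric])
  moreover have "integrable \<mu> (\<lambda>z. fst u \<bullet> (moment_density z *v fst u))"
    by (rule integrable_bounded_linear[OF bounded_linear_quadratic integrable_moment_density])
  ultimately have "fst u \<bullet> (moment_matrix *v fst u) + snd u * (LINT z|\<mu>. 6 * (bump z)\<^sup>2 * snd z)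
     = (LINT z|\<mu>. fst u \<bullet> (moment_density z *v fst u) + snd u * (6 * (bump z)\<^sup>2 * snd z))"
    using i by simp
  also have "\<dots> = 0" unfolding quadratic_moment_density by (rule moment_identity[OF u])
  finally show ?thesis by (simp add: mult.commute)
qed

lemma cone_scaling:
  assumes l: "0 < l"
  shows "mass2 = l ^ (2 * CARD('n) + 3) * (LINT z|\<mu>. (norm (fst z))\<^sup>2 * (max 0 (1 - l ^ 4 * koranyi_norm z ^ 4))\<^sup>2)"
proof -
  let ?g = "\<lambda>z. (norm (fst z))\<^sup>2 * (bump z)\<^sup>2" and ?h = "\<lambda>z. (norm (fst z))\<^sup>2 * (max 0 (1 - l ^ 4 * koranyi_norm z ^ 4))\<^sup>2"
  have c: "continuous_on UNIV (?g :: 'n heis \<Rightarrow> real)" "continuous_on UNIV (?h :: 'n heis \<Rightarrow> real)"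
    by (intro continuous_intros continuous_koranyi_norm)+
  have gh: "?g (heis_dil l z) = l\<^sup>2 * ?h z" for z :: "'n heis"
    using l by (simp add: bump_def koranyi_norm_dil power_mult_distrib) (simp add: heis_dil_def power_mult_distrib)
  have "mass2 = (LINT z|\<mu>. ?g z)" by (simp add: mass2_def mult.commute)
  also have "\<dots> = enn2real (\<integral>\<^sup>+z. ennreal (?g z) \<partial>\<mu>)" by (rule integral_eq_nn_integral[OF measurable_mu[OF c(1)]]) simp
  also have "(\<integral>\<^sup>+z. ennreal (?g z) \<partial>\<mu>) = ennreal (l ^ (2 * CARD('n) + 1)) * (\<integral>\<^sup>+z. ennreal (?g (heis_dil l z)) \<partial>\<mu>)"
    by (rule nn_integral_scale[OF l]) (use borel_measurable_continuous_onI[OF c(1)] in measurable)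
  also have "(\<integral>\<^sup>+z. ennreal (?g (heis_dil l z)) \<partial>\<mu>) = ennreal (l\<^sup>2) * (\<integral>\<^sup>+z. ennreal (?h z) \<partial>\<mu>)"
  proof -
    have "(\<integral>\<^sup>+z. ennreal (?g (heis_dil l z)) \<partial>\<mu>) = (\<integral>\<^sup>+z. ennreal (l\<^sup>2) * ennreal (?h z) \<partial>\<mu>)"
      unfolding gh by (intro nn_integral_cong ennreal_mult') simp
    also have "\<dots> = ennreal (l\<^sup>2) * (\<integral>\<^sup>+z. ennreal (?h z) \<partial>\<mu>)"
      by (rule nn_integral_cmult) (use measurable_mu[OF c(2)] in measurable)
    finally show ?thesis .
  qed
  also have "enn2real (ennreal (l ^ (2 * CARD('n) + 1)) * (ennreal (l\<^sup>2) * (\<integral>\<^sup>+z. ennreal (?h z) \<partial>\<mu>)))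
    = l ^ (2 * CARD('n) + 1) * (l\<^sup>2 * enn2real (\<integral>\<^sup>+z. ennreal (?h z) \<partial>\<mu>))"
    using l by (simp add: enn2real_mult)
  also have "enn2real (\<integral>\<^sup>+z. ennreal (?h z) \<partial>\<mu>) = (LINT z|\<mu>. ?h z)"
    by (rule integral_eq_nn_integral[OF measurable_mu[OF c(2)], symmetric]) simp
  finally show ?thesis by (simp add: power_add power2_eq_square power3_eq_cube mult_ac)
qed

text \<open>Differentiate the identity \<open>cone_scaling\<close> at \<open>l = 1\<close>.\<close>
lemma radial_moment: "8 * (LINT z|\<mu>. bump z * koranyi_norm z ^ 4 * (norm (fst z))\<^sup>2) = (2 * real CARD('n) + 3) * mass2"
proof -
  let ?p = "2 * CARD('n) + 3"
  define E where "E = 2 * (LINT z|\<mu>. bump z * koranyi_norm z ^ 4 * (norm (fst z))\<^sup>2)"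
  define K where "K = 1024 * measure \<mu> (koranyi_ball 2 0)"
  let ?g = "\<lambda>z. (norm (fst z))\<^sup>2 * (bump z)\<^sup>2"
  let ?k = "\<lambda>z. bump z * koranyi_norm z ^ 4 * (norm (fst z))\<^sup>2"
  have i1: "integrable \<mu> ?g" "integrable \<mu> ?k"
    by (rule integrable_compact[where r = 1]; auto intro!: continuous_intros continuous_koranyi_norm simp: bump_zero)+
  \<comment> \<open>The error is of second order at \<open>l = 1\<close>, so difference quotients from the left determine the derivative there.\<close>
  have est: "\<bar>mass2 - l ^ ?p * mass2 - l ^ ?p * ((1 - l ^ 4) * E)\<bar> \<le> K * (1 - l ^ 4)\<^sup>2" if l: "1/2 \<le> l" "l \<le> 1" for l
  proof -
    let ?h = "\<lambda>z. (norm (fst z))\<^sup>2 * (max 0 (1 - l ^ 4 * koranyi_norm z ^ 4))\<^sup>2"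
    have "(1/2::real) ^ 4 = 1/16" by (simp add: power4_eq_xxxx)
    moreover have "(1/2) ^ 4 \<le> l ^ 4" using l by (intro power_mono) auto
    moreover have "l ^ 4 \<le> 1" using l by (intro power_le_one) auto
    ultimately have l4: "l ^ 4 \<le> 1" "1/16 \<le> l ^ 4" by linarith+
    have out: "?h z = 0" if "koranyi_norm z > 2" for z :: "'n heis"
    proof -
      have "2 ^ 4 \<le> koranyi_norm z ^ 4" using that by (intro power_mono) auto
      then have "1/16 * 16 \<le> l ^ 4 * koranyi_norm z ^ 4" using l4 by (intro mult_mono) auto
      then show ?thesis by simp
    qed
    have i2: "integrable \<mu> ?h"
      by (rule integrable_compact[where r = 2]) (use out in \<open>auto intro!: continuous_intros continuous_koranyi_norm\<close>)
    have bound: "\<bar>?h z - ?g z - (1 - l ^ 4) * (2 * ?k z)\<bar> \<le> 1024 * (1 - l ^ 4)\<^sup>2 * indicator (koranyi_ball 2 0) z" for z :: "'n heis"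
    proof (cases "koranyi_norm z \<le> 2")
      case True
      define s where "s = koranyi_norm z ^ 4"
      have s: "0 \<le> s" "s \<le> 16" using power_mono[OF True, of 4] koranyi_norm_nonneg[of z] by (auto simp: s_def)
      define d where "d = (1 - l ^ 4) * s"
      have "d \<ge> 0" unfolding d_def using s l4 by (intro mult_nonneg_nonneg) auto
      then have d: "d \<ge> 0" "1 - l ^ 4 * s = (1 - s) + d" by (simp_all add: d_def algebra_simps)
      have n: "(norm (fst z))\<^sup>2 \<le> 4" using norm_fst_le_koranyi[of z] True power_mono[of "norm (fst z)" 2 2] by simp
      have d2: "d\<^sup>2 \<le> (1 - l ^ 4)\<^sup>2 * 256"
      proof -
        have "s\<^sup>2 \<le> 16\<^sup>2" using s by (intro power_mono) auto
        then show ?thesis unfolding d_def power_mult_distrib by (intro mult_left_mono) auto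
      qed
      have "?h z - ?g z - (1 - l ^ 4) * (2 * ?k z) = (norm (fst z))\<^sup>2 * ((max 0 ((1 - s) + d))\<^sup>2 - (max 0 (1 - s))\<^sup>2 - 2 * max 0 (1 - s) * d)"
        unfolding d(2)[symmetric] by (simp add: s_def[symmetric] bump_def d_def algebra_simps)
      then have "\<bar>?h z - ?g z - (1 - l ^ 4) * (2 * ?k z)\<bar> \<le> (norm (fst z))\<^sup>2 * d\<^sup>2"
        using pos_part_square_taylor[OF d(1), of "1 - s"] by (simp add: abs_mult mult_left_mono)
      also have "\<dots> \<le> 4 * ((1 - l ^ 4)\<^sup>2 * 256)" using n d2 by (intro mult_mono) auto
      finally show ?thesis using True by (simp add: mem_koranyi_ball_0)
    next
      case False
      then have "koranyi_norm z > 2" "koranyi_norm z \<ge> 1" by simp_all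
      note out[OF this(1)] bump_zero[OF this(2)]
      then show ?thesis by (simp only:) (simp add: indicator_def)
    qed
    have eq: "(LINT z|\<mu>. ?h z - ?g z - (1 - l ^ 4) * (2 * ?k z)) = (LINT z|\<mu>. ?h z) - mass2 - (1 - l ^ 4) * E"
      using i1 i2 by (simp add: mass2_def E_def mult.commute)
    have "\<bar>(LINT z|\<mu>. ?h z) - mass2 - (1 - l ^ 4) * E\<bar> \<le> (LINT z|\<mu>. \<bar>?h z - ?g z - (1 - l ^ 4) * (2 * ?k z)\<bar>)"
      unfolding eq[symmetric] by (rule integral_abs_bound)
    also have "\<dots> \<le> (LINT z|\<mu>. 1024 * (1 - l ^ 4)\<^sup>2 * indicator (koranyi_ball 2 0) z)"
    proof (rule integral_mono)
      show "integrable \<mu> (\<lambda>z. \<bar>?h z - ?g z - (1 - l ^ 4) * (2 * ?k z)\<bar>)"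
        using i1 i2 by (intro integrable_abs Bochner_Integration.integrable_diff integrable_mult_right)
      show "integrable \<mu> (\<lambda>z. 1024 * (1 - l ^ 4)\<^sup>2 * indicator (koranyi_ball 2 0) z)"
        using mu_finite_ball[of 2] by (intro integrable_mult_right integrable_real_indicator) auto
    qed (rule bound)
    also have "\<dots> = K * (1 - l ^ 4)\<^sup>2" by (simp add: K_def)
    finally have H: "\<bar>(LINT z|\<mu>. ?h z) - mass2 - (1 - l ^ 4) * E\<bar> \<le> K * (1 - l ^ 4)\<^sup>2" .
    have "l > 0" using l by simp
    note cs = cone_scaling[OF this]
    have "mass2 - l ^ ?p * mass2 - l ^ ?p * ((1 - l ^ 4) * E) = l ^ ?p * ((LINT z|\<mu>. ?h z) - mass2 - (1 - l ^ 4) * E)"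
      using cs by (simp only: right_diff_distrib)
    then have "\<bar>mass2 - l ^ ?p * mass2 - l ^ ?p * ((1 - l ^ 4) * E)\<bar> = l ^ ?p * \<bar>(LINT z|\<mu>. ?h z) - mass2 - (1 - l ^ 4) * E\<bar>"
      using l by (simp add: abs_mult)
    also have "\<dots> \<le> 1 * (K * (1 - l ^ 4)\<^sup>2)" using H l by (intro mult_mono power_le_one) auto
    finally show ?thesis by simp
  qed
  define \<Phi> where "\<Phi> l = mass2 - l ^ ?p * mass2 - l ^ ?p * ((1 - l ^ 4) * E)" for l
  define \<Phi>' where "\<Phi>' = - (real ?p * mass2) + 4 * E"
  have "(\<Phi> has_real_derivative \<Phi>') (at 1)"
    unfolding \<Phi>_def[abs_def] \<Phi>'_def by (auto intro!: derivative_eq_intros simp del: power_Suc)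
  then have lim: "((\<lambda>h. (\<Phi> (1 + h) - \<Phi> 1) / h) \<longlongrightarrow> \<Phi>') (at 0)" by (simp only: DERIV_def)
  define h where "h k = - inverse (real (Suc (Suc k)))" for k
  have h0: "h \<longlonglongrightarrow> - 0" unfolding h_def by (intro tendsto_minus LIMSEQ_Suc[OF LIMSEQ_inverse_real_of_nat])
  have "filterlim h (at 0) sequentially"
    using h0 unfolding filterlim_at by (auto simp: h_def)
  then have lim': "(\<lambda>k. \<bar>(\<Phi> (1 + h k) - \<Phi> 1) / h k\<bar>) \<longlonglongrightarrow> \<bar>\<Phi>'\<bar>"
    by (intro tendsto_rabs filterlim_compose[OF lim])
  have K0: "K \<ge> 0" by (simp add: K_def)
  have "\<bar>(\<Phi> (1 + h k) - \<Phi> 1) / h k\<bar> \<le> 16 * K * (- h k)" for k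
  proof -
    define e where "e = inverse (real (Suc (Suc k)))"
    have e: "0 < e" "e \<le> 1/2" by (auto simp: e_def field_simps)
    have "\<bar>\<Phi> (1 - e)\<bar> \<le> K * (1 - (1 - e) ^ 4)\<^sup>2" unfolding \<Phi>_def using e by (intro est) auto
    also have "\<dots> \<le> K * (4 * e)\<^sup>2"
    proof (intro mult_left_mono K0 power_mono)
      have "1 - 4 * e \<le> (1 - e) ^ 4" using Bernoulli_inequality[of "- e" 4] e by simp
      then show "1 - (1 - e) ^ 4 \<le> 4 * e" by simp
      show "0 \<le> 1 - (1 - e) ^ 4" using e by (simp add: power_le_one)
    qed
    also have "\<dots> = 16 * K * e * e" by (simp add: power2_eq_square)
    finally have "\<bar>\<Phi> (1 - e)\<bar> / e \<le> 16 * K * e" using e by (simp add: pos_divide_le_eq)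
    moreover have "\<Phi> 1 = 0" by (simp add: \<Phi>_def)
    moreover have hk: "h k = - e" by (simp only: h_def e_def)
    ultimately show ?thesis using e unfolding hk by (simp add: abs_divide)
  qed
  moreover have "(\<lambda>k. 16 * K * (- h k)) \<longlonglongrightarrow> 16 * K * (- (- 0))" by (intro tendsto_mult tendsto_const tendsto_minus h0)
  ultimately have "\<bar>\<Phi>'\<bar> \<le> 16 * K * (- (- 0))" by (intro LIMSEQ_le[OF lim']) auto
  then show ?thesis unfolding \<Phi>'_def E_def by (simp add: algebra_simps)
qed

text \<open>The value shows that the quadratic part of the equation of the support vanishes only if
  \<open>mass2\<close> does. By \<open>radial_moment\<close> the two terms of the trace combine to
  \<open>(- 12 * (n + 2) + 6 * (2 * n + 3)) * mass2\<close>.\<close>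
lemma trace_moment_matrix: "trace moment_matrix = - 6 * mass2"
proof -
  have i: "integrable \<mu> (\<lambda>z. (bump z)\<^sup>2 * (norm (fst z))\<^sup>2)" "integrable \<mu> (\<lambda>z. bump z * koranyi_norm z ^ 4 * (norm (fst z))\<^sup>2)"
    by (rule integrable_compact[where r = 1]; auto intro!: continuous_intros continuous_koranyi_norm simp: bump_zero)+
  have "trace moment_matrix = (LINT z|\<mu>. trace (moment_density z))"
    unfolding moment_matrix_def by (rule integral_bounded_linear[OF bounded_linear_trace integrable_moment_density, symmetric])
  also have "\<dots> = - 12 * (real CARD('n) + 2) * mass2 + 48 * (LINT z|\<mu>. bump z * koranyi_norm z ^ 4 * (norm (fst z))\<^sup>2)"
    unfolding trace_moment_density mass2_def using i by simp
  finally show ?thesis using radial_moment by (simp add: algebra_simps)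
qed

section \<open>Horizontal uniform cones are quadratic graphs\<close>


abbreviation graph_of :: "real ^ ('n + 'n) ^ ('n + 'n) \<Rightarrow> (real ^ ('n + 'n)) set" where
  "graph_of A \<equiv> {x. lift A x \<in> msupport \<mu>}"

abbreviation shadow :: "(real ^ ('n + 'n)) measure" where
  "shadow \<equiv> distr \<mu> borel fst"

lemma fst_measurable [measurable]: "fst \<in> borel_measurable \<mu>"
  by (intro measurable_mu continuous_intros)

lemma support_on_axis:
  assumes m: "mass2 = 0" and u: "u \<in> msupport \<mu>"
  shows "fst u = 0"
proof (rule ccontr)
  assume nz: "fst u \<noteq> 0"
  let ?g = "\<lambda>z. (bump z)\<^sup>2 * (norm (fst z))\<^sup>2"
  have i: "integrable \<mu> ?g"
    by (rule integrable_compact[where r = 1]) (auto intro!: continuous_intros simp: bump_zero)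
  have "AE z in \<mu>. ?g z = 0"
    using m unfolding mass2_def by (subst (asm) integral_nonneg_eq_0_iff_AE[OF i]) auto
  let ?U = "{z :: 'n heis. koranyi_norm z < 1 \<and> fst z \<noteq> 0}"
  have oU: "open ?U"
  proof -
    have "open {z :: 'n heis. koranyi_norm z < 1}" by (intro open_Collect_less continuous_koranyi_norm continuous_intros)
    moreover have "open {z :: 'n heis. fst z \<noteq> 0}" by (intro open_Collect_neq continuous_intros)
    moreover have "?U = {z. koranyi_norm z < 1} \<inter> {z. fst z \<noteq> 0}" by auto
    ultimately show ?thesis by auto
  qed
  have "AE z in \<mu>. z \<notin> ?U"
    using \<open>AE z in \<mu>. ?g z = 0\<close>
  proof eventually_elim
    fix z :: "'n heis" assume z: "?g z = 0"
    show "z \<notin> ?U"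
    proof
      assume U: "z \<in> ?U"
      then have "koranyi_norm z ^ 4 < 1" using koranyi_norm_nonneg[of z] by (simp add: power_less_one_iff)
      then show False using z U by (simp add: bump_def)
    qed
  qed
  then have "emeasure \<mu> ?U = 0"
    by (subst (asm) AE_iff_null_sets[symmetric]) (use oU in \<open>auto simp: null_sets_def\<close>)
  moreover
  define l where "l = 1 / (2 * (1 + koranyi_norm u))"
  have l: "l > 0" using koranyi_norm_nonneg[of u] by (simp add: l_def)
  have "l * koranyi_norm u < 1" using koranyi_norm_nonneg[of u] by (simp add: l_def field_simps)
  then have "koranyi_norm (heis_dil l u) < 1" using koranyi_norm_dil[of l u] l by simp
  moreover have "fst (heis_dil l u) \<noteq> 0" using nz l by (simp add: heis_dil_def)
  ultimately have "emeasure \<mu> ?U = 0 \<and> heis_dil l u \<in> ?U" by simp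
  then show False using dil_supp[OF u l] oU unfolding msupport_def by force
qed

end

text \<open>In \<open>moment_quadric\<close> the coefficient of \<open>snd u\<close> cannot vanish, since
  the moment matrix is non-zero and the support would lie in a vertical quadric. If all points of
  the support were singular, their projections would lie in the kernel of \<open>hgrad A\<close>,
  a proper subspace by \<open>hgrad_nonzero\<close>, hence again in a vertical quadric.\<close>
lemma horizontal_uniform_cone_graph:
  fixes \<mu> :: "('n::finite) heis measure" and f :: "real ^ ('n + 'n)"
  assumes cone: "uniform_cone_H (2 * CARD('n) + 1) \<mu>" and hor: "horizontal_uniform \<mu>" and f: "norm f = 1"
  obtains A where "uniform_graph A (distr \<mu> borel fst) {x. lift A x \<in> msupport \<mu>} f"
    "\<And>u. u \<in> msupport \<mu> \<Longrightarrow> u = lift A (fst u)" "\<exists>x. lift A x \<in> msupport \<mu> \<and> hgrad A x \<noteq> 0"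
proof -
  interpret uniform_cone \<mu> by unfold_locales (rule cone)
  have nv: False if "transpose Q = Q" "Q \<noteq> 0" "msupport \<mu> \<subseteq> quadric_H b Q 0" for b Q
    using hor that unfolding horizontal_uniform_def vertical_uniform_def by blast
  define T where "T = (LINT z|\<mu>. 6 * (bump z)\<^sup>2 * snd z)"
  have m: "mass2 \<noteq> 0"
  proof
    assume "mass2 = 0"
    then have "msupport \<mu> \<subseteq> quadric_H 0 (mat 1) 0"
      using support_on_axis by (auto simp: quadric_H_def)
    moreover have "(mat 1 :: real ^ ('n + 'n) ^ ('n + 'n)) \<noteq> 0"
      by (simp add: mat_def vec_eq_iff)
    ultimately show False using nv[of "mat 1" 0] by simp
  qed
  have Q0: "moment_matrix \<noteq> 0" using trace_moment_matrix m by (auto simp: trace_def)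
  have T: "T \<noteq> 0"
  proof
    assume "T = 0"
    then have "msupport \<mu> \<subseteq> quadric_H 0 moment_matrix 0"
      using moment_quadric unfolding T_def quadric_H_def by force
    then show False by (rule nv[OF transpose_moment_matrix Q0])
  qed
  define A where "A = (- (1 / T)) *\<^sub>R moment_matrix"
  have A: "transpose A = A" unfolding A_def transpose_scalar transpose_moment_matrix ..
  have graph: "u = lift A (fst u)" if u: "u \<in> msupport \<mu>" for u
  proof -
    have "fst u \<bullet> (A *v fst u) = (- (1 / T)) * (fst u \<bullet> (moment_matrix *v fst u))"
      unfolding A_def scaleR_matrix_vector_assoc[symmetric] by simp
    also have "\<dots> = snd u" using moment_quadric[OF u] T unfolding T_def[symmetric] by (simp add: field_simps)
    finally show ?thesis by (simp add: lift_def prod_eq_iff)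
  qed
  have cl: "continuous_on UNIV (lift A)" unfolding lift_def[abs_def] by (intro continuous_intros)
  have ug: "uniform_graph A shadow (graph_of A) f"
  proof
    show "transpose A = A" by (rule A)
    show "norm f = 1" by (rule f)
    show "sets shadow = sets borel" by simp
    show clE: "closed (graph_of A)"
      using closed_vimage[OF closed_msupport cl] by (simp add: vimage_def)
    show "emeasure shadow (- graph_of A) = 0"
    proof -
      have "emeasure shadow (- graph_of A) = emeasure \<mu> (fst -` (- graph_of A) \<inter> space \<mu>)"
        using clE by (intro emeasure_distr) auto
      also have "\<dots> \<le> emeasure \<mu> (- msupport \<mu>)"
      proof (rule emeasure_mono)
        show "- msupport \<mu> \<in> sets \<mu>" unfolding sets_mu by (rule borel_open) (rule open_Compl[OF closed_msupport])
        show "fst -` (- graph_of A) \<inter> space \<mu> \<subseteq> - msupport \<mu>" using graph by force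
      qed
      also have "\<dots> = 0" by (rule null_outside_msupport) simp
      finally show ?thesis by simp
    qed
    show "0 \<in> graph_of A" using zero_supp by (simp add: lift_def zero_prod_def)
    show "l *\<^sub>R x \<in> graph_of A" if "x \<in> graph_of A" "l > 0" for x l
    proof -
      have "lift A (l *\<^sub>R x) = heis_dil l (lift A x)"
        by (simp add: lift_def heis_dil_def matrix_vector_mult_scaleR power2_eq_square)
      then show ?thesis using dil_supp that by auto
    qed
    show "emeasure shadow (hball A r x) = ennreal (r ^ (2 * CARD('n) + 1))" if x: "x \<in> graph_of A" and r: "r > 0" for x r
    proof -
      have "emeasure shadow (hball A r x) = emeasure \<mu> (fst -` hball A r x \<inter> space \<mu>)"
        by (rule emeasure_distr) auto
      also have "\<dots> = emeasure \<mu> (koranyi_ball r (lift A x))"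
      proof (rule emeasure_eq_AE)
        show "AE z in \<mu>. z \<in> fst -` hball A r x \<inter> space \<mu> \<longleftrightarrow> z \<in> koranyi_ball r (lift A x)"
          using AE_supp
        proof eventually_elim
          fix z assume "z \<in> msupport \<mu>"
          then have "z = lift A (fst z)" by (rule graph)
          then have "gdist A x (fst z) = koranyi_dist (lift A x) z" by (simp add: gdist_def)
          then show "z \<in> fst -` hball A r x \<inter> space \<mu> \<longleftrightarrow> z \<in> koranyi_ball r (lift A x)"
            by (simp add: hball_def koranyi_ball_def)
        qed
        show "fst -` hball A r x \<inter> space \<mu> \<in> sets \<mu>" by (rule measurable_sets[OF fst_measurable]) simp
        show "koranyi_ball r (lift A x) \<in> sets \<mu>" by simp
      qed
      also have "\<dots> = ennreal (r ^ (2 * CARD('n) + 1))" using x r by (intro mu_ball) auto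
      finally show ?thesis .
    qed
  qed
  have "\<exists>x. lift A x \<in> msupport \<mu> \<and> hgrad A x \<noteq> 0"
  proof (rule ccontr)
    assume "\<not> (\<exists>x. lift A x \<in> msupport \<mu> \<and> hgrad A x \<noteq> 0)"
    then have all0: "hgrad A (fst u) = 0" if "u \<in> msupport \<mu>" for u using graph[OF that] that by metis
    obtain z where z: "hgrad A z \<noteq> 0" using hgrad_nonzero[OF A] by blast
    define e where "e = hgrad A z"
    define w where "w = 2 *\<^sub>R (A *v e - sympl_J *v e)"
    have we: "w \<bullet> x = e \<bullet> hgrad A x" for x
      using symmetric_matrix_swap[OF A, of e x] sympl_J_antisym[of e x]
      by (simp add: w_def hgrad_def inner_add_right inner_diff_left)
    have "w \<bullet> z \<noteq> 0" unfolding we using z by (simp add: e_def)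
    then have "outer w \<noteq> 0" using quadratic_outer[of z w] by (auto simp: inner_commute)
    moreover have "msupport \<mu> \<subseteq> quadric_H 0 (outer w) 0"
    proof
      fix u assume "u \<in> msupport \<mu>"
      then have "fst u \<bullet> w = 0" using we[of "fst u"] all0 by (simp add: inner_commute)
      then show "u \<in> quadric_H 0 (outer w) 0" by (cases u) (simp add: quadric_H_def quadratic_outer)
    qed
    ultimately show False using nv[OF transpose_outer] by blast
  qed
  then show ?thesis using that[OF ug graph] by blast
qed

section \<open>Consequences of the comparison of area and mass\<close>

lemma slab_volume_le:
  fixes e :: "'a::euclidean_space"
  assumes e: "norm e = 1" and h: "h \<ge> 0" and [measurable]: "P \<in> sets borel"
  shows "emeasure lborel {y. \<bar>e \<bullet> y\<bar> \<le> h \<and> perp e y \<in> P} = ennreal (2 * h) * emeasure lborel {y. 0 \<le> e \<bullet> y \<and> e \<bullet> y \<le> 1 \<and> perp e y \<in> P}"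
proof -
  have ee: "e \<bullet> e = 1" using e by (simp add: dot_square_norm)
  have "emeasure lborel {y. \<bar>e \<bullet> y\<bar> \<le> h \<and> perp e y \<in> P} = (\<integral>\<^sup>+y. indicator {y. \<bar>e \<bullet> y\<bar> \<le> h \<and> perp e y \<in> P} y \<partial>lborel)"
    by (subst nn_integral_indicator) measurable
  also have "\<dots> = (\<integral>\<^sup>+y. indicator {y. 0 \<le> e \<bullet> y \<and> e \<bullet> y \<le> 1} y * (\<integral>\<^sup>+t. indicator {y. \<bar>e \<bullet> y\<bar> \<le> h \<and> perp e y \<in> P} (y + t *\<^sub>R e) \<partial>lborel) \<partial>lborel)"
    by (rule lborel_slices[OF e]) measurable
  also have "\<dots> = (\<integral>\<^sup>+y. ennreal (2 * h) * indicator {y. 0 \<le> e \<bullet> y \<and> e \<bullet> y \<le> 1 \<and> perp e y \<in> P} y \<partial>lborel)"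
  proof (rule nn_integral_cong)
    fix y
    have "(\<integral>\<^sup>+t. indicator {y. \<bar>e \<bullet> y\<bar> \<le> h \<and> perp e y \<in> P} (y + t *\<^sub>R e) \<partial>lborel) = (\<integral>\<^sup>+t. indicator P (perp e y) * indicator {- h - e \<bullet> y .. h - e \<bullet> y} t \<partial>lborel)"
      by (intro nn_integral_cong) (auto simp: indicator_def inner_add_right ee perp_shift[OF e])
    also have "\<dots> = indicator P (perp e y) * ennreal (2 * h)"
      using h by (subst nn_integral_cmult_indicator) auto
    finally show "indicator {y. 0 \<le> e \<bullet> y \<and> e \<bullet> y \<le> 1} y * (\<integral>\<^sup>+t. indicator {y. \<bar>e \<bullet> y\<bar> \<le> h \<and> perp e y \<in> P} (y + t *\<^sub>R e) \<partial>lborel)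
      = ennreal (2 * h) * indicator {y. 0 \<le> e \<bullet> y \<and> e \<bullet> y \<le> 1 \<and> perp e y \<in> P} y"
      by (auto simp: indicator_def)
  qed
  also have "\<dots> = ennreal (2 * h) * emeasure lborel {y. 0 \<le> e \<bullet> y \<and> e \<bullet> y \<le> 1 \<and> perp e y \<in> P}"
    by (rule nn_integral_cmult_indicator) measurable
  finally show ?thesis .
qed

lemma codim_two_volume_le:
  fixes e1 e2 :: "'a::euclidean_space"
  assumes e1: "norm e1 = 1" and e2: "norm e2 = 1" and o: "e1 \<bullet> e2 = 0" and h: "h \<ge> 0"
  shows "emeasure lborel {y. \<bar>e1 \<bullet> y\<bar> \<le> h \<and> \<bar>e2 \<bullet> y\<bar> \<le> h \<and> norm y \<le> 2} \<le> ennreal (4 * h\<^sup>2) * emeasure lborel (cball (0::'a) 4)"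
proof -
  have pe: "e2 \<bullet> perp e1 y = e2 \<bullet> y" for y using o by (simp add: perp_def inner_diff_right inner_commute)
  have np: "norm y \<le> norm (perp e y) + \<bar>e \<bullet> y\<bar>" if "norm e = 1" for e y :: 'a
  proof -
    have "y = perp e y + (e \<bullet> y) *\<^sub>R e" by (simp add: perp_def)
    then have "norm y \<le> norm (perp e y) + norm ((e \<bullet> y) *\<^sub>R e)" by (metis norm_triangle_ineq)
    then show ?thesis using that by simp
  qed
  have "emeasure lborel {y. \<bar>e1 \<bullet> y\<bar> \<le> h \<and> \<bar>e2 \<bullet> y\<bar> \<le> h \<and> norm y \<le> 2}
    \<le> emeasure lborel {y. \<bar>e1 \<bullet> y\<bar> \<le> h \<and> perp e1 y \<in> {p. \<bar>e2 \<bullet> p\<bar> \<le> h \<and> norm p \<le> 2}}"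
    using norm_perp_le[OF e1] by (intro emeasure_mono) (auto simp: pe intro: order_trans)
  also have "\<dots> = ennreal (2 * h) * emeasure lborel {y. 0 \<le> e1 \<bullet> y \<and> e1 \<bullet> y \<le> 1 \<and> perp e1 y \<in> {p. \<bar>e2 \<bullet> p\<bar> \<le> h \<and> norm p \<le> 2}}"
    by (rule slab_volume_le[OF e1 h]) measurable
  also have "\<dots> \<le> ennreal (2 * h) * emeasure lborel {y. \<bar>e2 \<bullet> y\<bar> \<le> h \<and> perp e2 y \<in> cball 0 3}"
  proof (intro mult_left_mono emeasure_mono subsetI)
    fix y assume y: "y \<in> {y. 0 \<le> e1 \<bullet> y \<and> e1 \<bullet> y \<le> 1 \<and> perp e1 y \<in> {p. \<bar>e2 \<bullet> p\<bar> \<le> h \<and> norm p \<le> 2}}"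
    then have "norm y \<le> 3" using np[OF e1, of y] by auto
    then show "y \<in> {y. \<bar>e2 \<bullet> y\<bar> \<le> h \<and> perp e2 y \<in> cball 0 3}" using y norm_perp_le[OF e2, of y] by (auto simp: pe)
  qed auto
  also have "emeasure lborel {y. \<bar>e2 \<bullet> y\<bar> \<le> h \<and> perp e2 y \<in> cball 0 3} = ennreal (2 * h) * emeasure lborel {y. 0 \<le> e2 \<bullet> y \<and> e2 \<bullet> y \<le> 1 \<and> perp e2 y \<in> cball 0 3}"
    by (rule slab_volume_le[OF e2 h]) measurable
  also have "ennreal (2 * h) * (ennreal (2 * h) * emeasure lborel {y. 0 \<le> e2 \<bullet> y \<and> e2 \<bullet> y \<le> 1 \<and> perp e2 y \<in> cball 0 3})
    \<le> ennreal (2 * h) * (ennreal (2 * h) * emeasure lborel (cball (0::'a) 4))"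
  proof (intro mult_left_mono emeasure_mono subsetI)
    fix y assume "y \<in> {y. 0 \<le> e2 \<bullet> y \<and> e2 \<bullet> y \<le> 1 \<and> perp e2 y \<in> cball 0 3}"
    then show "y \<in> cball 0 4" using np[OF e2, of y] by auto
  qed auto
  also have "\<dots> = ennreal (4 * h\<^sup>2) * emeasure lborel (cball (0::'a) 4)"
    using h by (simp add: mult.assoc[symmetric] ennreal_mult'[symmetric] power2_eq_square)
  finally show ?thesis .
qed

text \<open>The ball contains a sheared product of a Euclidean ball of radius \<open>h / 2\<close> and an
  interval of length \<open>h\<^sup>2\<close>.\<close>
lemma koranyi_ball_volume_ge:
  fixes u :: "('n::finite) heis"
  assumes h: "h > 0"
  shows "emeasure lborel (koranyi_ball h u) \<ge> ennreal (h\<^sup>2 * (h / 2) ^ (2 * CARD('n))) * emeasure lborel (cball (0::real ^ ('n + 'n)) 1)"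
proof -
  obtain x t where u: "u = (x, t)" by (cases u)
  let ?S = "{(y, s). norm (y - x) \<le> h / 2 \<and> \<bar>s - t - 2 * (x \<bullet> (sympl_J *v y))\<bar> \<le> h\<^sup>2 / 2}"
  have S: "?S \<in> sets (borel \<Otimes>\<^sub>M borel)"
  proof -
    have "closed ?S" unfolding case_prod_beta
      by (intro closed_Collect_conj closed_Collect_le continuous_intros)
    then show ?thesis unfolding borel_prod by simp
  qed
  have cb: "emeasure lborel (cball x (h/2)) = ennreal ((h/2) ^ (2 * CARD('n))) * emeasure lborel (cball (0::real ^ ('n + 'n)) 1)"
  proof -
    have d: "DIM(real ^ ('n + 'n)) = 2 * CARD('n)" by (simp add: mult_2)
    have h2: "0 \<le> h / 2" using h by simp
    have 1: "emeasure lborel (cball x (h/2)) = ennreal (unit_ball_vol (real (2 * CARD('n))) * (h/2) ^ (2 * CARD('n)))"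
      using emeasure_cball[OF h2, of x] unfolding d .
    have 2: "emeasure lborel (cball (0::real ^ ('n + 'n)) 1) = ennreal (unit_ball_vol (real (2 * CARD('n))))"
      using emeasure_cball[of 1 "0::real ^ ('n + 'n)"] unfolding d by (simp only: power_one mult_1_right zero_le_one)
    have "ennreal (unit_ball_vol (real (2 * CARD('n))) * (h/2) ^ (2 * CARD('n))) = ennreal ((h/2) ^ (2 * CARD('n)) * unit_ball_vol (real (2 * CARD('n))))"
      by (simp only: mult.commute)
    also have "\<dots> = ennreal ((h/2) ^ (2 * CARD('n))) * ennreal (unit_ball_vol (real (2 * CARD('n))))"
      by (rule ennreal_mult') (use h2 in simp)
    finally show ?thesis unfolding 1 2 .
  qed
  have "ennreal (h\<^sup>2 * (h / 2) ^ (2 * CARD('n))) * emeasure lborel (cball (0::real ^ ('n + 'n)) 1) = ennreal (h\<^sup>2) * emeasure lborel (cball x (h/2))"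
    using h unfolding cb by (simp add: ennreal_mult' mult.assoc)
  also have "\<dots> = (\<integral>\<^sup>+y. ennreal (h\<^sup>2) * indicator (cball x (h/2)) y \<partial>lborel)"
    by (rule nn_integral_cmult_indicator[symmetric]) simp
  also have "\<dots> = (\<integral>\<^sup>+y. emeasure lborel (Pair y -` ?S) \<partial>lborel)"
  proof (rule nn_integral_cong)
    fix y
    have int: "{s. \<bar>s - t - q\<bar> \<le> a} = {t + q - a .. t + q + a}" for q a :: real by auto
    have "Pair y -` ?S = (if y \<in> cball x (h/2) then {s. \<bar>s - t - 2 * (x \<bullet> (sympl_J *v y))\<bar> \<le> h\<^sup>2 / 2} else {})"
      by (auto simp: dist_norm norm_minus_commute)
    then have "Pair y -` ?S = (if y \<in> cball x (h/2) then {t + 2 * (x \<bullet> (sympl_J *v y)) - h\<^sup>2/2 .. t + 2 * (x \<bullet> (sympl_J *v y)) + h\<^sup>2/2} else {})"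
      unfolding int .
    then show "ennreal (h\<^sup>2) * indicator (cball x (h/2)) y = emeasure lborel (Pair y -` ?S)" by simp
  qed
  also have "\<dots> = emeasure (lborel \<Otimes>\<^sub>M lborel) ?S"
    using S by (intro lborel.emeasure_pair_measure_alt[symmetric]) (simp cong: sets_pair_measure_cong)
  also have "\<dots> = emeasure lborel ?S" by (simp only: lborel_prod)
  also have "\<dots> \<le> emeasure lborel (koranyi_ball h u)"
  proof (rule emeasure_mono)
    show "?S \<subseteq> koranyi_ball h u"
    proof
      fix z assume "z \<in> ?S"
      then obtain y s where z: "z = (y, s)" "norm (y - x) \<le> h / 2" "\<bar>s - t - 2 * (x \<bullet> (sympl_J *v y))\<bar> \<le> h\<^sup>2 / 2" by auto
      have 1: "norm (y - x) ^ 4 \<le> (h / 2) ^ 4" using z(2) by (intro power_mono) auto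
      have "\<bar>s - t - 2 * (x \<bullet> (sympl_J *v y))\<bar>\<^sup>2 \<le> (h\<^sup>2 / 2)\<^sup>2" using z(3) by (intro power_mono) auto
      then have 2: "(s - t - 2 * (x \<bullet> (sympl_J *v y)))\<^sup>2 \<le> (h\<^sup>2 / 2)\<^sup>2" by simp
      have "(h / 2) ^ 4 + (h\<^sup>2 / 2)\<^sup>2 \<le> h ^ 4" by (simp add: power_divide flip: power_mult)
      then have "norm (y - x) ^ 4 + (s - t - 2 * (x \<bullet> (sympl_J *v y)))\<^sup>2 \<le> h ^ 4" using 1 2 by linarith
      then have "koranyi_norm (y - x, s - t - 2 * (x \<bullet> (sympl_J *v y))) \<le> h"
        using h by (subst koranyi_norm_le_iff) simp_all
      then show "z \<in> koranyi_ball h u" by (simp add: koranyi_ball_def koranyi_dist_eq u z)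
    qed
    have "continuous_on UNIV (\<lambda>z. koranyi_dist u z)"
      unfolding koranyi_dist_eq koranyi_norm_def by (intro continuous_intros)
    then show "koranyi_ball h u \<in> sets lborel" unfolding koranyi_ball_def sets_lborel
      by (intro borel_closed closed_Collect_le continuous_intros)
  qed
  finally show ?thesis .
qed

context uniform_graph begin

lemma M_lift_ball_le:
  assumes "r > 0" shows "emeasure M {v. koranyi_dist (lift A v) w \<le> r} \<le> ennreal ((2 * r) ^ (2 * CARD('n) + 1))"
proof (cases "{v. koranyi_dist (lift A v) w \<le> r} \<inter> E = {}")
  case True
  then have "emeasure M {v. koranyi_dist (lift A v) w \<le> r} \<le> emeasure M (- E)" by (intro emeasure_mono) auto
  then show ?thesis by (simp add: null_E)
next
  case False
  then obtain v where v: "v \<in> E" "koranyi_dist (lift A v) w \<le> r" by auto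
  have "{v. koranyi_dist (lift A v) w \<le> r} \<subseteq> B (2 * r) v"
  proof
    fix x assume "x \<in> {v. koranyi_dist (lift A v) w \<le> r}"
    then show "x \<in> B (2 * r) v"
      using koranyi_dist_triangle[of "lift A v" "lift A x" w] v(2) koranyi_dist_commute[of w "lift A x"]
      by (simp add: hball_def gdist_def)
  qed
  then have "emeasure M {v. koranyi_dist (lift A v) w \<le> r} \<le> emeasure M (B (2 * r) v)" by (intro emeasure_mono) auto
  then show ?thesis using unif[OF v(1), of "2 * r"] assms by simp
qed

text \<open>Fubini for the pairs \<open>(v, w)\<close> with \<open>w\<close> within distance
  \<open>h\<close> of the graph point over \<open>v\<close>: each \<open>v\<close> sees a Koranyi
  ball of volume of order \<open>h ^ (2 * n + 2)\<close>, each \<open>w\<close> sees mass of order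
  \<open>h ^ (2 * n + 1)\<close>. A set of mass one thus has an \<open>h\<close>-neighbourhood of
  volume at least of order \<open>h\<close>.\<close>
lemma neighbourhood_volume_ge:
  assumes h: "h > 0" and [measurable]: "S \<in> sets borel" "W \<in> sets borel"
    and W: "\<And>v w. v \<in> S \<Longrightarrow> koranyi_dist (lift A v) w \<le> h \<Longrightarrow> w \<in> W"
  shows "emeasure M S * (ennreal (h\<^sup>2 * (h / 2) ^ (2 * CARD('n))) * emeasure lborel (cball (0::real ^ ('n + 'n)) 1))
     \<le> ennreal ((2 * h) ^ (2 * CARD('n) + 1)) * emeasure lborel W"
proof -
  interpret M: sigma_finite_measure M by (rule sigma_finite_M)
  interpret P: pair_sigma_finite "lborel :: 'n heis measure" M ..
  let ?K = "{x :: 'n heis \<times> (real ^ ('n + 'n)). koranyi_dist (lift A (snd x)) (fst x) \<le> h}"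
  have cK: "continuous_on UNIV (\<lambda>x :: 'n heis \<times> (real ^ ('n + 'n)). koranyi_dist (lift A (snd x)) (fst x))"
    unfolding koranyi_dist_eq koranyi_norm_def lift_def by (intro continuous_intros)
  have [measurable]: "?K \<in> sets (borel \<Otimes>\<^sub>M borel)"
    unfolding borel_prod using cK by (intro borel_closed closed_Collect_le continuous_intros)
  let ?\<kappa> = "ennreal (h\<^sup>2 * (h / 2) ^ (2 * CARD('n))) * emeasure lborel (cball (0::real ^ ('n + 'n)) 1)"
  have "emeasure M S * ?\<kappa> = (\<integral>\<^sup>+v. ?\<kappa> * indicator S v \<partial>M)"
    by (subst nn_integral_cmult_indicator) (simp_all add: mult.commute)
  also have "\<dots> \<le> (\<integral>\<^sup>+v. (\<integral>\<^sup>+w. indicator S v * indicator ?K (w, v) \<partial>lborel) \<partial>M)"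
  proof (rule nn_integral_mono)
    fix v
    have [measurable]: "koranyi_ball h (lift A v) \<in> sets borel"
    proof -
      have "continuous_on UNIV (\<lambda>z. koranyi_dist (lift A v) z)"
        unfolding koranyi_dist_eq koranyi_norm_def by (intro continuous_intros)
      then show ?thesis unfolding koranyi_ball_def by (intro borel_closed closed_Collect_le continuous_intros)
    qed
    have "(\<integral>\<^sup>+w. indicator S v * indicator ?K (w, v) \<partial>lborel) = (\<integral>\<^sup>+w. indicator S v * indicator (koranyi_ball h (lift A v)) w \<partial>lborel)"
      by (intro nn_integral_cong) (simp add: indicator_def koranyi_ball_def)
    also have "\<dots> = indicator S v * emeasure lborel (koranyi_ball h (lift A v))"
      by (rule nn_integral_cmult_indicator) simp
    finally show "?\<kappa> * indicator S v \<le> (\<integral>\<^sup>+w. indicator S v * indicator ?K (w, v) \<partial>lborel)"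
      using koranyi_ball_volume_ge[OF h, of "lift A v"] by (simp add: indicator_def)
  qed
  also have "\<dots> = (\<integral>\<^sup>+w. (\<integral>\<^sup>+v. indicator S v * indicator ?K (w, v) \<partial>M) \<partial>lborel)"
    by (rule P.Fubini') measurable
  also have "\<dots> \<le> (\<integral>\<^sup>+w. ennreal ((2 * h) ^ (2 * CARD('n) + 1)) * indicator W w \<partial>lborel)"
  proof (rule nn_integral_mono)
    fix w :: "'n heis"
    have [measurable]: "{v. koranyi_dist (lift A v) w \<le> h} \<in> sets borel"
    proof -
      have "continuous_on UNIV (\<lambda>v. koranyi_dist (lift A v) w)"
        unfolding koranyi_dist_eq koranyi_norm_def lift_def by (intro continuous_intros)
      then show ?thesis by (intro borel_closed closed_Collect_le continuous_intros)
    qed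
    have "(\<integral>\<^sup>+v. indicator S v * indicator ?K (w, v) \<partial>M) \<le> (\<integral>\<^sup>+v. indicator W w * indicator {v. koranyi_dist (lift A v) w \<le> h} v \<partial>M)"
      using W by (intro nn_integral_mono) (auto simp: indicator_def)
    also have "\<dots> = indicator W w * emeasure M {v. koranyi_dist (lift A v) w \<le> h}"
      by (rule nn_integral_cmult_indicator) simp
    also have "\<dots> \<le> indicator W w * ennreal ((2 * h) ^ (2 * CARD('n) + 1))"
      by (intro mult_left_mono M_lift_ball_le h) simp
    finally show "(\<integral>\<^sup>+v. indicator S v * indicator ?K (w, v) \<partial>M) \<le> ennreal ((2 * h) ^ (2 * CARD('n) + 1)) * indicator W w"
      by (simp only: mult.commute)
  qed
  also have "\<dots> = ennreal ((2 * h) ^ (2 * CARD('n) + 1)) * emeasure lborel W"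
    by (rule nn_integral_cmult_indicator) simp
  finally show ?thesis .
qed

text \<open>All unit balls about points of \<open>E\<close> have mass one, and area is at most
  \<open>c\<close> times mass.\<close>
lemma surf_le_flat:
  assumes x: "x \<in> E" "hgrad A x \<noteq> 0" and u: "hgrad A u \<noteq> 0"
  shows "surf A (hgrad A u) 1 \<le> c"
proof -
  have "surf A (hgrad A u) 1 = emeasure lam (B 1 u)" by (simp add: harea_hball[OF A])
  also have "\<dots> \<le> c * emeasure M (B 1 u)" by (rule area_le_M_full[OF x compact_hball])
  also have "emeasure M (B 1 u) = 1" using unif[OF regular_subset[OF x u], of 1] by simp
  finally show ?thesis by simp
qed

end

section \<open>Sequences of graphs with concentrating measures\<close>

lemma eventually_neighbourhood:
  fixes F :: "nat \<Rightarrow> 'a::topological_space" and z :: "'b::metric_space"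
  assumes F: "F \<longlonglongrightarrow> a" and P: "open P" "(a, z) \<in> P"
  obtains \<rho> where "\<rho> > 0" "eventually (\<lambda>i. \<forall>x\<in>cball z \<rho>. (F i, x) \<in> P) sequentially"
proof -
  obtain U V where "open U" "open V" "(a, z) \<in> U \<times> V" "U \<times> V \<subseteq> P" by (rule open_prod_elim[OF P])
  then have UV: "open U" "open V" "a \<in> U" "z \<in> V" "U \<times> V \<subseteq> P" by simp_all
  obtain \<rho> where \<rho>: "\<rho> > 0" "cball z \<rho> \<subseteq> V" using UV(2,4) open_contains_cball by blast
  have "eventually (\<lambda>i. F i \<in> U) sequentially" using F UV(1,3) by (rule topological_tendstoD)
  then have "eventually (\<lambda>i. \<forall>x\<in>cball z \<rho>. (F i, x) \<in> P) sequentially"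
    by eventually_elim (use \<rho> UV(5) in blast)
  then show ?thesis using that \<rho>(1) by blast
qed

text \<open>What a sequence of counterexamples would provide, stated without the measures: the bounds
  \<open>surf_le\<close> and \<open>vol\<close> from uniformity, and in \<open>small\<close> that
  the area of the unit ball concentrates near the hyperplanes orthogonal to \<open>m i\<close>.
  The factors \<open>s i\<close> keep the matrices bounded, so that a limit exists after passing
  to a subsequence; \<open>s0 > 0\<close> means that the matrices themselves stay bounded.\<close>
locale concentrating_sequence =
  fixes A :: "nat \<Rightarrow> real ^ ('n::finite + 'n) ^ ('n + 'n)" and m :: "nat \<Rightarrow> real ^ ('n + 'n)"
    and s :: "nat \<Rightarrow> real" and B :: "real ^ ('n + 'n) ^ ('n + 'n)" and d :: "real ^ ('n + 'n)" and s0 :: real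
    and g :: "real ^ ('n + 'n)"
  assumes sym: "\<And>i. transpose (A i) = A i" and unit_m: "\<And>i. norm (m i) = 1" and unit_g: "norm g = 1"
    and surf_le: "\<And>i u. hgrad (A i) u \<noteq> 0 \<Longrightarrow> surf (A i) (hgrad (A i) u) 1 \<le> cyl 0 g"
    and vol: "\<And>i h W. h > 0 \<Longrightarrow> W \<in> sets borel \<Longrightarrow>
        (\<And>v w. v \<in> hball (A i) 1 0 \<Longrightarrow> koranyi_dist (lift (A i) v) w \<le> h \<Longrightarrow> w \<in> W) \<Longrightarrow>
        ennreal (h\<^sup>2 * (h / 2) ^ (2 * CARD('n))) * emeasure lborel (cball (0::real ^ ('n + 'n)) 1)
          \<le> ennreal ((2 * h) ^ (2 * CARD('n) + 1)) * emeasure lborel W"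
    and small: "\<And>i C \<gamma>. compact C \<Longrightarrow> C \<subseteq> hball (A i) 1 0 \<Longrightarrow> 0 \<le> \<gamma> \<Longrightarrow> (\<And>x. x \<in> C \<Longrightarrow> \<gamma> \<le> (m i \<bullet> x)\<^sup>2) \<Longrightarrow>
        ennreal \<gamma> * emeasure (harea (A i)) C \<le> cyl 0 g * ennreal (inverse (real (Suc i)))"
    and s_def: "\<And>i. s i = 1 / (1 + norm (A i))"
    and lim_m: "m \<longlonglongrightarrow> d" and lim_s: "s \<longlonglongrightarrow> s0" and lim_B: "(\<lambda>i. s i *\<^sub>R A i) \<longlonglongrightarrow> B"
begin

lemma s_pos: "s i > 0" unfolding s_def by (simp add: add_pos_nonneg)

lemma unit_d: "norm d = 1"
proof -
  have "(\<lambda>i. norm (m i)) \<longlonglongrightarrow> norm d" by (intro tendsto_norm lim_m)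
  then have "(\<lambda>i::nat. 1::real) \<longlonglongrightarrow> norm d" unfolding unit_m .
  then show ?thesis by (simp add: LIMSEQ_const_iff)
qed

lemma sym_B: "transpose B = B"
proof -
  have "(\<lambda>i. transpose (s i *\<^sub>R A i)) \<longlonglongrightarrow> transpose B"
    by (rule bounded_linear.tendsto[OF bounded_linear_transpose lim_B])
  then have "(\<lambda>i. s i *\<^sub>R A i) \<longlonglongrightarrow> transpose B" unfolding transpose_scalar sym .
  then show ?thesis using lim_B by (rule LIMSEQ_unique)
qed

lemma no_uniform_mass:
  assumes \<gamma>: "\<gamma> > 0" and V: "V > 0"
    and ev: "eventually (\<lambda>i. \<exists>C. compact C \<and> C \<subseteq> hball (A i) 1 0 \<and> (\<forall>x\<in>C. \<gamma> \<le> (m i \<bullet> x)\<^sup>2) \<and> V \<le> emeasure (harea (A i)) C) sequentially"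
  shows False
proof -
  have c: "cyl 0 g < top" using cyl_finite[OF unit_g, of 0] by simp
  have lim: "(\<lambda>i. cyl 0 g * ennreal (inverse (real (Suc i)))) \<longlonglongrightarrow> cyl 0 g * ennreal 0"
    by (intro ennreal_tendsto_cmult c tendsto_ennrealI LIMSEQ_inverse_real_of_nat)
  from ev have "eventually (\<lambda>i. ennreal \<gamma> * V \<le> cyl 0 g * ennreal (inverse (real (Suc i)))) sequentially"
  proof eventually_elim
    case (elim i)
    then obtain C where C: "compact C" "C \<subseteq> hball (A i) 1 0" "\<forall>x\<in>C. \<gamma> \<le> (m i \<bullet> x)\<^sup>2" "V \<le> emeasure (harea (A i)) C" by blast
    have "ennreal \<gamma> * V \<le> ennreal \<gamma> * emeasure (harea (A i)) C" by (intro mult_left_mono C) simp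
    also have "\<dots> \<le> cyl 0 g * ennreal (inverse (real (Suc i)))" using small[OF C(1,2)] C(3) \<gamma> by auto
    finally show ?case .
  qed
  then have "ennreal \<gamma> * V \<le> cyl 0 g * ennreal 0" by (intro tendsto_lowerbound[OF lim]) auto
  then show False using \<gamma> V by (simp add: ennreal_zero_less_mult_iff)
qed

text \<open>The matrices converge, and a small ball about a regular point of the limit that is not
  orthogonal to \<open>d\<close> keeps a definite area.\<close>
lemma bounded_impossible: assumes s0: "s0 > 0" shows False
proof -
  define A0 where "A0 = inverse s0 *\<^sub>R B"
  have lim_A: "A \<longlonglongrightarrow> A0"
  proof -
    have "(\<lambda>i. inverse (s i) *\<^sub>R (s i *\<^sub>R A i)) \<longlonglongrightarrow> inverse s0 *\<^sub>R B"
      using s0 by (intro tendsto_scaleR tendsto_inverse lim_s lim_B) auto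
    moreover have "inverse (s i) *\<^sub>R (s i *\<^sub>R A i) = A i" for i using s_pos[of i] by simp
    ultimately show ?thesis by (simp add: A0_def)
  qed
  have "transpose A0 = A0" unfolding A0_def transpose_scalar sym_B ..
  then obtain x where x: "hgrad A0 x \<noteq> 0" using hgrad_nonzero by blast
  have dd: "d \<bullet> d = 1" using unit_d by (simp add: dot_square_norm)
  obtain y where y: "hgrad A0 y \<noteq> 0" "d \<bullet> y \<noteq> 0"
  proof (cases "d \<bullet> x = 0")
    case True
    have "hgrad A0 (x + d) \<noteq> 0 \<or> hgrad A0 (x + (- 1) *\<^sub>R d) \<noteq> 0"
    proof (rule ccontr)
      assume "\<not> ?thesis"
      then have "hgrad A0 (x + d) + hgrad A0 (x + (- 1) *\<^sub>R d) = 0" by simp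
      then have "2 *\<^sub>R hgrad A0 x = 0" unfolding hgrad_add hgrad_scale by (simp add: scaleR_2)
      then show False using x by simp
    qed
    then show ?thesis
    proof
      assume "hgrad A0 (x + d) \<noteq> 0" then show ?thesis using that True dd by (simp add: inner_add_right)
    next
      assume "hgrad A0 (x + (- 1) *\<^sub>R d) \<noteq> 0" then show ?thesis using that[of "x + (- 1) *\<^sub>R d"] True dd by (simp add: inner_diff_right)
    qed
  qed (use x that in blast)
  define t where "t = 1 / (1 + norm y + \<bar>hgt A0 0 y\<bar>) / 2"
  have t: "t > 0" "t \<le> 1/2" by (auto simp: t_def field_simps add_pos_nonneg)
  have t1: "t * norm y \<le> 1/2" "t * \<bar>hgt A0 0 y\<bar> \<le> 1/2"
    by (auto simp: t_def field_simps add_pos_nonneg)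
  define z where "z = t *\<^sub>R y"
  have z1: "hgrad A0 z \<noteq> 0" "d \<bullet> z \<noteq> 0" using y t by (auto simp: z_def hgrad_scale)
  have z2: "norm z ^ 4 + (hgt A0 0 z)\<^sup>2 < 1"
  proof -
    have "norm z ^ 4 \<le> (1/2) ^ 4" using t1 t by (intro power_mono) (auto simp: z_def)
    moreover have "hgt A0 0 z = t * (t * hgt A0 0 y)" by (simp add: z_def hgt_def matrix_vector_mult_scaleR)
    then have "\<bar>hgt A0 0 z\<bar> = t * (t * \<bar>hgt A0 0 y\<bar>)" using t by (simp add: abs_mult)
    then have "\<bar>hgt A0 0 z\<bar> \<le> (1/2) * (1/2)" using t1 t by (simp only:) (intro mult_mono, auto)
    then have "\<bar>hgt A0 0 z\<bar>\<^sup>2 \<le> (1/4)\<^sup>2" by (intro power_mono) auto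
    ultimately show ?thesis by (simp add: power2_eq_square power4_eq_xxxx)
  qed
  define \<gamma> where "\<gamma> = (d \<bullet> z)\<^sup>2 / 2"
  define \<kappa> where "\<kappa> = norm (hgrad A0 z) / 2"
  have gk: "\<gamma> > 0" "\<kappa> > 0" using z1 by (auto simp: \<gamma>_def \<kappa>_def)
  let ?P = "{((A', m'), x). norm x ^ 4 + (hgt A' 0 x)\<^sup>2 < 1} \<inter> {((A', m'), x). \<gamma> < (m' \<bullet> x)\<^sup>2} \<inter> {((A', m'), x). \<kappa> < norm (hgrad A' x)}
    :: (((real ^ ('n + 'n) ^ ('n + 'n)) \<times> (real ^ ('n + 'n))) \<times> (real ^ ('n + 'n))) set"
  have oP: "open ?P"
    unfolding case_prod_beta hgt_def hgrad_def by (intro open_Int open_Collect_less continuous_intros)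
  have inP: "((A0, d), z) \<in> ?P"
    using z1 z2 by (simp add: \<gamma>_def \<kappa>_def)
  obtain \<rho> where \<rho>: "\<rho> > 0" "eventually (\<lambda>i. \<forall>x\<in>cball z \<rho>. ((A i, m i), x) \<in> ?P) sequentially"
    using eventually_neighbourhood[OF tendsto_Pair[OF lim_A lim_m] oP inP] by blast
  let ?V = "ennreal \<kappa> * emeasure lborel (cball z \<rho>)"
  show False
  proof (rule no_uniform_mass[OF gk(1)])
    have "0 < emeasure lborel (cball z \<rho>)"
      using \<rho>(1) by (simp add: emeasure_cball unit_ball_vol_pos ennreal_zero_less_mult_iff)
    then show "?V > 0" using gk by (simp add: ennreal_zero_less_mult_iff)
    from \<rho>(2) show "eventually (\<lambda>i. \<exists>C. compact C \<and> C \<subseteq> hball (A i) 1 0 \<and> (\<forall>x\<in>C. \<gamma> \<le> (m i \<bullet> x)\<^sup>2) \<and> ?V \<le> emeasure (harea (A i)) C) sequentially"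
    proof eventually_elim
      case (elim i)
      show ?case
      proof (intro exI[of _ "cball z \<rho>"] conjI)
        show "cball z \<rho> \<subseteq> hball (A i) 1 0"
          using elim by (auto simp: hball_def gdist_le_iff[OF sym] hgt_def hgrad_def intro: less_imp_le)
        show "\<forall>x\<in>cball z \<rho>. \<gamma> \<le> (m i \<bullet> x)\<^sup>2" using elim by (auto intro: less_imp_le)
        have "?V = (\<integral>\<^sup>+x. ennreal \<kappa> * indicator (cball z \<rho>) x \<partial>lborel)" by (rule nn_integral_cmult_indicator[symmetric]) simp
        also have "\<dots> \<le> (\<integral>\<^sup>+x. indicator (cball z \<rho>) x * ennreal (norm (hgrad (A i) x)) \<partial>lborel)"
        proof (rule nn_integral_mono)
          fix x
          show "ennreal \<kappa> * indicator (cball z \<rho>) x \<le> indicator (cball z \<rho>) x * ennreal (norm (hgrad (A i) x))"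
          proof (cases "x \<in> cball z \<rho>")
            case True
            then have "\<kappa> \<le> norm (hgrad (A i) x)" using elim by (auto intro: less_imp_le)
            then show ?thesis using True by (simp add: ennreal_leI)
          qed simp
        qed
        finally show "?V \<le> emeasure (harea (A i)) (cball z \<rho>)" by (simp add: emeasure_harea)
      qed simp
    qed
  qed
qed

section \<open>Unbounded sequences: the rescaled limit\<close>


abbreviation Bn :: "nat \<Rightarrow> real ^ ('n + 'n) ^ ('n + 'n)" where "Bn i \<equiv> s i *\<^sub>R A i"

lemma A_mv: "A i *v x = inverse (s i) *\<^sub>R (Bn i *v x)"
  using s_pos[of i] by (simp add: scaleR_matrix_vector_assoc[symmetric])

lemma hgt_A: "hgt (A i) 0 x = (x \<bullet> (Bn i *v x)) / s i"
  by (simp add: hgt_def A_mv divide_inverse mult.commute)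

lemma s_eventually_small: assumes "s0 = 0" "k > 0" shows "eventually (\<lambda>i. s i \<le> k) sequentially"
proof -
  have "eventually (\<lambda>i. s i < k) sequentially" using lim_s assms by (intro order_tendstoD(2)) auto
  then show ?thesis by eventually_elim simp
qed

lemma norm_B: assumes "s0 = 0" shows "norm B = 1"
proof -
  have "norm (Bn i) = 1 - s i" for i
  proof -
    have "1 + norm (A i) > 0" by (simp add: add_pos_nonneg)
    then show ?thesis by (simp add: s_def field_simps)
  qed
  then have "(\<lambda>i. 1 - s i) \<longlonglongrightarrow> norm B" using tendsto_norm[OF lim_B] by simp
  moreover have "(\<lambda>i. 1 - s i) \<longlonglongrightarrow> 1 - 0" using assms lim_s by (intro tendsto_intros) auto
  ultimately show ?thesis using LIMSEQ_unique by force
qed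

text \<open>Otherwise \<open>hgt (A i) 0\<close> vanishes near \<open>z\<close> and is steep there, so a
  sheet of the unit ball passes near \<open>z\<close>. The volume of a sheet is of the order of
  the inverse slope, while the density of its area is of the order of the slope, so its area stays
  bounded below.\<close>
lemma null_point_small:
  assumes s0: "s0 = 0" and z: "z \<bullet> (B *v z) = 0" "B *v z \<noteq> 0" "norm z < 1/2"
  shows "d \<bullet> z = 0"
proof (rule ccontr)
  assume dz: "d \<bullet> z \<noteq> 0"
  define f where "f = (B *v z) /\<^sub>R norm (B *v z)"
  have f: "norm f = 1" using z by (simp add: f_def)
  have ff: "f \<bullet> f = 1" using f by (simp add: dot_square_norm)
  define \<kappa> where "\<kappa> = norm (B *v z) / 2"
  have fBz: "f \<bullet> (B *v z) = 2 * \<kappa>" using z by (simp add: f_def \<kappa>_def dot_square_norm power2_eq_square)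
  define \<gamma> where "\<gamma> = (d \<bullet> z)\<^sup>2 / 2"
  have gk: "\<gamma> > 0" "\<kappa> > 0" using z dz by (auto simp: \<gamma>_def \<kappa>_def)
  let ?P1 = "{((A', m'), x). \<kappa> < f \<bullet> (A' *v x)} \<inter> {((A', m'), x). \<gamma> < (m' \<bullet> x)\<^sup>2} \<inter> {((A', m'), x). norm x < 1/2}
    :: (((real ^ ('n + 'n) ^ ('n + 'n)) \<times> (real ^ ('n + 'n))) \<times> (real ^ ('n + 'n))) set"
  have oP1: "open ?P1" unfolding case_prod_beta by (intro open_Int open_Collect_less continuous_intros)
  have inP1: "((B, d), z) \<in> ?P1" using z gk fBz dz by (simp add: \<gamma>_def)
  obtain \<rho>1 where \<rho>1: "\<rho>1 > 0" "eventually (\<lambda>i. \<forall>x\<in>cball z \<rho>1. ((Bn i, m i), x) \<in> ?P1) sequentially"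
    using eventually_neighbourhood[OF tendsto_Pair[OF lim_B lim_m] oP1 inP1] by blast
  \<comment> \<open>First a radius on which the slope is bounded below, then a smaller one across the direction \<open>f\<close> on which the height at the level of \<open>z\<close> is small compared with slope times radius.\<close>
  define \<rho> where "\<rho> = \<rho>1 / 2"
  have \<rho>: "\<rho> > 0" using \<rho>1 by (simp add: \<rho>_def)
  let ?P2 = "{((A', m'), x). \<bar>x \<bullet> (A' *v x)\<bar> < \<kappa> * \<rho>} :: (((real ^ ('n + 'n) ^ ('n + 'n)) \<times> (real ^ ('n + 'n))) \<times> (real ^ ('n + 'n))) set"
  have oP2: "open ?P2" unfolding case_prod_beta by (intro open_Collect_less continuous_intros)
  have inP2: "((B, d), z) \<in> ?P2" using z gk \<rho> by simp
  obtain \<rho>2 where \<rho>2: "\<rho>2 > 0" "eventually (\<lambda>i. \<forall>x\<in>cball z \<rho>2. ((Bn i, m i), x) \<in> ?P2) sequentially"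
    using eventually_neighbourhood[OF tendsto_Pair[OF lim_B lim_m] oP2 inP2] by blast
  define \<rho>' where "\<rho>' = min \<rho> \<rho>2"
  have \<rho>': "\<rho>' > 0" "\<rho>' \<le> \<rho>" "\<rho>' \<le> \<rho>2" using \<rho> \<rho>2 by (auto simp: \<rho>'_def)
  define Y where "Y = {y. norm (y - perp f z) \<le> \<rho>'}"
  have Y[measurable]: "Y \<in> sets borel" unfolding Y_def by measurable
  have split: "x - z = (perp f x - perp f z) + (f \<bullet> x - f \<bullet> z) *\<^sub>R f" for x
    by (simp add: perp_def algebra_simps)
  have near: "norm (x - z) \<le> norm (perp f x - perp f z) + \<bar>f \<bullet> x - f \<bullet> z\<bar>" for x
    unfolding split[of x] using norm_triangle_ineq[of "perp f x - perp f z" "(f \<bullet> x - f \<bullet> z) *\<^sub>R f"] f by simp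
  have near1: "x \<in> cball z \<rho>1" if "perp f x \<in> Y" "\<bar>f \<bullet> x - f \<bullet> z\<bar> \<le> \<rho>" for x
    using near[of x] that \<rho>'(2) by (simp add: Y_def \<rho>_def dist_norm norm_minus_commute)
  let ?S = "{y. 0 \<le> f \<bullet> y \<and> f \<bullet> y \<le> 1}"
  let ?V0 = "\<integral>\<^sup>+y. indicator ?S y * (indicator Y (perp f y) * ennreal (2 * (1/2))) \<partial>lborel"
  have V0: "?V0 > 0"
  proof -
    let ?U = "{y. 0 < f \<bullet> y} \<inter> {y. f \<bullet> y < 1} \<inter> {y. norm (perp f y - perp f z) < \<rho>'}"
    have "open ?U" unfolding perp_def by (intro open_Int open_Collect_less continuous_intros)
    moreover have "perp f z + (1/2) *\<^sub>R f \<in> ?U"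
      using \<rho>' perp_shift[OF f, of "perp f z" "1/2"] perp_shift[OF f, of z "- (f \<bullet> z)"]
      by (simp add: inner_add_right ff) (simp add: perp_def inner_diff_right ff)
    ultimately obtain e where e: "e > 0" "cball (perp f z + (1/2) *\<^sub>R f) e \<subseteq> ?U" by (meson open_contains_cball)
    have "0 < emeasure lborel (cball (perp f z + (1/2) *\<^sub>R f) e)"
      using e(1) by (simp add: emeasure_cball unit_ball_vol_pos ennreal_zero_less_mult_iff)
    also have "\<dots> = (\<integral>\<^sup>+y. indicator (cball (perp f z + (1/2) *\<^sub>R f) e) y \<partial>lborel)" by simp
    also have "\<dots> \<le> ?V0" using e(2) by (intro nn_integral_mono) (auto simp: indicator_def Y_def)
    finally show ?thesis .
  qed
  let ?V = "ennreal (1/2) * ?V0"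
  have "0 < ennreal (1/2)" by (simp only: ennreal_less_zero_iff)
  then have Vpos: "?V > 0" using V0 unfolding ennreal_zero_less_mult_iff by blast
  show False
  proof (rule no_uniform_mass[OF gk(1) Vpos])
    have "2 * (\<kappa> * \<rho>) > 0" using gk \<rho> by simp
    from \<rho>1(2) \<rho>2(2) s_eventually_small[OF s0 gk(2)] s_eventually_small[OF s0 this]
    show "eventually (\<lambda>i. \<exists>C. compact C \<and> C \<subseteq> hball (A i) 1 0 \<and> (\<forall>x\<in>C. \<gamma> \<le> (m i \<bullet> x)\<^sup>2) \<and> ?V \<le> emeasure (harea (A i)) C) sequentially"
    proof eventually_elim
      case (elim i)
      note sl = elim(4)
      have i1: "\<kappa> < f \<bullet> (Bn i *v x)" "\<gamma> < (m i \<bullet> x)\<^sup>2" "norm x < 1/2" if "x \<in> cball z \<rho>1" for x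
        using elim(1) that by auto
      have i2: "\<bar>x \<bullet> (Bn i *v x)\<bar> < \<kappa> * \<rho>" if "x \<in> cball z \<rho>2" for x
        using elim(2) that by auto
      have fA: "f \<bullet> (A i *v x) \<ge> \<kappa> / s i" if "x \<in> cball z \<rho>1" for x
        using i1(1)[OF that] s_pos[of i] by (simp add: A_mv field_simps)
      have ks: "\<kappa> * \<rho> / s i \<ge> 1/2" using sl s_pos[of i] by (simp add: pos_le_divide_eq)
      have k1: "\<kappa> / s i \<ge> 1" using elim(3) s_pos[of i] by (simp add: pos_le_divide_eq)
      let ?C = "{x. \<bar>f \<bullet> x - f \<bullet> z\<bar> \<le> \<rho> \<and> norm (perp f x - perp f z) \<le> \<rho>' \<and> \<bar>hgt (A i) 0 x\<bar> \<le> 1/2}"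
      have C1: "x \<in> cball z \<rho>1" if "x \<in> ?C" for x using that near1 by (auto simp: Y_def)
      have Ccl: "closed ?C" unfolding perp_def hgt_def by (intro closed_Collect_conj closed_Collect_le continuous_intros)
      have Ccomp: "compact ?C"
        unfolding compact_eq_bounded_closed using Ccl C1 bounded_subset[OF bounded_cball, of ?C z \<rho>1] by blast
      have Chb: "?C \<subseteq> hball (A i) 1 0"
      proof
        fix x assume x: "x \<in> ?C"
        have "norm x ^ 4 \<le> (1/2) ^ 4" using i1(3)[OF C1[OF x]] by (intro power_mono) auto
        moreover have "\<bar>hgt (A i) 0 x\<bar>\<^sup>2 \<le> (1/2)\<^sup>2" using x by (intro power_mono) auto
        ultimately have "norm x ^ 4 + (hgt (A i) 0 x)\<^sup>2 \<le> 1" by (simp add: power2_eq_square power4_eq_xxxx)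
        moreover have "hgrad (A i) 0 = 0" by (simp add: hgrad_def)
        ultimately show "x \<in> hball (A i) 1 0" by (simp add: hball_def gdist_le_iff[OF sym])
      qed
      have "?V \<le> (\<integral>\<^sup>+x. indicator {x \<in> ?C. \<bar>f \<bullet> x - f \<bullet> z\<bar> \<le> \<rho>} x * ennreal (norm (hgrad (A i) x)) \<partial>lborel)"
      proof (rule sheet_lower[where p = "hgt (A i) 0" and p' = "\<lambda>y. 2 * (f \<bullet> (A i *v y)) + 0 \<bullet> f" and w = "\<lambda>_. 1/2" and Y = Y])
        show "continuous_on UNIV (\<lambda>y. 2 * (f \<bullet> (A i *v y)) + 0 \<bullet> f)" by (intro continuous_intros)
        show "((\<lambda>t. hgt (A i) 0 (y + t *\<^sub>R f)) has_real_derivative 2 * (f \<bullet> (A i *v y)) + 0 \<bullet> f) (at 0)" for y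
          by (rule hgt_deriv[OF sym])
        show "?C \<in> sets borel" using Ccl by (rule borel_closed)
        fix x assume x: "perp f x \<in> Y"
        { assume x2: "\<bar>f \<bullet> x - f \<bullet> z\<bar> \<le> \<rho>"
          have xc: "x \<in> cball z \<rho>1" by (rule near1[OF x x2])
          have "f \<bullet> (A i *v x) \<ge> 1" using fA[OF xc] k1 by linarith
          moreover have "norm (hgrad (A i) x) \<ge> f \<bullet> hgrad (A i) x"
            using Cauchy_Schwarz_ineq2[of f "hgrad (A i) x"] f by simp
          moreover have "f \<bullet> hgrad (A i) x = 2 * (f \<bullet> (A i *v x)) + 2 * (f \<bullet> (sympl_J *v x))"
            by (simp add: hgrad_def inner_add_right)
          moreover have "\<bar>f \<bullet> (sympl_J *v x)\<bar> \<le> 1/2"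
            using Cauchy_Schwarz_ineq2[of f "sympl_J *v x"] f i1(3)[OF xc] by (simp add: sympl_J_norm)
          ultimately show "0 \<le> 2 * (f \<bullet> (A i *v x)) + 0 \<bullet> f \<and> 1/2 * (2 * (f \<bullet> (A i *v x)) + 0 \<bullet> f) \<le> norm (hgrad (A i) x)"
            by simp
          assume "\<bar>hgt (A i) 0 x\<bar> \<le> 1/2"
          then show "x \<in> ?C" using x x2 by (simp add: Y_def) }
        have edge: "v \<in> cball z \<rho>2 \<and> v \<in> cball z \<rho>1" if "f \<bullet> v = f \<bullet> z" "perp f v = perp f x" for v
          using near[of v] that x \<rho>' near1[of v] \<rho> by (simp add: Y_def dist_norm norm_minus_commute)
        { assume x2: "f \<bullet> x = f \<bullet> z - \<rho>"
          define v where "v = x + \<rho> *\<^sub>R f"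
          have v: "v \<in> cball z \<rho>2" "v \<in> cball z \<rho>1"
            using edge[of v] x2 by (auto simp: v_def inner_add_right ff perp_shift[OF f])
          have xc: "x \<in> cball z \<rho>1" by (rule near1[OF x]) (use x2 \<rho> in simp)
          have "x = v + (- \<rho>) *\<^sub>R f" by (simp add: v_def)
          then have e: "hgt (A i) 0 x = hgt (A i) 0 v + (- \<rho>) * (2 * (f \<bullet> (A i *v v)) + 0 \<bullet> f) + (- \<rho>)\<^sup>2 * (f \<bullet> (A i *v f))"
            using hgt_shift[OF sym] by metis
          have e2: "f \<bullet> (A i *v x) = f \<bullet> (A i *v v) - \<rho> * (f \<bullet> (A i *v f))"
            by (simp add: v_def algebra_simps inner_add_right)
          have "hgt (A i) 0 x = hgt (A i) 0 v - \<rho> * (f \<bullet> (A i *v v) + f \<bullet> (A i *v x))"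
            unfolding e e2 by (simp add: power2_eq_square algebra_simps)
          moreover have "\<rho> * (f \<bullet> (A i *v v) + f \<bullet> (A i *v x)) \<ge> \<rho> * (\<kappa> / s i + \<kappa> / s i)"
            using fA[OF v(2)] fA[OF xc] \<rho> by (intro mult_left_mono) auto
          moreover have "hgt (A i) 0 v \<le> \<kappa> * \<rho> / s i"
            unfolding hgt_A using i2[OF v(1)] s_pos[of i] by (intro divide_right_mono) auto
          ultimately have "hgt (A i) 0 x \<le> - (\<kappa> * \<rho> / s i)" by (simp add: algebra_simps)
          then show "hgt (A i) 0 x \<le> - (1/2)" using ks by linarith }
        { assume x2: "f \<bullet> x = f \<bullet> z + \<rho>"
          define v where "v = x + (- \<rho>) *\<^sub>R f"
          have v: "v \<in> cball z \<rho>2" "v \<in> cball z \<rho>1"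
            using edge[of v] x2 perp_shift[OF f, of x "- \<rho>"] by (auto simp: v_def inner_diff_right ff)
          have xc: "x \<in> cball z \<rho>1" by (rule near1[OF x]) (use x2 \<rho> in simp)
          have "x = v + \<rho> *\<^sub>R f" by (simp add: v_def)
          then have e: "hgt (A i) 0 x = hgt (A i) 0 v + \<rho> * (2 * (f \<bullet> (A i *v v)) + 0 \<bullet> f) + \<rho>\<^sup>2 * (f \<bullet> (A i *v f))"
            using hgt_shift[OF sym] by metis
          have e2: "f \<bullet> (A i *v x) = f \<bullet> (A i *v v) + \<rho> * (f \<bullet> (A i *v f))"
            by (simp add: v_def algebra_simps inner_diff_right)
          have "hgt (A i) 0 x = hgt (A i) 0 v + \<rho> * (f \<bullet> (A i *v v) + f \<bullet> (A i *v x))"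
            unfolding e e2 by (simp add: power2_eq_square algebra_simps)
          moreover have "\<rho> * (f \<bullet> (A i *v v) + f \<bullet> (A i *v x)) \<ge> \<rho> * (\<kappa> / s i + \<kappa> / s i)"
            using fA[OF v(2)] fA[OF xc] \<rho> by (intro mult_left_mono) auto
          moreover have "hgt (A i) 0 v \<ge> - (\<kappa> * \<rho>) / s i"
            unfolding hgt_A using i2[OF v(1)] s_pos[of i] by (intro divide_right_mono) auto
          ultimately have "hgt (A i) 0 x \<ge> \<kappa> * \<rho> / s i" by (simp add: algebra_simps)
          then show "1/2 \<le> hgt (A i) 0 x" using ks by linarith }
      next
        show "(\<lambda>y. 2 * (f \<bullet> (A i *v y)) + 0 \<bullet> f) \<in> borel_measurable borel" by measurable
        show "(\<lambda>x. norm (hgrad (A i) x)) \<in> borel_measurable borel" by measurable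
        show "0 \<le> \<rho>" using \<rho> by simp
      qed (use f in simp_all)
      also have "\<dots> \<le> (\<integral>\<^sup>+x. indicator ?C x * ennreal (norm (hgrad (A i) x)) \<partial>lborel)"
        by (intro nn_integral_mono) (auto simp: indicator_def)
      also have "\<dots> = emeasure (harea (A i)) ?C" by (rule emeasure_harea[OF borel_closed[OF Ccl], symmetric])
      finally have "?V \<le> emeasure (harea (A i)) ?C" .
      moreover have "\<forall>x\<in>?C. \<gamma> \<le> (m i \<bullet> x)\<^sup>2" using i1(2)[OF C1] by (auto intro: less_imp_le)
      ultimately show ?case using Ccomp Chb by blast
    qed
  qed
qed

lemma null_point:
  assumes s0: "s0 = 0" and z: "z \<bullet> (B *v z) = 0" "B *v z \<noteq> 0"
  shows "d \<bullet> z = 0"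
proof -
  define t where "t = 1 / (4 * (1 + norm z))"
  have t: "t > 0" "t * norm z < 1/2" by (auto simp: t_def field_simps add_pos_nonneg)
  have "d \<bullet> (t *\<^sub>R z) = 0"
    by (rule null_point_small[OF s0]) (use z t in \<open>simp_all add: matrix_vector_mult_scaleR\<close>)
  then show ?thesis using t by simp
qed

text \<open>An indefinite form takes both signs on the half space \<open>d \<bullet> x > 0\<close>. The
  segment between two such points contains a null point, and it is outside the kernel of
  \<open>B\<close>, since on a segment through a kernel point the form has a constant sign. This
  contradicts \<open>null_point\<close>.\<close>
lemma B_semidefinite:
  assumes s0: "s0 = 0"
  shows "(\<forall>x. x \<bullet> (B *v x) \<ge> 0) \<or> (\<forall>x. x \<bullet> (B *v x) \<le> 0)"
proof (rule ccontr)
  let ?Q = "\<lambda>x. x \<bullet> (B *v x)"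
  assume "\<not> ?thesis"
  then obtain x0 y0 where xy: "?Q x0 < 0" "?Q y0 > 0" by (auto simp: not_le)
  have dd: "d \<bullet> d = 1" using unit_d by (simp add: dot_square_norm)
  have Qm: "?Q (- x) = ?Q x" for x using matrix_vector_mult_scaleR[of B "-1" x] by simp
  have perturb: "\<exists>y. \<sigma> * ?Q y > 0 \<and> d \<bullet> y > 0" if x: "\<sigma> * ?Q x > 0" for \<sigma> x
  proof (cases "d \<bullet> x = 0")
    case True
    let ?h = "\<lambda>t. \<sigma> * ?Q (x + t *\<^sub>R d)"
    have "continuous_on UNIV ?h" by (intro continuous_intros)
    then have "isCont ?h 0" by (simp add: continuous_on_eq_continuous_at)
    then have "eventually (\<lambda>t. ?h t > 0) (at 0)" using x by (intro order_tendstoD(1)[of ?h "?h 0"]) (auto simp: isCont_def)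
    then obtain e where e: "e > 0" "\<And>t. t \<noteq> 0 \<Longrightarrow> dist t 0 < e \<Longrightarrow> ?h t > 0" unfolding eventually_at by auto
    have "?h (e/2) > 0" using e by (intro e(2)) auto
    moreover have "d \<bullet> (x + (e/2) *\<^sub>R d) > 0" using True e dd by (simp add: inner_add_right)
    ultimately show ?thesis by blast
  next
    case False
    then show ?thesis
    proof (cases "d \<bullet> x > 0")
      case True then show ?thesis using x by blast
    next
      case F: False
      then have "d \<bullet> (- x) > 0" using False by simp
      moreover have "\<sigma> * ?Q (- x) > 0" using x Qm by simp
      ultimately show ?thesis by blast
    qed
  qed
  obtain x where x: "?Q x < 0" "d \<bullet> x > 0" using perturb[of "-1" x0] xy by auto
  obtain y where y: "?Q y > 0" "d \<bullet> y > 0" using perturb[of 1 y0] xy by auto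
  define \<gamma> where "\<gamma> t = x + t *\<^sub>R (y - x)" for t :: real
  have "continuous_on {0..1} (\<lambda>t. ?Q (\<gamma> t))" unfolding \<gamma>_def by (intro continuous_intros)
  then have "\<exists>t. 0 \<le> t \<and> t \<le> 1 \<and> ?Q (\<gamma> t) = 0"
    using x y by (intro IVT') (auto simp: \<gamma>_def)
  then obtain t where t: "0 \<le> t" "t \<le> 1" "?Q (\<gamma> t) = 0" by blast
  have dt: "d \<bullet> \<gamma> t > 0"
  proof -
    have e: "d \<bullet> \<gamma> t = (1 - t) * (d \<bullet> x) + t * (d \<bullet> y)" by (simp add: \<gamma>_def inner_add_right inner_diff_right algebra_simps)
    show ?thesis
    proof (cases "t = 1")
      case True then show ?thesis unfolding e using y by simp
    next
      case False
      then have "(1 - t) * (d \<bullet> x) > 0" using t x by (intro mult_pos_pos) auto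
      moreover have "t * (d \<bullet> y) \<ge> 0" using t y by (intro mult_nonneg_nonneg) auto
      ultimately show ?thesis unfolding e by linarith
    qed
  qed
  have "B *v \<gamma> t \<noteq> 0"
  proof
    assume B0: "B *v \<gamma> t = 0"
    have q: "?Q (\<gamma> t + h *\<^sub>R (y - x)) = h\<^sup>2 * ?Q (y - x)" for h
      using symmetric_matrix_swap[OF sym_B, of "\<gamma> t" "y - x"] B0
      by (simp add: matrix_vector_right_distrib matrix_vector_mult_scaleR inner_add_left inner_add_right power2_eq_square mult.assoc)
    have "x = \<gamma> t + (- t) *\<^sub>R (y - x)" "y = \<gamma> t + (1 - t) *\<^sub>R (y - x)" by (simp_all add: \<gamma>_def algebra_simps)
    then have "?Q x = (- t)\<^sup>2 * ?Q (y - x)" "?Q y = (1 - t)\<^sup>2 * ?Q (y - x)" using q by metis+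
    then have "(- t)\<^sup>2 * ?Q (y - x) < 0" "(1 - t)\<^sup>2 * ?Q (y - x) > 0" using x y by simp_all
    then show False by (simp add: mult_less_0_iff zero_less_mult_iff)
  qed
  then show False using null_point[OF s0 t(3)] dt by simp
qed

text \<open>Evaluate the semidefinite form at \<open>x - B x\<close> or \<open>x + B x\<close>, using that
  \<open>B\<close> has norm one.\<close>
lemma B_bound:
  assumes s0: "s0 = 0" shows "(norm (B *v x))\<^sup>2 \<le> \<bar>x \<bullet> (B *v x)\<bar>"
proof -
  let ?Q = "\<lambda>x. x \<bullet> (B *v x)"
  let ?y = "B *v x"
  have "\<bar>?Q ?y\<bar> \<le> norm ?y * norm (B *v ?y)" by (rule Cauchy_Schwarz_ineq2)
  also have "\<dots> \<le> norm ?y * (norm B * norm ?y)" by (intro mult_left_mono norm_matrix_vector_le) simp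
  finally have b: "\<bar>?Q ?y\<bar> \<le> (norm ?y)\<^sup>2" using norm_B[OF s0] by (simp add: power2_eq_square)
  have e: "?Q (x + h *\<^sub>R ?y) = ?Q x + 2 * h * (norm ?y)\<^sup>2 + h\<^sup>2 * ?Q ?y" for h
  proof -
    have "x \<bullet> (B *v ?y) = ?y \<bullet> ?y" by (rule symmetric_matrix_swap[OF sym_B])
    then show ?thesis unfolding power2_norm_eq_inner
      by (simp add: matrix_vector_right_distrib matrix_vector_mult_scaleR inner_add_left inner_add_right power2_eq_square algebra_simps)
  qed
  from B_semidefinite[OF s0] show ?thesis
  proof
    assume "\<forall>x. 0 \<le> ?Q x"
    then have "0 \<le> ?Q (x + (- 1) *\<^sub>R ?y)" by blast
    then show ?thesis unfolding e using b by simp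
  next
    assume "\<forall>x. ?Q x \<le> 0"
    then have "?Q (x + 1 *\<^sub>R ?y) \<le> 0" by blast
    then show ?thesis unfolding e using b by simp
  qed
qed

section \<open>Exclusion of every rescaled limit\<close>


text \<open>The unit ball of the graph collapses onto the kernel of \<open>B\<close>, which has codimension
  at least two. Its \<open>h\<close>-neighbourhood has volume at most of order
  \<open>h\<^sup>2\<close>, whereas uniformity demands at least order \<open>h\<close>.\<close>
lemma high_rank_impossible:
  assumes s0: "s0 = 0" and rank: "\<And>w. \<exists>x. \<forall>t. B *v x \<noteq> t *\<^sub>R w"
  shows False
proof -
  obtain a where a: "B *v a \<noteq> 0" using rank[of 0] by auto
  define e1 where "e1 = (B *v a) /\<^sub>R norm (B *v a)"
  have e1: "norm e1 = 1" using a by (simp add: e1_def)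
  obtain b where b: "\<And>t. B *v b \<noteq> t *\<^sub>R e1" using rank by blast
  define v2 where "v2 = perp e1 (B *v b)"
  have v2: "v2 \<noteq> 0" using b[of "e1 \<bullet> (B *v b)"] by (auto simp: v2_def perp_def)
  define e2 where "e2 = v2 /\<^sub>R norm v2"
  have e2: "norm e2 = 1" using v2 by (simp add: e2_def)
  have ee: "e1 \<bullet> e1 = 1" using e1 by (simp add: dot_square_norm)
  have o: "e1 \<bullet> e2 = 0" by (simp add: e2_def v2_def perp_def inner_diff_right ee)
  have sw: "(B *v c) \<bullet> x = c \<bullet> (B *v x)" for c x by (rule symmetric_matrix_swap[OF sym_B, symmetric])
  \<comment> \<open>Two orthonormal vectors in the range of \<open>B\<close>: the coordinates along them are controlled by \<open>B *v x\<close>.\<close>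
  define K1 where "K1 = norm a / norm (B *v a)"
  have b1: "\<bar>e1 \<bullet> x\<bar> \<le> K1 * norm (B *v x)" for x
  proof -
    have "e1 \<bullet> x = (a \<bullet> (B *v x)) / norm (B *v a)" by (simp add: e1_def sw divide_inverse mult.commute)
    then have "\<bar>e1 \<bullet> x\<bar> = \<bar>a \<bullet> (B *v x)\<bar> / norm (B *v a)" by simp
    also have "\<dots> \<le> (norm a * norm (B *v x)) / norm (B *v a)"
      by (intro divide_right_mono Cauchy_Schwarz_ineq2) simp
    finally show ?thesis by (simp add: K1_def)
  qed
  define K2 where "K2 = (norm b + \<bar>e1 \<bullet> (B *v b)\<bar> * K1) / norm v2"
  have b2: "\<bar>e2 \<bullet> x\<bar> \<le> K2 * norm (B *v x)" for x
  proof -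
    have "e2 \<bullet> x = (b \<bullet> (B *v x) - (e1 \<bullet> (B *v b)) * (e1 \<bullet> x)) / norm v2"
      by (simp add: e2_def v2_def perp_def inner_diff_left sw divide_inverse mult.commute)
    then have "\<bar>e2 \<bullet> x\<bar> = \<bar>b \<bullet> (B *v x) - (e1 \<bullet> (B *v b)) * (e1 \<bullet> x)\<bar> / norm v2" by simp
    also have "\<dots> \<le> (norm b * norm (B *v x) + \<bar>e1 \<bullet> (B *v b)\<bar> * (K1 * norm (B *v x))) / norm v2"
    proof (rule divide_right_mono)
      have "\<bar>(e1 \<bullet> (B *v b)) * (e1 \<bullet> x)\<bar> \<le> \<bar>e1 \<bullet> (B *v b)\<bar> * (K1 * norm (B *v x))"
        unfolding abs_mult by (intro mult_left_mono b1) simp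
      then show "\<bar>b \<bullet> (B *v x) - (e1 \<bullet> (B *v b)) * (e1 \<bullet> x)\<bar> \<le> norm b * norm (B *v x) + \<bar>e1 \<bullet> (B *v b)\<bar> * (K1 * norm (B *v x))"
        using Cauchy_Schwarz_ineq2[of b "B *v x"] by linarith
    qed simp
    finally show ?thesis by (simp add: K2_def algebra_simps)
  qed
  define K where "K = K1 + K2 + 1"
  have Kp: "K1 \<ge> 0" "K2 \<ge> 0" by (auto simp: K1_def K2_def)
  then have K: "K > 0" "K1 \<le> K" "K2 \<le> K" by (auto simp: K_def)
  define V where "V = measure lborel (cball (0::real ^ ('n + 'n)) 4)"
  define \<omega> where "\<omega> = measure lborel (cball (0::real ^ ('n + 'n)) 1)"
  have fV: "emeasure lborel (cball (0::real ^ ('n + 'n)) 4) = ennreal V" "emeasure lborel (cball (0::real ^ ('n + 'n)) 1) = ennreal \<omega>"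
    unfolding V_def \<omega>_def
    by (rule emeasure_eq_ennreal_measure, rule less_imp_neq, simp flip: infinity_ennreal_def, rule emeasure_bounded_finite, simp)+
  have \<omega>: "\<omega> > 0"
  proof -
    have "0 < emeasure lborel (cball (0::real ^ ('n + 'n)) 1)" by (simp add: emeasure_cball unit_ball_vol_pos)
    then show ?thesis unfolding fV by (simp add: ennreal_less_zero_iff)
  qed
  have V0: "V \<ge> 0" by (simp add: V_def)
  let ?m = "2 * CARD('n)"
  have key: "\<omega> / 2 ^ ?m \<le> (384 * V * 2 ^ ?m) * h" if h: "0 < h" "h \<le> 1" for h
  proof -
    define \<epsilon> where "\<epsilon> = (h / K)\<^sup>2 / 2"
    have \<epsilon>: "\<epsilon> > 0" using h K by (simp add: \<epsilon>_def)
    have "eventually (\<lambda>i. norm (Bn i - B) < \<epsilon>) sequentially"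
      using LIMSEQ_D[OF lim_B \<epsilon>] by (auto simp: eventually_sequentially)
    moreover note s_eventually_small[OF s0 \<epsilon>]
    ultimately have "eventually (\<lambda>i. norm (Bn i - B) < \<epsilon> \<and> s i \<le> \<epsilon>) sequentially" by eventually_elim simp
    then obtain i where i: "norm (Bn i - B) < \<epsilon>" "s i \<le> \<epsilon>" by (auto simp: eventually_sequentially)
    let ?W1 = "{y :: real ^ ('n + 'n). \<bar>e1 \<bullet> y\<bar> \<le> 2 * h \<and> \<bar>e2 \<bullet> y\<bar> \<le> 2 * h \<and> norm y \<le> 2}"
    have W1[measurable]: "?W1 \<in> sets borel" by measurable
    \<comment> \<open>The last coordinate is at most \<open>h\<^sup>2 + 1 + 2 * (1 * 2)\<close> in absolute value.\<close>
    let ?W = "?W1 \<times> {-6..6::real}"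
    have Wm: "?W \<in> sets borel" unfolding borel_prod[symmetric] by (intro pair_measureI) auto
    have "ennreal (h\<^sup>2 * (h / 2) ^ ?m) * emeasure lborel (cball (0::real ^ ('n + 'n)) 1) \<le> ennreal ((2 * h) ^ (?m + 1)) * emeasure lborel ?W"
    proof (rule vol[OF h(1) Wm])
      fix v w assume v: "v \<in> hball (A i) 1 0" and w: "koranyi_dist (lift (A i) v) w \<le> h"
      have "norm v ^ 4 + (hgt (A i) (hgrad (A i) 0) v)\<^sup>2 \<le> 1"
        using v by (simp add: hball_def gdist_le_iff[OF sym])
      moreover have "hgrad (A i) 0 = 0" by (simp add: hgrad_def)
      ultimately have hb: "norm v ^ 4 + (hgt (A i) 0 v)\<^sup>2 \<le> 1" by simp
      have "norm v ^ 4 \<le> 1" "(hgt (A i) 0 v)\<^sup>2 \<le> 1"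
        using hb zero_le_power2[of "hgt (A i) 0 v"] zero_le_power[OF norm_ge_zero, of v 4] by linarith+
      then have nv: "norm v \<le> 1" and hv: "\<bar>hgt (A i) 0 v\<bar> \<le> 1"
        by (simp_all add: power_le_one_iff abs_square_le_1)
      have "\<bar>v \<bullet> (Bn i *v v)\<bar> \<le> s i" using hv s_pos[of i] unfolding hgt_A by (simp add: pos_divide_le_eq)
      moreover have "\<bar>v \<bullet> ((Bn i - B) *v v)\<bar> \<le> \<epsilon>"
      proof -
        have "\<bar>v \<bullet> ((Bn i - B) *v v)\<bar> \<le> norm v * (norm (Bn i - B) * norm v)"
          by (rule order_trans[OF Cauchy_Schwarz_ineq2]) (intro mult_left_mono norm_matrix_vector_le, simp)
        also have "\<dots> \<le> 1 * (\<epsilon> * 1)" using nv i \<epsilon> by (intro mult_mono) auto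
        finally show ?thesis by simp
      qed
      moreover have "v \<bullet> (B *v v) = v \<bullet> (Bn i *v v) - v \<bullet> ((Bn i - B) *v v)"
        by (simp add: matrix_vector_mult_diff_rdistrib inner_diff_right)
      ultimately have "\<bar>v \<bullet> (B *v v)\<bar> \<le> 2 * \<epsilon>" using i(2) by linarith
      then have "(norm (B *v v))\<^sup>2 \<le> (h / K)\<^sup>2" using B_bound[OF s0, of v] by (simp add: \<epsilon>_def)
      then have Bv: "norm (B *v v) \<le> h / K" by (rule power2_le_imp_le) (use h K in simp)
      have e1v: "\<bar>e1 \<bullet> v\<bar> \<le> h" "\<bar>e2 \<bullet> v\<bar> \<le> h"
      proof -
        have "q * norm (B *v v) \<le> K * (h / K)" if "0 \<le> q" "q \<le> K" for q
          using that Bv K by (intro mult_mono) auto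
        then have "q * norm (B *v v) \<le> h" if "0 \<le> q" "q \<le> K" for q
          using that K by simp
        then show "\<bar>e1 \<bullet> v\<bar> \<le> h" "\<bar>e2 \<bullet> v\<bar> \<le> h"
          using b1[of v] b2[of v] K Kp order_trans by blast+
      qed
      obtain y \<tau> where yw: "w = (y, \<tau>)" by (cases w)
      let ?q = "(y - v, \<tau> - v \<bullet> (A i *v v) - 2 * (v \<bullet> (sympl_J *v y)))"
      have kq: "koranyi_norm ?q \<le> h" using w by (simp add: koranyi_dist_eq lift_def yw)
      have yv: "norm (y - v) \<le> h" using norm_fst_le_koranyi[of ?q] kq by simp
      have "\<bar>snd ?q\<bar> \<le> (koranyi_norm ?q)\<^sup>2" by (rule snd_le_koranyi)
      also have "\<dots> \<le> 1\<^sup>2" using kq h koranyi_norm_nonneg[of ?q] by (intro power_mono) auto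
      finally have tq: "\<bar>\<tau> - v \<bullet> (A i *v v) - 2 * (v \<bullet> (sympl_J *v y))\<bar> \<le> 1" by simp
      have ny: "norm y \<le> 2" using norm_triangle_ineq[of "y - v" v] yv nv h by simp
      have "\<bar>v \<bullet> (sympl_J *v y)\<bar> \<le> norm v * norm y" using Cauchy_Schwarz_ineq2[of v "sympl_J *v y"] by (simp add: sympl_J_norm)
      also have "\<dots> \<le> 1 * 2" using nv ny by (intro mult_mono) auto
      finally have "\<bar>\<tau>\<bar> \<le> 6" using tq hv by (simp add: hgt_def abs_le_iff)
      moreover have "\<bar>e \<bullet> y\<bar> \<le> 2 * h" if "\<bar>e \<bullet> v\<bar> \<le> h" "norm e = 1" for e
      proof -
        have "e \<bullet> y = e \<bullet> (y - v) + e \<bullet> v" by (simp add: inner_diff_right)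
        moreover have "\<bar>e \<bullet> (y - v)\<bar> \<le> h" using Cauchy_Schwarz_ineq2[of e "y - v"] that(2) yv by simp
        ultimately show ?thesis using that(1) by linarith
      qed
      ultimately show "w \<in> ?W" using ny e1v e1 e2 by (auto simp: yw abs_le_iff)
    qed
    also have "emeasure lborel ?W = emeasure lborel ?W1 * emeasure lborel {-6..6::real}"
      unfolding lborel_prod[symmetric] by (rule lborel.emeasure_pair_measure_Times) auto
    also have "\<dots> \<le> (ennreal (4 * (2 * h)\<^sup>2) * ennreal V) * ennreal 12"
      using codim_two_volume_le[OF e1 e2 o, of "2 * h"] h unfolding fV by (intro mult_mono) auto
    finally have "ennreal (h\<^sup>2 * (h / 2) ^ ?m) * ennreal \<omega> \<le> ennreal ((2 * h) ^ (?m + 1)) * ((ennreal (4 * (2 * h)\<^sup>2) * ennreal V) * ennreal 12)"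
      unfolding fV by (simp add: mult_left_mono)
    also have "\<dots> = ennreal ((2 * h) ^ (?m + 1) * (4 * (2 * h)\<^sup>2 * V * 12))"
      using h V0 by (simp only: ennreal_mult' zero_le_power mult_nonneg_nonneg less_imp_le zero_le_numeral)
    finally have "h\<^sup>2 * (h / 2) ^ ?m * \<omega> \<le> (2 * h) ^ (?m + 1) * (4 * (2 * h)\<^sup>2 * V * 12)"
      using h \<omega> V0 by (simp add: ennreal_mult'[symmetric] del: power_Suc power_add)
    then have "h\<^sup>2 * h ^ ?m * (\<omega> / 2 ^ ?m) \<le> h\<^sup>2 * h ^ ?m * ((384 * V * 2 ^ ?m) * h)"
      by (simp add: power_mult_distrib power_divide power2_eq_square mult_ac)
    moreover have "h\<^sup>2 * h ^ ?m > 0" using h by simp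
    ultimately show ?thesis by (simp only: mult_le_cancel_left_pos)
  qed
  have "\<omega> / 2 ^ ?m = 0"
  proof (rule zero_of_small[of 1])
    fix h :: real assume "0 < h" "h \<le> 1"
    then show "\<bar>\<omega> / 2 ^ ?m\<bar> \<le> (384 * V * 2 ^ ?m) * h" using key \<omega> by simp
  qed simp
  then show False using \<omega> by simp
qed

text \<open>Here \<open>B\<close> is a multiple of the projection to \<open>f\<close>. In the unit ball
  about the graph point over \<open>f / 4\<close> the rescaled height is close to \<open>\<kappa>
  * ((f \<bullet> z)\<^sup>2 + (f \<bullet> z) / 2)\<close>, with steep zeros at \<open>f
  \<bullet> z = 0\<close> and \<open>f \<bullet> z = - 1/2\<close>. The first sheet alone has
  almost the flat area \<open>cyl 0 f\<close>, and the second adds a definite amount: too much for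
  \<open>surf_le\<close>.\<close>
lemma rank_one_impossible:
  assumes s0: "s0 = 0" and w: "\<And>x. \<exists>t. B *v x = t *\<^sub>R w"
  shows False
proof -
  have B0: "B \<noteq> 0" using norm_B[OF s0] by auto
  have "w \<noteq> 0"
  proof
    assume "w = 0"
    then have "B *v x = 0" for x using w[of x] by auto
    then have "B = 0" by (metis matrix_eq matrix_vector_mult_0)
    then show False using B0 by simp
  qed
  define f where "f = w /\<^sub>R norm w"
  have f: "norm f = 1" using \<open>w \<noteq> 0\<close> by (simp add: f_def)
  have ff: "f \<bullet> f = 1" using f by (simp add: dot_square_norm)
  define \<kappa> where "\<kappa> = f \<bullet> (B *v f)"
  have par: "B *v x = (f \<bullet> (B *v x)) *\<^sub>R f" for x
  proof -
    obtain t where "B *v x = t *\<^sub>R w" using w by blast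
    then have "B *v x = (t * norm w) *\<^sub>R f" using \<open>w \<noteq> 0\<close> by (simp add: f_def)
    then show ?thesis by (simp add: ff)
  qed
  have Bx: "B *v x = (\<kappa> * (f \<bullet> x)) *\<^sub>R f" for x
  proof -
    have "f \<bullet> (B *v x) = (B *v f) \<bullet> x" by (rule symmetric_matrix_swap[OF sym_B])
    also have "\<dots> = \<kappa> * (f \<bullet> x)" by (subst par[of f]) (simp add: \<kappa>_def)
    finally show ?thesis by (subst par[of x]) simp
  qed
  have \<kappa>0: "\<kappa> \<noteq> 0"
  proof
    assume "\<kappa> = 0"
    then have "B *v x = 0" for x by (subst Bx) simp
    then have "B = 0" by (metis matrix_eq matrix_vector_mult_0)
    then show False using B0 by simp
  qed
  define \<sigma> where "\<sigma> = sgn \<kappa>"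
  have \<sigma>: "\<sigma> = 1 \<or> \<sigma> = -1" "- \<sigma> = 1 \<or> - \<sigma> = -1" "\<sigma> * \<kappa> = \<bar>\<kappa>\<bar>" "\<bar>\<sigma>\<bar> = 1" using \<kappa>0 by (auto simp: \<sigma>_def sgn_real_def)
  define k where "k = \<bar>\<kappa>\<bar>"
  have k: "k > 0" using \<kappa>0 by (simp add: k_def)
  have main: "ennreal \<theta> * (cyl \<eta> f + cyl (1/2 + \<eta>) f) \<le> cyl 0 g" if \<theta>: "0 \<le> \<theta>" "\<theta> < 1" and \<eta>: "0 < \<eta>" "\<eta> \<le> 1/16" for \<theta> \<eta>
  proof -
    \<comment> \<open>The first bound makes the height leave \<open>[-1, 1]\<close> at distance \<open>\<eta>\<close> from either zero, the second gives the slope that \<open>one_sheet_lower\<close> needs.\<close>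
    define \<epsilon> where "\<epsilon> = min (k * \<eta> / 80) (k * (1 - \<theta>) / 320)"
    have \<epsilon>: "\<epsilon> > 0" "\<epsilon> \<le> k * \<eta> / 80" "\<epsilon> \<le> k * (1 - \<theta>) / 320" using k \<eta> \<theta> by (auto simp: \<epsilon>_def)
    have "eventually (\<lambda>i. norm (Bn i - B) < \<epsilon>) sequentially"
      using LIMSEQ_D[OF lim_B \<epsilon>(1)] by (auto simp: eventually_sequentially)
    moreover note s_eventually_small[OF s0 \<epsilon>(1)]
    ultimately have "eventually (\<lambda>i. norm (Bn i - B) < \<epsilon> \<and> s i \<le> \<epsilon>) sequentially" by eventually_elim simp
    then obtain i where i: "norm (Bn i - B) < \<epsilon>" "s i \<le> \<epsilon>" by (auto simp: eventually_sequentially)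
    have si: "s i > 0" by (rule s_pos)
    define u where "u = (1/4) *\<^sub>R f"
    define b where "b = hgrad (A i) u"
    define E where "E = Bn i - B"
    have BE: "Bn i *v x = (\<kappa> * (f \<bullet> x)) *\<^sub>R f + E *v x" for x
      unfolding E_def matrix_vector_mult_diff_rdistrib Bx by simp
    have Eb: "\<bar>x \<bullet> (E *v y)\<bar> \<le> \<epsilon> * (norm x * norm y)" for x y
    proof -
      have "\<bar>x \<bullet> (E *v y)\<bar> \<le> norm x * (norm E * norm y)"
        by (rule order_trans[OF Cauchy_Schwarz_ineq2]) (intro mult_left_mono norm_matrix_vector_le, simp)
      also have "\<dots> \<le> norm x * (\<epsilon> * norm y)" using i by (intro mult_left_mono mult_right_mono) (auto simp: E_def)
      finally show ?thesis by (simp add: mult_ac)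
    qed
    have sb: "s i *\<^sub>R b = (\<kappa> / 2) *\<^sub>R f + (1/2) *\<^sub>R (E *v f) + (s i / 2) *\<^sub>R (sympl_J *v f)"
    proof -
      have "s i *\<^sub>R b = 2 *\<^sub>R (Bn i *v u + s i *\<^sub>R (sympl_J *v u))"
        by (simp add: b_def hgrad_def scaleR_right_distrib scaleR_matrix_vector_assoc mult.commute)
      also have "Bn i *v u = (1/4) *\<^sub>R (Bn i *v f)" unfolding u_def by (rule matrix_vector_mult_scaleR)
      also have "Bn i *v f = \<kappa> *\<^sub>R f + E *v f" unfolding BE by (simp add: ff)
      also have "sympl_J *v u = (1/4) *\<^sub>R (sympl_J *v f)" unfolding u_def by (rule matrix_vector_mult_scaleR)
      finally show ?thesis by (simp add: scaleR_right_distrib)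
    qed
    have hg: "\<bar>s i * hgt (A i) b z - \<kappa> * ((f \<bullet> z)\<^sup>2 + (f \<bullet> z) / 2)\<bar> \<le> 6 * \<epsilon>" if z: "norm z \<le> 2" for z
    proof -
      have "s i * hgt (A i) b z = z \<bullet> (Bn i *v z) + (s i *\<^sub>R b) \<bullet> z"
        using si by (simp add: hgt_def A_mv distrib_left)
      also have "\<dots> = \<kappa> * ((f \<bullet> z)\<^sup>2 + (f \<bullet> z) / 2) + (z \<bullet> (E *v z) + (z \<bullet> (E *v f)) / 2 + (s i / 2) * (z \<bullet> (sympl_J *v f)))"
        unfolding sb BE by (simp add: inner_add_left inner_add_right inner_commute power2_eq_square algebra_simps)
      finally have e: "s i * hgt (A i) b z - \<kappa> * ((f \<bullet> z)\<^sup>2 + (f \<bullet> z) / 2) = z \<bullet> (E *v z) + (z \<bullet> (E *v f)) / 2 + (s i / 2) * (z \<bullet> (sympl_J *v f))"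
        by simp
      have "norm z * norm z \<le> 2 * 2" using z by (intro mult_mono) auto
      then have "\<epsilon> * (norm z * norm z) \<le> \<epsilon> * 4" using \<epsilon> by (intro mult_left_mono) auto
      then have 1: "\<bar>z \<bullet> (E *v z)\<bar> \<le> 4 * \<epsilon>" using Eb[of z z] by linarith
      have "\<epsilon> * (norm z * norm f) \<le> \<epsilon> * 2" using \<epsilon> z f by (intro mult_left_mono) auto
      then have 2: "\<bar>z \<bullet> (E *v f)\<bar> \<le> 2 * \<epsilon>" using Eb[of z f] by linarith
      have "\<bar>z \<bullet> (sympl_J *v f)\<bar> \<le> 2" using Cauchy_Schwarz_ineq2[of z "sympl_J *v f"] z f by (simp add: sympl_J_norm)
      then have "\<bar>(s i / 2) * (z \<bullet> (sympl_J *v f))\<bar> \<le> (\<epsilon> / 2) * 2" unfolding abs_mult using i si by (intro mult_mono) auto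
      then show ?thesis unfolding e using 1 2 by linarith
    qed
    have gr: "\<bar>s i * (2 * (f \<bullet> (A i *v z)) + b \<bullet> f) - 2 * \<kappa> * (f \<bullet> z + 1/4)\<bar> \<le> 6 * \<epsilon>" if z: "norm z \<le> 2" for z
    proof -
      have "s i * (2 * (f \<bullet> (A i *v z)) + b \<bullet> f) = 2 * (f \<bullet> (Bn i *v z)) + (s i *\<^sub>R b) \<bullet> f"
        using si by (simp add: A_mv distrib_left)
      also have "\<dots> = 2 * \<kappa> * (f \<bullet> z + 1/4) + (2 * (f \<bullet> (E *v z)) + (f \<bullet> (E *v f)) / 2)"
        unfolding sb BE using sympl_J_self[of f] by (simp add: inner_add_left inner_add_right ff inner_commute algebra_simps)
      finally have e: "s i * (2 * (f \<bullet> (A i *v z)) + b \<bullet> f) - 2 * \<kappa> * (f \<bullet> z + 1/4) = 2 * (f \<bullet> (E *v z)) + (f \<bullet> (E *v f)) / 2"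
        by simp
      have "\<epsilon> * (norm f * norm z) \<le> \<epsilon> * 2" using \<epsilon> z f by (intro mult_left_mono) auto
      then have 1: "\<bar>f \<bullet> (E *v z)\<bar> \<le> 2 * \<epsilon>" using Eb[of f z] by linarith
      have 2: "\<bar>f \<bullet> (E *v f)\<bar> \<le> \<epsilon>" using Eb[of f f] f by simp
      show ?thesis unfolding e using 1 2 \<epsilon> by linarith
    qed
    have sgn_est: "\<tau> * x \<ge> \<tau> * y - 6 * \<epsilon>" "\<tau> * x \<le> \<tau> * y + 6 * \<epsilon>" if "\<bar>x - y\<bar> \<le> 6 * \<epsilon>" "\<tau> = 1 \<or> \<tau> = -1" for \<tau> x y :: real
      using that by (auto simp: abs_le_iff)
    have steep: "(1 - \<theta>) * (\<tau> * (2 * (f \<bullet> (A i *v z)) + b \<bullet> f)) \<ge> 4"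
      if z: "norm z \<le> 2" and \<tau>: "\<tau> = 1 \<or> \<tau> = -1" and ge: "\<tau> * (2 * \<kappa> * (f \<bullet> z + 1/4)) \<ge> k / 4" for \<tau> z
    proof -
      have "\<tau> * (s i * (2 * (f \<bullet> (A i *v z)) + b \<bullet> f)) \<ge> k / 4 - 6 * \<epsilon>" using sgn_est(1)[OF gr[OF z] \<tau>] ge by linarith
      moreover have "6 * \<epsilon> \<le> k / 8"
      proof -
        have "k * \<eta> \<le> k * 1" using k \<eta> by (intro mult_left_mono) auto
        then show ?thesis using \<epsilon>(2) k by linarith
      qed
      ultimately have "s i * (\<tau> * (2 * (f \<bullet> (A i *v z)) + b \<bullet> f)) \<ge> k / 8" by (simp add: mult.left_commute)
      then have 1: "(1 - \<theta>) * (s i * (\<tau> * (2 * (f \<bullet> (A i *v z)) + b \<bullet> f))) \<ge> (1 - \<theta>) * (k / 8)" using \<theta> by (intro mult_left_mono) auto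
      have "4 * s i \<le> (1 - \<theta>) * (k / 8)" using i(2) \<epsilon>(3) k \<theta> si by (simp add: algebra_simps)
      moreover have "(1 - \<theta>) * (s i * (\<tau> * (2 * (f \<bullet> (A i *v z)) + b \<bullet> f))) = s i * ((1 - \<theta>) * (\<tau> * (2 * (f \<bullet> (A i *v z)) + b \<bullet> f)))"
        by (rule mult.left_commute)
      ultimately have "s i * 4 \<le> s i * ((1 - \<theta>) * (\<tau> * (2 * (f \<bullet> (A i *v z)) + b \<bullet> f)))" using 1 by linarith
      then show ?thesis using si by (simp only: mult_le_cancel_left_pos)
    qed
    have up: "\<tau> * hgt (A i) b z \<ge> 1" if z: "norm z \<le> 2" and \<tau>: "\<tau> = 1 \<or> \<tau> = -1"
      and ge: "\<tau> * (\<kappa> * ((f \<bullet> z)\<^sup>2 + (f \<bullet> z) / 2)) \<ge> k * \<eta> / 4" for \<tau> z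
    proof -
      have "\<tau> * (s i * hgt (A i) b z) \<ge> k * \<eta> / 4 - 6 * \<epsilon>" using sgn_est(1)[OF hg[OF z] \<tau>] ge by linarith
      then have "\<tau> * (s i * hgt (A i) b z) \<ge> s i" using \<epsilon>(2) i(2) si by linarith
      then have "s i * (\<tau> * hgt (A i) b z) \<ge> s i * 1" by (simp add: mult.left_commute)
      then show ?thesis using si by (simp only: mult_le_cancel_left_pos)
    qed
    have down: "\<tau> * hgt (A i) b z \<le> - 1" if z: "norm z \<le> 2" and \<tau>: "\<tau> = 1 \<or> \<tau> = -1"
      and ge: "\<tau> * (\<kappa> * ((f \<bullet> z)\<^sup>2 + (f \<bullet> z) / 2)) \<le> - (k * \<eta> / 4)" for \<tau> z
    proof -
      have "(- \<tau>) * hgt (A i) b z \<ge> 1" by (rule up[OF z]) (use \<tau> ge in auto)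
      then show ?thesis by simp
    qed
    have kk: "\<sigma> * (\<kappa> * q) = k * q" "(- \<sigma>) * (\<kappa> * q) = - (k * q)" for q
      using \<sigma>(3) by (simp_all add: k_def mult.assoc[symmetric])
    have "\<eta> * \<eta> \<le> \<eta> * (1/16)" using \<eta> by (intro mult_left_mono) auto
    then have "\<eta> * (\<eta> - 1/2) \<le> - (\<eta> / 4)" "\<eta> / 4 \<le> \<eta> * (\<eta> + 1/2)"
      using \<eta> zero_le_square[of \<eta>] unfolding right_diff_distrib distrib_left by linarith+
    from this[THEN mult_left_mono, of k] k
    have "k * (\<eta> * (\<eta> - 1/2)) \<le> k * - (\<eta> / 4)" "k * (\<eta> / 4) \<le> k * (\<eta> * (\<eta> + 1/2))"
      by (simp_all only: less_imp_le)
    then have qm: "k * (\<eta> * (\<eta> - 1/2)) \<le> - (k * \<eta> / 4)" and qp: "k * \<eta> / 4 \<le> k * (\<eta> * (\<eta> + 1/2))"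
      by simp_all
    let ?G = "{z. norm z ^ 4 + (hgt (A i) b z)\<^sup>2 \<le> 1}"
    have s1: "ennreal \<theta> * cyl (\<bar>0\<bar> + \<eta>) f \<le> (\<integral>\<^sup>+z. indicator {z \<in> ?G. \<bar>f \<bullet> z - 0\<bar> \<le> \<eta>} z * ennreal (norm (b + hgrad (A i) z)) \<partial>lborel)"
    proof (rule one_sheet_lower[OF sym \<theta> \<sigma>(1)])
      fix z assume z: "norm (perp f z) \<le> 1"
      { assume fz: "\<bar>f \<bullet> z - 0\<bar> \<le> \<eta>"
        have zn: "norm z \<le> 2" by (rule norm_le_of_perp[OF f z]) (use fz \<eta> in linarith)
        have "k * (2 * (f \<bullet> z + 1/4)) \<ge> k * (1/4)" using k fz \<eta> by (intro mult_left_mono) auto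
        moreover have "\<sigma> * (2 * \<kappa> * (f \<bullet> z + 1/4)) = k * (2 * (f \<bullet> z + 1/4))" using kk(1)[of "2 * (f \<bullet> z + 1/4)"] by (simp add: mult_ac)
        ultimately show "(1 - \<theta>) * (\<sigma> * (2 * (f \<bullet> (A i *v z)) + b \<bullet> f)) \<ge> 4" by (intro steep[OF zn \<sigma>(1)]) linarith }
      { assume fz: "f \<bullet> z = 0 - \<eta>"
        have zn: "norm z \<le> 2" by (rule norm_le_of_perp[OF f z]) (use fz \<eta> in linarith)
        have sq: "(f \<bullet> z)\<^sup>2 + (f \<bullet> z) / 2 = \<eta> * (\<eta> - 1/2)" unfolding fz by (simp add: power2_eq_square field_simps)
        show "\<sigma> * hgt (A i) b z \<le> - 1" by (rule down[OF zn \<sigma>(1)]) (use qm in \<open>simp only: sq kk\<close>) }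
      { assume fz: "f \<bullet> z = 0 + \<eta>"
        have zn: "norm z \<le> 2" by (rule norm_le_of_perp[OF f z]) (use fz \<eta> in linarith)
        have sq: "(f \<bullet> z)\<^sup>2 + (f \<bullet> z) / 2 = \<eta> * (\<eta> + 1/2)" unfolding fz by (simp add: power2_eq_square field_simps)
        show "\<sigma> * hgt (A i) b z \<ge> 1" by (rule up[OF zn \<sigma>(1)]) (use qp in \<open>simp only: sq kk\<close>) }
    qed (use \<eta> f in auto)
    have s2: "ennreal \<theta> * cyl (\<bar>- 1/2\<bar> + \<eta>) f \<le> (\<integral>\<^sup>+z. indicator {z \<in> ?G. \<bar>f \<bullet> z - (- 1/2)\<bar> \<le> \<eta>} z * ennreal (norm (b + hgrad (A i) z)) \<partial>lborel)"
    proof (rule one_sheet_lower[OF sym \<theta> \<sigma>(2)])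
      fix z assume z: "norm (perp f z) \<le> 1"
      { assume fz: "\<bar>f \<bullet> z - (- 1/2)\<bar> \<le> \<eta>"
        have zn: "norm z \<le> 2" by (rule norm_le_of_perp[OF f z]) (use fz \<eta> in linarith)
        have "k * (- (2 * (f \<bullet> z + 1/4))) \<ge> k * (1/4)" using k fz \<eta> by (intro mult_left_mono) (auto simp: abs_le_iff)
        moreover have "(- \<sigma>) * (2 * \<kappa> * (f \<bullet> z + 1/4)) = k * (- (2 * (f \<bullet> z + 1/4)))"
        proof -
          have "2 * \<kappa> * q = \<kappa> * (2 * q)" for q by simp
          then show ?thesis unfolding kk by (simp only: kk mult_minus_right)
        qed
        ultimately show "(1 - \<theta>) * ((- \<sigma>) * (2 * (f \<bullet> (A i *v z)) + b \<bullet> f)) \<ge> 4" by (intro steep[OF zn \<sigma>(2)]) linarith }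
      { assume fz: "f \<bullet> z = - 1/2 - \<eta>"
        have zn: "norm z \<le> 2" by (rule norm_le_of_perp[OF f z]) (use fz \<eta> in linarith)
        have sq: "(f \<bullet> z)\<^sup>2 + (f \<bullet> z) / 2 = \<eta> * (\<eta> + 1/2)" unfolding fz by (simp add: power2_eq_square field_simps)
        show "(- \<sigma>) * hgt (A i) b z \<le> - 1" by (rule down[OF zn \<sigma>(2)]) (use qp in \<open>simp only: sq kk neg_le_iff_le\<close>) }
      { assume fz: "f \<bullet> z = - 1/2 + \<eta>"
        have zn: "norm z \<le> 2" by (rule norm_le_of_perp[OF f z]) (use fz \<eta> in linarith)
        have sq: "(f \<bullet> z)\<^sup>2 + (f \<bullet> z) / 2 = \<eta> * (\<eta> - 1/2)" unfolding fz by (simp add: power2_eq_square field_simps)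
        have "(- \<sigma>) * (\<kappa> * ((f \<bullet> z)\<^sup>2 + (f \<bullet> z) / 2)) = - (k * (\<eta> * (\<eta> - 1/2)))" unfolding sq by (rule kk(2))
        then have "(- \<sigma>) * (\<kappa> * ((f \<bullet> z)\<^sup>2 + (f \<bullet> z) / 2)) \<ge> k * \<eta> / 4" using qm by linarith
        then show "(- \<sigma>) * hgt (A i) b z \<ge> 1" by (rule up[OF zn \<sigma>(2)]) }
    qed (use \<eta> f in auto)
    have b0: "b \<noteq> 0"
    proof
      assume "b = 0"
      then have "\<bar>s i * hgt (A i) b (\<eta> *\<^sub>R f) - \<kappa> * (\<eta>\<^sup>2 + \<eta> / 2)\<bar> \<le> 6 * \<epsilon>" using hg[of "\<eta> *\<^sub>R f"] f \<eta> by (simp add: ff)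
      have "\<bar>s i * (2 * (f \<bullet> (A i *v 0)) + b \<bullet> f) - 2 * \<kappa> * (f \<bullet> 0 + 1/4)\<bar> \<le> 6 * \<epsilon>" by (rule gr) simp
      then have "k / 2 \<le> 6 * \<epsilon>" using \<open>b = 0\<close> by (simp add: k_def abs_mult)
      moreover have "k * \<eta> \<le> k * 1" using k \<eta> by (intro mult_left_mono) auto
      ultimately show False using \<epsilon>(2) k by linarith
    qed
    have G[measurable]: "?G \<in> sets borel" by measurable
    have "ennreal \<theta> * (cyl \<eta> f + cyl (1/2 + \<eta>) f) = ennreal \<theta> * cyl (\<bar>0\<bar> + \<eta>) f + ennreal \<theta> * cyl (\<bar>- 1/2\<bar> + \<eta>) f"
      by (simp add: distrib_left)
    also have "\<dots> \<le> (\<integral>\<^sup>+z. indicator {z \<in> ?G. \<bar>f \<bullet> z - 0\<bar> \<le> \<eta>} z * ennreal (norm (b + hgrad (A i) z)) \<partial>lborel)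
       + (\<integral>\<^sup>+z. indicator {z \<in> ?G. \<bar>f \<bullet> z - (- 1/2)\<bar> \<le> \<eta>} z * ennreal (norm (b + hgrad (A i) z)) \<partial>lborel)"
      by (rule add_mono[OF s1 s2])
    also have "\<dots> = (\<integral>\<^sup>+z. indicator {z \<in> ?G. \<bar>f \<bullet> z - 0\<bar> \<le> \<eta>} z * ennreal (norm (b + hgrad (A i) z))
       + indicator {z \<in> ?G. \<bar>f \<bullet> z - (- 1/2)\<bar> \<le> \<eta>} z * ennreal (norm (b + hgrad (A i) z)) \<partial>lborel)"
      by (rule nn_integral_add[symmetric]) measurable
    also have "\<dots> \<le> surf (A i) b 1"
      unfolding surf_def
    proof (rule nn_integral_mono)
      fix z
      have "\<not> (\<bar>f \<bullet> z - 0\<bar> \<le> \<eta> \<and> \<bar>f \<bullet> z - (- 1/2)\<bar> \<le> \<eta>)" using \<eta> by linarith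
      then show "indicator {z \<in> ?G. \<bar>f \<bullet> z - 0\<bar> \<le> \<eta>} z * ennreal (norm (b + hgrad (A i) z))
       + indicator {z \<in> ?G. \<bar>f \<bullet> z - (- 1/2)\<bar> \<le> \<eta>} z * ennreal (norm (b + hgrad (A i) z))
       \<le> indicator {z. norm z ^ 4 + (hgt (A i) b z)\<^sup>2 \<le> 1 ^ 4} z * ennreal (norm (b + hgrad (A i) z))"
        by (auto simp: indicator_def)
    qed
    also have "\<dots> \<le> cyl 0 g" using surf_le[of i u] b0 by (simp add: b_def)
    finally show ?thesis .
  qed
  have main2: "cyl \<eta> f + cyl (3/4) f \<le> cyl 0 f" if \<eta>: "0 < \<eta>" "\<eta> \<le> 1/16" for \<eta>
  proof (rule le_of_eps)
    fix \<epsilon> :: real assume \<epsilon>: "\<epsilon> > 0"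
    have "ennreal (1 / (1 + \<epsilon>)) * (cyl \<eta> f + cyl (3/4) f) \<le> ennreal (1 / (1 + \<epsilon>)) * (cyl \<eta> f + cyl (1/2 + \<eta>) f)"
      using \<eta> by (intro mult_left_mono add_left_mono cyl_antimono f) auto
    also have "\<dots> \<le> cyl 0 g" using \<epsilon> \<eta> by (intro main) auto
    also have "\<dots> = cyl 0 f" by (rule cyl_direction[OF unit_g f])
    finally have "ennreal (1 + \<epsilon>) * (ennreal (1 / (1 + \<epsilon>)) * (cyl \<eta> f + cyl (3/4) f)) \<le> ennreal (1 + \<epsilon>) * cyl 0 f"
      by (rule mult_left_mono) simp
    moreover have "ennreal (1 + \<epsilon>) * ennreal (1 / (1 + \<epsilon>)) = 1"
      using \<epsilon> by (subst ennreal_mult'[symmetric]) (auto simp del: ennreal_plus)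
    ultimately show "cyl \<eta> f + cyl (3/4) f \<le> ennreal (1 + \<epsilon>) * cyl 0 f" by (simp only: mult.assoc[symmetric] mult_1)
  qed
  define c where "c = enn2real (cyl 0 f)"
  define c' where "c' = enn2real (cyl (3/4) f)"
  have c: "cyl 0 f = ennreal c" "cyl (3/4) f = ennreal c'" "c' > 0" "c \<ge> 0"
    using cyl_finite[OF f, of 0] cyl_finite[OF f, of "3/4"] cyl_positive[OF f, of "3/4"]
    by (auto simp: c_def c'_def enn2real_positive_iff)
  have "c' \<le> c" using cyl_antimono[OF f, of 0 "3/4"] c by simp
  then have "ennreal (c - c' / 2) < cyl 0 f" using c by (simp add: ennreal_less_iff)
  from cyl_continuous_0[OF f this] obtain \<eta>0 where \<eta>0: "0 < \<eta>0" "ennreal (c - c' / 2) < cyl \<eta>0 f" by blast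
  define \<eta> where "\<eta> = min \<eta>0 (1/16)"
  have \<eta>: "0 < \<eta>" "\<eta> \<le> 1/16" "\<eta> \<le> \<eta>0" using \<eta>0 by (auto simp: \<eta>_def)
  have "ennreal (c - c' / 2) \<le> cyl \<eta> f"
    using \<eta>0(2) cyl_antimono[OF f, of \<eta> \<eta>0] \<eta> by (simp add: less_le_trans less_imp_le)
  then have "ennreal (c - c' / 2) + ennreal c' \<le> ennreal c"
    using main2[OF \<eta>(1,2)] c by (metis add_right_mono order_trans)
  then have "ennreal (c - c' / 2 + c') \<le> ennreal c" using \<open>c' \<le> c\<close> c by (subst ennreal_plus) auto
  then show False using c by (simp add: ennreal_le_iff)
qed

theorem no_such_sequence: False
proof -
  have "s0 \<ge> 0" by (rule LIMSEQ_le_const[OF lim_s]) (use s_pos in \<open>auto intro: less_imp_le\<close>)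
  then consider "s0 > 0" | "s0 = 0" by linarith
  then show False
  proof cases
    case 1 then show ?thesis by (rule bounded_impossible)
  next
    case 2
    show ?thesis
    proof (cases "\<exists>w. \<forall>x. \<exists>t. B *v x = t *\<^sub>R w")
      case True then show ?thesis using rank_one_impossible[OF 2] by blast
    next
      case False then show ?thesis using high_rank_impossible[OF 2] by blast
    qed
  qed
qed

end

section \<open>The lower bound\<close>

text \<open>Area is at most \<open>cyl 0 g\<close> times mass, and the mass is weighted by the moment
  (Chebyshev).\<close>
lemma small_moment_area_le:
  fixes \<mu> :: "('n::finite) heis measure" and A :: "real ^ ('n + 'n) ^ ('n + 'n)"
  assumes cone: "uniform_cone_H (2 * CARD('n) + 1) \<mu>"
    and ug: "uniform_graph A (distr \<mu> borel fst) {x. lift A x \<in> msupport \<mu>} g"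
    and graph: "\<And>u. u \<in> msupport \<mu> \<Longrightarrow> u = lift A (fst u)"
    and x: "lift A x \<in> msupport \<mu>" "hgrad A x \<noteq> 0"
    and C: "compact C" "C \<subseteq> hball A 1 0" and \<gamma>: "0 \<le> \<gamma>" "\<And>x. x \<in> C \<Longrightarrow> \<gamma> \<le> (m \<bullet> x)\<^sup>2"
  shows "ennreal \<gamma> * emeasure (harea A) C \<le> cyl 0 g * ennreal (LINT z:koranyi_ball 1 0|\<mu>. (m \<bullet> fst z)\<^sup>2)"
proof -
  interpret uniform_cone \<mu> by unfold_locales (rule cone)
  have [measurable]: "C \<in> sets borel" using C by (simp add: borel_compact)
  have [measurable]: "fst -` C \<in> sets borel"
    using C(1) by (intro borel_closed closed_vimage_fst compact_imp_closed)
  have meas [measurable]: "(\<lambda>z. (m \<bullet> fst z)\<^sup>2) \<in> borel_measurable \<mu>" by (intro measurable_mu continuous_intros)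
  have "integrable \<mu> (\<lambda>z. indicator (koranyi_ball 1 0) z *\<^sub>R (m \<bullet> fst z)\<^sup>2)"
  proof (rule integrableI_bounded_set_indicator[where B = "(norm m)\<^sup>2"])
    show "AE z in \<mu>. z \<in> koranyi_ball 1 0 \<longrightarrow> norm ((m \<bullet> fst z)\<^sup>2) \<le> (norm m)\<^sup>2"
    proof (intro AE_I2 impI)
      fix z :: "'n heis" assume "z \<in> koranyi_ball 1 0"
      then have "norm (fst z) \<le> 1" using norm_fst_le_koranyi[of z] by (simp add: mem_koranyi_ball_0)
      then have "\<bar>m \<bullet> fst z\<bar> \<le> norm m"
        using Cauchy_Schwarz_ineq2[of m "fst z"] mult_left_mono[of "norm (fst z)" 1 "norm m"] by simp
      then have "(m \<bullet> fst z)\<^sup>2 \<le> (norm m)\<^sup>2" by (metis abs_le_square_iff abs_norm_cancel)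
      then show "norm ((m \<bullet> fst z)\<^sup>2) \<le> (norm m)\<^sup>2" by simp
    qed
  qed (use mu_finite_ball in auto)
  then have I: "ennreal (LINT z:koranyi_ball 1 0|\<mu>. (m \<bullet> fst z)\<^sup>2) = (\<integral>\<^sup>+z. ennreal (indicator (koranyi_ball 1 0) z *\<^sub>R (m \<bullet> fst z)\<^sup>2) \<partial>\<mu>)"
    unfolding set_lebesgue_integral_def by (intro nn_integral_eq_integral[symmetric]) auto
  have "ennreal \<gamma> * emeasure (distr \<mu> borel fst) C = ennreal \<gamma> * emeasure \<mu> (fst -` C)"
    by (simp add: emeasure_distr)
  also have "\<dots> = (\<integral>\<^sup>+z. ennreal \<gamma> * indicator (fst -` C) z \<partial>\<mu>)"
    by (rule nn_integral_cmult_indicator[symmetric]) simp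
  also have "\<dots> \<le> ennreal (LINT z:koranyi_ball 1 0|\<mu>. (m \<bullet> fst z)\<^sup>2)"
    unfolding I
  proof (rule nn_integral_mono_AE)
    show "AE z in \<mu>. ennreal \<gamma> * indicator (fst -` C) z \<le> ennreal (indicator (koranyi_ball 1 0) z *\<^sub>R (m \<bullet> fst z)\<^sup>2)"
      using AE_supp
    proof eventually_elim
      fix z assume "z \<in> msupport \<mu>"
      then have z: "z = lift A (fst z)" by (rule graph)
      have l0: "lift A 0 = 0" by (simp add: lift_def zero_prod_def)
      show "ennreal \<gamma> * indicator (fst -` C) z \<le> ennreal (indicator (koranyi_ball 1 0) z *\<^sub>R (m \<bullet> fst z)\<^sup>2)"
      proof (cases "fst z \<in> C")
        case True
        then have "gdist A 0 (fst z) \<le> 1" using C(2) by (auto simp: hball_def)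
        then have "z \<in> koranyi_ball 1 0" unfolding gdist_def l0 z[symmetric] by (simp add: koranyi_ball_def)
        then show ?thesis using True \<gamma>(2)[OF True] by (simp add: ennreal_leI)
      next
        case False
        then show ?thesis by simp
      qed
    qed
  qed
  finally have "cyl 0 g * (ennreal \<gamma> * emeasure (distr \<mu> borel fst) C) \<le> cyl 0 g * ennreal (LINT z:koranyi_ball 1 0|\<mu>. (m \<bullet> fst z)\<^sup>2)"
    by (rule mult_left_mono) simp
  moreover have "ennreal \<gamma> * emeasure (harea A) C \<le> ennreal \<gamma> * (cyl 0 g * emeasure (distr \<mu> borel fst) C)"
    using x by (intro mult_left_mono uniform_graph.area_le_M_full[OF ug _ _ C(1), of x]) auto
  ultimately show ?thesis by (simp add: mult_ac)
qed

lemma subsequence_rescaled: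
  fixes A :: "nat \<Rightarrow> 'a::euclidean_space" and m :: "nat \<Rightarrow> 'b::euclidean_space"
  assumes m: "\<And>i. norm (m i) = 1"
  obtains r d s B where "strict_mono (r :: nat \<Rightarrow> nat)" "(\<lambda>i. m (r i)) \<longlonglongrightarrow> d"
    "(\<lambda>i. 1 / (1 + norm (A (r i)))) \<longlonglongrightarrow> s" "(\<lambda>i. (1 / (1 + norm (A (r i)))) *\<^sub>R A (r i)) \<longlonglongrightarrow> B"
proof -
  define p where "p i = (m i, 1 / (1 + norm (A i)), (1 / (1 + norm (A i))) *\<^sub>R A i)" for i
  have "bounded (range p)"
  proof (rule bounded_subset)
    show "bounded (cball 0 1 \<times> cball 0 1 \<times> cball (0::'a) 1 :: ('b \<times> real \<times> 'a) set)"
      by (intro bounded_Times bounded_cball)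
    show "range p \<subseteq> cball 0 1 \<times> cball 0 1 \<times> cball 0 1"
    proof
      fix q assume "q \<in> range p"
      then obtain i where q: "q = p i" by blast
      have "1 + norm (A i) > 0" by (simp add: add_pos_nonneg)
      then have "1 / (1 + norm (A i)) \<le> 1" "norm (A i) / (1 + norm (A i)) \<le> 1" by simp_all
      then show "q \<in> cball 0 1 \<times> cball 0 1 \<times> cball 0 1" by (simp add: q p_def m)
    qed
  qed
  then obtain l r where r: "strict_mono (r :: nat \<Rightarrow> nat)" and l: "(p \<circ> r) \<longlonglongrightarrow> l"
    using bounded_imp_convergent_subsequence by blast
  have "(\<lambda>i. fst ((p \<circ> r) i)) \<longlonglongrightarrow> fst l" "(\<lambda>i. fst (snd ((p \<circ> r) i))) \<longlonglongrightarrow> fst (snd l)"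
    "(\<lambda>i. snd (snd ((p \<circ> r) i))) \<longlonglongrightarrow> snd (snd l)"
    by (intro tendsto_fst tendsto_snd l)+
  with r show ?thesis by (intro that[of r "fst l" "fst (snd l)" "snd (snd l)"]) (simp_all add: p_def)
qed

theorem theorem1p7:
  "\<exists>C::real. C > 0 \<and>
     (\<forall>m \<in> sphere (0 :: real ^ ('n::finite + 'n)) 1. \<forall>\<mu> :: 'n heis measure.
        uniform_cone_H (2 * CARD('n) + 1) \<mu> \<and> horizontal_uniform \<mu> \<longrightarrow>
        (LINT z:koranyi_ball 1 0|\<mu>. (m \<bullet> fst z)\<^sup>2) \<ge> C)"
proof (rule ccontr)
  assume neg: "\<not> ?thesis"
  define bad where "bad i m \<mu> \<longleftrightarrow> norm m = 1 \<and> uniform_cone_H (2 * CARD('n) + 1) \<mu> \<and> horizontal_uniform \<mu> \<and>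
      (LINT z:koranyi_ball 1 0|\<mu>. (m \<bullet> fst z)\<^sup>2) < inverse (real (Suc i))"
    for i and m :: "real ^ ('n + 'n)" and \<mu> :: "'n heis measure"
  have "\<exists>m \<mu>. bad i m \<mu>" for i
  proof (rule ccontr)
    assume none: "\<not> (\<exists>m \<mu>. bad i m \<mu>)"
    have "\<forall>m \<in> sphere (0 :: real ^ ('n + 'n)) 1. \<forall>\<mu> :: 'n heis measure.
        uniform_cone_H (2 * CARD('n) + 1) \<mu> \<and> horizontal_uniform \<mu> \<longrightarrow>
        (LINT z:koranyi_ball 1 0|\<mu>. (m \<bullet> fst z)\<^sup>2) \<ge> inverse (real (Suc i))"
    proof (intro ballI allI impI)
      fix m :: "real ^ ('n + 'n)" and \<mu> :: "'n heis measure"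
      assume "m \<in> sphere 0 1" and "uniform_cone_H (2 * CARD('n) + 1) \<mu> \<and> horizontal_uniform \<mu>"
      then show "(LINT z:koranyi_ball 1 0|\<mu>. (m \<bullet> fst z)\<^sup>2) \<ge> inverse (real (Suc i))"
        using none unfolding bad_def not_ex de_Morgan_conj not_less by (auto dest!: spec[of _ m] spec[of _ \<mu>])
    qed
    moreover have "inverse (real (Suc i)) > 0" by simp
    ultimately show False using neg by blast
  qed
  then have "\<forall>i. \<exists>p. bad i (fst p) (snd p)" by (simp add: split_paired_Ex)
  from choice[OF this] obtain p where p: "\<And>i. bad i (fst (p i)) (snd (p i))" by blast
  define m where "m i = fst (p i)" for i
  define \<mu> where "\<mu> i = snd (p i)" for i
  have unit_m: "norm (m i) = 1" and cone: "uniform_cone_H (2 * CARD('n) + 1) (\<mu> i)" and hor: "horizontal_uniform (\<mu> i)"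
    and moment: "(LINT z:koranyi_ball 1 0|\<mu> i. (m i \<bullet> fst z)\<^sup>2) < inverse (real (Suc i))" for i
    using p[of i] unfolding bad_def m_def \<mu>_def by blast+
  obtain g :: "real ^ ('n + 'n)" where g: "norm g = 1" by (metis norm_axis_1)
  have "\<exists>A. uniform_graph A (distr (\<mu> i) borel fst) {x. lift A x \<in> msupport (\<mu> i)} g \<and>
     (\<forall>u \<in> msupport (\<mu> i). u = lift A (fst u)) \<and> (\<exists>x. lift A x \<in> msupport (\<mu> i) \<and> hgrad A x \<noteq> 0)" for i
    by (rule horizontal_uniform_cone_graph[OF cone[of i] hor[of i] g]) blast
  then obtain A where ug: "\<And>i. uniform_graph (A i) (distr (\<mu> i) borel fst) {x. lift (A i) x \<in> msupport (\<mu> i)} g"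
    and graph: "\<And>i u. u \<in> msupport (\<mu> i) \<Longrightarrow> u = lift (A i) (fst u)"
    and "\<And>i. \<exists>x. lift (A i) x \<in> msupport (\<mu> i) \<and> hgrad (A i) x \<noteq> 0" by metis
  then obtain x where x: "\<And>i. lift (A i) (x i) \<in> msupport (\<mu> i)" "\<And>i. hgrad (A i) (x i) \<noteq> 0" by metis
  obtain r d s0 B where r: "strict_mono (r :: nat \<Rightarrow> nat)" and lim: "(\<lambda>i. m (r i)) \<longlonglongrightarrow> d"
    "(\<lambda>i. 1 / (1 + norm (A (r i)))) \<longlonglongrightarrow> s0" "(\<lambda>i. (1 / (1 + norm (A (r i)))) *\<^sub>R A (r i)) \<longlonglongrightarrow> B"
    by (rule subsequence_rescaled[OF unit_m])
  have "concentrating_sequence (\<lambda>i. A (r i)) (\<lambda>i. m (r i)) (\<lambda>i. 1 / (1 + norm (A (r i)))) B d s0 g"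
  proof
    show "transpose (A (r i)) = A (r i)" for i by (rule uniform_graph.A[OF ug])
    show "norm (m (r i)) = 1" for i by (rule unit_m)
    show "norm g = 1" by (rule g)
    show "surf (A (r i)) (hgrad (A (r i)) u) 1 \<le> cyl 0 g" if "hgrad (A (r i)) u \<noteq> 0" for i u
      by (rule uniform_graph.surf_le_flat[OF ug _ x(2) that]) (simp add: x(1))
    show "ennreal (h\<^sup>2 * (h / 2) ^ (2 * CARD('n))) * emeasure lborel (cball (0::real ^ ('n + 'n)) 1)
        \<le> ennreal ((2 * h) ^ (2 * CARD('n) + 1)) * emeasure lborel W"
      if "h > 0" "W \<in> sets borel" "\<And>v w. v \<in> hball (A (r i)) 1 0 \<Longrightarrow> koranyi_dist (lift (A (r i)) v) w \<le> h \<Longrightarrow> w \<in> W"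
      for i h W
    proof -
      have one: "emeasure (distr (\<mu> (r i)) borel fst) (hball (A (r i)) 1 0) = 1"
        using uniform_graph.unif[OF ug uniform_graph.E0[OF ug], of 1] by simp
      have "emeasure (distr (\<mu> (r i)) borel fst) (hball (A (r i)) 1 0)
          * (ennreal (h\<^sup>2 * (h / 2) ^ (2 * CARD('n))) * emeasure lborel (cball (0::real ^ ('n + 'n)) 1))
        \<le> ennreal ((2 * h) ^ (2 * CARD('n) + 1)) * emeasure lborel W"
        by (rule uniform_graph.neighbourhood_volume_ge[OF ug]) (rule that hball_borel | assumption)+
      then show ?thesis unfolding one mult_1 .
    qed
    show "ennreal \<gamma> * emeasure (harea (A (r i))) C \<le> cyl 0 g * ennreal (inverse (real (Suc i)))"
      if "compact C" "C \<subseteq> hball (A (r i)) 1 0" "0 \<le> \<gamma>" "\<And>x. x \<in> C \<Longrightarrow> \<gamma> \<le> (m (r i) \<bullet> x)\<^sup>2" for i C \<gamma>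
    proof (rule order_trans[OF small_moment_area_le[OF cone ug graph x that]])
      have "inverse (real (Suc (r i))) \<le> inverse (real (Suc i))" using seq_suble[OF r, of i] by simp
      then have "(LINT z:koranyi_ball 1 0|\<mu> (r i). (m (r i) \<bullet> fst z)\<^sup>2) \<le> inverse (real (Suc i))"
        using moment[of "r i"] by linarith
      then show "cyl 0 g * ennreal (LINT z:koranyi_ball 1 0|\<mu> (r i). (m (r i) \<bullet> fst z)\<^sup>2) \<le> cyl 0 g * ennreal (inverse (real (Suc i)))"
        by (intro mult_left_mono ennreal_leI) simp_all
    qed
  qed (rule refl | rule lim)+
  then show False by (rule concentrating_sequence.no_such_sequence)
qed

end
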